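(* Suppose that for every $\tau\in\mathcal{T}$ there is a vector function $\widetilde\rho_\tau$ such that, as $\Delta\to0$, $$\int\big(\sqrt{g_{\tau,\Delta}}-1-\Delta^t\widetilde\rho_\tau/2\big)^2\,dG_\tau=o(\|\Delta\|^2),\qquad \int g_{\tau,\Delta}\,dG_\tau=1+o(\|\Delta\|^2),$$ that $E_\tau u^2(X,\theta)$ is locally bounded in $\tau$, and that $I_\tau$ is of full rank for all $\tau\in\mathcal{T}$. Let $\widehat\tau_n$ be an asymptotically linear estimator of $\tau$ with influence functions $\kappa_\tau$, i.e., for every $\tau\in\mathcal{T}$, $$\widehat\tau_n=\tau+\frac1n\sum_{j=1}^n\kappa_\tau(X_j)+o_{P_\tau}(n^{-1/2}),\qquad E_\tau\kappa_\tau(X)\rho_\tau^t(X)=\text{identity matrix},$$ and let $\widehat S_n\equiv\sum_{j=1}^n\overline u_{\widehat\tau_n}(X_j)$. Suppose further that $E_\tau\overline u_{\tau+\Delta}^2(X)=O(1)$ as $\Delta\to0$ for every $\tau\in\mathcal{T}$, and that for all $\tau\in\mathcal{T}$ and $c>0$, $$\sup_{\|\Delta\|\le c/\sqrt n}\Big|\sum_{j=1}^n\big[\overline u_{\tau+\Delta}(X_j)-\overline u_\tau(X_j)-\{E_\tau\overline u_{\tau+\Delta}(X)-\mu_\tau\}\big]\Big|=o_{P_\tau}(n^{1/2}).$$ Let $$\gamma_\tau\equiv E_\tau\{u(X,\theta)\widetilde\rho_\tau(\theta)-\overline u_\tau(X)\rho_\tau(X)\},\quad \phi_{*,\tau}\equiv\overline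 u_\tau-\mu_\tau+\rho_\tau^tI_\tau^{-1}\gamma_\tau,\quad \kappa_{*,\tau}\equiv I_\tau^{-1}\rho_\tau.$$ Then, under $P_\tau$, $$\frac{\widehat S_n-S_n}{n^{1/2}}\xrightarrow{D}N(0,\sigma_\tau^2),\qquad \sigma_\tau^2=\sigma_{*,\tau}^2+\operatorname{Var}_\tau\big(\{\kappa_\tau(X)-\kappa_{*,\tau}(X)\}^t\gamma_\tau\big),$$ where $S_n=\sum_{j=1}^nu(X_j,\theta_j)$ and $\sigma_{*,\tau}^2\equiv\operatorname{Var}_\tau(\phi_{*,\tau}(X)-u(X,\theta))$. Consequently, $\widehat S_n$ is an asymptotically efficient estimator of $S_n$ at $P_{\tau_0}$ if and only if $\gamma_{\tau_0}^t\widehat\tau_n$ is an asymptotically efficient estimator of $\gamma_{\tau_0}^t\tau$ in contiguous neighborhoods of $P_{\tau_0}$.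
   Context: $\{G_\tau,\tau\in\mathcal{T}\}$ is a parametric family of distributions with $\mathcal{T}$ an open subset of a Euclidean space. Under $P_\tau$ (with expectation $E_\tau$), $(X,\theta),(X_1,\theta_1),(X_2,\theta_2),\dots$ are i.i.d. with $\theta\sim G_\tau$ and, given $\theta$, $X$ has density $f(x|\theta)$ with respect to a measure $\nu$, where $f(\cdot|\cdot)$ is known. The $X_j$ are observed, the $\theta_j$ and $\tau$ are not; estimators are functions of $X_1,\dots,X_n$. The utility $u(x,\vartheta)$ is a known Borel function. $g_{\tau,\Delta}$ is the Radon–Nikodym derivative of the absolutely continuous part of $G_{\tau+\Delta}$ with respect to $G_\tau$. Define $\rho_\tau(x)\equiv E_\tau[\widetilde\rho_\tau(\theta)|X=x]$, $I_\tau\equiv\operatorname{Cov}_\tau(\rho_\tau(X))$, $\overline u_\tau(x)\equiv E_\tau[u(X,\theta)|X=x]$, $\mu_\tau\equiv E_\tau u(X,\theta)$. As usual, influence functions $\kappa_\tau(X)$ have mean zero and finite second moments under $P_\tau$. Regularity and efficiency for $S_n$: an estimator $\widetilde S_n$ is regular at $P_\tau$ if there is a random variable $\xi_0$ such that for every fixed vector $a$ the law of $n^{-1/2}(\widetilde S_n-S_n)$ under $P_{\tau+a/\sqrt n}$ converges weakly to the law of $\xi_0$ (the same for all $a$). It is asymptotically efficient at $P_\tau$ (in contiguous neighborhoods) if it is regular at $P_\tau$ and $E\xi_0^2$ equals the sharp lower bound for the variance of the limits of all estimators regular at $P_\tau$. Efficiency for a linear functional $b^t\tau$ with $b$ fixed: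 an estimator $T_n$ of $b^t\tau$ is asymptotically efficient in contiguous neighborhoods of $P_{\tau_0}$ iff $T_n=b^t\tau_0+\frac1n\sum_{j=1}^nb^tI_{\tau_0}^{-1}\rho_{\tau_0}(X_j)+o_{P_{\tau_0}}(n^{-1/2})$, i.e. $b^t\kappa_{*,\tau_0}$, with $\kappa_{*,\tau_0}=I_{\tau_0}^{-1}\rho_{\tau_0}$, is the efficient influence function. *)

theory Defs
  imports "HOL-Probability.Probability" "HOL-Library.Landau_Symbols"
begin

section \<open>The mixture model\<close>

text \<open>
  The measure \<open>\<nu>\<close> serves both as dominating measure and as carrier of the measurable structure of the
  observations.  The law is assembled from the kernel \<open>\<theta> \<mapsto> f(\<cdot>|\<theta>) d\<nu>\<close> rather than as a density
  of a product measure, so that \<open>\<nu>\<close> need not be sigma-finite.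
\<close>

definition joint_law :: "'x measure \<Rightarrow> ('x \<Rightarrow> 't \<Rightarrow> real) \<Rightarrow> 't measure \<Rightarrow> ('x \<times> 't) measure" where
  "joint_law \<nu> f G =
     G \<bind> (\<lambda>\<theta>. distr (density \<nu> (\<lambda>x. ennreal (f x \<theta>))) (\<nu> \<Otimes>\<^sub>M G) (\<lambda>x. (x, \<theta>)))"

text \<open>The law of the i.i.d. sequence; the pairs are indexed from 0, so that the first \<open>n\<close> of them
  have the indices \<open>j < n\<close>.\<close>

definition sample_law :: "('x \<times> 't) measure \<Rightarrow> (nat \<Rightarrow> 'x \<times> 't) measure" where
  "sample_law Q = (\<Pi>\<^sub>M j\<in>UNIV. Q)"

definition observed :: "nat \<Rightarrow> (nat \<Rightarrow> 'x \<times> 't) \<Rightarrow> nat \<Rightarrow> 'x" where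
  "observed n \<omega> = (\<lambda>j\<in>{..<n}. fst (\<omega> j))"

definition is_estimator ::
    "'x measure \<Rightarrow> (nat \<Rightarrow> (nat \<Rightarrow> 'x) \<Rightarrow> 'b::topological_space) \<Rightarrow> bool" where
  "is_estimator \<nu> T \<longleftrightarrow> (\<forall>n. T n \<in> borel_measurable (\<Pi>\<^sub>M j\<in>{..<n}. \<nu>))"

definition utility_sum :: "('x \<Rightarrow> 't \<Rightarrow> real) \<Rightarrow> nat \<Rightarrow> (nat \<Rightarrow> 'x \<times> 't) \<Rightarrow> real" where
  "utility_sum u n \<omega> = (\<Sum>j<n. u (fst (\<omega> j)) (snd (\<omega> j)))"

definition plug_in_sum ::
    "('p \<Rightarrow> 'x \<Rightarrow> real) \<Rightarrow> (nat \<Rightarrow> (nat \<Rightarrow> 'x) \<Rightarrow> 'p) \<Rightarrow> nat \<Rightarrow> (nat \<Rightarrow> 'x) \<Rightarrow> real" where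
  "plug_in_sum ubar tauhat n x = (\<Sum>j<n. ubar (tauhat n x) (x j))"

text \<open>\<open>r x = E[h(X,\<theta>) | X = x]\<close>: \<open>r\<close> is a measurable function such that \<open>r(X)\<close> is a version of the
  conditional expectation given the sigma-algebra generated by \<open>X\<close>.\<close>

definition is_cond_exp_X ::
    "'x measure \<Rightarrow> ('x \<times> 't) measure \<Rightarrow> ('x \<times> 't \<Rightarrow> real) \<Rightarrow> ('x \<Rightarrow> real) \<Rightarrow> bool" where
  "is_cond_exp_X \<nu> Q h r \<longleftrightarrow>
     integrable Q h \<and> r \<in> borel_measurable \<nu> \<and>
     (AE z in Q. r (fst z) = real_cond_exp Q (vimage_algebra (space Q) fst \<nu>) h z)"

definition cov_matrix :: "'a measure \<Rightarrow> ('a \<Rightarrow> real ^ 'd) \<Rightarrow> real ^ 'd ^ 'd" where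
  "cov_matrix M Y =
     (\<chi> i j. \<integral>z. (Y z $ i - (\<integral>w. Y w $ i \<partial>M)) * (Y z $ j - (\<integral>w. Y w $ j \<partial>M)) \<partial>M)"

section \<open>Densities of absolutely continuous parts\<close>

text \<open>The absolutely continuous part of \<open>N\<close> in its Lebesgue decomposition with respect to \<open>M\<close>.  It is
  needed since \<^const>\<open>RN_deriv\<close> is the zero function when \<open>N\<close> is not absolutely continuous.\<close>

definition ac_part :: "'a measure \<Rightarrow> 'a measure \<Rightarrow> 'a measure" where
  "ac_part M N = (SOME A. sets A = sets M \<and> absolutely_continuous M A \<and>
     (\<exists>S. sets S = sets M \<and> (\<exists>B\<in>null_sets M. emeasure S (space M - B) = 0) \<and>
          (\<forall>E\<in>sets M. emeasure N E = emeasure A E + emeasure S E)))"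

definition ac_density :: "'a measure \<Rightarrow> 'a measure \<Rightarrow> 'a \<Rightarrow> real" where
  "ac_density M N z = enn2real (RN_deriv M (ac_part M N) z)"

section \<open>Asymptotics\<close>

text \<open>\<open>Y\<^sub>n = o\<^sub>P(r\<^sub>n)\<close> for nonnegative \<open>Y\<^sub>n\<close>.  Outer measure, since \<open>Y\<^sub>n\<close> may be an uncountable supremum
  that is not measurable; extended real values, since the supremum may be infinite.\<close>

definition small_oP :: "'a measure \<Rightarrow> (nat \<Rightarrow> 'a \<Rightarrow> ereal) \<Rightarrow> (nat \<Rightarrow> real) \<Rightarrow> bool" where
  "small_oP M Y r \<longleftrightarrow>
     (\<forall>\<epsilon>>0. (\<lambda>n. outer_measure_of M {\<omega> \<in> space M. ereal (\<epsilon> * r n) < Y n \<omega>}) \<longlonglongrightarrow> 0)"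

text \<open>\<open>N(0, v)\<close>, including the point mass at 0 for \<open>v = 0\<close>.\<close>

definition centered_normal :: "real \<Rightarrow> real measure" where
  "centered_normal v = distr std_normal_distribution borel (\<lambda>x. sqrt v * x)"

section \<open>Regular and efficient estimation of the utility sum\<close>

text \<open>The estimator \<open>T\<close> is regular at \<open>\<tau>\<close>, \<open>L\<close> being the law of the limit variable \<open>\<xi>\<^sub>0\<close>.  For parameters
  ranging over an open set only, \<open>\<tau> + a/\<surd>n\<close> lies in it for large \<open>n\<close>, and the values of \<open>P\<close> elsewhere
  are irrelevant.\<close>

definition regular_with_limit ::
    "'x measure \<Rightarrow> (real ^ 'd \<Rightarrow> ('x \<times> 't) measure) \<Rightarrow> ('x \<Rightarrow> 't \<Rightarrow> real) \<Rightarrow> real ^ 'd \<Rightarrow>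
     (nat \<Rightarrow> (nat \<Rightarrow> 'x) \<Rightarrow> real) \<Rightarrow> real measure \<Rightarrow> bool" where
  "regular_with_limit \<nu> P u \<tau> T L \<longleftrightarrow>
     is_estimator \<nu> T \<and> real_distribution L \<and>
     (\<forall>a. weak_conv_m
        (\<lambda>n. distr (sample_law (P (\<tau> + a /\<^sub>R sqrt (real n)))) borel
               (\<lambda>\<omega>. (T n (observed n \<omega>) - utility_sum u n \<omega>) / sqrt (real n))) L)"

definition variance_of_law :: "real measure \<Rightarrow> ennreal" where
  "variance_of_law L =
     (if integrable L (\<lambda>x. x\<^sup>2) then ennreal (\<integral>x. (x - (\<integral>y. y \<partial>L))\<^sup>2 \<partial>L) else \<infinity>)"

definition variance_bound ::
    "'x measure \<Rightarrow> (real ^ 'd \<Rightarrow> ('x \<times> 't) measure) \<Rightarrow> ('x \<Rightarrow> 't \<Rightarrow> real) \<Rightarrow> real ^ 'd \<Rightarrow> ennreal" where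
  "variance_bound \<nu> P u \<tau> = (INF L\<in>{L. \<exists>T. regular_with_limit \<nu> P u \<tau> T L}. variance_of_law L)"

definition efficient_for_sum ::
    "'x measure \<Rightarrow> (real ^ 'd \<Rightarrow> ('x \<times> 't) measure) \<Rightarrow> ('x \<Rightarrow> 't \<Rightarrow> real) \<Rightarrow> real ^ 'd \<Rightarrow>
     (nat \<Rightarrow> (nat \<Rightarrow> 'x) \<Rightarrow> real) \<Rightarrow> bool" where
  "efficient_for_sum \<nu> P u \<tau> T \<longleftrightarrow>
     (\<exists>L. regular_with_limit \<nu> P u \<tau> T L \<and>
          (\<integral>\<^sup>+x. ennreal (x\<^sup>2) \<partial>L) = variance_bound \<nu> P u \<tau>)"

section \<open>Efficient estimation of a linear functional of the parameter\<close>

text \<open>Here \<open>Q\<close> is the joint law at the parameter value \<open>\<tau>\<close>, and \<open>\<rho>\<close> the score of \<open>X\<close> there.\<close>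

definition efficient_for_linear ::
    "'x measure \<Rightarrow> ('x \<times> 't) measure \<Rightarrow> ('x \<Rightarrow> real ^ 'd) \<Rightarrow> real ^ 'd \<Rightarrow> real ^ 'd \<Rightarrow>
     (nat \<Rightarrow> (nat \<Rightarrow> 'x) \<Rightarrow> real) \<Rightarrow> bool" where
  "efficient_for_linear \<nu> Q \<rho> \<tau> b T \<longleftrightarrow>
     is_estimator \<nu> T \<and>
     small_oP (sample_law Q)
       (\<lambda>n \<omega>. ereal \<bar>T n (observed n \<omega>) - b \<bullet> \<tau> - (1 / real n) *
          (\<Sum>j<n. b \<bullet> (matrix_inv (cov_matrix Q (\<lambda>z. \<rho> (fst z))) *v \<rho> (fst (\<omega> j))))\<bar>)
       (\<lambda>n. 1 / sqrt (real n))"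

end

theory Submission
  imports Defs "HOL-Complex_Analysis.Great_Picard"
begin

text \<open>Let \<open>v = I\<^sup>-\<^sup>1 \<gamma>\<close> and \<open>d = ubar + v \<bullet> \<rho> - u\<close>.  Then \<open>d\<close> is orthogonal to the scores \<open>a \<bullet> rhot\<close> and
  \<open>d - v \<bullet> rhot\<close> has conditional mean zero given \<open>X\<close>.  Expanding \<open>ubar\<close> at the estimated parameter gives
  \<open>\<Sum>(d + (\<kappa> - \<kappa>star) \<bullet> \<gamma>)\<close> as the linear part of the plug-in error, and the two summands are uncorrelated.
  Such sums of functions orthogonal to the scores keep their normal limit along local alternatives.

  For the lower bound \<open>E d\<^sup>2\<close>, let \<open>\<psi>\<close> be the characteristic function of the limit law of a regular \<open>T\<close>.
  The likelihood ratio of \<open>\<tau> + s v / \<surd>n\<close> is \<open>L\<^sup>1\<close>-close to \<open>exp (- s\<^sup>2 V) \<Prod>(1 + s y\<^sub>n / \<surd>n)\<^sup>2\<close>, where \<open>y\<^sub>n\<close> is a truncation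
  of \<open>v \<bullet> rhot / 2\<close> and \<open>E y\<^sub>n\<^sup>2 \<longlonglongrightarrow> V\<close>.  Hence the entire functions
  \<open>exp (- s\<^sup>2 V) E (exp (i t (T - S) / \<surd>n) \<Prod>(1 + s y\<^sub>n / \<surd>n)\<^sup>2)\<close> tend to \<open>\<psi> t\<close> for real \<open>s\<close>, so by Montel's theorem also,
  along a subsequence, at \<open>s = - i t\<close>.  There \<open>T\<close> contributes a factor of modulus one depending on the \<open>X\<close>s only, while
  \<open>exp (- i t u / \<surd>n) (1 - i t y\<^sub>n / \<surd>n)\<^sup>2\<close> is to first order a function of \<open>X\<close>, up to a conditionally centred term, and
  second moments give \<open>\<bar>\<psi> t\<bar> \<le> exp (- t\<^sup>2 E d\<^sup>2 / 2)\<close>.\<close>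

section \<open>Square integrable functions\<close>

text \<open>The likelihood ratio depends on the unobserved \<theta>s, while T sees the Xs alone.
  Along real s the limit is constant and says nothing about E d^2; at imaginary s the ratio
  oscillates like exp (- i t S / \<surd>n), and conditioning on the Xs averages both at once. The
  true ratio has no evident extension to complex s, but its approximation by a product of squares is
  a polynomial in s. Truncating the score at the order n^(1/4) supplies the fourth moments that a
  square integrable score may lack. Singular parts of G (\<tau> + \<Delta>) never get a density:
  alternatives merely dominate a subdensity, and the condition on its mass makes the total loss over
  n observations vanish. No differentiability of ubar in the parameter is assumed. The P \<tau>-mean
  of ubar (\<tau> + \<Delta>) is expanded by comparing u with ubar (\<tau> + \<Delta>), two
  functions with the same mean under P (\<tau> + \<Delta>): changing the law back to P \<tau> costs
  each of them a first-order term, and the difference of these terms is \<Delta> \<bullet> \<gamma>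
  up to o(norm \<Delta>).\<close>

definition sq_integrable :: "'a measure \<Rightarrow> ('a \<Rightarrow> 'b::{banach,second_countable_topology}) \<Rightarrow> bool" where
  "sq_integrable M f \<longleftrightarrow> f \<in> borel_measurable M \<and> integrable M (\<lambda>x. (norm (f x))\<^sup>2)"

lemma sq_integrable_measurable: "sq_integrable M f \<Longrightarrow> f \<in> borel_measurable M"
  by (simp add: sq_integrable_def)

lemma sq_integrable_norm2: "sq_integrable M f \<Longrightarrow> integrable M (\<lambda>x. (norm (f x))\<^sup>2)"
  by (simp add: sq_integrable_def)

lemma sq_integrable_real_iff:
  "sq_integrable M (f :: _ \<Rightarrow> real) \<longleftrightarrow> f \<in> borel_measurable M \<and> integrable M (\<lambda>x. (f x)\<^sup>2)"
  by (simp add: sq_integrable_def)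

lemma sq_integrable_bound:
  assumes "sq_integrable M g" and [measurable]: "f \<in> borel_measurable M"
    and "\<And>x. x \<in> space M \<Longrightarrow> norm (f x) \<le> C * norm (g x)"
  shows "sq_integrable M f"
proof -
  have [measurable]: "g \<in> borel_measurable M" using assms(1) by (rule sq_integrable_measurable)
  have "integrable M (\<lambda>x. C\<^sup>2 * (norm (g x))\<^sup>2)"
    using assms(1) by (auto simp: sq_integrable_def)
  then have "integrable M (\<lambda>x. (norm (f x))\<^sup>2)"
  proof (rule Bochner_Integration.integrable_bound)
    show "AE x in M. norm ((norm (f x))\<^sup>2) \<le> norm (C\<^sup>2 * (norm (g x))\<^sup>2)"
    proof (rule AE_I2)
      fix x assume "x \<in> space M"
      then have "(norm (f x))\<^sup>2 \<le> (C * norm (g x))\<^sup>2" by (intro power_mono assms) auto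
      then show "norm ((norm (f x))\<^sup>2) \<le> norm (C\<^sup>2 * (norm (g x))\<^sup>2)"
        by (simp add: power_mult_distrib)
    qed
  qed simp
  then show ?thesis by (simp add: sq_integrable_def)
qed

lemma sq_integrable_of_real:
  "sq_integrable M (f :: _ \<Rightarrow> real) \<Longrightarrow> sq_integrable M (\<lambda>x. complex_of_real (f x))"
  by (auto simp: sq_integrable_def)

lemma norm_add_power2_le: "(norm (a + b))\<^sup>2 \<le> 2 * (norm a)\<^sup>2 + 2 * (norm b)\<^sup>2"
proof -
  have "(norm (a + b))\<^sup>2 \<le> (norm a + norm b)\<^sup>2"
    by (intro power_mono norm_triangle_ineq) auto
  also have "\<dots> \<le> 2 * (norm a)\<^sup>2 + 2 * (norm b)\<^sup>2"
    using zero_le_power2[of "norm a - norm b"] by (simp add: power2_eq_square algebra_simps)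
  finally show ?thesis .
qed

lemma sq_integrable_add:
  assumes f: "sq_integrable M f" and g: "sq_integrable M g"
  shows "sq_integrable M (\<lambda>x. f x + g x)"
proof -
  have [measurable]: "f \<in> borel_measurable M" "g \<in> borel_measurable M"
    using f g by (simp_all add: sq_integrable_def)
  have "integrable M (\<lambda>x. 2 * (norm (f x))\<^sup>2 + 2 * (norm (g x))\<^sup>2)"
    using f g by (auto simp: sq_integrable_def)
  then have "integrable M (\<lambda>x. (norm (f x + g x))\<^sup>2)"
    by (rule Bochner_Integration.integrable_bound) (auto simp: norm_add_power2_le)
  then show ?thesis by (simp add: sq_integrable_def)
qed

lemma sq_integrable_cmult:
  fixes f :: "_ \<Rightarrow> _::{real_normed_field,banach,second_countable_topology}"
  assumes "sq_integrable M f" shows "sq_integrable M (\<lambda>x. c * f x)"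
  using sq_integrable_measurable[OF assms]
  by (intro sq_integrable_bound[OF assms, where C="norm c"]) (auto simp: norm_mult)

lemma sq_integrable_uminus: "sq_integrable M f \<Longrightarrow> sq_integrable M (\<lambda>x. - f x)"
  by (auto simp: sq_integrable_def)

lemma sq_integrable_diff:
  assumes f: "sq_integrable M f" and g: "sq_integrable M g"
  shows "sq_integrable M (\<lambda>x. f x - g x)"
  using sq_integrable_add[OF f sq_integrable_uminus[OF g]] by simp

lemma sq_integrable_sum:
  "(\<And>i. i \<in> I \<Longrightarrow> sq_integrable M (f i)) \<Longrightarrow> sq_integrable M (\<lambda>x. \<Sum>i\<in>I. f i x)"
  by (induction I rule: infinite_finite_induct) (auto intro: sq_integrable_add simp: sq_integrable_def[of M "\<lambda>x. 0"])

lemma (in finite_measure) sq_integrable_const: "sq_integrable M (\<lambda>x. c)"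
  by (auto simp: sq_integrable_def)

lemma (in finite_measure) sq_integrable_bounded:
  assumes "f \<in> borel_measurable M" "\<And>x. x \<in> space M \<Longrightarrow> norm (f x) \<le> C"
  shows "sq_integrable M f"
  using assms by (intro sq_integrable_bound[OF sq_integrable_const[of "1::real"], where C="max C 0"]) (auto simp: le_max_iff_disj)

lemma norm_mult_le_sum_squares: "norm a * norm b \<le> ((norm a)\<^sup>2 + (norm b)\<^sup>2) / 2"
  using zero_le_power2[of "norm a - norm b"] by (simp add: power2_eq_square algebra_simps)

lemma sq_integrable_mult_integrable:
  fixes f g :: "_ \<Rightarrow> _::{real_normed_field,banach,second_countable_topology}"
  assumes f: "sq_integrable M f" and g: "sq_integrable M g"
  shows "integrable M (\<lambda>x. f x * g x)"
proof -
  have [measurable]: "f \<in> borel_measurable M" "g \<in> borel_measurable M"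
    using f g by (simp_all add: sq_integrable_def)
  have "integrable M (\<lambda>x. ((norm (f x))\<^sup>2 + (norm (g x))\<^sup>2) / 2)"
    using f g by (auto simp: sq_integrable_def)
  then show ?thesis
    by (rule Bochner_Integration.integrable_bound)
       (use norm_mult_le_sum_squares[of "f _" "g _"] in \<open>auto simp: norm_mult\<close>)
qed

lemma (in finite_measure) sq_integrable_integrable:
  fixes f :: "_ \<Rightarrow> _::{real_normed_field,banach,second_countable_topology}"
  shows "sq_integrable M f \<Longrightarrow> integrable M f"
  using sq_integrable_mult_integrable[OF _ sq_integrable_const[of 1]] by auto

text \<open>The absolute value stands inside the integral because the comparison of likelihoods in
  \<open>likelihood_L1\<close> is an L1 estimate; the versions for normed fields follow by passing
  to norms.\<close>

lemma cauchy_schwarz_abs: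
  fixes f g :: "_ \<Rightarrow> real"
  assumes f: "sq_integrable M f" and g: "sq_integrable M g"
  shows "(\<integral>x. \<bar>f x * g x\<bar> \<partial>M) \<le> sqrt (\<integral>x. (f x)\<^sup>2 \<partial>M) * sqrt (\<integral>x. (g x)\<^sup>2 \<partial>M)"
proof -
  have [measurable]: "f \<in> borel_measurable M" "g \<in> borel_measurable M"
    using f g by (simp_all add: sq_integrable_def)
  have i: "integrable M (\<lambda>x. \<bar>f x * g x\<bar>)"
    using sq_integrable_mult_integrable[OF f g] by simp
  have i2: "integrable M (\<lambda>x. (f x)\<^sup>2)" "integrable M (\<lambda>x. (g x)\<^sup>2)"
    using f g by (auto simp: sq_integrable_def)
  have "(\<integral>\<^sup>+x. ennreal \<bar>f x\<bar> * ennreal \<bar>g x\<bar> \<partial>M)\<^sup>2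
      \<le> (\<integral>\<^sup>+x. (ennreal \<bar>f x\<bar>)\<^sup>2 \<partial>M) * (\<integral>\<^sup>+x. (ennreal \<bar>g x\<bar>)\<^sup>2 \<partial>M)"
    by (rule Cauchy_Schwarz_nn_integral) auto
  also have "(\<integral>\<^sup>+x. (ennreal \<bar>f x\<bar>)\<^sup>2 \<partial>M) = ennreal (\<integral>x. (f x)\<^sup>2 \<partial>M)"
    using i2 by (subst nn_integral_eq_integral[symmetric]) (auto simp: ennreal_power)
  also have "(\<integral>\<^sup>+x. (ennreal \<bar>g x\<bar>)\<^sup>2 \<partial>M) = ennreal (\<integral>x. (g x)\<^sup>2 \<partial>M)"
    using i2 by (subst nn_integral_eq_integral[symmetric]) (auto simp: ennreal_power)
  also have "(\<integral>\<^sup>+x. ennreal \<bar>f x\<bar> * ennreal \<bar>g x\<bar> \<partial>M) = ennreal (\<integral>x. \<bar>f x * g x\<bar> \<partial>M)"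
    using i by (subst nn_integral_eq_integral[symmetric]) (auto simp: ennreal_mult[symmetric] abs_mult)
  finally have "(\<integral>x. \<bar>f x * g x\<bar> \<partial>M)\<^sup>2 \<le> (\<integral>x. (f x)\<^sup>2 \<partial>M) * (\<integral>x. (g x)\<^sup>2 \<partial>M)"
    by (simp add: ennreal_power ennreal_mult[symmetric])
  then have "sqrt ((\<integral>x. \<bar>f x * g x\<bar> \<partial>M)\<^sup>2) \<le> sqrt ((\<integral>x. (f x)\<^sup>2 \<partial>M) * (\<integral>x. (g x)\<^sup>2 \<partial>M))"
    by (rule real_sqrt_le_mono)
  then show ?thesis by (simp add: real_sqrt_mult)
qed

lemma sq_integrable_norm: "sq_integrable M f \<Longrightarrow> sq_integrable M (\<lambda>x. norm (f x))"
  by (auto simp: sq_integrable_def)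

lemma cauchy_schwarz_norm:
  fixes f g :: "_ \<Rightarrow> _::{real_normed_field,banach,second_countable_topology}"
  assumes f: "sq_integrable M f" and g: "sq_integrable M g"
  shows "(\<integral>x. norm (f x * g x) \<partial>M) \<le> sqrt (\<integral>x. (norm (f x))\<^sup>2 \<partial>M) * sqrt (\<integral>x. (norm (g x))\<^sup>2 \<partial>M)"
  using cauchy_schwarz_abs[OF sq_integrable_norm[OF f] sq_integrable_norm[OF g]]
  by (simp add: norm_mult)

lemma cauchy_schwarz:
  fixes f g :: "_ \<Rightarrow> _::{real_normed_field,banach,second_countable_topology}"
  assumes f: "sq_integrable M f" and g: "sq_integrable M g"
  shows "norm (\<integral>x. f x * g x \<partial>M) \<le> sqrt (\<integral>x. (norm (f x))\<^sup>2 \<partial>M) * sqrt (\<integral>x. (norm (g x))\<^sup>2 \<partial>M)"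
  using integral_norm_bound[of M "\<lambda>x. f x * g x"] cauchy_schwarz_norm[OF assms] by linarith

text \<open>Square integrability of every member is part of the notion, so that inner products of
  two such sequences are integrals of integrable functions for all n and not just
  eventually.\<close>

definition L2_tendsto ::
    "'a measure \<Rightarrow> (nat \<Rightarrow> 'a \<Rightarrow> 'b::{banach,second_countable_topology}) \<Rightarrow> ('a \<Rightarrow> 'b) \<Rightarrow> bool" where
  "L2_tendsto M X Y \<longleftrightarrow> (\<forall>n. sq_integrable M (X n)) \<and> sq_integrable M Y \<and>
     (\<lambda>n. \<integral>x. (norm (X n x - Y x))\<^sup>2 \<partial>M) \<longlonglongrightarrow> 0"

lemma L2_tendstoD:
  assumes "L2_tendsto M X Y"
  shows "sq_integrable M (X n)" "sq_integrable M Y" "(\<lambda>n. \<integral>x. (norm (X n x - Y x))\<^sup>2 \<partial>M) \<longlonglongrightarrow> 0"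
  using assms by (auto simp: L2_tendsto_def)

lemma L2_tendsto_const: "sq_integrable M f \<Longrightarrow> L2_tendsto M (\<lambda>n. f) f"
  by (simp add: L2_tendsto_def)

lemma L2_tendsto_of_real:
  fixes Y :: "_ \<Rightarrow> real"
  shows "L2_tendsto M X Y \<Longrightarrow> L2_tendsto M (\<lambda>n x. complex_of_real (X n x)) (\<lambda>x. complex_of_real (Y x))"
  unfolding L2_tendsto_def of_real_diff[symmetric] norm_of_real
  by (simp add: sq_integrable_of_real)

lemma L2_tendsto_add:
  assumes X: "L2_tendsto M X Y" and X': "L2_tendsto M X' Y'"
  shows "L2_tendsto M (\<lambda>n x. X n x + X' n x) (\<lambda>x. Y x + Y' x)"
proof -
  note D = L2_tendstoD[OF X] L2_tendstoD[OF X']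
  have "(\<lambda>n. \<integral>x. (norm (X n x + X' n x - (Y x + Y' x)))\<^sup>2 \<partial>M) \<longlonglongrightarrow> 0"
  proof (rule tendsto_sandwich[OF _ _ tendsto_const])
    show "(\<lambda>n. 2 * (\<integral>x. (norm (X n x - Y x))\<^sup>2 \<partial>M) + 2 * (\<integral>x. (norm (X' n x - Y' x))\<^sup>2 \<partial>M)) \<longlonglongrightarrow> 0"
      using D by (auto intro!: tendsto_eq_intros)
    have i: "integrable M (\<lambda>x. (norm (X n x - Y x))\<^sup>2)" "integrable M (\<lambda>x. (norm (X' n x - Y' x))\<^sup>2)" for n
      using D by (auto intro!: sq_integrable_norm2 sq_integrable_diff)
    have s: "sq_integrable M (\<lambda>x. X n x + X' n x - (Y x + Y' x))" for n
      using D by (auto intro!: sq_integrable_add sq_integrable_diff)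
    have "(norm (X n x + X' n x - (Y x + Y' x)))\<^sup>2 \<le> 2 * (norm (X n x - Y x))\<^sup>2 + 2 * (norm (X' n x - Y' x))\<^sup>2" for n x
      using norm_add_power2_le[of "X n x - Y x" "X' n x - Y' x"] by (simp add: algebra_simps)
    then have "(\<integral>x. (norm (X n x + X' n x - (Y x + Y' x)))\<^sup>2 \<partial>M)
        \<le> (\<integral>x. 2 * (norm (X n x - Y x))\<^sup>2 + 2 * (norm (X' n x - Y' x))\<^sup>2 \<partial>M)" for n
      using i[of n] s[of n] by (intro integral_mono) (auto intro: sq_integrable_norm2)
    then show "\<forall>\<^sub>F n in sequentially. (\<integral>x. (norm (X n x + X' n x - (Y x + Y' x)))\<^sup>2 \<partial>M)
        \<le> 2 * (\<integral>x. (norm (X n x - Y x))\<^sup>2 \<partial>M) + 2 * (\<integral>x. (norm (X' n x - Y' x))\<^sup>2 \<partial>M)"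
      using i by simp
  qed auto
  then show ?thesis using D by (simp add: L2_tendsto_def sq_integrable_add)
qed

lemma L2_tendsto_cmult:
  fixes Y :: "_ \<Rightarrow> _::{real_normed_field,banach,second_countable_topology}"
  assumes X: "L2_tendsto M X Y"
  shows "L2_tendsto M (\<lambda>n x. c * X n x) (\<lambda>x. c * Y x)"
proof -
  note D = L2_tendstoD[OF X]
  have "(\<lambda>n. (norm c)\<^sup>2 * (\<integral>x. (norm (X n x - Y x))\<^sup>2 \<partial>M)) \<longlonglongrightarrow> 0"
    using D by (auto intro!: tendsto_eq_intros)
  then show ?thesis
    using D by (simp add: L2_tendsto_def sq_integrable_cmult right_diff_distrib[symmetric] norm_mult power_mult_distrib)
qed

lemma L2_tendsto_dominated:
  fixes Y :: "_ \<Rightarrow> _::{banach,second_countable_topology}"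
  assumes [measurable]: "\<And>n. X n \<in> borel_measurable M" "Y \<in> borel_measurable M"
    and g: "sq_integrable M (g :: _ \<Rightarrow> real)"
    and b: "\<And>n x. x \<in> space M \<Longrightarrow> norm (X n x) \<le> g x"
    and l: "\<And>x. x \<in> space M \<Longrightarrow> (\<lambda>n. X n x) \<longlonglongrightarrow> Y x"
  shows "L2_tendsto M X Y"
proof -
  have [measurable]: "g \<in> borel_measurable M" using g by (simp add: sq_integrable_def)
  have bY: "norm (Y x) \<le> g x" if "x \<in> space M" for x
    by (rule LIMSEQ_le_const2[OF tendsto_norm[OF l[OF that]]]) (use b that in auto)
  have g0: "0 \<le> g x" if "x \<in> space M" for x using b[OF that] norm_ge_zero order_trans by blast
  have sX: "sq_integrable M (X n)" for n
    using b g0 by (intro sq_integrable_bound[OF g, where C=1]) force+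
  have sY: "sq_integrable M Y"
    using bY g0 by (intro sq_integrable_bound[OF g, where C=1]) force+
  have "(\<lambda>n. \<integral>x. (norm (X n x - Y x))\<^sup>2 \<partial>M) \<longlonglongrightarrow> (\<integral>x. 0 \<partial>M)"
  proof (rule integral_dominated_convergence[where w="\<lambda>x. 4 * (g x)\<^sup>2"])
    show "integrable M (\<lambda>x. 4 * (g x)\<^sup>2)" using g by (simp add: sq_integrable_def)
    show "AE x in M. (\<lambda>n. (norm (X n x - Y x))\<^sup>2) \<longlonglongrightarrow> 0"
    proof (rule AE_I2)
      fix x assume "x \<in> space M"
      then have "(\<lambda>n. (norm (X n x - Y x))\<^sup>2) \<longlonglongrightarrow> (norm (Y x - Y x))\<^sup>2"
        by (intro tendsto_intros l)
      then show "(\<lambda>n. (norm (X n x - Y x))\<^sup>2) \<longlonglongrightarrow> 0" by simp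
    qed
    show "AE x in M. norm ((norm (X n x - Y x))\<^sup>2) \<le> 4 * (g x)\<^sup>2" for n
    proof (rule AE_I2)
      fix x assume x: "x \<in> space M"
      have "norm (X n x - Y x) \<le> norm (X n x) + norm (Y x)" by (rule norm_triangle_ineq4)
      also have "\<dots> \<le> 2 * g x" using b[OF x, of n] bY[OF x] by simp
      finally have "(norm (X n x - Y x))\<^sup>2 \<le> (2 * g x)\<^sup>2" by (rule power_mono) simp
      then show "norm ((norm (X n x - Y x))\<^sup>2) \<le> 4 * (g x)\<^sup>2" by (simp add: power_mult_distrib)
    qed
  qed simp_all
  then show ?thesis using sX sY by (simp add: L2_tendsto_def)
qed

lemma L2_tendsto_0I:
  assumes "\<And>n. sq_integrable M (X n)" and [measurable]: "\<And>n. Y n \<in> borel_measurable M"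
    and "L2_tendsto M X (\<lambda>_. 0)" and b: "\<And>n x. x \<in> space M \<Longrightarrow> norm (Y n x) \<le> C * norm (X n x)"
  shows "L2_tendsto M Y (\<lambda>_. 0)"
proof -
  have s: "sq_integrable M (Y n)" for n using b by (intro sq_integrable_bound[OF assms(1)]) auto
  have "(\<lambda>n. \<integral>x. (norm (Y n x))\<^sup>2 \<partial>M) \<longlonglongrightarrow> 0"
  proof (rule tendsto_sandwich[OF _ _ tendsto_const])
    show "(\<lambda>n. C\<^sup>2 * (\<integral>x. (norm (X n x))\<^sup>2 \<partial>M)) \<longlonglongrightarrow> 0"
      using L2_tendstoD(3)[OF assms(3)] by (auto intro!: tendsto_eq_intros)
    have "(\<integral>x. (norm (Y n x))\<^sup>2 \<partial>M) \<le> (\<integral>x. C\<^sup>2 * (norm (X n x))\<^sup>2 \<partial>M)" for n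
      using s[of n] assms(1)[of n] power_mono[OF b, of _ n 2]
      by (intro integral_mono) (auto simp: sq_integrable_def power_mult_distrib)
    then show "\<forall>\<^sub>F n in sequentially. (\<integral>x. (norm (Y n x))\<^sup>2 \<partial>M) \<le> C\<^sup>2 * (\<integral>x. (norm (X n x))\<^sup>2 \<partial>M)"
      by simp
  qed auto
  then show ?thesis using s by (simp add: L2_tendsto_def sq_integrable_def)
qed

text \<open>Since \<open>e n\<close> converges pointwise and at no uniform rate, X e is split as (X
  - Y) e + Y e. The first part is small because of the bound 1 on \<open>e n\<close>, the second by
  dominated convergence with dominating function norm Y.\<close>

lemma L2_tendsto_mult_bounded:
  fixes Y :: "_ \<Rightarrow> _::{real_normed_field,banach,second_countable_topology}"
  assumes X: "L2_tendsto M X Y" and [measurable]: "\<And>n. e n \<in> borel_measurable M"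
    and e1: "\<And>n x. x \<in> space M \<Longrightarrow> norm (e n x) \<le> 1"
    and e: "\<And>x. x \<in> space M \<Longrightarrow> (\<lambda>n. e n x) \<longlonglongrightarrow> 1"
  shows "L2_tendsto M (\<lambda>n x. X n x * e n x) Y"
proof -
  note D = L2_tendstoD[OF X]
  have [measurable]: "X n \<in> borel_measurable M" "Y \<in> borel_measurable M" for n
    using D by (auto simp: sq_integrable_def)
  have "L2_tendsto M (\<lambda>n x. (X n x - Y x) * e n x) (\<lambda>x. 0)"
  proof (rule L2_tendsto_0I[where C=1])
    show "L2_tendsto M (\<lambda>n x. X n x - Y x) (\<lambda>x. 0)"
      using L2_tendsto_add[OF X L2_tendsto_const[OF sq_integrable_uminus[OF D(2)]]] by simp
    show "norm ((X n x - Y x) * e n x) \<le> 1 * norm (X n x - Y x)" if "x \<in> space M" for n x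
      using e1[OF that, of n] by (simp add: norm_mult mult_left_le)
  qed (use D in \<open>auto intro: sq_integrable_diff\<close>)
  moreover have "L2_tendsto M (\<lambda>n x. Y x * e n x) Y"
  proof (rule L2_tendsto_dominated[where g="\<lambda>x. norm (Y x)"])
    show "sq_integrable M (\<lambda>x. norm (Y x))" using D by (simp add: sq_integrable_def)
    show "norm (Y x * e n x) \<le> norm (Y x)" if "x \<in> space M" for n x
      using e1[OF that, of n] by (simp add: norm_mult mult_left_le)
    show "(\<lambda>n. Y x * e n x) \<longlonglongrightarrow> Y x" if "x \<in> space M" for x
      using e[OF that] by (auto intro!: tendsto_eq_intros)
  qed simp_all
  ultimately have "L2_tendsto M (\<lambda>n x. (X n x - Y x) * e n x + Y x * e n x) (\<lambda>x. 0 + Y x)"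
    by (rule L2_tendsto_add)
  then show ?thesis by (simp add: algebra_simps)
qed

text \<open>Continuity of the inner product, without conjugation: X X' - Y Y' = (X - Y)(X' - Y') + Y
  (X' - Y') + (X - Y) Y', and Cauchy-Schwarz bounds each term.\<close>

lemma L2_tendsto_mult:
  fixes Y :: "_ \<Rightarrow> _::{real_normed_field,banach,second_countable_topology}"
  assumes X: "L2_tendsto M X Y" and X': "L2_tendsto M X' Y'"
  shows "(\<lambda>n. \<integral>x. X n x * X' n x \<partial>M) \<longlonglongrightarrow> (\<integral>x. Y x * Y' x \<partial>M)"
proof -
  note D = L2_tendstoD[OF X] L2_tendstoD[OF X']
  define a where "a n = (\<integral>x. (norm (X n x - Y x))\<^sup>2 \<partial>M)" for n
  define b where "b n = (\<integral>x. (norm (X' n x - Y' x))\<^sup>2 \<partial>M)" for n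
  have ab: "a \<longlonglongrightarrow> 0" "b \<longlonglongrightarrow> 0" using D unfolding a_def b_def by auto
  have sd: "sq_integrable M (\<lambda>x. X n x - Y x)" "sq_integrable M (\<lambda>x. X' n x - Y' x)" for n
    using D by (auto intro: sq_integrable_diff)
  let ?A = "sqrt (\<integral>x. (norm (Y x))\<^sup>2 \<partial>M)" let ?B = "sqrt (\<integral>x. (norm (Y' x))\<^sup>2 \<partial>M)"
  have bound: "norm ((\<integral>x. X n x * X' n x \<partial>M) - (\<integral>x. Y x * Y' x \<partial>M))
     \<le> sqrt (a n) * sqrt (b n) + ?A * sqrt (b n) + sqrt (a n) * ?B" for n
  proof -
    have "(\<integral>x. X n x * X' n x \<partial>M) - (\<integral>x. Y x * Y' x \<partial>M) = (\<integral>x. X n x * X' n x - Y x * Y' x \<partial>M)"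
      using D by (intro Bochner_Integration.integral_diff[symmetric] sq_integrable_mult_integrable) auto
    also have "\<dots> = (\<integral>x. ((X n x - Y x) * (X' n x - Y' x) + Y x * (X' n x - Y' x)) + (X n x - Y x) * Y' x \<partial>M)"
      by (simp add: algebra_simps)
    also have "\<dots> = (\<integral>x. (X n x - Y x) * (X' n x - Y' x) \<partial>M) + (\<integral>x. Y x * (X' n x - Y' x) \<partial>M)
        + (\<integral>x. (X n x - Y x) * Y' x \<partial>M)"
      using D sd[of n] by (simp add: sq_integrable_mult_integrable Bochner_Integration.integrable_add)
    finally have e: "(\<integral>x. X n x * X' n x \<partial>M) - (\<integral>x. Y x * Y' x \<partial>M) = (\<integral>x. (X n x - Y x) * (X' n x - Y' x) \<partial>M) + (\<integral>x. Y x * (X' n x - Y' x) \<partial>M)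
        + (\<integral>x. (X n x - Y x) * Y' x \<partial>M)" .
    show ?thesis unfolding e a_def b_def
      by (intro norm_triangle_le add_mono cauchy_schwarz D sd)
  qed
  have lim: "(\<lambda>n. sqrt (a n) * sqrt (b n) + ?A * sqrt (b n) + sqrt (a n) * ?B) \<longlonglongrightarrow> 0"
    using ab by (auto intro!: tendsto_eq_intros)
  have "(\<lambda>n. (\<integral>x. X n x * X' n x \<partial>M) - (\<integral>x. Y x * Y' x \<partial>M)) \<longlonglongrightarrow> 0"
    by (rule Lim_null_comparison[OF always_eventually lim]) (intro allI bound)
  then show ?thesis by (simp add: LIM_zero_iff)
qed

section \<open>Limits of powers and of holomorphic functions\<close>

lemma LIMSEQ_of_scaled:
  fixes x :: "nat \<Rightarrow> 'a::real_normed_field"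
  assumes "(\<lambda>n. of_nat n * x n) \<longlonglongrightarrow> a"
  shows "x \<longlonglongrightarrow> 0"
proof -
  have "(\<lambda>n. of_nat n * x n * inverse (of_nat n)) \<longlonglongrightarrow> a * 0"
    by (intro tendsto_mult assms lim_inverse_n)
  moreover have "\<forall>\<^sub>F n in sequentially. of_nat n * x n * inverse (of_nat n) = x n"
    using eventually_gt_at_top[of 0] by eventually_elim auto
  ultimately show ?thesis by (simp add: Lim_transform_eventually)
qed

text \<open>The power is written as exp (n x h(x)) with h(z) = Ln (1 + z) / z. Since n x converges,
  x tends to 0, and h extends continuously to 0 with value 1, the derivative of Ln at 1. The
  identity needs 1 + x to be nonzero, which holds eventually.\<close>

lemma one_plus_power_tendsto_exp:
  fixes x :: "nat \<Rightarrow> complex"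
  assumes x: "(\<lambda>n. of_nat n * x n) \<longlonglongrightarrow> a"
  shows "(\<lambda>n. (1 + x n) ^ n) \<longlonglongrightarrow> exp a"
proof -
  have x0: "x \<longlonglongrightarrow> 0" using LIMSEQ_of_scaled[OF x] .
  define h where "h z = (if z = 0 then 1 else Ln (1 + z) / z)" for z :: complex
  have "(Ln has_field_derivative inverse 1) (at 1)"
    by (rule has_field_derivative_Ln) (auto simp: complex_nonpos_Reals_iff)
  then have "((\<lambda>z. (Ln (1 + z) - Ln 1) / z) \<longlongrightarrow> 1) (at 0)"
    by (simp add: DERIV_def)
  then have "(h \<longlongrightarrow> 1) (at 0)"
    by (rule Lim_transform_eventually) (auto simp: h_def eventually_at_filter)
  then have "isCont h 0" by (simp add: isCont_def h_def)
  then have "(\<lambda>n. h (x n)) \<longlonglongrightarrow> h 0" using x0 by (rule isCont_tendsto_compose)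
  then have "(\<lambda>n. exp ((of_nat n * x n) * h (x n))) \<longlonglongrightarrow> exp (a * 1)"
    by (intro tendsto_intros x) (simp add: h_def)
  moreover have "\<forall>\<^sub>F n in sequentially. dist (x n) 0 < 1" using x0 by (rule tendstoD) simp
  then have "\<forall>\<^sub>F n in sequentially. exp ((of_nat n * x n) * h (x n)) = (1 + x n) ^ n"
  proof eventually_elim
    fix n assume "dist (x n) 0 < 1"
    then have nz: "1 + x n \<noteq> 0" by (metis add_eq_0_iff2 dist_0_norm dist_commute less_irrefl norm_minus_cancel norm_one)
    have "x n * h (x n) = Ln (1 + x n)" by (simp add: h_def)
    then have "exp ((of_nat n * x n) * h (x n)) = exp (of_nat n * Ln (1 + x n))" by (simp add: mult.assoc)
    also have "\<dots> = (1 + x n) ^ n" using nz by (simp add: exp_of_nat_mult)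
    finally show "exp ((of_nat n * x n) * h (x n)) = (1 + x n) ^ n" .
  qed
  ultimately show ?thesis by (simp add: Lim_transform_eventually)
qed

lemma one_plus_power_tendsto_exp_real:
  fixes x :: "nat \<Rightarrow> real"
  assumes "(\<lambda>n. real n * x n) \<longlonglongrightarrow> a"
  shows "(\<lambda>n. (1 + x n) ^ n) \<longlonglongrightarrow> exp a"
proof -
  have "(\<lambda>n. of_real (real n * x n) :: complex) \<longlonglongrightarrow> of_real a" by (intro tendsto_of_real assms)
  then have "(\<lambda>n. of_nat n * complex_of_real (x n)) \<longlonglongrightarrow> of_real a" by simp
  from one_plus_power_tendsto_exp[OF this]
  have "(\<lambda>n. complex_of_real ((1 + x n) ^ n)) \<longlonglongrightarrow> of_real (exp a)" by (simp add: exp_of_real)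
  then show ?thesis by (simp only: tendsto_of_real_iff)
qed

lemma power_tendsto_exp:
  fixes x :: "nat \<Rightarrow> complex"
  assumes "(\<lambda>n. of_nat n * (x n - 1)) \<longlonglongrightarrow> a"
  shows "(\<lambda>n. x n ^ n) \<longlonglongrightarrow> exp a"
  using one_plus_power_tendsto_exp[OF assms] by simp

lemma power_tendsto_exp_real:
  fixes x :: "nat \<Rightarrow> real"
  assumes "(\<lambda>n. real n * (x n - 1)) \<longlonglongrightarrow> a"
  shows "(\<lambda>n. x n ^ n) \<longlonglongrightarrow> exp a"
  using one_plus_power_tendsto_exp_real[OF assms] by simp

text \<open>By Montel's theorem a subsequence converges to an entire function, which is constant since it
  is so on the real line.\<close>

lemma norm_real_limit_le:
  fixes F :: "nat \<Rightarrow> complex \<Rightarrow> complex"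
  assumes hol: "\<And>n. F n holomorphic_on UNIV"
    and bdd: "\<And>R. \<exists>B. \<forall>n z. norm z \<le> R \<longrightarrow> norm (F n z) \<le> B"
    and lim: "\<And>x. (\<lambda>n. F n (complex_of_real x)) \<longlonglongrightarrow> c"
    and le: "\<And>n. norm (F n w) \<le> b n" and b: "b \<longlonglongrightarrow> b0"
  shows "norm c \<le> b0"
proof -
  have "\<exists>B. \<forall>h\<in>range F. \<forall>z\<in>K. norm (h z) \<le> B" if K: "compact K" for K
  proof -
    from compact_imp_bounded[OF K] obtain R where "\<forall>z\<in>K. norm z \<le> R" by (auto simp: bounded_iff)
    with bdd[of R] show ?thesis by fast
  qed
  note bddK = this
  obtain g r where g: "g holomorphic_on UNIV" and r: "strict_mono (r :: nat \<Rightarrow> nat)"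
    and gl: "\<And>x. (\<lambda>n. F (r n) x) \<longlonglongrightarrow> g x"
  proof (rule Montel[of UNIV "range F" F])
    show "\<exists>B. \<forall>h\<in>range F. \<forall>z\<in>K. norm (h z) \<le> B" if "compact K" for K by (rule bddK[OF that])
    show "h holomorphic_on UNIV" if "h \<in> range F" for h using that hol by auto
    fix g r
    assume "g holomorphic_on UNIV" "strict_mono (r :: nat \<Rightarrow> nat)" "\<And>x. x \<in> UNIV \<Longrightarrow> (\<lambda>n. F (r n) x) \<longlonglongrightarrow> g x"
    then show thesis using that by auto
  qed auto
  have greal: "g (of_real x) = c" for x
    using LIMSEQ_unique[OF gl[of "of_real x"]] LIMSEQ_subseq_LIMSEQ[OF lim[of x] r] by (simp add: o_def)
  have "g w - c = 0"
  proof (rule analytic_continuation[where S=UNIV and U="range complex_of_real" and \<xi>=0 and f="\<lambda>z. g z - c"])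
    show "(\<lambda>z. g z - c) holomorphic_on UNIV" by (intro holomorphic_intros g)
    show "0 islimpt range complex_of_real"
      unfolding islimpt_sequential
    proof (intro exI conjI allI)
      show "complex_of_real (inverse (real (Suc n))) \<in> range complex_of_real - {0}" for n
        by (intro DiffI rangeI) (simp del: of_real_inverse of_nat_Suc)
      show "(\<lambda>n. complex_of_real (inverse (real (Suc n)))) \<longlonglongrightarrow> 0"
        using tendsto_of_real[OF LIMSEQ_inverse_real_of_nat, where 'a=complex] by simp
    qed
  qed (auto simp: greal)
  then have "(\<lambda>n. norm (F (r n) w)) \<longlonglongrightarrow> norm c" using tendsto_norm[OF gl[of w]] by simp
  moreover have "(\<lambda>n. b (r n)) \<longlonglongrightarrow> b0" using LIMSEQ_subseq_LIMSEQ[OF b r] by (simp add: o_def)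
  ultimately show ?thesis by (rule LIMSEQ_le) (use le in auto)
qed

section \<open>Expansions in quadratic mean\<close>

lemma (in prob_space) truncation:
  fixes y :: "'a \<Rightarrow> real"
  assumes y: "sq_integrable M y" and y0: "(\<integral>x. y x \<partial>M) = 0"
  obtains yn where "L2_tendsto M yn y" "\<And>n. (\<integral>x. yn n x \<partial>M) = 0"
    "\<And>n x. x \<in> space M \<Longrightarrow> \<bar>yn n x\<bar> \<le> 2 * sqrt (sqrt (real n))"
proof -
  have [measurable]: "y \<in> borel_measurable M" using y by (simp add: sq_integrable_def)
  define t where "t n x = (if \<bar>y x\<bar> \<le> sqrt (sqrt (real n)) then y x else 0)" for n x
  define yn where "yn n x = t n x + (- (\<integral>x. t n x \<partial>M))" for n x
  have [measurable]: "t n \<in> borel_measurable M" for n unfolding t_def by measurable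
  have tb: "norm (t n x) \<le> norm (sqrt (sqrt (real n)))" for n x by (auto simp: t_def)
  have ti: "integrable M (t n)" for n
    by (rule Bochner_Integration.integrable_bound[OF _ _ AE_I2[OF tb]]) auto
  have tl: "L2_tendsto M t y"
  proof (rule L2_tendsto_dominated[OF _ _ sq_integrable_norm[OF y]])
    show "(\<lambda>n. t n x) \<longlonglongrightarrow> y x" for x
    proof (rule tendsto_eventually)
      have "filterlim (\<lambda>n. sqrt (sqrt (real n))) at_top sequentially"
        by (intro filterlim_compose[OF sqrt_at_top] filterlim_real_sequentially)
      then have "\<forall>\<^sub>F n in sequentially. \<bar>y x\<bar> \<le> sqrt (sqrt (real n))"
        by (simp add: filterlim_at_top)
      then show "\<forall>\<^sub>F n in sequentially. t n x = y x" by eventually_elim (simp add: t_def)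
    qed
  qed (auto simp: t_def)
  have "(\<lambda>n. \<integral>x. t n x * 1 \<partial>M) \<longlonglongrightarrow> (\<integral>x. y x * 1 \<partial>M)"
    by (intro L2_tendsto_mult tl L2_tendsto_const sq_integrable_const)
  then have "(\<lambda>n. \<integral>x. t n x \<partial>M) \<longlonglongrightarrow> 0" using y0 by simp
  then have "L2_tendsto M (\<lambda>n x. - (\<integral>x. t n x \<partial>M)) (\<lambda>x. 0)"
    using sq_integrable_const by (auto simp: L2_tendsto_def prob_space intro!: tendsto_eq_intros)
  from L2_tendsto_add[OF tl this] have "L2_tendsto M yn y" unfolding yn_def by simp
  moreover have "(\<integral>x. yn n x \<partial>M) = 0" for n unfolding yn_def using ti by (simp add: prob_space)
  moreover have "\<bar>yn n x\<bar> \<le> 2 * sqrt (sqrt (real n))" for n x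
  proof -
    have "\<bar>\<integral>x. t n x \<partial>M\<bar> \<le> (\<integral>x. \<bar>t n x\<bar> \<partial>M)" by (rule integral_abs_bound)
    also have "\<dots> \<le> (\<integral>x. sqrt (sqrt (real n)) \<partial>M)" using ti[of n] tb[of n] by (intro integral_mono) auto
    finally show ?thesis using tb[of n x] by (simp add: yn_def prob_space)
  qed
  ultimately show ?thesis using that by blast
qed

lemma iexp_minus_1_bound: "cmod (iexp x - 1) \<le> \<bar>x\<bar>"
  using iexp_approx1[of x 0] by simp

lemma iexp_approx_linear: "cmod (iexp x - 1 - \<i> * x) \<le> x\<^sup>2 / 2"
  using iexp_approx1[of x 1] by (simp add: diff_diff_eq power2_eq_square)

lemma iexp_approx_quadratic: "cmod (iexp x - 1 - \<i> * x + x\<^sup>2 / 2) \<le> \<bar>x\<bar> ^ 3 / 6"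
proof -
  have "(\<Sum>k\<le>2. (\<i> * complex_of_real x) ^ k / fact k) = 1 + \<i> * x - x\<^sup>2 / 2"
  proof -
    have "{..2::nat} = {0, 1, 2}" by auto
    then show ?thesis by (simp add: power_mult_distrib)
  qed
  then show ?thesis using iexp_approx1[of x 2] by (simp add: fact_numeral algebra_simps eval_nat_numeral)
qed

section \<open>Limits of the scaled complex exponential\<close>

lemma iexp_sqrt_tendsto:
  "(\<lambda>n. sqrt (real n) * (iexp (x / sqrt (real n)) - 1)) \<longlonglongrightarrow> \<i> * complex_of_real x"
proof -
  have "(\<lambda>n. sqrt (real n) * (iexp (x / sqrt (real n)) - 1) - \<i> * x) \<longlonglongrightarrow> 0"
  proof (rule Lim_null_comparison)
    show "(\<lambda>n. x\<^sup>2 / 2 * inverse (sqrt (real n))) \<longlonglongrightarrow> 0"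
      by (intro tendsto_mult_right_zero tendsto_inverse_0_at_top filterlim_compose[OF sqrt_at_top] filterlim_real_sequentially)
    show "\<forall>\<^sub>F n in sequentially. cmod (sqrt (real n) * (iexp (x / sqrt (real n)) - 1) - \<i> * x) \<le> x\<^sup>2 / 2 * inverse (sqrt (real n))"
      using eventually_gt_at_top[of 0]
    proof eventually_elim
      fix n :: nat assume n: "0 < n"
      let ?y = "x / sqrt (real n)"
      have "sqrt (real n) * (iexp ?y - 1) - \<i> * x = sqrt (real n) * (iexp ?y - 1 - \<i> * ?y)"
        using n by (simp add: field_simps)
      then have "cmod (sqrt (real n) * (iexp ?y - 1) - \<i> * x) = sqrt (real n) * cmod (iexp ?y - 1 - \<i> * ?y)"
        by (simp add: norm_mult)
      also have "\<dots> \<le> sqrt (real n) * (?y\<^sup>2 / 2)" by (intro mult_left_mono iexp_approx_linear) auto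
      also have "\<dots> = x\<^sup>2 / 2 * inverse (sqrt (real n))"
        using n by (simp add: field_simps power2_eq_square)
      finally show "cmod (sqrt (real n) * (iexp ?y - 1) - \<i> * x) \<le> x\<^sup>2 / 2 * inverse (sqrt (real n))" .
    qed
  qed
  then show ?thesis by (simp add: LIM_zero_iff)
qed

lemma iexp_second_order_tendsto:
  "(\<lambda>n. real n * (iexp (x / sqrt (real n)) - 1 - \<i> * (x / sqrt (real n)))) \<longlonglongrightarrow> - complex_of_real (x\<^sup>2 / 2)"
proof -
  have "(\<lambda>n. real n * (iexp (x / sqrt (real n)) - 1 - \<i> * (x / sqrt (real n))) + complex_of_real (x\<^sup>2 / 2)) \<longlonglongrightarrow> 0"
  proof (rule Lim_null_comparison)
    show "(\<lambda>n. \<bar>x\<bar> ^ 3 / 6 * inverse (sqrt (real n))) \<longlonglongrightarrow> 0"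
      by (intro tendsto_mult_right_zero tendsto_inverse_0_at_top filterlim_compose[OF sqrt_at_top] filterlim_real_sequentially)
    show "\<forall>\<^sub>F n in sequentially. cmod (real n * (iexp (x / sqrt (real n)) - 1 - \<i> * (x / sqrt (real n))) + complex_of_real (x\<^sup>2 / 2))
        \<le> \<bar>x\<bar> ^ 3 / 6 * inverse (sqrt (real n))"
      using eventually_gt_at_top[of 0]
    proof eventually_elim
      fix n :: nat assume n: "0 < n"
      let ?y = "x / sqrt (real n)"
      have "x\<^sup>2 / 2 = real n * (?y\<^sup>2 / 2)" using n by (simp add: power_divide)
      then have "real n * (iexp ?y - 1 - \<i> * ?y) + complex_of_real (x\<^sup>2 / 2)
          = of_real (real n) * (iexp ?y - 1 - \<i> * ?y + ?y\<^sup>2 / 2)"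
        by (simp only:) (simp add: algebra_simps)
      then have "cmod (real n * (iexp ?y - 1 - \<i> * ?y) + complex_of_real (x\<^sup>2 / 2))
          = real n * cmod (iexp ?y - 1 - \<i> * ?y + ?y\<^sup>2 / 2)" by (simp only: norm_mult) simp
      also have "\<dots> \<le> real n * (\<bar>?y\<bar> ^ 3 / 6)" by (intro mult_left_mono iexp_approx_quadratic) auto
      also have "\<dots> = \<bar>x\<bar> ^ 3 / 6 * inverse (sqrt (real n))"
        using n by (simp add: field_simps power3_eq_cube abs_divide)
      finally show "cmod (real n * (iexp ?y - 1 - \<i> * ?y) + complex_of_real (x\<^sup>2 / 2))
        \<le> \<bar>x\<bar> ^ 3 / 6 * inverse (sqrt (real n))" .
    qed
  qed
  from tendsto_diff[OF this tendsto_const[of "complex_of_real (x\<^sup>2 / 2)"]] show ?thesis by simp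
qed

lemma iexp_sqrt_tendsto_1: "(\<lambda>n. iexp (x / sqrt (real n))) \<longlonglongrightarrow> 1"
proof -
  have "(\<lambda>n. x * inverse (sqrt (real n))) \<longlonglongrightarrow> 0"
    by (intro tendsto_mult_right_zero tendsto_inverse_0_at_top filterlim_compose[OF sqrt_at_top] filterlim_real_sequentially)
  then have "(\<lambda>n. iexp (x * inverse (sqrt (real n)))) \<longlonglongrightarrow> iexp 0"
    by (intro tendsto_intros)
  then show ?thesis by (simp add: divide_inverse)
qed

text \<open>Intended reading: \<open>d\<close> is the summand of a linear statistic,
  \<open>y\<close> half the score in some direction and \<open>yn\<close> its truncation. Half,
  because the square root of a density has half the score as its derivative. No relation between
  \<open>d\<close> and \<open>y\<close> is fixed here; their covariance stays visible in
  \<open>moment_ew2\<close>.\<close>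

locale perturbation = prob_space +
  fixes d :: "'a \<Rightarrow> real" and yn :: "nat \<Rightarrow> 'a \<Rightarrow> real" and y :: "'a \<Rightarrow> real"
  assumes d: "sq_integrable M d" and d0: "(\<integral>x. d x \<partial>M) = 0"
    and y: "L2_tendsto M yn y" and y0: "\<And>n. (\<integral>x. yn n x \<partial>M) = 0"
    and yb: "\<And>n x. x \<in> space M \<Longrightarrow> \<bar>yn n x\<bar> \<le> 2 * sqrt (sqrt (real n))"
begin

lemma meas [measurable]: "d \<in> borel_measurable M" "yn n \<in> borel_measurable M" "y \<in> borel_measurable M"
  using d L2_tendstoD[OF y] by (auto simp: sq_integrable_def)

text \<open>One factor of the exponential of i t times the normalized sum of \<open>d\<close>; by
  independence the n-th power of its mean is the characteristic function of that sum.\<close>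

definition e :: "real \<Rightarrow> nat \<Rightarrow> 'a \<Rightarrow> complex" where
  "e t n x = iexp (t * d x / sqrt (real n))"

lemma e_measurable [measurable]: "e t n \<in> borel_measurable M"
  unfolding e_def by measurable

lemma norm_e: "norm (e t n x) = 1"
  unfolding e_def by (rule norm_exp_i_times)

lemma e_tendsto: "(\<lambda>n. e t n x) \<longlonglongrightarrow> 1"
  unfolding e_def by (rule iexp_sqrt_tendsto_1)

lemma sq_yn: "sq_integrable M (yn n)" and sq_y: "sq_integrable M y"
  using L2_tendstoD[OF y] by auto

text \<open>Pointwise the limit is the derivative of the exponential. The inequality abs (iexp x -
  1) \<le> abs x provides the square integrable majorant abs (t d), so no moment of \<open>d\<close>
  beyond the second enters.\<close>

lemma L2_e: "L2_tendsto M (\<lambda>n x. sqrt (real n) * (e t n x - 1)) (\<lambda>x. \<i> * complex_of_real (t * d x))"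
proof (rule L2_tendsto_dominated[where g="\<lambda>x. norm (t * d x)"])
  show "sq_integrable M (\<lambda>x. norm (t * d x))" by (intro sq_integrable_norm sq_integrable_cmult d)
  show "(\<lambda>n. sqrt (real n) * (e t n x - 1)) \<longlonglongrightarrow> \<i> * complex_of_real (t * d x)" for x
    unfolding e_def by (rule iexp_sqrt_tendsto)
  show "norm (sqrt (real n) * (e t n x - 1)) \<le> norm (t * d x)" for n x
  proof -
    have "norm (sqrt (real n) * (e t n x - 1)) \<le> sqrt (real n) * \<bar>t * d x / sqrt (real n)\<bar>"
      unfolding e_def norm_mult norm_of_real abs_of_nonneg[OF real_sqrt_ge_zero[OF of_nat_0_le_iff]]
      by (intro mult_left_mono iexp_minus_1_bound) auto
    also have "\<dots> \<le> norm (t * d x)" by (cases "n = 0") auto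
    finally show ?thesis .
  qed
qed measurable

lemma L2_y: "L2_tendsto M (\<lambda>n x. complex_of_real (yn n x)) (\<lambda>x. complex_of_real (y x))"
  by (rule L2_tendsto_of_real[OF y])

lemma L2_ye: "L2_tendsto M (\<lambda>n x. complex_of_real (yn n x) * e t n x) (\<lambda>x. complex_of_real (y x))"
  by (rule L2_tendsto_mult_bounded[OF L2_y]) (auto simp: norm_e e_tendsto)

text \<open>The linear term i t d / \<surd>n has mean zero and may be subtracted before multiplying
  by n. What is left is dominated by (t d)^2 / 2.\<close>

lemma moment_e: "(\<lambda>n. of_nat n * ((\<integral>x. e t n x \<partial>M) - 1)) \<longlonglongrightarrow> - complex_of_real (t\<^sup>2 * (\<integral>x. (d x)\<^sup>2 \<partial>M) / 2)"
proof -
  have ie: "integrable M (e t n)" for n by (rule integrable_const_bound[of _ 1]) (auto simp: norm_e)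
  have id: "integrable M d" by (rule sq_integrable_integrable[OF d])
  have "(\<lambda>n. \<integral>x. of_nat n * (e t n x - 1 - \<i> * (t * d x / sqrt (real n))) \<partial>M)
      \<longlonglongrightarrow> (\<integral>x. - complex_of_real ((t * d x)\<^sup>2 / 2) \<partial>M)"
  proof (rule integral_dominated_convergence[where w="\<lambda>x. (t * d x)\<^sup>2 / 2"])
    show "integrable M (\<lambda>x. (t * d x)\<^sup>2 / 2)"
      using sq_integrable_cmult[OF d, of t] by (simp add: sq_integrable_def)
    show "AE x in M. (\<lambda>n. of_nat n * (e t n x - 1 - \<i> * (t * d x / sqrt (real n)))) \<longlonglongrightarrow> - complex_of_real ((t * d x)\<^sup>2 / 2)"
    proof (rule AE_I2)
      fix x
      show "(\<lambda>n. of_nat n * (e t n x - 1 - \<i> * (t * d x / sqrt (real n)))) \<longlonglongrightarrow> - complex_of_real ((t * d x)\<^sup>2 / 2)"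
        using iexp_second_order_tendsto[of "t * d x"] by (simp add: e_def)
    qed
    show "AE x in M. cmod (of_nat n * (e t n x - 1 - \<i> * (t * d x / sqrt (real n)))) \<le> (t * d x)\<^sup>2 / 2" for n
    proof (rule AE_I2)
      fix x
      have "cmod (of_nat n * (e t n x - 1 - \<i> * (t * d x / sqrt (real n)))) \<le> real n * ((t * d x / sqrt (real n))\<^sup>2 / 2)"
        unfolding e_def norm_mult norm_of_nat using iexp_approx_linear[of "t * d x / sqrt (real n)"]
        by (intro mult_left_mono) auto
      also have "\<dots> \<le> (t * d x)\<^sup>2 / 2" by (cases "n = 0") (auto simp: power_divide)
      finally show "cmod (of_nat n * (e t n x - 1 - \<i> * (t * d x / sqrt (real n)))) \<le> (t * d x)\<^sup>2 / 2" .
    qed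
  qed measurable
  moreover have E: "(\<integral>x. of_nat n * (e t n x - 1 - \<i> * (t * d x / sqrt (real n))) \<partial>M) = of_nat n * ((\<integral>x. e t n x \<partial>M) - 1)" for n
  proof -
    have "(\<integral>x. \<i> * complex_of_real (t * d x / sqrt (real n)) \<partial>M) = \<i> * complex_of_real (\<integral>x. t * d x / sqrt (real n) \<partial>M)"
      by (simp only: integral_complex_of_real integral_mult_right_zero)
    also have "\<dots> = 0" using d0 id by simp
    finally show ?thesis using ie[of n] id by (simp add: prob_space)
  qed
  have "(\<integral>x. - complex_of_real ((t * d x)\<^sup>2 / 2) \<partial>M) = - complex_of_real (\<integral>x. (t * d x)\<^sup>2 / 2 \<partial>M)"
    by (simp only: integral_complex_of_real integral_minus)
  then have E2: "(\<integral>x. - complex_of_real ((t * d x)\<^sup>2 / 2) \<partial>M) = - complex_of_real (t\<^sup>2 * (\<integral>x. (d x)\<^sup>2 \<partial>M) / 2)"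
    by (simp only: power_mult_distrib integral_divide_zero integral_mult_right_zero)
  ultimately show ?thesis unfolding E E2 by blast
qed

text \<open>Up to normalization of the product, its square is for real c the approximate likelihood
  ratio of one observation. It is defined for complex c because the lower bound evaluates it at c =
  - i t.\<close>

definition w :: "complex \<Rightarrow> nat \<Rightarrow> 'a \<Rightarrow> complex" where
  "w c n x = 1 + c * of_real (yn n x) / of_real (sqrt (real n))"

lemma w_measurable [measurable]: "w c n \<in> borel_measurable M"
  unfolding w_def by measurable

lemma sq_w: "sq_integrable M (w c n)"
proof -
  have "sq_integrable M (\<lambda>x. 1 + (c / of_real (sqrt (real n))) * complex_of_real (yn n x))"
    by (intro sq_integrable_add sq_integrable_cmult sq_integrable_of_real sq_yn sq_integrable_const)
  then show ?thesis by (simp add: w_def[abs_def])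
qed

text \<open>Expanding the square gives the mean of \<open>e\<close>, a cross term and a quadratic
  term. In the cross term \<open>yn\<close> has mean zero, so \<open>e\<close> may be replaced by
  \<open>e\<close> - 1, which after scaling by \<surd>n converges in L2; the quadratic term is an
  inner product of two L2-convergent sequences.\<close>

lemma moment_ew2: "(\<lambda>n. of_nat n * ((\<integral>x. e t n x * (w c n x)\<^sup>2 \<partial>M) - 1))
    \<longlonglongrightarrow> - complex_of_real (t\<^sup>2 * (\<integral>x. (d x)\<^sup>2 \<partial>M) / 2) + c\<^sup>2 * of_real (\<integral>x. (y x)\<^sup>2 \<partial>M)
        + 2 * \<i> * of_real t * c * of_real (\<integral>x. d x * y x \<partial>M)"
proof -
  have iy: "integrable M (\<lambda>x. complex_of_real (yn n x))" for n
    by (intro sq_integrable_integrable sq_integrable_of_real sq_yn)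
  have "(\<lambda>n. \<integral>x. complex_of_real (yn n x) * (sqrt (real n) * (e t n x - 1)) \<partial>M)
      \<longlonglongrightarrow> (\<integral>x. complex_of_real (y x) * (\<i> * complex_of_real (t * d x)) \<partial>M)"
    by (intro L2_tendsto_mult L2_y L2_e)
  also have "(\<integral>x. complex_of_real (y x) * (\<i> * complex_of_real (t * d x)) \<partial>M) = (\<integral>x. \<i> * of_real t * complex_of_real (d x * y x) \<partial>M)"
    by (intro Bochner_Integration.integral_cong) auto
  also have "\<dots> = \<i> * of_real t * of_real (\<integral>x. d x * y x \<partial>M)"
    by (simp only: integral_complex_of_real integral_mult_right_zero)
  finally have T2: "(\<lambda>n. \<integral>x. complex_of_real (yn n x) * (sqrt (real n) * (e t n x - 1)) \<partial>M)
      \<longlonglongrightarrow> \<i> * of_real t * of_real (\<integral>x. d x * y x \<partial>M)" .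
  have "(\<lambda>n. \<integral>x. (complex_of_real (yn n x) * e t n x) * complex_of_real (yn n x) \<partial>M)
      \<longlonglongrightarrow> (\<integral>x. complex_of_real (y x) * complex_of_real (y x) \<partial>M)"
    by (intro L2_tendsto_mult L2_y L2_ye)
  also have "(\<integral>x. complex_of_real (y x) * complex_of_real (y x) \<partial>M) = of_real (\<integral>x. (y x)\<^sup>2 \<partial>M)"
    by (simp only: of_real_mult[symmetric] integral_complex_of_real power2_eq_square)
  finally have T3: "(\<lambda>n. \<integral>x. (complex_of_real (yn n x) * e t n x) * complex_of_real (yn n x) \<partial>M) \<longlonglongrightarrow> of_real (\<integral>x. (y x)\<^sup>2 \<partial>M)" .
  have "of_nat n * ((\<integral>x. e t n x \<partial>M) - 1) + 2 * c * (\<integral>x. complex_of_real (yn n x) * (sqrt (real n) * (e t n x - 1)) \<partial>M)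
       + c\<^sup>2 * (\<integral>x. (complex_of_real (yn n x) * e t n x) * complex_of_real (yn n x) \<partial>M)
      = of_nat n * ((\<integral>x. e t n x * (w c n x)\<^sup>2 \<partial>M) - 1)" if n: "n > 0" for n
  proof -
    let ?s = "complex_of_real (sqrt (real n))"
    have s: "?s * ?s = of_nat n" "?s \<noteq> 0"
      using n by (simp_all add: of_real_mult[symmetric] del: of_real_mult)
    have ie: "integrable M (e t n)" by (rule integrable_const_bound[of _ 1]) (auto simp: norm_e)
    have iye: "integrable M (\<lambda>x. complex_of_real (yn n x) * e t n x)"
      by (rule Bochner_Integration.integrable_bound[OF iy[of n]]) (auto simp: norm_mult norm_e)
    have iyye: "integrable M (\<lambda>x. (complex_of_real (yn n x) * e t n x) * complex_of_real (yn n x))"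
      using L2_tendstoD(1)[OF L2_ye] sq_integrable_of_real[OF sq_yn] by (rule sq_integrable_mult_integrable)
    have exp: "e t n x * (w c n x)\<^sup>2 = e t n x + (2 * c / ?s) * (complex_of_real (yn n x) * e t n x)
        + (c\<^sup>2 / of_nat n) * ((complex_of_real (yn n x) * e t n x) * complex_of_real (yn n x))" for x
      unfolding w_def s(1)[symmetric] using s(2) by (simp add: field_simps power2_eq_square)
    have "(\<integral>x. e t n x * (w c n x)\<^sup>2 \<partial>M) = (\<integral>x. e t n x \<partial>M) + (2 * c / ?s) * (\<integral>x. complex_of_real (yn n x) * e t n x \<partial>M)
        + (c\<^sup>2 / of_nat n) * (\<integral>x. (complex_of_real (yn n x) * e t n x) * complex_of_real (yn n x) \<partial>M)"
      unfolding exp using ie iye iyye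
      by (simp only: Bochner_Integration.integral_add Bochner_Integration.integrable_add integrable_mult_right integral_mult_right_zero simp_thms)
    moreover have "(\<integral>x. complex_of_real (yn n x) * (?s * (e t n x - 1)) \<partial>M) = ?s * (\<integral>x. complex_of_real (yn n x) * e t n x \<partial>M)"
    proof -
      have "(\<integral>x. complex_of_real (yn n x) * (?s * (e t n x - 1)) \<partial>M)
         = (\<integral>x. ?s * (complex_of_real (yn n x) * e t n x) - ?s * complex_of_real (yn n x) \<partial>M)"
        by (intro Bochner_Integration.integral_cong) (auto simp: algebra_simps)
      also have "\<dots> = ?s * (\<integral>x. complex_of_real (yn n x) * e t n x \<partial>M) - ?s * (\<integral>x. complex_of_real (yn n x) \<partial>M)"
        using iye iy[of n] by (simp only: Bochner_Integration.integral_diff integrable_mult_right integral_mult_right_zero simp_thms)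
      also have "(\<integral>x. complex_of_real (yn n x) \<partial>M) = 0" by (simp only: integral_complex_of_real y0 of_real_0)
      finally show ?thesis by simp
    qed
    moreover have "of_nat n * (J0 - 1) + 2 * c * (?s * J1) + c\<^sup>2 * J2
        = of_nat n * ((J0 + (2 * c / ?s) * J1 + (c\<^sup>2 / of_nat n) * J2) - 1)" for J0 J1 J2
    proof -
      have a: "of_nat n * (2 * c / ?s) = 2 * c * ?s"
        unfolding s(1)[symmetric] using s(2) by (simp del: of_real_mult)
      have b: "of_nat n * (c\<^sup>2 / of_nat n) = c\<^sup>2" using n by simp
      have "of_nat n * ((J0 + (2 * c / ?s) * J1 + (c\<^sup>2 / of_nat n) * J2) - 1)
          = of_nat n * (J0 - 1) + (of_nat n * (2 * c / ?s)) * J1 + (of_nat n * (c\<^sup>2 / of_nat n)) * J2"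
        by (simp only: ring_distribs diff_conv_add_uminus ac_simps)
      then show ?thesis unfolding a b by (simp only: ac_simps)
    qed
    ultimately show ?thesis by (simp only:)
  qed
  then have "\<forall>\<^sub>F n in sequentially. of_nat n * ((\<integral>x. e t n x \<partial>M) - 1) + 2 * c * (\<integral>x. complex_of_real (yn n x) * (sqrt (real n) * (e t n x - 1)) \<partial>M)
       + c\<^sup>2 * (\<integral>x. (complex_of_real (yn n x) * e t n x) * complex_of_real (yn n x) \<partial>M)
      = of_nat n * ((\<integral>x. e t n x * (w c n x)\<^sup>2 \<partial>M) - 1)"
    by (rule eventually_mono[OF eventually_gt_at_top[of 0]])
  moreover have "(\<lambda>n. of_nat n * ((\<integral>x. e t n x \<partial>M) - 1) + 2 * c * (\<integral>x. complex_of_real (yn n x) * (sqrt (real n) * (e t n x - 1)) \<partial>M)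
       + c\<^sup>2 * (\<integral>x. (complex_of_real (yn n x) * e t n x) * complex_of_real (yn n x) \<partial>M))
     \<longlonglongrightarrow> - complex_of_real (t\<^sup>2 * (\<integral>x. (d x)\<^sup>2 \<partial>M) / 2) + 2 * c * (\<i> * of_real t * of_real (\<integral>x. d x * y x \<partial>M)) + c\<^sup>2 * of_real (\<integral>x. (y x)\<^sup>2 \<partial>M)"
    by (intro tendsto_intros moment_e T2 T3)
  ultimately have "(\<lambda>n. of_nat n * ((\<integral>x. e t n x * (w c n x)\<^sup>2 \<partial>M) - 1))
     \<longlonglongrightarrow> - complex_of_real (t\<^sup>2 * (\<integral>x. (d x)\<^sup>2 \<partial>M) / 2) + 2 * c * (\<i> * of_real t * of_real (\<integral>x. d x * y x \<partial>M)) + c\<^sup>2 * of_real (\<integral>x. (y x)\<^sup>2 \<partial>M)"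
    by (rule Lim_transform_eventually[rotated])
  then show ?thesis by (simp add: algebra_simps)
qed

text \<open>The linear part is written with the limit \<open>y\<close> and not with
  \<open>yn\<close>: for c = - i t it becomes i t (d - 2 y) / \<surd>n, which is conditionally
  centred in the application. The remainder consists of the error of \<open>e\<close>, the
  truncation error and the quadratic term, treated as A, B and C.\<close>

lemma remainder_ew2:
  "(\<lambda>n. real n * (\<integral>x. (cmod (e t n x * (w c n x)\<^sup>2 - 1 - \<i> * (t * d x / sqrt (real n)) - 2 * c * of_real (y x) / of_real (sqrt (real n))))\<^sup>2 \<partial>M)) \<longlonglongrightarrow> 0"
proof -
  let ?r = "\<lambda>n x. e t n x * (w c n x)\<^sup>2 - 1 - \<i> * (t * d x / sqrt (real n)) - 2 * c * of_real (y x) / of_real (sqrt (real n))"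
  have A: "L2_tendsto M (\<lambda>n x. sqrt (real n) * (e t n x - 1) + - (\<i> * complex_of_real (t * d x))) (\<lambda>x. \<i> * complex_of_real (t * d x) + - (\<i> * complex_of_real (t * d x)))"
    by (intro L2_tendsto_add L2_e L2_tendsto_const sq_integrable_uminus sq_integrable_cmult sq_integrable_of_real d)
  have B: "L2_tendsto M (\<lambda>n x. 2 * c * (complex_of_real (yn n x) * e t n x + - complex_of_real (y x))) (\<lambda>x. 2 * c * (complex_of_real (y x) + - complex_of_real (y x)))"
    by (intro L2_tendsto_add L2_tendsto_cmult L2_ye L2_tendsto_const sq_integrable_uminus sq_integrable_of_real sq_y)
  \<comment> \<open>The quadratic term would need a fourth moment of \<open>y\<close>. The
    truncation replaces it: \<open>yn\<close>^4 / n \<le> 4 \<open>yn\<close>^2 / \<surd>n, whose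
    integral tends to 0.\<close>
  have C: "L2_tendsto M (\<lambda>n x. c\<^sup>2 * ((complex_of_real (yn n x) * e t n x) * (yn n x / sqrt (real n)))) (\<lambda>x. c\<^sup>2 * 0)"
  proof (rule L2_tendsto_cmult)
    have s: "sq_integrable M (\<lambda>x. (complex_of_real (yn n x) * e t n x) * (yn n x / sqrt (real n)))" for n
    proof (rule sq_integrable_bound[OF sq_yn[of n]])
      show "norm ((complex_of_real (yn n x) * e t n x) * (yn n x / sqrt (real n))) \<le> (2 * sqrt (sqrt (real n)) / sqrt (real n)) * norm (yn n x)" if "x \<in> space M" for x
      proof -
        have "\<bar>yn n x\<bar> * \<bar>yn n x\<bar> \<le> 2 * sqrt (sqrt (real n)) * \<bar>yn n x\<bar>"
          by (intro mult_right_mono yb that) auto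
        then have "\<bar>yn n x\<bar> * \<bar>yn n x\<bar> / sqrt (real n) \<le> 2 * sqrt (sqrt (real n)) * \<bar>yn n x\<bar> / sqrt (real n)"
          by (intro divide_right_mono) auto
        then show ?thesis by (simp only: norm_mult norm_divide norm_e norm_of_real real_norm_def abs_divide) simp
      qed
    qed measurable
    have lim: "(\<lambda>n. 4 * inverse (sqrt (real n)) * (\<integral>x. (norm (yn n x))\<^sup>2 \<partial>M)) \<longlonglongrightarrow> 4 * 0 * (\<integral>x. y x * y x \<partial>M)"
    proof (intro tendsto_mult tendsto_const tendsto_inverse_0_at_top filterlim_compose[OF sqrt_at_top] filterlim_real_sequentially)
      show "(\<lambda>n. (\<integral>x. (norm (yn n x))\<^sup>2 \<partial>M)) \<longlonglongrightarrow> (\<integral>x. y x * y x \<partial>M)"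
        using L2_tendsto_mult[OF y y] by (simp add: power2_eq_square)
    qed
    have "(\<lambda>n. \<integral>x. (norm ((complex_of_real (yn n x) * e t n x) * (yn n x / sqrt (real n))))\<^sup>2 \<partial>M) \<longlonglongrightarrow> 0"
    proof (rule tendsto_sandwich[OF _ _ tendsto_const])
      show "(\<lambda>n. 4 * inverse (sqrt (real n)) * (\<integral>x. (norm (yn n x))\<^sup>2 \<partial>M)) \<longlonglongrightarrow> 0"
        using lim by simp
      have "(\<integral>x. (norm ((complex_of_real (yn n x) * e t n x) * (yn n x / sqrt (real n))))\<^sup>2 \<partial>M)
        \<le> (\<integral>x. 4 * inverse (sqrt (real n)) * (norm (yn n x))\<^sup>2 \<partial>M)" if n: "n > 0" for n
      proof (rule integral_mono[OF sq_integrable_norm2[OF s]])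
        show "integrable M (\<lambda>x. 4 * inverse (sqrt (real n)) * (norm (yn n x))\<^sup>2)"
          using sq_integrable_norm2[OF sq_yn[of n]] by (rule integrable_mult_right)
        fix x assume "x \<in> space M"
        then have "(yn n x)\<^sup>2 \<le> (2 * sqrt (sqrt (real n)))\<^sup>2"
          by (intro power2_le_iff_abs_le[THEN iffD2] yb) auto
        then have b: "(yn n x)\<^sup>2 \<le> 4 * sqrt (real n)" by (simp add: power_mult_distrib)
        have "(norm ((complex_of_real (yn n x) * e t n x) * (yn n x / sqrt (real n))))\<^sup>2 = (yn n x)\<^sup>2 * (yn n x)\<^sup>2 / real n"
          by (simp add: norm_mult norm_divide norm_e power_mult_distrib power_divide)
        also have "\<dots> \<le> (4 * sqrt (real n)) * (yn n x)\<^sup>2 / real n"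
          using b by (intro divide_right_mono mult_right_mono) auto
        also have "\<dots> = 4 * inverse (sqrt (real n)) * (norm (yn n x))\<^sup>2"
          using n by (simp add: field_simps)
        finally show "(norm ((complex_of_real (yn n x) * e t n x) * (yn n x / sqrt (real n))))\<^sup>2 \<le> 4 * inverse (sqrt (real n)) * (norm (yn n x))\<^sup>2" .
      qed
      then show "\<forall>\<^sub>F n in sequentially. (\<integral>x. (norm ((complex_of_real (yn n x) * e t n x) * (yn n x / sqrt (real n))))\<^sup>2 \<partial>M)
        \<le> 4 * inverse (sqrt (real n)) * (\<integral>x. (norm (yn n x))\<^sup>2 \<partial>M)"
        by (intro eventually_mono[OF eventually_gt_at_top[of 0]]) simp
    qed auto
    then show "L2_tendsto M (\<lambda>n x. (complex_of_real (yn n x) * e t n x) * (yn n x / sqrt (real n))) (\<lambda>x. 0)"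
      using s by (simp add: L2_tendsto_def sq_integrable_const)
  qed
  have "L2_tendsto M (\<lambda>n x. (sqrt (real n) * (e t n x - 1) + - (\<i> * complex_of_real (t * d x)))
      + (2 * c * (complex_of_real (yn n x) * e t n x + - complex_of_real (y x)))
      + c\<^sup>2 * ((complex_of_real (yn n x) * e t n x) * (yn n x / sqrt (real n)))) (\<lambda>x. 0)"
    using L2_tendsto_add[OF L2_tendsto_add[OF A B] C] by simp
  from L2_tendstoD(3)[OF this]
  have "(\<lambda>n. \<integral>x. (cmod ((sqrt (real n) * (e t n x - 1) + - (\<i> * complex_of_real (t * d x)))
      + (2 * c * (complex_of_real (yn n x) * e t n x + - complex_of_real (y x)))
      + c\<^sup>2 * ((complex_of_real (yn n x) * e t n x) * (yn n x / sqrt (real n)))))\<^sup>2 \<partial>M) \<longlonglongrightarrow> 0" by simp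
  moreover have "\<forall>\<^sub>F n in sequentially. (\<integral>x. (cmod ((sqrt (real n) * (e t n x - 1) + - (\<i> * complex_of_real (t * d x)))
      + (2 * c * (complex_of_real (yn n x) * e t n x + - complex_of_real (y x)))
      + c\<^sup>2 * ((complex_of_real (yn n x) * e t n x) * (yn n x / sqrt (real n)))))\<^sup>2 \<partial>M) = real n * (\<integral>x. (cmod (?r n x))\<^sup>2 \<partial>M)"
    using eventually_gt_at_top[of 0]
  proof eventually_elim
    fix n :: nat assume n: "n > 0"
    let ?s = "complex_of_real (sqrt (real n))"
    have s: "?s * ?s = of_nat n" "?s \<noteq> 0"
      using n by (simp_all add: of_real_mult[symmetric] del: of_real_mult)
    have "(sqrt (real n) * (e t n x - 1) + - (\<i> * complex_of_real (t * d x)))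
      + (2 * c * (complex_of_real (yn n x) * e t n x + - complex_of_real (y x)))
      + c\<^sup>2 * ((complex_of_real (yn n x) * e t n x) * (yn n x / sqrt (real n))) = ?s * ?r n x" for x
      unfolding w_def using s(2) by (simp add: field_simps power2_eq_square)
    then show "(\<integral>x. (cmod ((sqrt (real n) * (e t n x - 1) + - (\<i> * complex_of_real (t * d x)))
      + (2 * c * (complex_of_real (yn n x) * e t n x + - complex_of_real (y x)))
      + c\<^sup>2 * ((complex_of_real (yn n x) * e t n x) * (yn n x / sqrt (real n)))))\<^sup>2 \<partial>M) = real n * (\<integral>x. (cmod (?r n x))\<^sup>2 \<partial>M)"
      by (simp only: norm_mult power_mult_distrib integral_mult_right_zero) simp
  qed
  ultimately show ?thesis by (rule Lim_transform_eventually)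
qed

text \<open>The term linear in \<open>yn\<close> integrates to zero, leaving 1 + O(1/n) per
  observation; n-th powers therefore stay bounded, locally uniformly in complex c.\<close>

lemma norm_w2: "(\<integral>x. (cmod (w c n x))\<^sup>2 \<partial>M) \<le> 1 + (cmod c)\<^sup>2 * (\<integral>x. (yn n x)\<^sup>2 \<partial>M) / real n"
proof -
  have e: "(cmod (w c n x))\<^sup>2 = 1 + (2 * Re c / sqrt (real n)) * yn n x + ((cmod c)\<^sup>2 / real n) * (yn n x)\<^sup>2" for x
  proof -
    have "w c n x = 1 + c * complex_of_real (yn n x / sqrt (real n))" by (simp add: w_def)
    then have "(cmod (w c n x))\<^sup>2 = (1 + Re c * (yn n x / sqrt (real n)))\<^sup>2 + (Im c * (yn n x / sqrt (real n)))\<^sup>2"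
      by (simp add: cmod_power2)
    also have "\<dots> = 1 + (2 * Re c / sqrt (real n)) * yn n x + ((Re c)\<^sup>2 + (Im c)\<^sup>2) * (yn n x / sqrt (real n))\<^sup>2"
      by (simp add: power2_eq_square algebra_simps)
    finally show ?thesis by (simp add: cmod_power2 power_divide)
  qed
  have "integrable M (yn n)" "integrable M (\<lambda>x. (yn n x)\<^sup>2)"
    using sq_yn[of n] sq_integrable_integrable[OF sq_yn] by (auto simp: sq_integrable_def)
  then show ?thesis unfolding e using y0[of n] by (simp add: prob_space)
qed

text \<open>Cauchy-Schwarz against the product of squares costs the fourth power. In (1 + z)^4 - 1 -
  4 z = z^2 (6 + 4 z + z^2) the linear term has mean zero, and the last factor is bounded thanks to
  the truncation.\<close>

lemma w4_bound:
  obtains C where "\<And>n. n > 0 \<Longrightarrow> integrable M (\<lambda>x. (1 + s * yn n x / sqrt (real n)) ^ 4)"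
    "\<And>n. n > 0 \<Longrightarrow> (\<integral>x. (1 + s * yn n x / sqrt (real n)) ^ 4 \<partial>M) \<le> 1 + C / real n" "C \<ge> 0"
proof -
  \<comment> \<open>With z = s \<open>yn\<close> / \<surd>n one has abs z \<le> 2 abs s, so K is s^2
    times the bound 6 + 8 abs s + 4 s^2 of the last factor.\<close>
  define K where "K = 6 * s\<^sup>2 + 8 * \<bar>s\<bar> ^ 3 + 4 * s ^ 4"
  have "(\<lambda>n. \<integral>x. yn n x * yn n x \<partial>M) \<longlonglongrightarrow> (\<integral>x. y x * y x \<partial>M)" by (rule L2_tendsto_mult[OF y y])
  then have "Bseq (\<lambda>n. \<integral>x. yn n x * yn n x \<partial>M)" by (intro convergent_imp_Bseq convergentI)
  then obtain B where B: "B > 0" "\<And>n. norm (\<integral>x. yn n x * yn n x \<partial>M) \<le> B" by (auto simp: Bseq_def)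
  have K0: "K \<ge> 0" unfolding K_def by auto
  have pw: "\<bar>(1 + s * yn n x / sqrt (real n)) ^ 4 - 1 - 4 * s / sqrt (real n) * yn n x\<bar> \<le> K / real n * (yn n x)\<^sup>2"
    if "x \<in> space M" "n > 0" for n x
  proof -
    let ?q = "sqrt (real n)"
    define z where "z = s * yn n x / ?q"
    have q: "?q \<ge> 1" using that by simp
    have z2: "z\<^sup>2 = s\<^sup>2 * (yn n x)\<^sup>2 / real n" by (simp add: z_def power_mult_distrib power_divide)
    have "sqrt ?q \<le> ?q" by (rule real_le_lsqrt) (use q self_le_power[of ?q 2] in auto)
    then have "\<bar>yn n x\<bar> \<le> 2 * ?q" using yb[OF that(1), of n] by linarith
    then have "\<bar>s\<bar> * \<bar>yn n x\<bar> \<le> \<bar>s\<bar> * (2 * ?q)" by (intro mult_left_mono) auto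
    then have zb: "\<bar>z\<bar> \<le> 2 * \<bar>s\<bar>" using q by (simp add: z_def abs_mult field_simps)
    have "z\<^sup>2 \<le> (2 * \<bar>s\<bar>)\<^sup>2" using zb by (intro power2_le_iff_abs_le[THEN iffD2]) auto
    then have z2b: "z\<^sup>2 \<le> 4 * s\<^sup>2" by (simp add: power_mult_distrib)
    have "(1 + z) ^ 4 - 1 - 4 * z = z\<^sup>2 * (6 + 4 * z + z\<^sup>2)"
      by (simp add: power2_eq_square power4_eq_xxxx algebra_simps)
    then have "\<bar>(1 + z) ^ 4 - 1 - 4 * z\<bar> = z\<^sup>2 * \<bar>6 + 4 * z + z\<^sup>2\<bar>" by (simp add: abs_mult)
    also have "\<dots> \<le> z\<^sup>2 * (6 + 8 * \<bar>s\<bar> + 4 * s\<^sup>2)" using zb z2b zero_le_power2[of z] by (intro mult_left_mono) linarith+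
    also have "\<dots> = K / real n * (yn n x)\<^sup>2"
      unfolding z2 K_def by (simp add: power3_eq_cube power4_eq_xxxx power2_eq_square algebra_simps add_divide_distrib)
    finally show ?thesis by (simp add: z_def)
  qed
  have i: "integrable M (yn n)" "integrable M (\<lambda>x. (yn n x)\<^sup>2)" for n
    using sq_yn[of n] sq_integrable_integrable[OF sq_yn] by (auto simp: sq_integrable_def)
  have int: "integrable M (\<lambda>x. (1 + s * yn n x / sqrt (real n)) ^ 4)" if "n > 0" for n
  proof -
    have "integrable M (\<lambda>x. (1 + s * yn n x / sqrt (real n)) ^ 4 - 1 - 4 * s / sqrt (real n) * yn n x)"
      by (rule Bochner_Integration.integrable_bound[where f="\<lambda>x. K / real n * (yn n x)\<^sup>2"])
        (use i[of n] pw[OF _ that] K0 in \<open>auto simp: abs_mult\<close>)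
    then have "integrable M (\<lambda>x. ((1 + s * yn n x / sqrt (real n)) ^ 4 - 1 - 4 * s / sqrt (real n) * yn n x) + (1 + 4 * s / sqrt (real n) * yn n x))"
      using i[of n] by (intro Bochner_Integration.integrable_add) auto
    then show ?thesis by simp
  qed
  show ?thesis
  proof (rule that[OF int])
    fix n :: nat assume n: "n > 0"
    have "(\<integral>x. (1 + s * yn n x / sqrt (real n)) ^ 4 \<partial>M) \<le> (\<integral>x. 1 + 4 * s / sqrt (real n) * yn n x + K / real n * (yn n x)\<^sup>2 \<partial>M)"
    proof (rule integral_mono[OF int[OF n]])
      show "integrable M (\<lambda>x. 1 + 4 * s / sqrt (real n) * yn n x + K / real n * (yn n x)\<^sup>2)" using i[of n] by auto
      fix x assume "x \<in> space M"
      from pw[OF this n] show "(1 + s * yn n x / sqrt (real n)) ^ 4 \<le> 1 + 4 * s / sqrt (real n) * yn n x + K / real n * (yn n x)\<^sup>2"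
        by linarith
    qed
    also have "\<dots> = 1 + K / real n * (\<integral>x. (yn n x)\<^sup>2 \<partial>M)" using i[of n] y0[of n] by (simp add: prob_space)
    also have "\<dots> \<le> 1 + K / real n * B"
      using B(2)[of n] K0 by (intro add_left_mono mult_left_mono) (auto simp: power2_eq_square)
    finally show "(\<integral>x. (1 + s * yn n x / sqrt (real n)) ^ 4 \<partial>M) \<le> 1 + (K * B) / real n" by simp
  qed (use K0 B in auto)
qed

end

section \<open>Finite powers of a probability space\<close>

abbreviation power_measure :: "nat \<Rightarrow> 'a measure \<Rightarrow> (nat \<Rightarrow> 'a) measure" where
  "power_measure n M \<equiv> Pi\<^sub>M {..<n} (\<lambda>_. M)"

lemma measurable_prod_components:
  fixes f :: "'a \<Rightarrow> 'b::{real_normed_field, second_countable_topology}"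
  assumes "f \<in> borel_measurable M"
  shows "(\<lambda>\<omega>. \<Prod>i\<in>I. f (\<omega> i)) \<in> borel_measurable (Pi\<^sub>M I (\<lambda>_. M))"
  by (intro borel_measurable_prod measurable_compose[OF _ assms] measurable_component_singleton)

lemma measurable_sum_components:
  fixes f :: "'a \<Rightarrow> 'b::{real_normed_vector, second_countable_topology}"
  assumes "f \<in> borel_measurable M"
  shows "(\<lambda>\<omega>. \<Sum>i\<in>I. f (\<omega> i)) \<in> borel_measurable (Pi\<^sub>M I (\<lambda>_. M))"
  by (intro borel_measurable_sum measurable_compose[OF _ assms] measurable_component_singleton)

context prob_space
begin

lemma product_prob: "product_prob_space (\<lambda>_. M)"
  by unfold_locales

lemma prob_space_power: "prob_space (Pi\<^sub>M I (\<lambda>_. M))"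
  by (rule prob_space_PiM) (rule prob_space_axioms)

lemma integral_power_prod:
  fixes f :: "'a \<Rightarrow> 'b::{real_normed_field,banach,second_countable_topology}"
  assumes "finite I" "integrable M f"
  shows "(\<integral>\<omega>. (\<Prod>i\<in>I. f (\<omega> i)) \<partial>Pi\<^sub>M I (\<lambda>_. M)) = (\<integral>x. f x \<partial>M) ^ card I"
    and "integrable (Pi\<^sub>M I (\<lambda>_. M)) (\<lambda>\<omega>. \<Prod>i\<in>I. f (\<omega> i))"
proof -
  interpret product_prob_space "\<lambda>_. M" by (rule product_prob)
  show "(\<integral>\<omega>. (\<Prod>i\<in>I. f (\<omega> i)) \<partial>Pi\<^sub>M I (\<lambda>_. M)) = (\<integral>x. f x \<partial>M) ^ card I"
    using product_integral_prod[of I "\<lambda>_. f"] assms by simp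
  show "integrable (Pi\<^sub>M I (\<lambda>_. M)) (\<lambda>\<omega>. \<Prod>i\<in>I. f (\<omega> i))"
    using product_integrable_prod[of I "\<lambda>_. f"] assms by simp
qed

text \<open>Different coordinates are independent and centred, so that the diagonal of the double
  sum is all that survives.\<close>

lemma power_second_moment:
  fixes f :: "'a \<Rightarrow> real" and I :: "'i set"
  assumes f: "sq_integrable M f" and f0: "(\<integral>x. f x \<partial>M) = 0" and I: "finite I"
  shows "integrable (Pi\<^sub>M I (\<lambda>_. M)) (\<lambda>\<omega>. (\<Sum>i\<in>I. f (\<omega> i))\<^sup>2)"
    and "(\<integral>\<omega>. (\<Sum>i\<in>I. f (\<omega> i))\<^sup>2 \<partial>Pi\<^sub>M I (\<lambda>_. M)) = real (card I) * (\<integral>x. (f x)\<^sup>2 \<partial>M)"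
proof -
  have fm: "f \<in> borel_measurable M" and f1: "integrable M f" and f2: "integrable M (\<lambda>x. (f x)\<^sup>2)"
    using f sq_integrable_integrable[OF f] by (auto simp: sq_integrable_def)
  have ps: "measure M (space M) = 1" by (rule prob_space)
  interpret product_prob_space "\<lambda>_. M" by (rule product_prob)
  let ?P = "Pi\<^sub>M I (\<lambda>_. M)"
  have c: "integrable ?P (\<lambda>\<omega>. f (\<omega> i) * f (\<omega> j))"
    "(\<integral>\<omega>. f (\<omega> i) * f (\<omega> j) \<partial>?P) = (if i = j then (\<integral>x. (f x)\<^sup>2 \<partial>M) else 0)" if ij: "i \<in> I" "j \<in> I" for i j
  proof -
    \<comment> \<open>A product of two coordinates is written as a product over all of I, with the
      factor 1 elsewhere, to which the product formula for integrals applies.\<close>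
    define g where "g k = (if k = i then (if i = j then (\<lambda>x. (f x)\<^sup>2) else f) else if k = j then f else (\<lambda>_. 1))" for k
    have gi: "integrable M (g k)" for k by (auto simp: g_def f1 f2)
    \<comment> \<open>The functional h is left open because the same evaluation is used twice, for
      the values at the coordinates and for the integrals.\<close>
    have p: "(\<Prod>k\<in>I. h (g k) k) = (if i = j then h (\<lambda>x. (f x)\<^sup>2) i else h f i * h f j)"
      if h: "\<And>k. h (\<lambda>_. 1) k = 1" for h :: "('a \<Rightarrow> real) \<Rightarrow> 'i \<Rightarrow> real"
    proof -
      have "(\<Prod>k\<in>I. h (g k) k) = (\<Prod>k\<in>{i, j}. h (g k) k)"
        using ij I by (intro prod.mono_neutral_right) (auto simp: g_def h)
      then show ?thesis by (auto simp: g_def)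
    qed
    have e: "(\<Prod>k\<in>I. g k (\<omega> k)) = f (\<omega> i) * f (\<omega> j)" for \<omega>
      using p[of "\<lambda>g k. g (\<omega> k)"] by (simp add: power2_eq_square)
    show "integrable ?P (\<lambda>\<omega>. f (\<omega> i) * f (\<omega> j))"
      using product_integrable_prod[OF I, of g] gi by (simp add: e)
    have "(\<integral>\<omega>. f (\<omega> i) * f (\<omega> j) \<partial>?P) = (\<Prod>k\<in>I. \<integral>x. g k x \<partial>M)"
      using product_integral_prod[OF I, of g] gi by (simp add: e)
    also have "\<dots> = (if i = j then (\<integral>x. (f x)\<^sup>2 \<partial>M) else 0)"
      using p[of "\<lambda>g k. \<integral>x. g x \<partial>M"] f0 ps by simp
    finally show "(\<integral>\<omega>. f (\<omega> i) * f (\<omega> j) \<partial>?P) = (if i = j then (\<integral>x. (f x)\<^sup>2 \<partial>M) else 0)" .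
  qed
  have s: "(\<Sum>i\<in>I. f (\<omega> i))\<^sup>2 = (\<Sum>i\<in>I. \<Sum>j\<in>I. f (\<omega> i) * f (\<omega> j))" for \<omega>
    by (simp add: power2_eq_square sum_product)
  show "integrable ?P (\<lambda>\<omega>. (\<Sum>i\<in>I. f (\<omega> i))\<^sup>2)"
    unfolding s by (intro Bochner_Integration.integrable_sum c)
  show "(\<integral>\<omega>. (\<Sum>i\<in>I. f (\<omega> i))\<^sup>2 \<partial>?P) = real (card I) * (\<integral>x. (f x)\<^sup>2 \<partial>M)"
    unfolding s using I c by (simp add: Bochner_Integration.integral_sum Bochner_Integration.integrable_sum sum.delta)
qed

end

text \<open>M' may have a part singular to M, so \<open>q\<close> is a subdensity and domination an
  inequality. It passes to powers by Tonelli: for nonnegative H one coordinate is dominated with the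
  others fixed, and the induction hypothesis takes care of the rest.\<close>

lemma power_measure_mono:
  fixes q :: "'a \<Rightarrow> real"
  assumes M: "prob_space M" and M': "prob_space M'" and sets_eq: "sets M' = sets M"
    and q: "q \<in> borel_measurable M"
    and dom: "\<And>h. h \<in> borel_measurable M \<Longrightarrow> (\<integral>\<^sup>+x. h x * ennreal (q x) \<partial>M) \<le> (\<integral>\<^sup>+x. h x \<partial>M')"
    and I: "finite I" and H: "H \<in> borel_measurable (Pi\<^sub>M I (\<lambda>_. M))"
  shows "(\<integral>\<^sup>+\<omega>. H \<omega> * (\<Prod>i\<in>I. ennreal (q (\<omega> i))) \<partial>Pi\<^sub>M I (\<lambda>_. M)) \<le> (\<integral>\<^sup>+\<omega>. H \<omega> \<partial>Pi\<^sub>M I (\<lambda>_. M'))"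
  using I H
proof (induction I arbitrary: H)
  case empty
  then show ?case by (simp add: PiM_empty)
next
  case (insert i I)
  interpret M: product_prob_space "\<lambda>_. M" using M by (rule prob_space.product_prob)
  interpret M': product_prob_space "\<lambda>_. M'" using M' by (rule prob_space.product_prob)
  have sP: "sets (Pi\<^sub>M I (\<lambda>_. M')) = sets (Pi\<^sub>M I (\<lambda>_. M))" for I by (intro sets_PiM_cong sets_eq refl)
  note [measurable] = insert.prems q
  have [measurable_cong]: "sets M' = sets M" by (rule sets_eq)
  have qP [measurable]: "(\<lambda>\<omega>. \<Prod>i\<in>J. ennreal (q (\<omega> i))) \<in> borel_measurable (Pi\<^sub>M J (\<lambda>_. M))" for J
    by (intro borel_measurable_prod_ennreal measurable_compose[OF measurable_component_singleton]) measurable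
  have H'm: "H \<in> borel_measurable (Pi\<^sub>M (insert i I) (\<lambda>_. M'))"
    using insert.prems by (simp cong: measurable_cong_sets add: measurable_cong_sets[OF sP refl])
  have upd [measurable]: "(\<lambda>p. H ((fst p)(i := snd p))) \<in> borel_measurable (Pi\<^sub>M I (\<lambda>_. M) \<Otimes>\<^sub>M M)"
    using insert.prems by (rule measurable_compose[rotated]) (rule measurable_fun_upd[where J=I], auto)
  have Hx: "(\<lambda>y. H (x(i := y))) \<in> borel_measurable M" if "x \<in> space (Pi\<^sub>M I (\<lambda>_. M))" for x
    using measurable_compose[OF measurable_Pair1'[OF that] upd] by simp
  have H'x [measurable]: "(\<lambda>x. \<integral>\<^sup>+y. H (x(i := y)) \<partial>M') \<in> borel_measurable (Pi\<^sub>M I (\<lambda>_. M))"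
  proof -
    have "(\<lambda>p. H ((fst p)(i := snd p))) \<in> borel_measurable (Pi\<^sub>M I (\<lambda>_. M) \<Otimes>\<^sub>M M')"
      using upd by (simp cong: measurable_cong_sets add: measurable_cong_sets[OF sets_pair_measure_cong[OF refl sets_eq] refl])
    from sigma_finite_measure.borel_measurable_nn_integral_fst[OF prob_space_imp_sigma_finite[OF M'] this]
    show ?thesis by simp
  qed
  have "(\<integral>\<^sup>+\<omega>. H \<omega> * (\<Prod>j\<in>insert i I. ennreal (q (\<omega> j))) \<partial>Pi\<^sub>M (insert i I) (\<lambda>_. M))
      = (\<integral>\<^sup>+x. \<integral>\<^sup>+y. H (x(i := y)) * (\<Prod>j\<in>insert i I. ennreal (q ((x(i := y)) j))) \<partial>M \<partial>Pi\<^sub>M I (\<lambda>_. M))"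
    using insert.hyps by (intro M.product_nn_integral_insert) auto
  also have "\<dots> = (\<integral>\<^sup>+x. (\<integral>\<^sup>+y. H (x(i := y)) * ennreal (q y) \<partial>M) * (\<Prod>j\<in>I. ennreal (q (x j))) \<partial>Pi\<^sub>M I (\<lambda>_. M))"
  proof (rule nn_integral_cong)
    fix x assume x: "x \<in> space (Pi\<^sub>M I (\<lambda>_. M))"
    have "(\<Prod>j\<in>insert i I. ennreal (q ((x(i := y)) j))) = ennreal (q y) * (\<Prod>j\<in>I. ennreal (q (x j)))" for y
    proof -
      have "(\<Prod>j\<in>I. ennreal (q ((x(i := y)) j))) = (\<Prod>j\<in>I. ennreal (q (x j)))"
        using insert.hyps by (intro prod.cong) auto
      then show ?thesis using insert.hyps by simp
    qed
    then show "(\<integral>\<^sup>+y. H (x(i := y)) * (\<Prod>j\<in>insert i I. ennreal (q ((x(i := y)) j))) \<partial>M)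
      = (\<integral>\<^sup>+y. H (x(i := y)) * ennreal (q y) \<partial>M) * (\<Prod>j\<in>I. ennreal (q (x j)))"
      using Hx[OF x] by (simp add: mult.assoc[symmetric] nn_integral_multc)
  qed
  also have "\<dots> \<le> (\<integral>\<^sup>+x. (\<integral>\<^sup>+y. H (x(i := y)) \<partial>M') * (\<Prod>j\<in>I. ennreal (q (x j))) \<partial>Pi\<^sub>M I (\<lambda>_. M))"
    by (intro nn_integral_mono mult_right_mono dom Hx) auto
  also have "\<dots> \<le> (\<integral>\<^sup>+x. (\<integral>\<^sup>+y. H (x(i := y)) \<partial>M') \<partial>Pi\<^sub>M I (\<lambda>_. M'))"
    by (rule insert.IH) measurable
  also have "\<dots> = (\<integral>\<^sup>+\<omega>. H \<omega> \<partial>Pi\<^sub>M (insert i I) (\<lambda>_. M'))"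
    using insert.hyps H'm by (intro M'.product_nn_integral_insert[symmetric]) auto
  finally show ?case .
qed

text \<open>Domination applies to nonnegative functions, here 1 + k and 1 - k. The two resulting
  inequalities enclose the difference, and the constant 1 contributes exactly the mass that the
  product subdensity lacks.\<close>

lemma power_measure_subdensity:
  fixes q :: "'a \<Rightarrow> real" and k :: "_ \<Rightarrow> real"
  assumes M: "prob_space M" and M': "prob_space M'" and sets_eq: "sets M' = sets M"
    and q: "q \<in> borel_measurable M" "\<And>x. 0 \<le> q x" "integrable M q"
    and dom: "\<And>h. h \<in> borel_measurable M \<Longrightarrow> (\<integral>\<^sup>+x. h x * ennreal (q x) \<partial>M) \<le> (\<integral>\<^sup>+x. h x \<partial>M')"
    and I: "finite I" and k: "k \<in> borel_measurable (Pi\<^sub>M I (\<lambda>_. M))" "\<And>\<omega>. \<omega> \<in> space (Pi\<^sub>M I (\<lambda>_. M)) \<Longrightarrow> \<bar>k \<omega>\<bar> \<le> 1"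
  shows "\<bar>(\<integral>\<omega>. k \<omega> \<partial>Pi\<^sub>M I (\<lambda>_. M')) - (\<integral>\<omega>. k \<omega> * (\<Prod>i\<in>I. q (\<omega> i)) \<partial>Pi\<^sub>M I (\<lambda>_. M))\<bar>
     \<le> 1 - (\<integral>x. q x \<partial>M) ^ card I"
proof -
  let ?P = "Pi\<^sub>M I (\<lambda>_. M)" and ?P' = "Pi\<^sub>M I (\<lambda>_. M')" and ?Q = "\<lambda>\<omega>. \<Prod>i\<in>I. q (\<omega> i)"
  interpret P: prob_space ?P by (rule prob_space.prob_space_power[OF M])
  interpret P': prob_space ?P' by (rule prob_space.prob_space_power[OF M'])
  have sP: "sets ?P' = sets ?P" by (intro sets_PiM_cong sets_eq refl)
  have spP: "space ?P' = space ?P" by (rule sets_eq_imp_space_eq[OF sP])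
  have [measurable]: "k \<in> borel_measurable ?P" "?Q \<in> borel_measurable ?P" using k measurable_prod_components[OF q(1)] by auto
  have [measurable]: "k \<in> borel_measurable ?P'" using k by (simp cong: measurable_cong_sets add: measurable_cong_sets[OF sP refl])
  have Qi: "integrable ?P ?Q" "(\<integral>\<omega>. ?Q \<omega> \<partial>?P) = (\<integral>x. q x \<partial>M) ^ card I"
    using prob_space.integral_power_prod[OF M I q(3)] by auto
  have Q0: "0 \<le> ?Q \<omega>" for \<omega> using q by (simp add: prod_nonneg)
  have kQ: "integrable ?P (\<lambda>\<omega>. k \<omega> * ?Q \<omega>)"
    by (rule Bochner_Integration.integrable_bound[OF Qi(1)]) (use k Q0 in \<open>auto simp: abs_mult intro!: mult_left_le_one_le AE_I2\<close>)
  have ki: "integrable ?P' k" by (rule P'.integrable_const_bound[of _ 1]) (use k spP in \<open>auto intro!: AE_I2\<close>)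
  have key: "(\<integral>\<omega>. (1 + s * k \<omega>) * ?Q \<omega> \<partial>?P) \<le> (\<integral>\<omega>. 1 + s * k \<omega> \<partial>?P')" if s: "s = 1 \<or> s = -1" for s :: real
  proof -
    have nn: "0 \<le> 1 + s * k \<omega>" if "\<omega> \<in> space ?P" for \<omega> using k(2)[OF that] s by auto
    have i1: "integrable ?P (\<lambda>\<omega>. (1 + s * k \<omega>) * ?Q \<omega>)" using kQ Qi by (simp add: ring_distribs mult.assoc)
    have i2: "integrable ?P' (\<lambda>\<omega>. 1 + s * k \<omega>)" using ki by simp
    have "ennreal (\<integral>\<omega>. (1 + s * k \<omega>) * ?Q \<omega> \<partial>?P) = (\<integral>\<^sup>+\<omega>. ennreal ((1 + s * k \<omega>) * ?Q \<omega>) \<partial>?P)"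
      using nn Q0 by (intro nn_integral_eq_integral[symmetric] i1) auto
    also have "\<dots> = (\<integral>\<^sup>+\<omega>. ennreal (1 + s * k \<omega>) * (\<Prod>i\<in>I. ennreal (q (\<omega> i))) \<partial>?P)"
      using nn Q0 q by (intro nn_integral_cong) (simp add: ennreal_mult prod_ennreal)
    also have "\<dots> \<le> (\<integral>\<^sup>+\<omega>. ennreal (1 + s * k \<omega>) \<partial>?P')"
      by (rule power_measure_mono[OF M M' sets_eq q(1) dom I]) auto
    also have "\<dots> = ennreal (\<integral>\<omega>. 1 + s * k \<omega> \<partial>?P')"
      using nn spP by (intro nn_integral_eq_integral i2) auto
    finally show ?thesis
      using nn spP ennreal_le_iff[OF Bochner_Integration.integral_nonneg[of ?P' "\<lambda>\<omega>. 1 + s * k \<omega>"]] by simp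
  qed
  from key[of 1] key[of "-1"] kQ Qi ki show ?thesis
    by (simp add: ring_distribs P'.prob_space abs_le_iff)
qed

lemma integral_sample_law:
  fixes g :: "_ \<Rightarrow> 'b::{banach,second_countable_topology}"
  assumes M: "prob_space M" and g: "g \<in> borel_measurable (power_measure n M)"
  shows "(\<integral>\<omega>. g (restrict \<omega> {..<n}) \<partial>sample_law M) = (\<integral>\<omega>. g \<omega> \<partial>power_measure n M)"
proof -
  interpret product_prob_space "\<lambda>_. M" UNIV using M by (rule prob_space.product_prob)
  have "distr (sample_law M) (power_measure n M) (\<lambda>\<omega>. restrict \<omega> {..<n}) = power_measure n M"
    unfolding sample_law_def by (rule distr_PiM_restrict_finite) auto
  moreover have "(\<lambda>\<omega>. restrict \<omega> {..<n}) \<in> sample_law M \<rightarrow>\<^sub>M power_measure n M"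
    unfolding sample_law_def by (rule measurable_restrict_subset) auto
  ultimately show ?thesis using g integral_distr[of "\<lambda>\<omega>. restrict \<omega> {..<n}" "sample_law M" "power_measure n M" g] by simp
qed

lemma measure_sample_law:
  assumes M: "prob_space M" and A: "A \<in> sets (power_measure n M)"
  shows "measure (sample_law M) {\<omega> \<in> space (sample_law M). restrict \<omega> {..<n} \<in> A} = measure (power_measure n M) A"
proof -
  interpret product_prob_space "\<lambda>_. M" UNIV using M by (rule prob_space.product_prob)
  have d: "distr (sample_law M) (power_measure n M) (\<lambda>\<omega>. restrict \<omega> {..<n}) = power_measure n M"
    unfolding sample_law_def by (rule distr_PiM_restrict_finite) auto
  have "(\<lambda>\<omega>. restrict \<omega> {..<n}) \<in> sample_law M \<rightarrow>\<^sub>M power_measure n M"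
    unfolding sample_law_def by (rule measurable_restrict_subset) auto
  from measure_distr[OF this A] show ?thesis unfolding d by (simp add: vimage_def Int_def conj_commute)
qed

lemma prob_space_sample_law: "prob_space M \<Longrightarrow> prob_space (sample_law M)"
  unfolding sample_law_def by (rule prob_space.prob_space_power)

section \<open>Local alternatives\<close>

text \<open>By \<open>dom\<close>, \<open>q n\<close> is a subdensity of \<open>M' n\<close>. By
  \<open>q1\<close> its mass falls short of 1 by o(1/n), hence that of its n-fold power by o(1). In
  \<open>hellinger\<close> the square root is approximated with the truncated \<open>yn\<close>,
  since the truncation is what makes the product of squares tractable.\<close>

locale local_alternative = perturbation M d yn y for M :: "'a measure" and d yn y +
  fixes M' :: "nat \<Rightarrow> 'a measure" and q :: "nat \<Rightarrow> 'a \<Rightarrow> real" and s :: real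
  assumes M': "\<And>n. prob_space (M' n)" and sets_M': "\<And>n. sets (M' n) = sets M"
    and q: "\<And>n. q n \<in> borel_measurable M" "\<And>n x. 0 \<le> q n x"
    and dom: "\<And>n h. h \<in> borel_measurable M \<Longrightarrow> (\<integral>\<^sup>+x. h x * ennreal (q n x) \<partial>M) \<le> (\<integral>\<^sup>+x. h x \<partial>M' n)"
    and q1: "(\<lambda>n. real n * ((\<integral>x. q n x \<partial>M) - 1)) \<longlonglongrightarrow> 0"
    and hellinger: "(\<lambda>n. real n * (\<integral>x. (sqrt (q n x) - (1 + s * yn n x / sqrt (real n)))\<^sup>2 \<partial>M)) \<longlonglongrightarrow> 0"
begin

definition v :: "nat \<Rightarrow> 'a \<Rightarrow> real" where
  "v n x = 1 + s * yn n x / sqrt (real n)"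

lemma v_measurable [measurable]: "v n \<in> borel_measurable M"
  unfolding v_def by measurable

lemma of_real_v: "complex_of_real (v n x) = w (of_real s) n x"
  by (simp add: v_def w_def)

lemma sq_v: "sq_integrable M (v n)"
proof -
  have "sq_integrable M (\<lambda>x. 1 + (s / sqrt (real n)) * yn n x)"
    by (intro sq_integrable_add sq_integrable_cmult sq_yn sq_integrable_const)
  then show ?thesis by (simp add: v_def[abs_def])
qed

lemma q_integrable: "integrable M (q n)" and sq_q: "sq_integrable M (\<lambda>x. sqrt (q n x))"
proof -
  have [measurable]: "q n \<in> borel_measurable M" by (rule q)
  have "(\<integral>\<^sup>+x. 1 * ennreal (q n x) \<partial>M) \<le> (\<integral>\<^sup>+x. 1 \<partial>M' n)" by (rule dom) simp
  also have "\<dots> = 1" using prob_space.emeasure_space_1[OF M'[of n]] by simp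
  finally show "integrable M (q n)"
    using q by (intro integrableI_bounded) (auto simp: less_top[symmetric] top_unique)
  then show "sq_integrable M (\<lambda>x. sqrt (q n x))" using q by (simp add: sq_integrable_def)
qed

lemma v2_moment: "(\<lambda>n. real n * ((\<integral>x. (v n x)\<^sup>2 \<partial>M) - 1)) \<longlonglongrightarrow> s\<^sup>2 * (\<integral>x. (y x)\<^sup>2 \<partial>M)"
proof -
  have "(\<lambda>n. s\<^sup>2 * (\<integral>x. yn n x * yn n x \<partial>M)) \<longlonglongrightarrow> s\<^sup>2 * (\<integral>x. y x * y x \<partial>M)"
    by (intro tendsto_intros L2_tendsto_mult y)
  moreover have "\<forall>\<^sub>F n in sequentially. s\<^sup>2 * (\<integral>x. yn n x * yn n x \<partial>M) = real n * ((\<integral>x. (v n x)\<^sup>2 \<partial>M) - 1)"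
    using eventually_gt_at_top[of 0]
  proof eventually_elim
    fix n :: nat assume n: "n > 0"
    have i: "integrable M (yn n)" "integrable M (\<lambda>x. yn n x * yn n x)"
      by (rule sq_integrable_integrable[OF sq_yn], rule sq_integrable_mult_integrable[OF sq_yn sq_yn])
    have "(v n x)\<^sup>2 = 1 + (2 * s / sqrt (real n)) * yn n x + (s\<^sup>2 / real n) * (yn n x * yn n x)" for x
    proof -
      have "(1 + a)\<^sup>2 = 1 + 2 * a + a\<^sup>2" for a :: real by (simp add: power2_eq_square algebra_simps)
      then show ?thesis unfolding v_def by (simp add: power_mult_distrib power_divide power2_eq_square[of "yn n x"])
    qed
    then have "(\<integral>x. (v n x)\<^sup>2 \<partial>M) = 1 + (s\<^sup>2 / real n) * (\<integral>x. yn n x * yn n x \<partial>M)"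
      using i y0[of n] by (simp add: prob_space)
    then show "s\<^sup>2 * (\<integral>x. yn n x * yn n x \<partial>M) = real n * ((\<integral>x. (v n x)\<^sup>2 \<partial>M) - 1)" using n by simp
  qed
  ultimately show ?thesis unfolding power2_eq_square[of "y _"] by (rule Lim_transform_eventually)
qed

definition V :: real where "V = (\<integral>x. (y x)\<^sup>2 \<partial>M)"

text \<open>Both products are squares, p^2 and W^2, and p^2 - W^2 = (p - W)(p + W). By
  Cauchy-Schwarz it is enough that the means of p^2, W^2 and p W all tend to 1, and up to constants
  these are n-th powers of integrals over one observation.\<close>

lemma likelihood_L1:
  "(\<lambda>n. \<integral>\<omega>. \<bar>(\<Prod>j<n. q n (\<omega> j)) - exp (- s\<^sup>2 * V) * (\<Prod>j<n. (v n (\<omega> j))\<^sup>2)\<bar> \<partial>power_measure n M) \<longlonglongrightarrow> 0"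
proof -
  \<comment> \<open>The normalization: the mean of the product of \<open>v\<close>^2 tends to exp
    (s^2 V), and \<kappa> is the square root of the reciprocal.\<close>
  define \<kappa> where "\<kappa> = exp (- s\<^sup>2 * V / 2)"
  have \<kappa>2: "exp (- s\<^sup>2 * V) = \<kappa>\<^sup>2" by (simp add: \<kappa>_def exp_double[symmetric])
  define p where "p n \<omega> = (\<Prod>j<n. sqrt (q n (\<omega> j)))" for n \<omega>
  define W where "W n \<omega> = \<kappa> * (\<Prod>j<n. v n (\<omega> j))" for n \<omega>
  define A where "A = (\<lambda>n. (\<integral>x. q n x \<partial>M) ^ n)"
  define B where "B = (\<lambda>n. \<kappa>\<^sup>2 * (\<integral>x. (v n x)\<^sup>2 \<partial>M) ^ n)"
  define D where "D = (\<lambda>n. \<kappa> * (\<integral>x. sqrt (q n x) * v n x \<partial>M) ^ n)"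
  have iqv: "integrable M (\<lambda>x. sqrt (q n x) * v n x)" and iv2: "integrable M (\<lambda>x. (v n x)\<^sup>2)" for n
    using sq_integrable_mult_integrable[OF sq_q sq_v] sq_v[of n] by (auto simp: sq_integrable_def)
  have Al: "A \<longlonglongrightarrow> 1"
    using power_tendsto_exp_real[OF q1] by (simp add: A_def)
  have "B \<longlonglongrightarrow> \<kappa>\<^sup>2 * exp (s\<^sup>2 * V)"
    using power_tendsto_exp_real[OF v2_moment] unfolding B_def V_def by (intro tendsto_intros)
  then have Bl: "B \<longlonglongrightarrow> 1" by (simp add: \<kappa>2[symmetric] exp_add[symmetric])
  \<comment> \<open>Polarization: E (sqrt q v) = (E q + E v^2 - E (sqrt q - v)^2) / 2 turns the
    Hellinger condition into the affinity of one observation, which is 1 + s^2 V / (2 n) +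
    o(1/n).\<close>
  have "(\<lambda>n. (real n * ((\<integral>x. q n x \<partial>M) - 1) + real n * ((\<integral>x. (v n x)\<^sup>2 \<partial>M) - 1)
      - real n * (\<integral>x. (sqrt (q n x) - v n x)\<^sup>2 \<partial>M)) / 2) \<longlonglongrightarrow> (0 + s\<^sup>2 * V - 0) / 2"
    using hellinger unfolding V_def v_def[symmetric] by (intro tendsto_intros q1 v2_moment) auto
  moreover have "(real n * ((\<integral>x. q n x \<partial>M) - 1) + real n * ((\<integral>x. (v n x)\<^sup>2 \<partial>M) - 1)
      - real n * (\<integral>x. (sqrt (q n x) - v n x)\<^sup>2 \<partial>M)) / 2 = real n * ((\<integral>x. sqrt (q n x) * v n x \<partial>M) - 1)" for n
  proof -
    have "(sqrt (q n x) - v n x)\<^sup>2 = q n x + (v n x)\<^sup>2 - 2 * (sqrt (q n x) * v n x)" for x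
      using q(2)[of n x] by (simp add: power2_diff)
    then have "(\<integral>x. (sqrt (q n x) - v n x)\<^sup>2 \<partial>M) = (\<integral>x. q n x \<partial>M) + (\<integral>x. (v n x)\<^sup>2 \<partial>M) - 2 * (\<integral>x. sqrt (q n x) * v n x \<partial>M)"
      using q_integrable[of n] iqv[of n] iv2[of n] by simp
    then show ?thesis by (simp only:) (simp add: field_simps)
  qed
  ultimately have "(\<lambda>n. real n * ((\<integral>x. sqrt (q n x) * v n x \<partial>M) - 1)) \<longlonglongrightarrow> s\<^sup>2 * V / 2" by simp
  from power_tendsto_exp_real[OF this] have "D \<longlonglongrightarrow> \<kappa> * exp (s\<^sup>2 * V / 2)" unfolding D_def by (intro tendsto_intros)
  then have Dl: "D \<longlonglongrightarrow> 1" by (simp add: \<kappa>_def exp_add[symmetric])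
  have p2: "(p n \<omega>)\<^sup>2 = (\<Prod>j<n. q n (\<omega> j))" for n \<omega>
    unfolding p_def using q by (simp add: prod_power_distrib)
  have W2: "(W n \<omega>)\<^sup>2 = \<kappa>\<^sup>2 * (\<Prod>j<n. (v n (\<omega> j))\<^sup>2)" for n \<omega>
    unfolding W_def by (simp add: power_mult_distrib prod_power_distrib[symmetric])
  have pW: "p n \<omega> * W n \<omega> = \<kappa> * (\<Prod>j<n. sqrt (q n (\<omega> j)) * v n (\<omega> j))" for n \<omega>
    unfolding W_def p_def by (simp add: prod.distrib)
  have Ip: "integrable (power_measure n M) (\<lambda>\<omega>. (p n \<omega>)\<^sup>2)" "(\<integral>\<omega>. (p n \<omega>)\<^sup>2 \<partial>power_measure n M) = A n" for n
    using integral_power_prod[OF finite_lessThan[of n] q_integrable] unfolding p2 A_def by auto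
  have IW: "integrable (power_measure n M) (\<lambda>\<omega>. (W n \<omega>)\<^sup>2)" "(\<integral>\<omega>. (W n \<omega>)\<^sup>2 \<partial>power_measure n M) = B n" for n
    using integral_power_prod[OF finite_lessThan[of n] iv2] unfolding W2 B_def by auto
  have IpW: "integrable (power_measure n M) (\<lambda>\<omega>. p n \<omega> * W n \<omega>)" "(\<integral>\<omega>. p n \<omega> * W n \<omega> \<partial>power_measure n M) = D n" for n
    using integral_power_prod[OF finite_lessThan[of n] iqv] unfolding pW D_def by auto
  have qm [measurable]: "q n \<in> borel_measurable M" for n by (rule q)
  have [measurable]: "p n \<in> borel_measurable (power_measure n M)" "W n \<in> borel_measurable (power_measure n M)" for n
    unfolding p_def W_def by (auto intro!: measurable_prod_components borel_measurable_times)
  have sp: "sq_integrable (power_measure n M) (p n)" and sW: "sq_integrable (power_measure n M) (W n)" for n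
    using Ip IW by (auto simp: sq_integrable_def)
  have bound: "(\<integral>\<omega>. \<bar>(\<Prod>j<n. q n (\<omega> j)) - exp (- s\<^sup>2 * V) * (\<Prod>j<n. (v n (\<omega> j))\<^sup>2)\<bar> \<partial>power_measure n M)
      \<le> sqrt (A n + B n - 2 * D n) * sqrt (A n + B n + 2 * D n)" for n
  proof -
    have "(\<Prod>j<n. q n (\<omega> j)) - exp (- s\<^sup>2 * V) * (\<Prod>j<n. (v n (\<omega> j))\<^sup>2) = (p n \<omega> - W n \<omega>) * (p n \<omega> + W n \<omega>)" for \<omega>
      unfolding \<kappa>2 W2[symmetric] p2[symmetric] by (simp add: power2_eq_square algebra_simps)
    then have "(\<integral>\<omega>. \<bar>(\<Prod>j<n. q n (\<omega> j)) - exp (- s\<^sup>2 * V) * (\<Prod>j<n. (v n (\<omega> j))\<^sup>2)\<bar> \<partial>power_measure n M)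
       = (\<integral>\<omega>. \<bar>(p n \<omega> - W n \<omega>) * (p n \<omega> + W n \<omega>)\<bar> \<partial>power_measure n M)" by simp
    also have "\<dots> \<le> sqrt (\<integral>\<omega>. (p n \<omega> - W n \<omega>)\<^sup>2 \<partial>power_measure n M) * sqrt (\<integral>\<omega>. (p n \<omega> + W n \<omega>)\<^sup>2 \<partial>power_measure n M)"
      by (intro cauchy_schwarz_abs sq_integrable_diff sq_integrable_add sp sW)
    also have "(\<integral>\<omega>. (p n \<omega> - W n \<omega>)\<^sup>2 \<partial>power_measure n M) = A n + B n - 2 * D n"
      unfolding power2_diff using Ip[of n] IW[of n] IpW[of n] by (simp add: mult.assoc)
    also have "(\<integral>\<omega>. (p n \<omega> + W n \<omega>)\<^sup>2 \<partial>power_measure n M) = A n + B n + 2 * D n"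
      unfolding power2_sum using Ip[of n] IW[of n] IpW[of n] by (simp add: mult.assoc)
    finally show ?thesis .
  qed
  have lim: "(\<lambda>n. sqrt (A n + B n - 2 * D n) * sqrt (A n + B n + 2 * D n)) \<longlonglongrightarrow> sqrt (1 + 1 - 2 * 1) * sqrt (1 + 1 + 2 * 1)"
    by (intro tendsto_intros Al Bl Dl)
  show ?thesis
  proof (rule tendsto_sandwich[OF _ _ tendsto_const])
    show "(\<lambda>n. sqrt (A n + B n - 2 * D n) * sqrt (A n + B n + 2 * D n)) \<longlonglongrightarrow> 0" using lim by simp
    show "\<forall>\<^sub>F n in sequentially. (\<integral>\<omega>. \<bar>(\<Prod>j<n. q n (\<omega> j)) - exp (- s\<^sup>2 * V) * (\<Prod>j<n. (v n (\<omega> j))\<^sup>2)\<bar> \<partial>power_measure n M)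
        \<le> sqrt (A n + B n - 2 * D n) * sqrt (A n + B n + 2 * D n)"
      by (intro always_eventually allI bound)
  qed simp
qed

text \<open>Two errors are separated. Replacing the law by its product subdensity loses mass,
  counted once for the real and once for the imaginary part; replacing that density by the
  normalized product of squares is the L1 error of \<open>likelihood_L1\<close>.\<close>

lemma likelihood_approx:
  fixes h :: "nat \<Rightarrow> _ \<Rightarrow> complex"
  assumes [measurable]: "\<And>n. h n \<in> borel_measurable (power_measure n M)"
    and h1: "\<And>n \<omega>. \<omega> \<in> space (power_measure n M) \<Longrightarrow> norm (h n \<omega>) \<le> 1"
  shows "(\<lambda>n. (\<integral>\<omega>. h n \<omega> \<partial>power_measure n (M' n))
      - exp (- s\<^sup>2 * V) * (\<integral>\<omega>. h n \<omega> * (\<Prod>j<n. (w (of_real s) n (\<omega> j))\<^sup>2) \<partial>power_measure n M)) \<longlonglongrightarrow> 0"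
proof (rule Lim_null_comparison)
  let ?L = "\<lambda>n. \<integral>\<omega>. \<bar>(\<Prod>j<n. q n (\<omega> j)) - exp (- s\<^sup>2 * V) * (\<Prod>j<n. (v n (\<omega> j))\<^sup>2)\<bar> \<partial>power_measure n M"
  have "(\<lambda>n. 2 * (1 - (\<integral>x. q n x \<partial>M) ^ n) + ?L n) \<longlonglongrightarrow> 2 * (1 - exp 0) + 0"
    by (intro tendsto_intros power_tendsto_exp_real[OF q1] likelihood_L1)
  then show "(\<lambda>n. 2 * (1 - (\<integral>x. q n x \<partial>M) ^ n) + ?L n) \<longlonglongrightarrow> 0" by simp
  show "\<forall>\<^sub>F n in sequentially. norm ((\<integral>\<omega>. h n \<omega> \<partial>power_measure n (M' n))
      - exp (- s\<^sup>2 * V) * (\<integral>\<omega>. h n \<omega> * (\<Prod>j<n. (w (of_real s) n (\<omega> j))\<^sup>2) \<partial>power_measure n M))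
     \<le> 2 * (1 - (\<integral>x. q n x \<partial>M) ^ n) + ?L n"
  proof (intro always_eventually allI)
    fix n
    let ?P = "power_measure n M" and ?P' = "power_measure n (M' n)"
    let ?Q = "\<lambda>\<omega>. \<Prod>j<n. q n (\<omega> j)" and ?W = "\<lambda>\<omega>. \<Prod>j<n. (v n (\<omega> j))\<^sup>2"
    have qm [measurable]: "q n \<in> borel_measurable M" by (rule q)
    interpret P: prob_space ?P by (rule prob_space_power)
    interpret P': prob_space ?P' by (rule prob_space.prob_space_power[OF M'])
    have sP: "sets ?P' = sets ?P" by (intro sets_PiM_cong sets_M' refl)
    have spP: "space ?P' = space ?P" by (rule sets_eq_imp_space_eq[OF sP])
    have [measurable]: "?Q \<in> borel_measurable ?P" "?W \<in> borel_measurable ?P"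
      by (intro measurable_prod_components; measurable)+
    have hm' [measurable]: "h n \<in> borel_measurable ?P'" using assms(1) by (simp cong: measurable_cong_sets add: measurable_cong_sets[OF sP refl])
    have Qi: "integrable ?P ?Q" and Wi: "integrable ?P ?W"
      using integral_power_prod(2)[OF finite_lessThan q_integrable] integral_power_prod(2)[OF finite_lessThan sq_integrable_norm2[OF sq_v]]
      by auto
    have hb: "integrable ?P (\<lambda>\<omega>. h n \<omega> * of_real (f \<omega>))" if "integrable ?P f" for f :: "_ \<Rightarrow> real"
    proof (rule Bochner_Integration.integrable_bound[OF that])
      show "AE \<omega> in ?P. norm (h n \<omega> * of_real (f \<omega>)) \<le> norm (f \<omega>)"
        using h1 by (intro AE_I2) (simp add: norm_mult mult_left_le_one_le)
    qed (use that in measurable)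
    have hi': "integrable ?P' (h n)" by (rule P'.integrable_const_bound[of _ 1]) (use h1 spP in \<open>auto intro!: AE_I2\<close>)
    let ?X = "(\<integral>\<omega>. h n \<omega> \<partial>?P') - (\<integral>\<omega>. h n \<omega> * of_real (?Q \<omega>) \<partial>?P)"
    have rest: "\<bar>(\<integral>\<omega>. k (h n \<omega>) \<partial>?P') - (\<integral>\<omega>. k (h n \<omega>) * ?Q \<omega> \<partial>?P)\<bar> \<le> 1 - (\<integral>x. q n x \<partial>M) ^ card {..<n}"
      if k: "k = Re \<or> k = Im" for k
      using k h1 order_trans[OF abs_Re_le_cmod] order_trans[OF abs_Im_le_cmod]
      by (intro power_measure_subdensity[OF prob_space_axioms M' sets_M' q q_integrable dom]) auto
    have "\<bar>Re ?X\<bar> \<le> 1 - (\<integral>x. q n x \<partial>M) ^ n"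
      using rest[of Re] hi' hb[OF Qi] by (simp add: integral_Re[symmetric] del: integral_Re of_real_prod)
    note ReX = this
    have ImX: "\<bar>Im ?X\<bar> \<le> 1 - (\<integral>x. q n x \<partial>M) ^ n"
      using rest[of Im] hi' hb[OF Qi] by (simp add: integral_Im[symmetric] del: integral_Im of_real_prod)
    have X: "norm ?X \<le> 2 * (1 - (\<integral>x. q n x \<partial>M) ^ n)"
      using order_trans[OF cmod_le add_mono[OF ReX ImX]] by simp
    let ?Y = "(\<integral>\<omega>. h n \<omega> * of_real (?Q \<omega>) \<partial>?P) - exp (- s\<^sup>2 * V) * (\<integral>\<omega>. h n \<omega> * of_real (?W \<omega>) \<partial>?P)"
    have "?Y = (\<integral>\<omega>. h n \<omega> * of_real (?Q \<omega>) - exp (- s\<^sup>2 * V) * (h n \<omega> * of_real (?W \<omega>)) \<partial>?P)"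
      using hb[OF Qi] hb[OF Wi] by simp
    also have "\<dots> = (\<integral>\<omega>. h n \<omega> * of_real (?Q \<omega> - exp (- s\<^sup>2 * V) * ?W \<omega>) \<partial>?P)"
      by (intro Bochner_Integration.integral_cong) (auto simp: algebra_simps)
    finally have "norm ?Y \<le> (\<integral>\<omega>. norm (h n \<omega> * of_real (?Q \<omega> - exp (- s\<^sup>2 * V) * ?W \<omega>)) \<partial>?P)"
      by (simp only: integral_norm_bound)
    also have "\<dots> \<le> ?L n"
    proof (rule integral_mono)
      show "integrable ?P (\<lambda>\<omega>. norm (h n \<omega> * of_real (?Q \<omega> - exp (- s\<^sup>2 * V) * ?W \<omega>)))"
        using hb[of "\<lambda>\<omega>. ?Q \<omega> - exp (- s\<^sup>2 * V) * ?W \<omega>"] Qi Wi by simp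
      show "integrable ?P (\<lambda>\<omega>. \<bar>?Q \<omega> - exp (- s\<^sup>2 * V) * ?W \<omega>\<bar>)" using Qi Wi by simp
      show "norm (h n \<omega> * of_real (?Q \<omega> - exp (- s\<^sup>2 * V) * ?W \<omega>)) \<le> \<bar>?Q \<omega> - exp (- s\<^sup>2 * V) * ?W \<omega>\<bar>" if "\<omega> \<in> space ?P" for \<omega>
        unfolding norm_mult norm_of_real using h1[OF that] by (intro mult_left_le_one_le) auto
    qed
    finally have Y: "norm ?Y \<le> ?L n" .
    have eq: "(\<integral>\<omega>. h n \<omega> * (\<Prod>j<n. (w (of_real s) n (\<omega> j))\<^sup>2) \<partial>?P) = (\<integral>\<omega>. h n \<omega> * of_real (?W \<omega>) \<partial>?P)"
      by (simp add: of_real_v)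
    have "norm (?X + ?Y) \<le> 2 * (1 - (\<integral>x. q n x \<partial>M) ^ n) + ?L n" using norm_triangle_mono[OF X Y] .
    then show "norm ((\<integral>\<omega>. h n \<omega> \<partial>?P') - exp (- s\<^sup>2 * V) * (\<integral>\<omega>. h n \<omega> * (\<Prod>j<n. (w (of_real s) n (\<omega> j))\<^sup>2) \<partial>?P))
      \<le> 2 * (1 - (\<integral>x. q n x \<partial>M) ^ n) + ?L n" unfolding eq by simp
  qed
qed

text \<open>A substitute for contiguity: statistics that are close under M remain interchangeable
  under the approximate likelihood, because the products of squares are bounded in L2.\<close>

lemma bounded_difference_negligible:
  fixes h h' :: "nat \<Rightarrow> _ \<Rightarrow> complex"
  assumes h [measurable]: "\<And>n. h n \<in> borel_measurable (power_measure n M)" "\<And>n. h' n \<in> borel_measurable (power_measure n M)"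
    and h1: "\<And>n \<omega>. norm (h n \<omega>) \<le> 1" "\<And>n \<omega>. norm (h' n \<omega>) \<le> 1"
    and lim: "(\<lambda>n. \<integral>\<omega>. (norm (h n \<omega> - h' n \<omega>))\<^sup>2 \<partial>power_measure n M) \<longlonglongrightarrow> 0"
  shows "(\<lambda>n. (\<integral>\<omega>. h n \<omega> * (\<Prod>j<n. (w (of_real s) n (\<omega> j))\<^sup>2) \<partial>power_measure n M)
      - (\<integral>\<omega>. h' n \<omega> * (\<Prod>j<n. (w (of_real s) n (\<omega> j))\<^sup>2) \<partial>power_measure n M)) \<longlonglongrightarrow> 0"
proof -
  obtain C where C: "\<And>n. n > 0 \<Longrightarrow> integrable M (\<lambda>x. (1 + s * yn n x / sqrt (real n)) ^ 4)"
    "\<And>n. n > 0 \<Longrightarrow> (\<integral>x. (1 + s * yn n x / sqrt (real n)) ^ 4 \<partial>M) \<le> 1 + C / real n" "C \<ge> 0"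
    by (rule w4_bound[of s]) blast
  let ?P = "\<lambda>n. power_measure n M"
  let ?W = "\<lambda>n \<omega>. \<Prod>j<n. (v n (\<omega> j))\<^sup>2"
  have [measurable]: "?W n \<in> borel_measurable (?P n)" for n
    by (intro measurable_prod_components) measurable
  have W4: "(?W n \<omega>)\<^sup>2 = (\<Prod>j<n. (v n (\<omega> j)) ^ 4)" for n \<omega>
    by (simp add: prod_power_distrib power_mult[symmetric])
  have sW: "sq_integrable (?P n) (?W n)" and W4b: "(\<integral>\<omega>. (?W n \<omega>)\<^sup>2 \<partial>?P n) \<le> exp C" if n: "n > 0" for n
  proof -
    have iv4: "integrable M (\<lambda>x. (v n x) ^ 4)" using C(1)[OF n] by (simp add: v_def)
    show "sq_integrable (?P n) (?W n)"
      unfolding sq_integrable_real_iff W4 using integral_power_prod(2)[OF finite_lessThan iv4] by auto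
    have "(\<integral>\<omega>. (?W n \<omega>)\<^sup>2 \<partial>?P n) = (\<integral>x. (v n x) ^ 4 \<partial>M) ^ n"
      unfolding W4 using integral_power_prod(1)[OF finite_lessThan[of n] iv4] by simp
    also have "\<dots> \<le> (1 + C / real n) ^ n"
      using C(2)[OF n] by (intro power_mono) (auto simp: v_def)
    also have "\<dots> \<le> exp C" using exp_ge_one_plus_x_over_n_power_n[of n C] n C(3) by simp
    finally show "(\<integral>\<omega>. (?W n \<omega>)\<^sup>2 \<partial>?P n) \<le> exp C" .
  qed
  show ?thesis
  proof (rule Lim_null_comparison)
    show "(\<lambda>n. sqrt (\<integral>\<omega>. (norm (h n \<omega> - h' n \<omega>))\<^sup>2 \<partial>?P n) * sqrt (exp C)) \<longlonglongrightarrow> 0"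
      using tendsto_mult_left_zero[OF tendsto_real_sqrt[OF lim, simplified]] by simp
    show "\<forall>\<^sub>F n in sequentially. norm ((\<integral>\<omega>. h n \<omega> * (\<Prod>j<n. (w (of_real s) n (\<omega> j))\<^sup>2) \<partial>?P n)
      - (\<integral>\<omega>. h' n \<omega> * (\<Prod>j<n. (w (of_real s) n (\<omega> j))\<^sup>2) \<partial>?P n)) \<le> sqrt (\<integral>\<omega>. (norm (h n \<omega> - h' n \<omega>))\<^sup>2 \<partial>?P n) * sqrt (exp C)"
      using eventually_gt_at_top[of 0]
    proof eventually_elim
      fix n :: nat assume n: "n > 0"
      interpret P: prob_space "?P n" by (rule prob_space_power)
      have sWc: "sq_integrable (?P n) (\<lambda>\<omega>. complex_of_real (?W n \<omega>))" using sW[OF n] by (rule sq_integrable_of_real)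
      have sh: "sq_integrable (?P n) (h n)" "sq_integrable (?P n) (h' n)"
        by (rule P.sq_integrable_bounded[OF h(1) h1(1)], rule P.sq_integrable_bounded[OF h(2) h1(2)])
      have eq: "(\<integral>\<omega>. f \<omega> * (\<Prod>j<n. (w (of_real s) n (\<omega> j))\<^sup>2) \<partial>?P n) = (\<integral>\<omega>. f \<omega> * of_real (?W n \<omega>) \<partial>?P n)" for f
        by (simp add: of_real_v)
      have "(\<integral>\<omega>. h n \<omega> * of_real (?W n \<omega>) \<partial>?P n) - (\<integral>\<omega>. h' n \<omega> * of_real (?W n \<omega>) \<partial>?P n)
         = (\<integral>\<omega>. h n \<omega> * of_real (?W n \<omega>) - h' n \<omega> * of_real (?W n \<omega>) \<partial>?P n)"
        by (intro Bochner_Integration.integral_diff[symmetric] sq_integrable_mult_integrable sh sWc)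
      also have "\<dots> = (\<integral>\<omega>. (h n \<omega> - h' n \<omega>) * of_real (?W n \<omega>) \<partial>?P n)"
        by (simp only: left_diff_distrib)
      finally have e: "(\<integral>\<omega>. h n \<omega> * of_real (?W n \<omega>) \<partial>?P n) - (\<integral>\<omega>. h' n \<omega> * of_real (?W n \<omega>) \<partial>?P n)
         = (\<integral>\<omega>. (h n \<omega> - h' n \<omega>) * of_real (?W n \<omega>) \<partial>?P n)" .
      have "norm (\<integral>\<omega>. (h n \<omega> - h' n \<omega>) * of_real (?W n \<omega>) \<partial>?P n)
         \<le> sqrt (\<integral>\<omega>. (norm (h n \<omega> - h' n \<omega>))\<^sup>2 \<partial>?P n) * sqrt (\<integral>\<omega>. (norm (complex_of_real (?W n \<omega>)))\<^sup>2 \<partial>?P n)"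
        by (intro cauchy_schwarz sq_integrable_diff sh sWc)
      also have "\<dots> \<le> sqrt (\<integral>\<omega>. (norm (h n \<omega> - h' n \<omega>))\<^sup>2 \<partial>?P n) * sqrt (exp C)"
        unfolding norm_of_real power2_abs
        by (intro mult_left_mono real_sqrt_le_mono W4b[OF n] real_sqrt_ge_zero Bochner_Integration.integral_nonneg) auto
      finally show "norm ((\<integral>\<omega>. h n \<omega> * (\<Prod>j<n. (w (of_real s) n (\<omega> j))\<^sup>2) \<partial>?P n)
        - (\<integral>\<omega>. h' n \<omega> * (\<Prod>j<n. (w (of_real s) n (\<omega> j))\<^sup>2) \<partial>?P n)) \<le> sqrt (\<integral>\<omega>. (norm (h n \<omega> - h' n \<omega>))\<^sup>2 \<partial>?P n) * sqrt (exp C)"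
        unfolding eq e .
    qed
  qed
qed

lemma iexp_close_in_mean_square:
  fixes \<xi> \<eta> :: "nat \<Rightarrow> _ \<Rightarrow> real"
  assumes [measurable]: "\<And>n. \<xi> n \<in> borel_measurable (power_measure n M)" "\<And>n. \<eta> n \<in> borel_measurable (power_measure n M)"
    and conv: "\<And>\<epsilon>. \<epsilon> > 0 \<Longrightarrow>
      (\<lambda>n. measure (power_measure n M) {\<omega> \<in> space (power_measure n M). \<epsilon> < \<bar>\<xi> n \<omega> - \<eta> n \<omega>\<bar>}) \<longlonglongrightarrow> 0"
  shows "(\<lambda>n. \<integral>\<omega>. (norm (iexp (t * \<xi> n \<omega>) - iexp (t * \<eta> n \<omega>)))\<^sup>2 \<partial>power_measure n M) \<longlonglongrightarrow> 0"
proof (rule LIMSEQ_I)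
  fix r :: real assume r: "r > 0"
  let ?P = "\<lambda>n. power_measure n M"
  let ?f = "\<lambda>n \<omega>. (norm (iexp (t * \<xi> n \<omega>) - iexp (t * \<eta> n \<omega>)))\<^sup>2"
  \<comment> \<open>Chosen so that (t \<epsilon>)^2 \<le> r / 2, with abs t + 1 in the denominator
    to allow t = 0. On the exceptional set the squared difference is at most 4, so probability r / 8
    takes the other half.\<close>
  define \<epsilon> where "\<epsilon> = sqrt (r / 2) / (\<bar>t\<bar> + 1)"
  have \<epsilon>: "\<epsilon> > 0" using r by (simp add: \<epsilon>_def)
  let ?A = "\<lambda>n. {\<omega> \<in> space (?P n). \<epsilon> < \<bar>\<xi> n \<omega> - \<eta> n \<omega>\<bar>}"
  have te: "(t * \<epsilon>)\<^sup>2 \<le> r / 2"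
  proof -
    have "\<bar>t\<bar> * \<epsilon> \<le> (\<bar>t\<bar> + 1) * \<epsilon>" using \<epsilon> by simp
    also have "\<dots> = sqrt (r / 2)" by (simp add: \<epsilon>_def)
    finally have "(\<bar>t\<bar> * \<epsilon>)\<^sup>2 \<le> (sqrt (r / 2))\<^sup>2" using \<epsilon> by (intro power_mono) auto
    then show ?thesis using r by (simp add: power_mult_distrib)
  qed
  have le: "?f n \<omega> \<le> r / 2 + 4 * indicator (?A n) \<omega>" if "\<omega> \<in> space (?P n)" for n \<omega>
  proof (cases "\<omega> \<in> ?A n")
    case True
    have "norm (iexp (t * \<xi> n \<omega>) - iexp (t * \<eta> n \<omega>)) \<le> 1 + 1"
      by (rule order_trans[OF norm_triangle_ineq4]) (simp only: norm_exp_i_times)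
    then have "?f n \<omega> \<le> 2\<^sup>2" by (intro power_mono) auto
    then show ?thesis using True r by simp
  next
    case False
    have "iexp (t * \<xi> n \<omega>) - iexp (t * \<eta> n \<omega>) = iexp (t * \<eta> n \<omega>) * (iexp (t * (\<xi> n \<omega> - \<eta> n \<omega>)) - 1)"
      by (simp add: right_diff_distrib exp_add[symmetric] algebra_simps)
    then have "norm (iexp (t * \<xi> n \<omega>) - iexp (t * \<eta> n \<omega>)) = norm (iexp (t * (\<xi> n \<omega> - \<eta> n \<omega>)) - 1)"
      by (simp only: norm_mult norm_exp_i_times)
    also have "\<dots> \<le> \<bar>t * (\<xi> n \<omega> - \<eta> n \<omega>)\<bar>" by (rule iexp_minus_1_bound)
    also have "\<dots> \<le> \<bar>t\<bar> * \<epsilon>" unfolding abs_mult using False that by (intro mult_left_mono) auto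
    finally have "?f n \<omega> \<le> (\<bar>t\<bar> * \<epsilon>)\<^sup>2" by (rule power_mono) simp
    moreover have "(\<bar>t\<bar> * \<epsilon>)\<^sup>2 \<le> r / 2" using te by (simp add: power_mult_distrib)
    moreover have "(0::real) \<le> 4 * indicator (?A n) \<omega>" by simp
    ultimately show ?thesis by linarith
  qed
  from conv[OF \<epsilon>] have "\<forall>\<^sub>F n in sequentially. measure (?P n) (?A n) < r / 8"
    using r by (intro order_tendstoD(2)) auto
  then obtain N where N: "\<And>n. n \<ge> N \<Longrightarrow> measure (?P n) (?A n) < r / 8" by (auto simp: eventually_sequentially)
  have "norm ((\<integral>\<omega>. ?f n \<omega> \<partial>?P n) - 0) < r" if "n \<ge> N" for n
  proof -
    interpret P: prob_space "?P n" by (rule prob_space_power)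
    have A [measurable]: "?A n \<in> sets (?P n)" by measurable
    have i: "integrable (?P n) (?f n)"
    proof (rule P.integrable_const_bound[where B="r / 2 + 4"])
      show "AE \<omega> in ?P n. norm (?f n \<omega>) \<le> r / 2 + 4"
      proof (rule AE_I2)
        fix \<omega> assume "\<omega> \<in> space (?P n)"
        from le[OF this] have "?f n \<omega> \<le> r / 2 + 4 * indicator (?A n) \<omega>" .
        also have "\<dots> \<le> r / 2 + 4" by (simp add: indicator_def)
        finally show "norm (?f n \<omega>) \<le> r / 2 + 4" by (simp only: real_norm_def abs_of_nonneg zero_le_power2)
      qed
    qed measurable
    have "(\<integral>\<omega>. ?f n \<omega> \<partial>?P n) \<le> (\<integral>\<omega>. r / 2 + 4 * indicator (?A n) \<omega> \<partial>?P n)"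
      by (rule integral_mono[OF i _ le])
        (intro Bochner_Integration.integrable_add integrable_mult_right integrable_real_indicator A P.integrable_const, simp add: P.emeasure_eq_measure)
    also have "\<dots> = r / 2 + 4 * measure (?P n) (?A n)"
    proof -
      have "(\<integral>\<omega>. r / 2 + 4 * indicator A \<omega> \<partial>?P n) = r / 2 + 4 * measure (?P n) A" if "A \<in> sets (?P n)" for A
        using that by (simp add: P.prob_space P.emeasure_eq_measure)
      from this[OF A] show ?thesis .
    qed
    also have "\<dots> < r" using N[OF that] by simp
    finally show ?thesis by simp
  qed
  then show "\<exists>N. \<forall>n\<ge>N. norm ((\<integral>\<omega>. ?f n \<omega> \<partial>?P n) - 0) < r" by blast
qed

text \<open>The orthogonal case of Le Cam's third lemma. With the cross term of
  \<open>moment_ew2\<close> gone, the one trace of s in the limit is the factor exp (s^2 V), which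
  the normalization exp (- s^2 V) removes.\<close>

lemma linear_statistic_limit:
  fixes \<xi> :: "nat \<Rightarrow> _ \<Rightarrow> real"
  assumes m [measurable]: "\<And>n. \<xi> n \<in> borel_measurable (power_measure n M)"
    and orth: "(\<integral>x. d x * y x \<partial>M) = 0"
    and conv: "\<And>\<epsilon>. \<epsilon> > 0 \<Longrightarrow> (\<lambda>n. measure (power_measure n M)
       {\<omega> \<in> space (power_measure n M). \<epsilon> < \<bar>\<xi> n \<omega> - (\<Sum>j<n. d (\<omega> j)) / sqrt (real n)\<bar>}) \<longlonglongrightarrow> 0"
  shows "(\<lambda>n. \<integral>\<omega>. iexp (t * \<xi> n \<omega>) \<partial>power_measure n (M' n)) \<longlonglongrightarrow> exp (- complex_of_real (t\<^sup>2 * (\<integral>x. (d x)\<^sup>2 \<partial>M) / 2))"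
proof -
  define \<eta> where "\<eta> n \<omega> = (\<Sum>j<n. d (\<omega> j)) / sqrt (real n)" for n \<omega>
  let ?W = "\<lambda>n \<omega>. \<Prod>j<n. (w (of_real s) n (\<omega> j))\<^sup>2"
  have m' [measurable]: "\<eta> n \<in> borel_measurable (power_measure n M)" for n
    unfolding \<eta>_def by (intro borel_measurable_divide measurable_sum_components) auto
  have 1: "(\<lambda>n. (\<integral>\<omega>. iexp (t * \<xi> n \<omega>) \<partial>power_measure n (M' n))
      - exp (- s\<^sup>2 * V) * (\<integral>\<omega>. iexp (t * \<xi> n \<omega>) * ?W n \<omega> \<partial>power_measure n M)) \<longlonglongrightarrow> 0"
  proof (rule likelihood_approx)
    show "(\<lambda>\<omega>. iexp (t * \<xi> n \<omega>)) \<in> borel_measurable (power_measure n M)" for n by measurable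
    show "norm (iexp (t * \<xi> n \<omega>)) \<le> 1" for n \<omega> by (simp only: norm_exp_i_times order_refl)
  qed
  have 2: "(\<lambda>n. (\<integral>\<omega>. iexp (t * \<xi> n \<omega>) * ?W n \<omega> \<partial>power_measure n M) - (\<integral>\<omega>. iexp (t * \<eta> n \<omega>) * ?W n \<omega> \<partial>power_measure n M)) \<longlonglongrightarrow> 0"
  proof (rule bounded_difference_negligible)
    show "(\<lambda>\<omega>. iexp (t * \<xi> n \<omega>)) \<in> borel_measurable (power_measure n M)"
      "(\<lambda>\<omega>. iexp (t * \<eta> n \<omega>)) \<in> borel_measurable (power_measure n M)" for n by measurable
    show "norm (iexp (t * \<xi> n \<omega>)) \<le> 1" "norm (iexp (t * \<eta> n \<omega>)) \<le> 1" for n \<omega>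
      by (simp_all only: norm_exp_i_times order_refl)
  qed (intro iexp_close_in_mean_square m m' conv[folded \<eta>_def])
  have prodform: "(\<integral>\<omega>. iexp (t * \<eta> n \<omega>) * ?W n \<omega> \<partial>power_measure n M) = (\<integral>x. e t n x * (w (of_real s) n x)\<^sup>2 \<partial>M) ^ n" for n
  proof -
    have i: "integrable M (\<lambda>x. e t n x * (w (of_real s) n x)\<^sup>2)"
      by (rule Bochner_Integration.integrable_bound[OF sq_integrable_norm2[OF sq_w[of "of_real s" n]]])
        (auto simp: norm_mult norm_e norm_power)
    have "iexp (t * \<eta> n \<omega>) = (\<Prod>j<n. e t n (\<omega> j))" for \<omega>
      unfolding e_def \<eta>_def by (simp add: exp_sum[symmetric] sum_distrib_left sum_divide_distrib)
    then have "(\<integral>\<omega>. iexp (t * \<eta> n \<omega>) * ?W n \<omega> \<partial>power_measure n M) = (\<integral>\<omega>. (\<Prod>j<n. e t n (\<omega> j) * (w (of_real s) n (\<omega> j))\<^sup>2) \<partial>power_measure n M)"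
      by (simp only: prod.distrib)
    also have "\<dots> = (\<integral>x. e t n x * (w (of_real s) n x)\<^sup>2 \<partial>M) ^ n"
      using integral_power_prod(1)[OF finite_lessThan[of n] i] by simp
    finally show ?thesis .
  qed
  define Z where "Z = - complex_of_real (t\<^sup>2 * (\<integral>x. (d x)\<^sup>2 \<partial>M) / 2)"
  have "(\<lambda>n. (\<integral>x. e t n x * (w (of_real s) n x)\<^sup>2 \<partial>M) ^ n) \<longlonglongrightarrow> exp (Z + (of_real s)\<^sup>2 * of_real V)"
    using power_tendsto_exp[OF moment_ew2[of t "of_real s"]] orth by (simp add: Z_def V_def)
  then have 3: "(\<lambda>n. (\<integral>\<omega>. iexp (t * \<eta> n \<omega>) * ?W n \<omega> \<partial>power_measure n M)) \<longlonglongrightarrow> exp (Z + (of_real s)\<^sup>2 * of_real V)"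
    unfolding prodform .
  have "(\<lambda>n. ((\<integral>\<omega>. iexp (t * \<xi> n \<omega>) \<partial>power_measure n (M' n))
      - exp (- s\<^sup>2 * V) * (\<integral>\<omega>. iexp (t * \<xi> n \<omega>) * ?W n \<omega> \<partial>power_measure n M))
     + exp (- s\<^sup>2 * V) * (((\<integral>\<omega>. iexp (t * \<xi> n \<omega>) * ?W n \<omega> \<partial>power_measure n M) - (\<integral>\<omega>. iexp (t * \<eta> n \<omega>) * ?W n \<omega> \<partial>power_measure n M))
       + (\<integral>\<omega>. iexp (t * \<eta> n \<omega>) * ?W n \<omega> \<partial>power_measure n M)))
    \<longlonglongrightarrow> 0 + exp (- s\<^sup>2 * V) * (0 + exp (Z + (of_real s)\<^sup>2 * of_real V))"
    by (intro tendsto_add tendsto_mult tendsto_const 1 2 3)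
  also have "0 + exp (- s\<^sup>2 * V) * (0 + exp (Z + (of_real s)\<^sup>2 * of_real V)) = exp Z"
    unfolding exp_of_real[symmetric] by (simp add: exp_add[symmetric])
  finally show ?thesis unfolding Z_def[symmetric] by (simp add: algebra_simps)
qed

end

section \<open>The bound on limit laws of regular estimators\<close>

text \<open>The hypothesis \<open>le\<close> is the bound B on the mean modulus of E[Y|X] in dual
  form. The factor \<alpha> couples all observations, so the integral does not split. Integrating
  out one coordinate with the others fixed turns \<alpha> into a function of the remaining
  observations whose bound has been multiplied by B, which is why K is arbitrary in the
  induction.\<close>

lemma product_with_observed_factor_le:
  fixes Y :: "'x \<times> 't \<Rightarrow> complex" and \<alpha> :: "('i \<Rightarrow> 'x) \<Rightarrow> complex"
  assumes P: "prob_space P" and fst [measurable]: "fst \<in> P \<rightarrow>\<^sub>M \<nu>"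
    and Y: "integrable P Y"
    and le: "\<And>\<beta>. \<beta> \<in> borel_measurable \<nu> \<Longrightarrow> (\<And>x. x \<in> space \<nu> \<Longrightarrow> norm (\<beta> x) \<le> 1) \<Longrightarrow>
        norm (\<integral>z. \<beta> (fst z) * Y z \<partial>P) \<le> B"
    and I: "finite I" and \<alpha>: "\<alpha> \<in> borel_measurable (Pi\<^sub>M I (\<lambda>_. \<nu>))"
    and bd: "\<And>x. x \<in> space (Pi\<^sub>M I (\<lambda>_. \<nu>)) \<Longrightarrow> norm (\<alpha> x) \<le> K"
  shows "norm (\<integral>\<omega>. \<alpha> (\<lambda>i\<in>I. fst (\<omega> i)) * (\<Prod>i\<in>I. Y (\<omega> i)) \<partial>Pi\<^sub>M I (\<lambda>_. P)) \<le> K * B ^ card I"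
  using I \<alpha> bd
proof (induction I arbitrary: \<alpha> K)
  case empty
  interpret E: prob_space "Pi\<^sub>M ({}::'i set) (\<lambda>_. P)" by (rule prob_space.prob_space_power[OF P])
  have "(\<lambda>_. undefined) \<in> space (Pi\<^sub>M ({}::'i set) (\<lambda>_. \<nu>))" by (simp add: space_PiM)
  from empty(2)[OF this] have "norm (\<alpha> (\<lambda>_. undefined)) \<le> K" .
  moreover have "(\<integral>\<omega>. \<alpha> (\<lambda>i\<in>{}. fst (\<omega> i)) * (\<Prod>i\<in>{}. Y (\<omega> i)) \<partial>Pi\<^sub>M ({}::'i set) (\<lambda>_. P)) = (\<integral>\<omega>. \<alpha> (\<lambda>_. undefined) \<partial>Pi\<^sub>M ({}::'i set) (\<lambda>_. P))"
    by (simp add: restrict_def)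
  ultimately show ?case by (simp only: lebesgue_integral_const E.prob_space scaleR_one card.empty power_0 mult_1_right)
next
  case (insert i I)
  have pp: "product_prob_space (\<lambda>_. P)" using P by (rule prob_space.product_prob)
  interpret pr: prob_space "Pi\<^sub>M I (\<lambda>_. P)" by (rule prob_space.prob_space_power[OF P])
  interpret pi: prob_space "Pi\<^sub>M (insert i I) (\<lambda>_. P)" by (rule prob_space.prob_space_power[OF P])
  have [measurable]: "Y \<in> borel_measurable P" using Y by auto
  have le': "norm (\<integral>z. \<beta> (fst z) * Y z \<partial>P) \<le> C * B"
    if b: "\<beta> \<in> borel_measurable \<nu>" "\<And>x. x \<in> space \<nu> \<Longrightarrow> norm (\<beta> x) \<le> C" and C: "C > 0" for \<beta> C
  proof -
    have "norm (\<integral>z. (\<beta> (fst z) / of_real C) * Y z \<partial>P) \<le> B"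
      using b C by (intro le[of "\<lambda>x. \<beta> x / of_real C"]) (auto simp: norm_divide)
    also have "(\<integral>z. (\<beta> (fst z) / of_real C) * Y z \<partial>P) = (\<integral>z. \<beta> (fst z) * Y z \<partial>P) / of_real C"
      by (simp only: times_divide_eq_left integral_divide_zero)
    finally show ?thesis using C by (simp add: norm_divide field_simps)
  qed
  have K0: "0 \<le> K"
  proof -
    have "space (Pi\<^sub>M (insert i I) (\<lambda>_. P)) \<noteq> {}" by (rule pi.not_empty)
    then obtain \<omega> where "\<omega> \<in> space (Pi\<^sub>M (insert i I) (\<lambda>_. P))" by blast
    then have "(\<lambda>i\<in>insert i I. fst (\<omega> i)) \<in> space (Pi\<^sub>M (insert i I) (\<lambda>_. \<nu>))"
      using measurable_space[OF fst] by (auto simp: space_PiM PiE_iff)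
    from insert.prems(2)[OF this] show ?thesis using norm_ge_zero order_trans by blast
  qed
  note [measurable] = insert.prems(1)
  have upd [measurable]: "(\<lambda>p. (fst p)(i := fst (snd p))) \<in> Pi\<^sub>M I (\<lambda>_. \<nu>) \<Otimes>\<^sub>M P \<rightarrow>\<^sub>M Pi\<^sub>M (insert i I) (\<lambda>_. \<nu>)"
    by (rule measurable_fun_upd[where J=I]) auto
  have upd2: "(\<lambda>x'. x(i := x')) \<in> \<nu> \<rightarrow>\<^sub>M Pi\<^sub>M (insert i I) (\<lambda>_. \<nu>)" if "x \<in> space (Pi\<^sub>M I (\<lambda>_. \<nu>))" for x
    using that by (intro measurable_fun_upd[where J=I]) auto
  define \<Psi> where "\<Psi> x = (\<integral>z. \<alpha> (x(i := fst z)) * Y z \<partial>P)" for x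
  have \<Psi>m: "\<Psi> \<in> borel_measurable (Pi\<^sub>M I (\<lambda>_. \<nu>))"
  proof -
    interpret P: sigma_finite_measure P using P by (rule prob_space_imp_sigma_finite)
    have "(\<lambda>p. \<alpha> ((fst p)(i := fst (snd p))) * Y (snd p)) \<in> borel_measurable (Pi\<^sub>M I (\<lambda>_. \<nu>) \<Otimes>\<^sub>M P)" by measurable
    then show ?thesis unfolding \<Psi>_def
      by (intro P.borel_measurable_lebesgue_integral) (simp add: split_beta')
  qed
  have \<Psi>b: "norm (\<Psi> x) \<le> K * B" if x: "x \<in> space (Pi\<^sub>M I (\<lambda>_. \<nu>))" for x
  \<comment> \<open>Normalizing the test function divides by its bound, so K = 0 is separate; then
    \<alpha> vanishes on its space.\<close>
  proof (cases "K = 0")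
    case True
    have "\<Psi> x = (\<integral>z. 0 \<partial>P)" unfolding \<Psi>_def
    proof (rule Bochner_Integration.integral_cong[OF refl])
      fix z assume "z \<in> space P"
      then have "x(i := fst z) \<in> space (Pi\<^sub>M (insert i I) (\<lambda>_. \<nu>))"
        using measurable_space[OF upd2[OF x]] measurable_space[OF fst] by auto
      from insert.prems(2)[OF this] have "\<alpha> (x(i := fst z)) = 0" unfolding True norm_le_zero_iff .
      then show "\<alpha> (x(i := fst z)) * Y z = 0" by (simp only: mult_zero_left)
    qed
    then show ?thesis using True by simp
  next
    case False
    show ?thesis unfolding \<Psi>_def
    proof (rule le'[of "\<lambda>x'. \<alpha> (x(i := x'))"])
      show "(\<lambda>x'. \<alpha> (x(i := x'))) \<in> borel_measurable \<nu>" by (rule measurable_compose[OF upd2[OF x] insert.prems(1)])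
      show "norm (\<alpha> (x(i := x'))) \<le> K" if "x' \<in> space \<nu>" for x'
        by (rule insert.prems(2)[OF measurable_space[OF upd2[OF x] that]])
      show "0 < K" using False K0 by simp
    qed
  qed
  have obs: "(\<lambda>j\<in>insert i I. fst ((x(i := z)) j)) = (\<lambda>j\<in>I. fst (x j))(i := fst z)" for x z
    using insert.hyps by (auto simp: fun_eq_iff restrict_def)
  have pr: "(\<Prod>j\<in>insert i I. Y ((x(i := z)) j)) = Y z * (\<Prod>j\<in>I. Y (x j))" for x z
  proof -
    have "(\<Prod>j\<in>I. Y ((x(i := z)) j)) = (\<Prod>j\<in>I. Y (x j))" using insert.hyps by (intro prod.cong) auto
    then show ?thesis using insert.hyps by simp
  qed
  have om: "(\<lambda>\<omega>. \<lambda>j\<in>J. fst (\<omega> j)) \<in> Pi\<^sub>M J (\<lambda>_. P) \<rightarrow>\<^sub>M Pi\<^sub>M J (\<lambda>_. \<nu>)" for J :: "'i set"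
    by (intro measurable_restrict measurable_compose[OF _ fst] measurable_component_singleton)
  have int: "integrable (Pi\<^sub>M (insert i I) (\<lambda>_. P)) (\<lambda>\<omega>. \<alpha> (\<lambda>j\<in>insert i I. fst (\<omega> j)) * (\<Prod>j\<in>insert i I. Y (\<omega> j)))"
  proof (rule Bochner_Integration.integrable_bound)
    show "integrable (Pi\<^sub>M (insert i I) (\<lambda>_. P)) (\<lambda>\<omega>. of_real K * (\<Prod>j\<in>insert i I. Y (\<omega> j)))"
      using insert.hyps by (intro integrable_mult_right prob_space.integral_power_prod(2)[OF P _ Y]) auto
    show "(\<lambda>\<omega>. \<alpha> (\<lambda>j\<in>insert i I. fst (\<omega> j)) * (\<Prod>j\<in>insert i I. Y (\<omega> j))) \<in> borel_measurable (Pi\<^sub>M (insert i I) (\<lambda>_. P))"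
      by (intro borel_measurable_times measurable_compose[OF om insert.prems(1)] measurable_prod_components) measurable
    show "AE \<omega> in Pi\<^sub>M (insert i I) (\<lambda>_. P). norm (\<alpha> (\<lambda>j\<in>insert i I. fst (\<omega> j)) * (\<Prod>j\<in>insert i I. Y (\<omega> j)))
        \<le> norm (of_real K * (\<Prod>j\<in>insert i I. Y (\<omega> j)))"
      using K0 measurable_space[OF om] by (intro AE_I2) (auto simp: norm_mult intro!: mult_right_mono insert.prems(2))
  qed
  have "(\<integral>\<omega>. \<alpha> (\<lambda>j\<in>insert i I. fst (\<omega> j)) * (\<Prod>j\<in>insert i I. Y (\<omega> j)) \<partial>Pi\<^sub>M (insert i I) (\<lambda>_. P))
     = (\<integral>\<omega>. (\<integral>z. \<alpha> ((\<lambda>j\<in>I. fst (\<omega> j))(i := fst z)) * (Y z * (\<Prod>j\<in>I. Y (\<omega> j))) \<partial>P) \<partial>Pi\<^sub>M I (\<lambda>_. P))"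
    unfolding product_sigma_finite.product_integral_insert[OF product_prob_space.axioms(1)[OF pp] insert.hyps int] obs pr ..
  also have "\<dots> = (\<integral>\<omega>. \<Psi> (\<lambda>j\<in>I. fst (\<omega> j)) * (\<Prod>j\<in>I. Y (\<omega> j)) \<partial>Pi\<^sub>M I (\<lambda>_. P))"
    unfolding \<Psi>_def by (simp add: mult.assoc[symmetric])
  finally have "norm (\<integral>\<omega>. \<alpha> (\<lambda>j\<in>insert i I. fst (\<omega> j)) * (\<Prod>j\<in>insert i I. Y (\<omega> j)) \<partial>Pi\<^sub>M (insert i I) (\<lambda>_. P)) \<le> (K * B) * B ^ card I"
    using insert.IH[OF \<Psi>m \<Psi>b] by (simp only:)
  moreover have "(K * B) * B ^ card I = K * B ^ card (insert i I)" using insert.hyps by simp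
  ultimately show ?case by (simp only:)
qed

text \<open>If \<open>\<zeta> - \<epsilon>\<close> has conditional mean zero given \<open>X\<close>, then \<open>E|E[1 + \<zeta>|X]| \<le> 1 + Re E\<zeta> + E|\<epsilon>|\<^sup>2/2\<close>.  The
  conditional expectation is avoided by testing against functions \<open>\<beta>\<close> of \<open>X\<close>; the computation
  uses \<open>|\<beta> - 1|\<^sup>2 \<le> 2(1 - Re \<beta>)\<close>.\<close>

lemma norm_observed_factor_le:
  fixes Y :: "'z \<Rightarrow> complex" and l :: "'z \<Rightarrow> complex"
  assumes P: "prob_space P" and X [measurable]: "X \<in> P \<rightarrow>\<^sub>M \<nu>"
    and Y: "integrable P Y" and l: "integrable P l"
    and cond: "\<And>\<beta> C. \<beta> \<in> borel_measurable \<nu> \<Longrightarrow> (\<And>x. x \<in> space \<nu> \<Longrightarrow> norm (\<beta> x) \<le> C) \<Longrightarrow> (\<integral>z. \<beta> (X z) * l z \<partial>P) = 0"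
    and eps: "sq_integrable P (\<lambda>z. Y z - 1 - l z)"
    and \<beta>: "\<beta> \<in> borel_measurable \<nu>" "\<And>x. x \<in> space \<nu> \<Longrightarrow> norm (\<beta> x) \<le> 1"
  shows "norm (\<integral>z. \<beta> (X z) * Y z \<partial>P) \<le> 1 + Re ((\<integral>z. Y z \<partial>P) - 1) + (\<integral>z. (norm (Y z - 1 - l z))\<^sup>2 \<partial>P) / 2"
proof -
  interpret prob_space P by (rule P)
  have [measurable]: "Y \<in> borel_measurable P" "l \<in> borel_measurable P" "\<beta> \<in> borel_measurable \<nu>" using Y l \<beta> by auto
  define J where "J = (\<integral>z. \<beta> (X z) * Y z \<partial>P)"
  \<comment> \<open>A unimodular constant that rotates J onto the nonnegative real axis; absorbed
    into \<beta>, it allows the norm to be computed as a real part.\<close>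
  define \<theta> where "\<theta> = (if J = 0 then 1 else cnj J / of_real (norm J))"
  have \<theta>1: "norm \<theta> = 1" by (auto simp: \<theta>_def norm_divide)
  have \<theta>J: "\<theta> * J = of_real (norm J)"
  proof (cases "J = 0")
    case False
    then have "\<theta> * J = (J * cnj J) / of_real (norm J)" by (simp add: \<theta>_def)
    also have "\<dots> = of_real ((norm J)\<^sup>2 / norm J)" by (simp only: complex_norm_square of_real_divide)
    finally show ?thesis using False by (simp add: power2_eq_square)
  qed simp
  define b where "b z = \<theta> * \<beta> (X z)" for z
  have [measurable]: "b \<in> borel_measurable P" unfolding b_def by measurable
  have b1: "norm (b z) \<le> 1" if "z \<in> space P" for z
    using \<beta>(2)[OF measurable_space[OF X that]] by (simp add: b_def norm_mult \<theta>1)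
  have ib: "integrable P (\<lambda>z. b z * f z)" if "integrable P f" for f
    by (rule Bochner_Integration.integrable_bound[OF that])
       (use that b1 in \<open>auto simp: norm_mult mult_left_le_one_le intro!: AE_I2\<close>)
  have ib0: "integrable P b" using ib[of "\<lambda>_. 1"] by simp
  have "(\<integral>z. b z * l z \<partial>P) = (\<integral>z. (\<lambda>x. \<theta> * \<beta> x) (X z) * l z \<partial>P)" by (simp add: b_def)
  also have "\<dots> = 0" using \<beta> by (intro cond[where C=1]) (auto simp: norm_mult \<theta>1)
  finally have bl: "(\<integral>z. b z * l z \<partial>P) = 0" .
  have l0: "(\<integral>z. l z \<partial>P) = 0" using cond[of "\<lambda>_. 1" 1] by simp
  let ?e = "\<lambda>z. Y z - 1 - l z"
  have ie: "integrable P ?e" using Y l by simp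
  have ie2: "integrable P (\<lambda>z. (norm (?e z))\<^sup>2)" using eps by (rule sq_integrable_norm2)
  have "complex_of_real (norm J) = (\<integral>z. b z * Y z \<partial>P)"
  proof -
    have "(\<integral>z. b z * Y z \<partial>P) = \<theta> * J" by (simp add: b_def J_def mult.assoc)
    then show ?thesis using \<theta>J by simp
  qed
  \<comment> \<open>Writing e for Y - 1 - l, the term b e is split as e + (b - 1) e. The mean of e
    is that of Y - 1, the quantity to be kept, and the rest is absorbed by Re b + abs (b - 1) abs e
    \<le> 1 + (abs e)^2 / 2.\<close>
  also have "\<dots> = (\<integral>z. b z + (b z * l z + ?e z + (b z - 1) * ?e z) \<partial>P)"
    by (intro Bochner_Integration.integral_cong) (auto simp: algebra_simps)
  also have "\<dots> = (\<integral>z. b z + (b z - 1) * ?e z \<partial>P) + (\<integral>z. ?e z \<partial>P)"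
  proof -
    have i1: "integrable P (\<lambda>z. b z + (b z - 1) * ?e z)" using ib[OF ie] ie ib0 by (simp add: left_diff_distrib)
    have "(\<integral>z. b z + (b z * l z + ?e z + (b z - 1) * ?e z) \<partial>P) = (\<integral>z. (b z + (b z - 1) * ?e z) + (?e z + b z * l z) \<partial>P)"
      by (simp add: algebra_simps)
    also have "\<dots> = (\<integral>z. b z + (b z - 1) * ?e z \<partial>P) + ((\<integral>z. ?e z \<partial>P) + (\<integral>z. b z * l z \<partial>P))"
      using i1 ie ib[OF l] by (simp only: Bochner_Integration.integral_add Bochner_Integration.integrable_add)
    finally show ?thesis using bl by simp
  qed
  also have "(\<integral>z. ?e z \<partial>P) = (\<integral>z. Y z \<partial>P) - 1" using Y l l0 by (simp add: prob_space)
  finally have "norm J = Re ((\<integral>z. b z + (b z - 1) * ?e z \<partial>P) + ((\<integral>z. Y z \<partial>P) - 1))"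
    by (metis Re_complex_of_real)
  also have "\<dots> = (\<integral>z. Re (b z + (b z - 1) * ?e z) \<partial>P) + Re ((\<integral>z. Y z \<partial>P) - 1)"
  proof -
    have i1: "integrable P (\<lambda>z. b z + (b z - 1) * ?e z)" using ib[OF ie] ie ib0 by (simp add: left_diff_distrib)
    show ?thesis unfolding plus_complex.sel integral_Re[OF i1, symmetric] ..
  qed
  also have "(\<integral>z. Re (b z + (b z - 1) * ?e z) \<partial>P) \<le> (\<integral>z. 1 + (norm (?e z))\<^sup>2 / 2 \<partial>P)"
  proof (rule integral_mono)
    show "integrable P (\<lambda>z. Re (b z + (b z - 1) * ?e z))"
      using ib[OF ie] ie ib0 by (intro integrable_Re) (simp add: left_diff_distrib)
    show "integrable P (\<lambda>z. 1 + (norm (?e z))\<^sup>2 / 2)" using ie2 by simp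
    fix z assume z: "z \<in> space P"
    have "(norm (b z - 1))\<^sup>2 = (norm (b z))\<^sup>2 - 2 * Re (b z) + 1"
      unfolding cmod_power2 by (simp add: power2_eq_square algebra_simps)
    moreover have "(norm (b z))\<^sup>2 \<le> 1\<^sup>2" using b1[OF z] by (intro power_mono) auto
    ultimately have 1: "(norm (b z - 1))\<^sup>2 \<le> 2 * (1 - Re (b z))" by simp
    have "Re ((b z - 1) * ?e z) \<le> norm (b z - 1) * norm (?e z)"
      using complex_Re_le_cmod[of "(b z - 1) * ?e z"] by (simp only: norm_mult)
    also have "\<dots> \<le> ((norm (b z - 1))\<^sup>2 + (norm (?e z))\<^sup>2) / 2" by (rule norm_mult_le_sum_squares)
    finally show "Re (b z + (b z - 1) * ?e z) \<le> 1 + (norm (?e z))\<^sup>2 / 2" using 1 by simp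
  qed
  also have "(\<integral>z. 1 + (norm (?e z))\<^sup>2 / 2 \<partial>P) = 1 + (\<integral>z. (norm (?e z))\<^sup>2 \<partial>P) / 2"
    using ie2 by (simp add: prob_space)
  finally show ?thesis unfolding J_def by simp
qed

lemma one_plus_divide_power_le_exp:
  assumes "0 \<le> (x::real)" shows "(1 + x / real n) ^ n \<le> exp x"
  using exp_ge_one_plus_x_over_n_power_n[of n x] assms by (cases "n = 0") auto

text \<open>At s = - i t the prefactor exp (- s^2 V) is exp (t^2 V), and the n-th power of the bound
  for one observation tends to exp (- t^2 E d^2 / 2 - t^2 V), so V cancels. In \<open>cond\<close>
  the term 2 y is the full score, and it arises from the square in the approximate
  likelihood.\<close>

lemma regular_limit_char_bound:
  fixes P :: "('x \<times> 't) measure" and u :: "'x \<times> 't \<Rightarrow> real" and m :: "'x \<Rightarrow> real"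
    and T :: "nat \<Rightarrow> (nat \<Rightarrow> 'x) \<Rightarrow> real"
  assumes alt: "\<And>s. local_alternative P d yn y (M' s) (q s) s"
    and fst [measurable]: "fst \<in> P \<rightarrow>\<^sub>M \<nu>"
    and T: "\<And>n. T n \<in> borel_measurable (Pi\<^sub>M {..<n} (\<lambda>_. \<nu>))"
    and u [measurable]: "u \<in> borel_measurable P" and m [measurable]: "m \<in> borel_measurable \<nu>"
    and d_eq: "\<And>z. d z = m (fst z) - u z"
    and cond: "\<And>\<beta> C. \<beta> \<in> borel_measurable \<nu> \<Longrightarrow> (\<And>x. x \<in> space \<nu> \<Longrightarrow> norm (\<beta> x) \<le> C) \<Longrightarrow>
       (\<integral>z. \<beta> (fst z) * complex_of_real (d z - 2 * y z) \<partial>P) = 0"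
    and orth: "(\<integral>z. d z * y z \<partial>P) = 0"
    and lim: "\<And>s. (\<lambda>n. \<integral>\<omega>. iexp (t * ((T n (\<lambda>j\<in>{..<n}. fst (\<omega> j)) - (\<Sum>j<n. u (\<omega> j))) / sqrt (real n)))
        \<partial>power_measure n (M' s n)) \<longlonglongrightarrow> c"
  shows "norm c \<le> exp (- t\<^sup>2 * (\<integral>z. (d z)\<^sup>2 \<partial>P) / 2)"
proof -
  interpret local_alternative P d yn y "M' 0" "q 0" 0 by (rule alt)
  let ?P = "\<lambda>n. power_measure n P"
  define h where "h n \<omega> = iexp (t * ((T n (\<lambda>j\<in>{..<n}. fst (\<omega> j)) - (\<Sum>j<n. u (\<omega> j))) / sqrt (real n)))" for n \<omega>
  define F where "F n s = exp (- s\<^sup>2 * of_real V) * (\<integral>\<omega>. h n \<omega> * (\<Prod>j<n. (w s n (\<omega> j))\<^sup>2) \<partial>?P n)" for n s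
  have om: "(\<lambda>\<omega>. \<lambda>j\<in>{..<n}. fst (\<omega> j)) \<in> ?P n \<rightarrow>\<^sub>M Pi\<^sub>M {..<n} (\<lambda>_. \<nu>)" for n :: nat
    by (intro measurable_restrict measurable_compose[OF _ fst] measurable_component_singleton)
  have hm [measurable]: "h n \<in> borel_measurable (?P n)" for n
  proof -
    have [measurable]: "(\<lambda>\<omega>. T n (\<lambda>j\<in>{..<n}. fst (\<omega> j))) \<in> borel_measurable (?P n)"
      by (rule measurable_compose[OF om T])
    have [measurable]: "(\<lambda>\<omega>. \<Sum>j<n. u (\<omega> j)) \<in> borel_measurable (?P n)"
      by (rule measurable_sum_components[OF u])
    show ?thesis unfolding h_def by measurable
  qed
  have h1: "norm (h n \<omega>) = 1" for n \<omega> unfolding h_def by (rule norm_exp_i_times)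
  have iw2: "integrable P (\<lambda>z. (w s n z)\<^sup>2)" for s n
    by (rule Bochner_Integration.integrable_bound[OF sq_integrable_norm2[OF sq_w[of s n]]]) (auto simp: norm_power)
  obtain B0 where B0: "B0 \<ge> 0" "\<And>n. (\<integral>z. (yn n z)\<^sup>2 \<partial>P) \<le> B0"
  proof -
    have "(\<lambda>n. \<integral>x. yn n x * yn n x \<partial>P) \<longlonglongrightarrow> (\<integral>x. y x * y x \<partial>P)" by (rule L2_tendsto_mult[OF y y])
    then have "Bseq (\<lambda>n. \<integral>x. yn n x * yn n x \<partial>P)" by (intro convergent_imp_Bseq convergentI)
    then obtain B where B: "B > 0" "\<And>n. norm (\<integral>x. yn n x * yn n x \<partial>P) \<le> B" by (auto simp: Bseq_def)
    show ?thesis using B(1) B(2) that[of B] by (simp add: power2_eq_square abs_le_iff)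
  qed
  have V0: "0 \<le> V" by (simp add: V_def)
  have hol: "F n holomorphic_on UNIV" for n
  proof -
    define C where "C j z = complex_of_real (yn n (z j)) / of_real (sqrt (real n))" for j :: nat and z
    define A where "A X \<omega> = (\<Prod>j\<in>X. C j \<omega>)" for X \<omega>
    \<comment> \<open>Expanding over subsets displays the integral as a polynomial in s, with finite
      coefficients since the truncated factors are bounded. Holomorphy then needs no differentiation
      under the integral.\<close>
    have wexp: "(\<Prod>j<n. w s n (\<omega> j)) = (\<Sum>X\<in>Pow {..<n}. s ^ card X * A X \<omega>)" for s \<omega>
    proof -
      have "(\<Prod>j<n. w s n (\<omega> j)) = (\<Prod>j<n. s * C j \<omega> + 1)" by (simp add: w_def C_def add.commute)
      also have "\<dots> = (\<Sum>X\<in>Pow {..<n}. (\<Prod>j\<in>X. s * C j \<omega>) * (\<Prod>j\<in>{..<n} - X. 1))" by (rule prod_add) simp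
      also have "\<dots> = (\<Sum>X\<in>Pow {..<n}. s ^ card X * A X \<omega>)" by (simp add: prod.distrib A_def)
      finally show ?thesis .
    qed
    have Cb: "norm (C j \<omega>) \<le> 2 * sqrt (sqrt (real n)) / sqrt (real n)" if "\<omega> \<in> space (?P n)" "j < n" for j \<omega>
      using yb[of "\<omega> j" n] that by (auto simp: C_def norm_divide space_PiM PiE_iff intro!: divide_right_mono)
    have Cm: "(\<lambda>\<omega>. C j \<omega>) \<in> borel_measurable (?P n)" if "j < n" for j
    proof -
      have "(\<lambda>\<omega>. \<omega> j) \<in> ?P n \<rightarrow>\<^sub>M P" using that by (intro measurable_component_singleton) auto
      then have "(\<lambda>\<omega>. yn n (\<omega> j)) \<in> borel_measurable (?P n)" by (rule measurable_compose) measurable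
      then show ?thesis unfolding C_def by measurable
    qed
    have Am: "A X \<in> borel_measurable (?P n)" if "X \<subseteq> {..<n}" for X
      unfolding A_def using that by (intro borel_measurable_prod Cm) auto
    interpret Pn: prob_space "?P n" by (rule prob_space_power)
    have i: "integrable (?P n) (\<lambda>\<omega>. h n \<omega> * (A X \<omega> * A Y \<omega>))" if XY: "X \<subseteq> {..<n}" "Y \<subseteq> {..<n}" for X Y
    proof (rule Pn.integrable_const_bound)
      let ?c = "2 * sqrt (sqrt (real n)) / sqrt (real n)"
      have Ab: "norm (A X \<omega>) \<le> ?c ^ card X" if "\<omega> \<in> space (?P n)" "X \<subseteq> {..<n}" for X \<omega>
      proof -
        have "norm (A X \<omega>) = (\<Prod>j\<in>X. norm (C j \<omega>))" by (simp add: A_def prod_norm)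
        also have "\<dots> \<le> (\<Prod>j\<in>X. ?c)" using that by (intro prod_mono conjI Cb) auto
        finally show ?thesis by simp
      qed
      show "AE \<omega> in ?P n. norm (h n \<omega> * (A X \<omega> * A Y \<omega>)) \<le> ?c ^ card X * ?c ^ card Y"
        unfolding norm_mult h1 using Ab XY by (intro AE_I2) (simp, intro mult_mono, auto)
      show "(\<lambda>\<omega>. h n \<omega> * (A X \<omega> * A Y \<omega>)) \<in> borel_measurable (?P n)"
        using Am[OF XY(1)] Am[OF XY(2)] by measurable
    qed
    have Feq: "F n = (\<lambda>s. exp (- s\<^sup>2 * of_real V) * (\<Sum>X\<in>Pow {..<n}. \<Sum>Y\<in>Pow {..<n}. (s ^ card X * s ^ card Y) * (\<integral>\<omega>. h n \<omega> * (A X \<omega> * A Y \<omega>) \<partial>?P n)))"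
    proof
      fix s
      have "h n \<omega> * (\<Prod>j<n. (w s n (\<omega> j))\<^sup>2) = (\<Sum>X\<in>Pow {..<n}. \<Sum>Y\<in>Pow {..<n}. (s ^ card X * s ^ card Y) * (h n \<omega> * (A X \<omega> * A Y \<omega>)))" for \<omega>
      proof -
        have "(\<Prod>j<n. (w s n (\<omega> j))\<^sup>2) = (\<Prod>j<n. w s n (\<omega> j))\<^sup>2" by (rule prod_power_distrib[symmetric])
        then show ?thesis unfolding wexp power2_eq_square[of "sum _ _"] sum_product
          by (simp only: sum_distrib_left ac_simps)
      qed
      then have "(\<integral>\<omega>. h n \<omega> * (\<Prod>j<n. (w s n (\<omega> j))\<^sup>2) \<partial>?P n) = (\<integral>\<omega>. (\<Sum>X\<in>Pow {..<n}. \<Sum>Y\<in>Pow {..<n}. (s ^ card X * s ^ card Y) * (h n \<omega> * (A X \<omega> * A Y \<omega>))) \<partial>?P n)"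
        by (simp only:)
      also have "\<dots> = (\<Sum>X\<in>Pow {..<n}. \<Sum>Y\<in>Pow {..<n}. (s ^ card X * s ^ card Y) * (\<integral>\<omega>. h n \<omega> * (A X \<omega> * A Y \<omega>) \<partial>?P n))"
      proof (subst Bochner_Integration.integral_sum)
        show "integrable (?P n) (\<lambda>\<omega>. \<Sum>Y\<in>Pow {..<n}. (s ^ card X * s ^ card Y) * (h n \<omega> * (A X \<omega> * A Y \<omega>)))" if "X \<in> Pow {..<n}" for X
          using that by (intro Bochner_Integration.integrable_sum integrable_mult_right i) auto
        show "(\<Sum>X\<in>Pow {..<n}. \<integral>\<omega>. (\<Sum>Y\<in>Pow {..<n}. (s ^ card X * s ^ card Y) * (h n \<omega> * (A X \<omega> * A Y \<omega>))) \<partial>?P n)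
          = (\<Sum>X\<in>Pow {..<n}. \<Sum>Y\<in>Pow {..<n}. (s ^ card X * s ^ card Y) * (\<integral>\<omega>. h n \<omega> * (A X \<omega> * A Y \<omega>) \<partial>?P n))"
        proof (rule sum.cong[OF refl])
          fix X assume "X \<in> Pow {..<n}"
          then show "(\<integral>\<omega>. (\<Sum>Y\<in>Pow {..<n}. (s ^ card X * s ^ card Y) * (h n \<omega> * (A X \<omega> * A Y \<omega>))) \<partial>?P n)
            = (\<Sum>Y\<in>Pow {..<n}. (s ^ card X * s ^ card Y) * (\<integral>\<omega>. h n \<omega> * (A X \<omega> * A Y \<omega>) \<partial>?P n))"
            by (subst Bochner_Integration.integral_sum) (auto intro!: integrable_mult_right i)
        qed
      qed
      finally show "F n s = exp (- s\<^sup>2 * of_real V) * (\<Sum>X\<in>Pow {..<n}. \<Sum>Y\<in>Pow {..<n}. (s ^ card X * s ^ card Y) * (\<integral>\<omega>. h n \<omega> * (A X \<omega> * A Y \<omega>) \<partial>?P n))"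
        by (simp only: F_def)
    qed
    show ?thesis unfolding Feq by (intro holomorphic_intros)
  qed
  \<comment> \<open>Since h has modulus one, second moments of \<open>w\<close> suffice; (1 + x /
    n)^n \<le> exp x makes the bound uniform in n.\<close>
  have bdd: "\<exists>B. \<forall>n s. norm s \<le> R \<longrightarrow> norm (F n s) \<le> B" for R
  proof (intro exI allI impI)
    fix n :: nat and s :: complex assume s: "norm s \<le> R"
    have s2: "(norm s)\<^sup>2 \<le> R\<^sup>2" using s by (intro power_mono) auto
    have "norm (\<integral>\<omega>. h n \<omega> * (\<Prod>j<n. (w s n (\<omega> j))\<^sup>2) \<partial>?P n) \<le> (\<integral>\<omega>. (\<Prod>j<n. (norm (w s n (\<omega> j)))\<^sup>2) \<partial>?P n)"
      by (rule order_trans[OF integral_norm_bound]) (simp add: norm_mult h1 prod_norm[symmetric] norm_power)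
    also have "\<dots> = (\<integral>z. (norm (w s n z))\<^sup>2 \<partial>P) ^ n"
      using integral_power_prod(1)[OF finite_lessThan[of n] sq_integrable_norm2[OF sq_w[of s n]]] by simp
    also have "\<dots> \<le> (1 + (norm s)\<^sup>2 * (\<integral>z. (yn n z)\<^sup>2 \<partial>P) / real n) ^ n"
      by (intro power_mono norm_w2) simp
    also have "\<dots> \<le> (1 + R\<^sup>2 * B0 / real n) ^ n"
      using s2 s B0 by (intro power_mono add_left_mono divide_right_mono mult_mono) auto
    also have "\<dots> \<le> exp (R\<^sup>2 * B0)" using B0 by (intro one_plus_divide_power_le_exp) auto
    finally have 1: "norm (\<integral>\<omega>. h n \<omega> * (\<Prod>j<n. (w s n (\<omega> j))\<^sup>2) \<partial>?P n) \<le> exp (R\<^sup>2 * B0)" .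
    have "norm (exp (- s\<^sup>2 * of_real V)) \<le> exp (norm (- s\<^sup>2 * complex_of_real V))" by (rule norm_exp)
    also have "norm (- s\<^sup>2 * complex_of_real V) = (norm s)\<^sup>2 * V" using V0 by (simp add: norm_mult norm_power)
    also have "exp ((norm s)\<^sup>2 * V) \<le> exp (R\<^sup>2 * V)" using s2 V0 by (simp add: mult_right_mono)
    finally show "norm (F n s) \<le> exp (R\<^sup>2 * V) * exp (R\<^sup>2 * B0)"
      unfolding F_def norm_mult using 1 by (intro mult_mono) auto
  qed
  have Flim: "(\<lambda>n. F n (complex_of_real s)) \<longlonglongrightarrow> c" for s
  proof -
    interpret s: local_alternative P d yn y "M' s" "q s" s by (rule alt)
    have "(\<lambda>n. (\<integral>\<omega>. h n \<omega> \<partial>power_measure n (M' s n))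
      - exp (- s\<^sup>2 * V) * (\<integral>\<omega>. h n \<omega> * (\<Prod>j<n. (w (of_real s) n (\<omega> j))\<^sup>2) \<partial>power_measure n P)) \<longlonglongrightarrow> 0"
      by (intro s.likelihood_approx hm) (simp add: h1)
    then have "(\<lambda>n. (\<integral>\<omega>. h n \<omega> \<partial>power_measure n (M' s n)) - F n (of_real s)) \<longlonglongrightarrow> 0"
      unfolding F_def by (simp add: exp_of_real[symmetric])
    from tendsto_diff[OF lim[of s, folded h_def] this] show ?thesis by simp
  qed
  \<comment> \<open>The bound that \<open>norm_observed_factor_le\<close> gives for a single
    observation at s = - i t.\<close>
  define b where "b n = 1 + Re ((\<integral>z. e t n z * (w (- \<i> * t) n z)\<^sup>2 \<partial>P) - 1)
    + (\<integral>z. (norm (e t n z * (w (- \<i> * t) n z)\<^sup>2 - 1 - \<i> * (t * d z / sqrt (real n)) - 2 * (- \<i> * t) * of_real (y z) / of_real (sqrt (real n))))\<^sup>2 \<partial>P) / 2" for n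
  have le: "norm (F n (- \<i> * t)) \<le> exp (t\<^sup>2 * V) * b n ^ n" for n
  proof -
    let ?E = "\<lambda>z. e t n z * (w (- \<i> * t) n z)\<^sup>2"
    let ?l = "\<lambda>z. (\<i> * t / of_real (sqrt (real n))) * complex_of_real (d z - 2 * y z)"
    \<comment> \<open>Y carries u in place of d. The two versions differ by a unimodular function of
      X, which the arbitrary test function \<beta> absorbs, so that the expansions around d apply to
      Y.\<close>
    define Y where "Y z = iexp (- t * u z / sqrt (real n)) * (w (- \<i> * t) n z)\<^sup>2" for z
    have YE: "Y z = iexp (- t * m (fst z) / sqrt (real n)) * ?E z" for z
      unfolding Y_def e_def d_eq mult.assoc[symmetric] exp_add[symmetric]
      by (simp add: algebra_simps diff_divide_distrib)
    have iE: "integrable P ?E"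
      by (rule Bochner_Integration.integrable_bound[OF iw2[of "- \<i> * t" n]]) (auto simp: norm_mult norm_e)
    have iY: "integrable P Y"
      unfolding Y_def by (rule Bochner_Integration.integrable_bound[OF iw2[of "- \<i> * t" n]]) (auto simp: norm_mult)
    have sdy: "sq_integrable P (\<lambda>z. complex_of_real (d z - 2 * y z))"
      by (intro sq_integrable_of_real sq_integrable_diff sq_integrable_cmult d sq_y)
    have il: "integrable P ?l"
      by (intro integrable_mult_right sq_integrable_integrable sdy)
    have leq: "?E z - 1 - ?l z = ?E z - 1 - \<i> * (t * d z / sqrt (real n)) - 2 * (- \<i> * t) * of_real (y z) / of_real (sqrt (real n))" for z
      by (simp add: algebra_simps diff_divide_distrib)
    have sE: "sq_integrable P ?E"
    proof (rule finite_measure.sq_integrable_bounded[OF finite_measure_axioms])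
      let ?c = "2 * sqrt (sqrt (real n)) / sqrt (real n)"
      show "norm (?E z) \<le> (1 + \<bar>t\<bar> * ?c)\<^sup>2" if "z \<in> space P" for z
      proof -
        have "norm (w (- \<i> * t) n z) \<le> 1 + \<bar>t\<bar> * (\<bar>yn n z\<bar> / sqrt (real n))"
          unfolding w_def by (rule order_trans[OF norm_triangle_ineq]) (simp add: norm_mult norm_divide)
        also have "\<dots> \<le> 1 + \<bar>t\<bar> * ?c" using yb[OF that, of n] by (intro add_left_mono mult_left_mono divide_right_mono) auto
        finally show ?thesis unfolding norm_mult norm_e norm_power by (simp add: power_mono)
      qed
    qed measurable
    have eps: "sq_integrable P (\<lambda>z. ?E z - 1 - ?l z)"
      by (intro sq_integrable_diff sE sq_integrable_const sq_integrable_cmult sdy)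
    have factor: "norm (\<integral>z. \<beta> (fst z) * Y z \<partial>P) \<le> b n"
      if \<beta>: "\<beta> \<in> borel_measurable \<nu>" "\<And>x. x \<in> space \<nu> \<Longrightarrow> norm (\<beta> x) \<le> 1" for \<beta>
    proof -
      have "norm (\<integral>z. (\<lambda>x. \<beta> x * iexp (- t * m x / sqrt (real n))) (fst z) * ?E z \<partial>P) \<le> 1 + Re ((\<integral>z. ?E z \<partial>P) - 1) + (\<integral>z. (norm (?E z - 1 - ?l z))\<^sup>2 \<partial>P) / 2"
      proof (rule norm_observed_factor_le[OF prob_space_axioms fst iE il _ eps])
        show "(\<integral>z. \<beta>' (fst z) * ?l z \<partial>P) = 0" if "\<beta>' \<in> borel_measurable \<nu>" "\<And>x. x \<in> space \<nu> \<Longrightarrow> norm (\<beta>' x) \<le> C" for \<beta>' C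
          using cond[OF that] by (simp only: mult.left_commute[of "\<beta>' _"] integral_mult_right_zero) simp
        show "(\<lambda>x. \<beta> x * iexp (- t * m x / sqrt (real n))) \<in> borel_measurable \<nu>" using \<beta>(1) by measurable
        show "norm (\<beta> x * iexp (- t * m x / sqrt (real n))) \<le> 1" if "x \<in> space \<nu>" for x
          unfolding norm_mult norm_exp_i_times using \<beta>(2)[OF that] by simp
      qed
      then show ?thesis unfolding leq b_def YE by (simp only: mult.assoc)
    qed
    have "norm (\<integral>\<omega>. (\<lambda>x. iexp (t * T n x / sqrt (real n))) (\<lambda>j\<in>{..<n}. fst (\<omega> j)) * (\<Prod>j<n. Y (\<omega> j)) \<partial>?P n) \<le> 1 * b n ^ card {..<n}"
    proof (rule product_with_observed_factor_le[OF prob_space_axioms fst iY factor])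
      note [measurable] = T
      show "(\<lambda>x. iexp (t * T n x / sqrt (real n))) \<in> borel_measurable (Pi\<^sub>M {..<n} (\<lambda>_. \<nu>))" by measurable
    qed (simp_all only: norm_exp_i_times order_refl finite_lessThan)
    moreover have "h n \<omega> * (\<Prod>j<n. (w (- \<i> * t) n (\<omega> j))\<^sup>2) = iexp (t * T n (\<lambda>j\<in>{..<n}. fst (\<omega> j)) / sqrt (real n)) * (\<Prod>j<n. Y (\<omega> j))" for \<omega>
    proof -
      have "(\<Prod>j<n. iexp (- t * u (\<omega> j) / sqrt (real n))) = iexp (\<Sum>j<n. - t * u (\<omega> j) / sqrt (real n))"
        by (simp add: exp_sum sum_distrib_left)
      also have "(\<Sum>j<n. - t * u (\<omega> j) / sqrt (real n)) = - t * (\<Sum>j<n. u (\<omega> j)) / sqrt (real n)"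
        by (simp only: sum_divide_distrib sum_distrib_left)
      finally have 1: "(\<Prod>j<n. iexp (- t * u (\<omega> j) / sqrt (real n))) = iexp (- t * (\<Sum>j<n. u (\<omega> j)) / sqrt (real n))" .
      have "h n \<omega> = iexp (t * T n (\<lambda>j\<in>{..<n}. fst (\<omega> j)) / sqrt (real n)) * iexp (- t * (\<Sum>j<n. u (\<omega> j)) / sqrt (real n))"
        unfolding h_def exp_add[symmetric] by (simp add: algebra_simps diff_divide_distrib)
      then show ?thesis unfolding Y_def prod.distrib 1 by (simp only: mult.assoc)
    qed
    ultimately have 1: "norm (\<integral>\<omega>. h n \<omega> * (\<Prod>j<n. (w (- \<i> * t) n (\<omega> j))\<^sup>2) \<partial>?P n) \<le> b n ^ n" by simp
    have "- (- \<i> * complex_of_real t)\<^sup>2 * of_real V = of_real (t\<^sup>2 * V)" by (simp add: power_mult_distrib)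
    then have "norm (exp (- (- \<i> * complex_of_real t)\<^sup>2 * of_real V)) = exp (t\<^sup>2 * V)" by (simp only: norm_exp_eq_Re Re_complex_of_real)
    then show ?thesis unfolding F_def norm_mult using 1 by (simp only: mult_left_mono exp_ge_zero)
  qed
  \<comment> \<open>Because (- i t)^2 = - t^2, the quadratic term contributes - t^2 V; the cross
    term drops out by \<open>orth\<close>, and the remainder does not affect the limit.\<close>
  have "(\<lambda>n. Re (of_nat n * ((\<integral>z. e t n z * (w (- \<i> * t) n z)\<^sup>2 \<partial>P) - 1)) +
     real n * (\<integral>z. (norm (e t n z * (w (- \<i> * t) n z)\<^sup>2 - 1 - \<i> * (t * d z / sqrt (real n)) - 2 * (- \<i> * t) * of_real (y z) / of_real (sqrt (real n))))\<^sup>2 \<partial>P) / 2)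
    \<longlonglongrightarrow> Re (- complex_of_real (t\<^sup>2 * (\<integral>x. (d x)\<^sup>2 \<partial>P) / 2) + (- \<i> * t)\<^sup>2 * of_real (\<integral>x. (y x)\<^sup>2 \<partial>P)
        + 2 * \<i> * of_real t * (- \<i> * t) * of_real (\<integral>x. d x * y x \<partial>P)) + 0 / 2"
    by (intro tendsto_add tendsto_Re moment_ew2 tendsto_divide remainder_ew2 tendsto_const) simp
  moreover have "Re (- complex_of_real (t\<^sup>2 * (\<integral>x. (d x)\<^sup>2 \<partial>P) / 2) + (- \<i> * t)\<^sup>2 * of_real (\<integral>x. (y x)\<^sup>2 \<partial>P)
        + 2 * \<i> * of_real t * (- \<i> * t) * of_real (\<integral>x. d x * y x \<partial>P)) + 0 / 2 = - t\<^sup>2 * (\<integral>x. (d x)\<^sup>2 \<partial>P) / 2 - t\<^sup>2 * V"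
    unfolding orth V_def by (simp add: power_mult_distrib)
  moreover have "Re (of_nat n * (E - 1)) + real n * R / 2 = real n * ((1 + Re (E - 1) + R / 2) - 1)" for n E R
    by (simp add: algebra_simps)
  ultimately have "(\<lambda>n. real n * (b n - 1)) \<longlonglongrightarrow> - t\<^sup>2 * (\<integral>x. (d x)\<^sup>2 \<partial>P) / 2 - t\<^sup>2 * V"
    unfolding b_def by (simp only:)
  from power_tendsto_exp_real[OF this]
  have "(\<lambda>n. exp (t\<^sup>2 * V) * b n ^ n) \<longlonglongrightarrow> exp (t\<^sup>2 * V) * exp (- t\<^sup>2 * (\<integral>x. (d x)\<^sup>2 \<partial>P) / 2 - t\<^sup>2 * V)"
    by (intro tendsto_intros)
  also have "exp (t\<^sup>2 * V) * exp (- t\<^sup>2 * (\<integral>x. (d x)\<^sup>2 \<partial>P) / 2 - t\<^sup>2 * V) = exp (- t\<^sup>2 * (\<integral>x. (d x)\<^sup>2 \<partial>P) / 2)"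
    by (simp add: exp_add[symmetric])
  finally show ?thesis
    by (rule norm_real_limit_le[OF hol bdd Flim le])
qed

text \<open>Comparison of curvatures at 0. Centring L at its mean leaves the modulus of its
  characteristic function alone and makes the real part at least 1 - t^2 W / 2, with W the variance;
  dividing by t^2 and letting t tend to 0 compares W with v. An infinite second moment makes the
  claim trivial.\<close>

lemma variance_of_law_ge:
  assumes L: "real_distribution L"
    and ch: "\<And>t. norm (char L t) \<le> exp (- t\<^sup>2 * v / 2)" and v: "0 \<le> v"
  shows "ennreal v \<le> variance_of_law L"
proof (cases "integrable L (\<lambda>x. x\<^sup>2)")
  case False
  then show ?thesis by (simp add: variance_of_law_def)
next
  case True
  interpret L: real_distribution L by (rule L)
  have s: "sq_integrable L (\<lambda>x. x)" using True by (simp add: sq_integrable_def)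
  define \<mu> where "\<mu> = (\<integral>y. y \<partial>L)"
  define W where "W = (\<integral>x. (x - \<mu>)\<^sup>2 \<partial>L)"
  have iW: "integrable L (\<lambda>x. (x - \<mu>)\<^sup>2)"
    using sq_integrable_diff[OF s L.sq_integrable_const[of \<mu>]] by (simp add: sq_integrable_def)
  have key: "v - v\<^sup>2 * t\<^sup>2 / 4 \<le> W" if t: "t \<noteq> 0" for t
  proof -
    have ic: "integrable L (\<lambda>x. iexp (t * (x - \<mu>)))"
      by (rule L.integrable_const_bound[of _ 1]) (auto simp: norm_exp_i_times simp del: of_real_mult of_real_diff)
    have "1 - t\<^sup>2 * W / 2 = (\<integral>x. 1 - t\<^sup>2 / 2 * (x - \<mu>)\<^sup>2 \<partial>L)"
      using iW L.prob_space by (simp add: W_def)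
    also have "\<dots> \<le> (\<integral>x. Re (iexp (t * (x - \<mu>))) \<partial>L)"
    proof (rule integral_mono)
      show "integrable L (\<lambda>x. 1 - t\<^sup>2 / 2 * (x - \<mu>)\<^sup>2)" using iW by simp
      show "integrable L (\<lambda>x. Re (iexp (t * (x - \<mu>))))" by (rule integrable_Re[OF ic])
      show "1 - t\<^sup>2 / 2 * (x - \<mu>)\<^sup>2 \<le> Re (iexp (t * (x - \<mu>)))" for x
      proof -
        have "1 - (t * (x - \<mu>))\<^sup>2 / 2 \<le> cos (t * (x - \<mu>))"
          using iexp_approx_linear[of "t * (x - \<mu>)"] abs_Re_le_cmod[of "iexp (t * (x - \<mu>)) - 1 - \<i> * (t * (x - \<mu>))"]
          by (simp add: Re_exp)
        then show ?thesis by (simp add: Re_exp power_mult_distrib)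
      qed
    qed
    also have "\<dots> = Re (\<integral>x. iexp (t * (x - \<mu>)) \<partial>L)" by (rule integral_Re[OF ic])
    also have "\<dots> \<le> norm (\<integral>x. iexp (t * (x - \<mu>)) \<partial>L)" by (rule complex_Re_le_cmod)
    also have "(\<integral>x. iexp (t * (x - \<mu>)) \<partial>L) = (\<integral>x. iexp (- t * \<mu>) * iexp (t * x) \<partial>L)"
      by (simp add: exp_add[symmetric] algebra_simps)
    also have "\<dots> = iexp (- t * \<mu>) * char L t" by (simp only: char_def integral_mult_right_zero)
    also have "norm (iexp (- t * \<mu>) * char L t) = norm (char L t)" by (simp only: norm_mult norm_exp_i_times mult_1)
    also have "\<dots> \<le> exp (- t\<^sup>2 * v / 2)" by (rule ch)
    \<comment> \<open>The upper bound for exp (- x) follows from the lower bound 1 + x + x^2 / 2 for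
      exp x, since (1 - x + x^2 / 2)(1 + x + x^2 / 2) = 1 + x^4 / 4 \<ge> 1.\<close>
    also have "\<dots> \<le> 1 - t\<^sup>2 * v / 2 + (t\<^sup>2 * v / 2)\<^sup>2 / 2"
    proof -
      let ?x = "t\<^sup>2 * v / 2"
      have "1 + ?x + ?x\<^sup>2 / 2 \<le> exp ?x" using v by (intro exp_lower_Taylor_quadratic) simp
      then have "exp (- ?x) \<le> inverse (1 + ?x + ?x\<^sup>2 / 2)"
        unfolding exp_minus using v by (intro le_imp_inverse_le add_pos_nonneg) auto
      also have "\<dots> \<le> 1 - ?x + ?x\<^sup>2 / 2"
      proof -
        have x0: "0 \<le> ?x" using v by simp
        have "(1 - a + a\<^sup>2 / 2) * (1 + a + a\<^sup>2 / 2) = 1 + a ^ 4 / 4" for a :: real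
          by (simp add: power2_eq_square power4_eq_xxxx algebra_simps)
        then have "1 \<le> (1 - ?x + ?x\<^sup>2 / 2) * (1 + ?x + ?x\<^sup>2 / 2)" by (simp only:) simp
        moreover have "0 < 1 + ?x + ?x\<^sup>2 / 2" using x0 by (intro add_pos_nonneg) auto
        ultimately show ?thesis by (metis divide_inverse mult.left_neutral pos_divide_le_eq)
      qed
      finally show ?thesis by simp
    qed
    finally have "t\<^sup>2 * (v - v\<^sup>2 * t\<^sup>2 / 4) \<le> t\<^sup>2 * W"
      by (simp add: power2_eq_square algebra_simps)
    then show ?thesis using t by (simp add: mult_le_cancel_left)
  qed
  have "(\<lambda>n. v - v\<^sup>2 * (inverse (real (Suc n)))\<^sup>2 / 4) \<longlonglongrightarrow> v - v\<^sup>2 * 0\<^sup>2 / 4"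
    by (intro tendsto_intros LIMSEQ_inverse_real_of_nat) simp
  then have "v \<le> W" by (intro LIMSEQ_le_const2) (auto intro!: key)
  then show ?thesis using True by (simp add: variance_of_law_def W_def \<mu>_def ennreal_leI)
qed

section \<open>Lebesgue decomposition\<close>

text \<open>A null set of maximal \<open>N\<close>-measure carries the singular part.\<close>

lemma Lebesgue_decomposition_exists:
  assumes N: "finite_measure N" and sets_eq [measurable_cong]: "sets N = sets M"
  shows "\<exists>A. sets A = sets M \<and> absolutely_continuous M A \<and>
     (\<exists>S. sets S = sets M \<and> (\<exists>B\<in>null_sets M. emeasure S (space M - B) = 0) \<and>
          (\<forall>E\<in>sets M. emeasure N E = emeasure A E + emeasure S E))"
proof -
  interpret N: finite_measure N by (rule N)
  define c where "c = (SUP B\<in>null_sets M. emeasure N B)"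
  have "null_sets M \<noteq> {}" by auto
  then obtain f :: "nat \<Rightarrow> _" where f: "range f \<subseteq> emeasure N ` null_sets M" "c = (SUP i. f i)"
    using ennreal_SUP_countable_SUP[of "null_sets M" "emeasure N"] unfolding c_def by (metis (no_types))
  then have "\<forall>i. \<exists>B. B \<in> null_sets M \<and> f i = emeasure N B" by blast
  then obtain C where C: "\<And>i. C i \<in> null_sets M" "\<And>i. f i = emeasure N (C i)" by metis
  define B where "B = (\<Union>i. C i)"
  have B: "B \<in> null_sets M" unfolding B_def using C by auto
  have [measurable]: "B \<in> sets M" using B by auto
  \<comment> \<open>The countable union of a maximizing sequence is null and attains the
    supremum.\<close>
  have cB: "c \<le> emeasure N B"
    unfolding f(2) C(2) B_def by (intro SUP_least emeasure_mono) (use C sets_eq in auto)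
  define A where "A = density N (indicator (space M - B))"
  define S where "S = density N (indicator B)"
  have eA: "emeasure A E = emeasure N ((space M - B) \<inter> E)" if "E \<in> sets M" for E
    unfolding A_def using that by (subst emeasure_density) (auto simp: indicator_inter_arith[symmetric] sets_eq intro!: nn_integral_indicator)
  have eS: "emeasure S E = emeasure N (B \<inter> E)" if "E \<in> sets M" for E
    unfolding S_def using that by (subst emeasure_density) (auto simp: indicator_inter_arith[symmetric] sets_eq intro!: nn_integral_indicator)
  have ac: "absolutely_continuous M A"
    unfolding absolutely_continuous_def
  proof
    fix E assume E: "E \<in> null_sets M"
    then have [measurable]: "E \<in> sets M" by auto
    \<comment> \<open>A null set E meeting the complement of B in positive N-measure would enlarge B
      beyond the maximum; finiteness of N permits the cancellation.\<close>
    have "emeasure N B + emeasure N ((space M - B) \<inter> E) = emeasure N (B \<union> ((space M - B) \<inter> E))"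
      by (intro plus_emeasure) (auto simp: sets_eq)
    also have "\<dots> \<le> c" unfolding c_def using B E by (intro SUP_upper) (auto intro!: null_sets.Un null_set_Int1)
    also have "\<dots> \<le> emeasure N B + 0" using cB by simp
    finally have "emeasure N ((space M - B) \<inter> E) = 0"
      using N.emeasure_finite[of B] by (metis add.right_neutral ennreal_add_left_cancel_le le_zero_eq infinity_ennreal_def)
    then show "E \<in> null_sets A" using eA[of E] E by (auto simp: null_sets_def A_def sets_eq)
  qed
  have S0: "emeasure S (space M - B) = 0" using eS[of "space M - B"] by (simp add: Diff_disjoint)
  have NAS: "emeasure N E = emeasure A E + emeasure S E" if [measurable]: "E \<in> sets M" for E
  proof -
    have "emeasure N ((space M - B) \<inter> E) + emeasure N (B \<inter> E) = emeasure N (((space M - B) \<inter> E) \<union> (B \<inter> E))"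
      by (intro plus_emeasure) (auto simp: sets_eq)
    also have "((space M - B) \<inter> E) \<union> (B \<inter> E) = E" using sets.sets_into_space[OF that] by auto
    finally show ?thesis using eA[OF that] eS[OF that] by simp
  qed
  have sA: "sets A = sets M" "sets S = sets M" unfolding A_def S_def sets_density by (rule sets_eq)+
  show ?thesis
    using sA ac S0 NAS B by blast
qed

lemma ac_density_measurable [measurable]: "ac_density M N \<in> borel_measurable M"
  unfolding ac_density_def by measurable

lemma ac_density_nonneg: "0 \<le> ac_density M N z"
  by (simp add: ac_density_def)

text \<open>Two losses make this an inequality: the singular part is dropped, and
  \<open>enn2real\<close> sends the value \<infinity> to 0. The existence of the decomposition
  justifies the choice made in \<open>ac_part\<close>.\<close>

lemma nn_integral_ac_density_le:
  assumes M: "finite_measure M" and N: "finite_measure N" and sets_eq: "sets N = sets M"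
    and [measurable]: "h \<in> borel_measurable M"
  shows "(\<integral>\<^sup>+x. h x * ennreal (ac_density M N x) \<partial>M) \<le> (\<integral>\<^sup>+x. h x \<partial>N)"
proof -
  interpret M: finite_measure M by (rule M)
  let ?A = "ac_part M N"
  from someI_ex[OF Lebesgue_decomposition_exists[OF N sets_eq]]
  have A: "sets ?A = sets M" "absolutely_continuous M ?A"
    and S: "\<exists>S. sets S = sets M \<and> (\<exists>B\<in>null_sets M. emeasure S (space M - B) = 0) \<and>
          (\<forall>E\<in>sets M. emeasure N E = emeasure ?A E + emeasure S E)"
    unfolding ac_part_def by blast+
  have le: "?A \<le> N"
    using S A(1) sets_eq by (subst le_measure) auto
  have "(\<integral>\<^sup>+x. h x * ennreal (ac_density M N x) \<partial>M) \<le> (\<integral>\<^sup>+x. RN_deriv M ?A x * h x \<partial>M)"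
    unfolding ac_density_def by (intro nn_integral_mono) (simp add: mult.commute mult_left_mono ennreal_enn2real_if)
  also have "\<dots> = (\<integral>\<^sup>+x. h x \<partial>?A)"
    by (subst M.RN_deriv_nn_integral[OF A(2) A(1)]) auto
  also have "\<dots> \<le> (\<integral>\<^sup>+x. h x \<partial>N)"
    by (rule nn_integral_mono_measure[OF _ le]) (use A(1) sets_eq in simp)
  finally show ?thesis .
qed

section \<open>The mixture model\<close>

locale mixture =
  fixes \<nu> :: "'x measure" and \<Theta> :: "'t measure" and f :: "'x \<Rightarrow> 't \<Rightarrow> real"
  assumes kernel: "(\<lambda>\<theta>. density \<nu> (\<lambda>x. ennreal (f x \<theta>))) \<in> \<Theta> \<rightarrow>\<^sub>M prob_algebra \<nu>"
begin

text \<open>A version of the conditional mean of h given \<theta>. It depends on the kernel and not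
  on G, which is what lets laws with different mixing distributions be compared.\<close>

definition K :: "('x \<times> 't \<Rightarrow> ennreal) \<Rightarrow> 't \<Rightarrow> ennreal" where
  "K h \<theta> = (\<integral>\<^sup>+x. h (x, \<theta>) \<partial>density \<nu> (\<lambda>x. ennreal (f x \<theta>)))"

lemma K_measurable:
  assumes "h \<in> borel_measurable (\<nu> \<Otimes>\<^sub>M \<Theta>)"
  shows "K h \<in> borel_measurable \<Theta>"
  unfolding K_def[abs_def]
proof (rule nn_integral_measurable_subprob_algebra2[OF _ measurable_prob_algebraD[OF kernel]])
  note [measurable] = assms
  show "(\<lambda>(\<theta>, x). h (x, \<theta>)) \<in> borel_measurable (\<Theta> \<Otimes>\<^sub>M \<nu>)" by measurable
qed

context
  fixes G :: "'t measure"
  assumes sets_G: "sets G = sets \<Theta>" and G: "prob_space G"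
begin

lemma kernel_G: "(\<lambda>\<theta>. density \<nu> (\<lambda>x. ennreal (f x \<theta>))) \<in> G \<rightarrow>\<^sub>M prob_algebra \<nu>"
  using kernel measurable_cong_sets[OF sets_G refl] by auto

lemma pair_kernel: "(\<lambda>\<theta>. distr (density \<nu> (\<lambda>x. ennreal (f x \<theta>))) (\<nu> \<Otimes>\<^sub>M G) (\<lambda>x. (x, \<theta>))) \<in> G \<rightarrow>\<^sub>M subprob_algebra (\<nu> \<Otimes>\<^sub>M G)"
  by (rule measurable_distr2[OF _ measurable_prob_algebraD[OF kernel_G]]) measurable

lemma sets_joint_law: "sets (joint_law \<nu> f G) = sets (\<nu> \<Otimes>\<^sub>M \<Theta>)"
proof -
  have "space G \<noteq> {}" using G by (rule prob_space.not_empty)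
  then have "sets (joint_law \<nu> f G) = sets (\<nu> \<Otimes>\<^sub>M G)"
    unfolding joint_law_def by (intro sets_bind) auto
  then show ?thesis using sets_pair_measure_cong[OF refl sets_G] by simp
qed

lemma prob_density: "\<theta> \<in> space G \<Longrightarrow> prob_space (density \<nu> (\<lambda>x. ennreal (f x \<theta>)))"
  using measurable_space[OF kernel_G] by (auto simp: space_prob_algebra)

lemma nn_integral_joint_law:
  assumes "h \<in> borel_measurable (\<nu> \<Otimes>\<^sub>M \<Theta>)"
  shows "(\<integral>\<^sup>+z. h z \<partial>joint_law \<nu> f G) = (\<integral>\<^sup>+\<theta>. K h \<theta> \<partial>G)"
proof -
  have [measurable]: "h \<in> borel_measurable (\<nu> \<Otimes>\<^sub>M G)"
    using assms measurable_cong_sets[OF sets_pair_measure_cong[OF refl sets_G] refl] by auto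
  have "(\<integral>\<^sup>+z. h z \<partial>joint_law \<nu> f G) = (\<integral>\<^sup>+\<theta>. \<integral>\<^sup>+z. h z \<partial>distr (density \<nu> (\<lambda>x. ennreal (f x \<theta>))) (\<nu> \<Otimes>\<^sub>M G) (\<lambda>x. (x, \<theta>)) \<partial>G)"
    unfolding joint_law_def by (rule nn_integral_bind[OF _ pair_kernel]) measurable
  also have "\<dots> = (\<integral>\<^sup>+\<theta>. K h \<theta> \<partial>G)"
    by (intro nn_integral_cong) (simp add: nn_integral_distr K_def)
  finally show ?thesis .
qed

lemma fst_measurable: "fst \<in> joint_law \<nu> f G \<rightarrow>\<^sub>M \<nu>"
  using measurable_fst measurable_cong_sets[OF sets_joint_law refl] by blast

lemma snd_measurable: "snd \<in> joint_law \<nu> f G \<rightarrow>\<^sub>M G"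
  using measurable_snd measurable_cong_sets[OF sets_joint_law sets_G] by blast

lemma K_snd: "\<theta> \<in> space G \<Longrightarrow> K (\<lambda>z. g (snd z)) \<theta> = g \<theta>"
  unfolding K_def using prob_space.emeasure_space_1[OF prob_density[of \<theta>]] by simp

lemma prob_space_joint_law: "prob_space (joint_law \<nu> f G)"
proof (rule prob_spaceI)
  have "emeasure (joint_law \<nu> f G) (space (joint_law \<nu> f G)) = (\<integral>\<^sup>+z. 1 \<partial>joint_law \<nu> f G)" by simp
  also have "\<dots> = (\<integral>\<^sup>+\<theta>. K (\<lambda>_. 1) \<theta> \<partial>G)" by (rule nn_integral_joint_law) simp
  also have "\<dots> = (\<integral>\<^sup>+\<theta>. 1 \<partial>G)" using K_snd[of _ "\<lambda>_. 1"] by (intro nn_integral_cong) simp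
  also have "\<dots> = 1" using prob_space.emeasure_space_1[OF G] by simp
  finally show "emeasure (joint_law \<nu> f G) (space (joint_law \<nu> f G)) = 1" .
qed

lemma distr_snd: "distr (joint_law \<nu> f G) G snd = G"
proof (rule measure_eqI)
  fix A assume "A \<in> sets (distr (joint_law \<nu> f G) G snd)"
  then have [measurable]: "A \<in> sets G" by simp
  then have [measurable]: "A \<in> sets \<Theta>" using sets_G by simp
  note [measurable] = snd_measurable
  have "emeasure (distr (joint_law \<nu> f G) G snd) A = (\<integral>\<^sup>+\<theta>. indicator A \<theta> \<partial>distr (joint_law \<nu> f G) G snd)" by simp
  also have "\<dots> = (\<integral>\<^sup>+z. indicator A (snd z) \<partial>joint_law \<nu> f G)" by (subst nn_integral_distr) measurable
  also have "\<dots> = (\<integral>\<^sup>+\<theta>. K (\<lambda>z. indicator A (snd z)) \<theta> \<partial>G)" by (rule nn_integral_joint_law) measurable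
  also have "\<dots> = (\<integral>\<^sup>+\<theta>. indicator A \<theta> \<partial>G)" by (intro nn_integral_cong K_snd)
  finally show "emeasure (distr (joint_law \<nu> f G) G snd) A = emeasure G A" by simp
qed simp

lemma integral_joint_law_snd:
  fixes g :: "'t \<Rightarrow> 'b::{banach,second_countable_topology}"
  assumes "g \<in> borel_measurable \<Theta>"
  shows "(\<integral>z. g (snd z) \<partial>joint_law \<nu> f G) = (\<integral>\<theta>. g \<theta> \<partial>G)"
    and "integrable (joint_law \<nu> f G) (\<lambda>z. g (snd z)) \<longleftrightarrow> integrable G g"
proof -
  have g: "g \<in> borel_measurable G" using assms measurable_cong_sets[OF sets_G refl] by auto
  show "(\<integral>z. g (snd z) \<partial>joint_law \<nu> f G) = (\<integral>\<theta>. g \<theta> \<partial>G)"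
    using integral_distr[OF snd_measurable g] unfolding distr_snd by simp
  show "integrable (joint_law \<nu> f G) (\<lambda>z. g (snd z)) \<longleftrightarrow> integrable G g"
    using integrable_distr_eq[OF snd_measurable g] unfolding distr_snd by simp
qed

end

text \<open>The kernel is shared, so joint laws compare as their mixing laws do at \<theta>: after
  integration over x the weight comes out of the inner integral, and the domination for G
  applies.\<close>

lemma joint_law_subdensity:
  assumes sets_G: "sets G = sets \<Theta>" and G: "prob_space G" and sets_G': "sets G' = sets \<Theta>" and G': "prob_space G'"
    and h: "h \<in> borel_measurable (joint_law \<nu> f G)"
  shows "(\<integral>\<^sup>+z. h z * ennreal (ac_density G G' (snd z)) \<partial>joint_law \<nu> f G) \<le> (\<integral>\<^sup>+z. h z \<partial>joint_law \<nu> f G')"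
proof -
  let ?q = "ac_density G G'"
  have hm [measurable]: "h \<in> borel_measurable (\<nu> \<Otimes>\<^sub>M \<Theta>)"
    using h measurable_cong_sets[OF sets_joint_law[OF sets_G G] refl] by auto
  have [measurable]: "?q \<in> borel_measurable \<Theta>"
    using ac_density_measurable[of G G'] unfolding measurable_cong_sets[OF sets_G refl] .
  have "(\<integral>\<^sup>+z. h z * ennreal (?q (snd z)) \<partial>joint_law \<nu> f G) = (\<integral>\<^sup>+\<theta>. K (\<lambda>z. h z * ennreal (?q (snd z))) \<theta> \<partial>G)"
    by (rule nn_integral_joint_law[OF sets_G G]) measurable
  also have "\<dots> = (\<integral>\<^sup>+\<theta>. K h \<theta> * ennreal (?q \<theta>) \<partial>G)"
  proof (rule nn_integral_cong)
    fix \<theta> assume "\<theta> \<in> space G"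
    then have "\<theta> \<in> space \<Theta>" using sets_eq_imp_space_eq[OF sets_G] by simp
    then have "(\<lambda>x. h (x, \<theta>)) \<in> borel_measurable \<nu>" by (rule measurable_compose[OF measurable_Pair2' hm])
    then show "K (\<lambda>z. h z * ennreal (?q (snd z))) \<theta> = K h \<theta> * ennreal (?q \<theta>)"
      unfolding K_def by (simp add: nn_integral_multc)
  qed
  also have "\<dots> \<le> (\<integral>\<^sup>+\<theta>. K h \<theta> \<partial>G')"
    using K_measurable[OF hm] measurable_cong_sets[OF sets_G refl] sets_G sets_G'
    by (intro nn_integral_ac_density_le prob_space.finite_measure G G') auto
  also have "\<dots> = (\<integral>\<^sup>+z. h z \<partial>joint_law \<nu> f G')" by (rule nn_integral_joint_law[OF sets_G' G' hm, symmetric])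
  finally show ?thesis .
qed

end

section \<open>Conditional expectations given the observation\<close>

locale cond_exp_X = prob_space Q for Q :: "('x \<times> 't) measure" +
  fixes \<nu> :: "'x measure" and h :: "'x \<times> 't \<Rightarrow> real" and r :: "'x \<Rightarrow> real"
  assumes fst [measurable]: "fst \<in> Q \<rightarrow>\<^sub>M \<nu>" and ce: "is_cond_exp_X \<nu> Q h r"
begin

lemma h_integrable: "integrable Q h" and r_measurable [measurable]: "r \<in> borel_measurable \<nu>"
  and AE_eq: "AE z in Q. r (fst z) = real_cond_exp Q (vimage_algebra (space Q) fst \<nu>) h z"
  using ce by (auto simp: is_cond_exp_X_def)

lemma sub: "finite_measure_subalgebra Q (vimage_algebra (space Q) fst \<nu>)"
proof (unfold_locales)
  show "subalgebra Q (vimage_algebra (space Q) fst \<nu>)"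
    unfolding subalgebra_def using sets_image_in_sets[OF refl fst] by simp
qed

lemma integral_mult:
  assumes b: "\<beta> \<in> borel_measurable \<nu>" and i: "integrable Q (\<lambda>z. \<beta> (fst z) * h z)"
  shows "integrable Q (\<lambda>z. \<beta> (fst z) * r (fst z))" "(\<integral>z. \<beta> (fst z) * r (fst z) \<partial>Q) = (\<integral>z. \<beta> (fst z) * h z \<partial>Q)"
proof -
  interpret S: finite_measure_subalgebra Q "vimage_algebra (space Q) fst \<nu>" by (rule sub)
  note [measurable] = b
  have [measurable]: "h \<in> borel_measurable Q" using h_integrable by auto
  have "fst \<in> vimage_algebra (space Q) fst \<nu> \<rightarrow>\<^sub>M \<nu>"
    using measurable_space[OF fst] by (intro measurable_vimage_algebra1) auto
  from measurable_compose[OF this b] have bF: "(\<lambda>z. \<beta> (fst z)) \<in> borel_measurable (vimage_algebra (space Q) fst \<nu>)" .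
  let ?c = "real_cond_exp Q (vimage_algebra (space Q) fst \<nu>) h"
  have 1: "integrable Q (\<lambda>z. \<beta> (fst z) * ?c z)" "(\<integral>z. \<beta> (fst z) * ?c z \<partial>Q) = (\<integral>z. \<beta> (fst z) * h z \<partial>Q)"
    using S.real_cond_exp_intg[OF i bF] by auto
  have ae: "AE z in Q. \<beta> (fst z) * ?c z = \<beta> (fst z) * r (fst z)" using AE_eq by eventually_elim simp
  show "integrable Q (\<lambda>z. \<beta> (fst z) * r (fst z))"
    by (rule integrable_cong_AE_imp[OF 1(1) _ ae]) measurable
  show "(\<integral>z. \<beta> (fst z) * r (fst z) \<partial>Q) = (\<integral>z. \<beta> (fst z) * h z \<partial>Q)"
    unfolding 1(2)[symmetric] by (rule integral_cong_AE[OF _ _ ae, symmetric]) measurable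
qed

lemma integral_r: "(\<integral>z. r (fst z) \<partial>Q) = (\<integral>z. h z \<partial>Q)"
  using integral_mult[of "\<lambda>_. 1"] h_integrable by auto

text \<open>Jensen's inequality for the square, moved from the conditional expectation to its
  version r along the almost everywhere equality.\<close>

lemma sq_integrable_r:
  assumes "sq_integrable Q h"
  shows "sq_integrable Q (\<lambda>z. r (fst z))"
proof -
  interpret S: finite_measure_subalgebra Q "vimage_algebra (space Q) fst \<nu>" by (rule sub)
  let ?c = "real_cond_exp Q (vimage_algebra (space Q) fst \<nu>) h"
  have I: "integrable Q (\<lambda>z. (?c z)\<^sup>2)"
    using assms
    by (intro S.integrable_convex_cond_exp[where I=UNIV and q="\<lambda>x. x\<^sup>2"] h_integrable)
       (auto simp: sq_integrable_def convex_power2)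
  have ae: "AE z in Q. (?c z)\<^sup>2 = (r (fst z))\<^sup>2" using AE_eq by eventually_elim simp
  have "integrable Q (\<lambda>z. (r (fst z))\<^sup>2)"
    by (rule integrable_cong_AE_imp[OF I _ ae]) measurable
  then show ?thesis by (simp add: sq_integrable_def)
qed

lemma integral_mult_sq:
  assumes "sq_integrable Q h" "\<beta> \<in> borel_measurable \<nu>" "sq_integrable Q (\<lambda>z. \<beta> (fst z))"
  shows "(\<integral>z. \<beta> (fst z) * r (fst z) \<partial>Q) = (\<integral>z. \<beta> (fst z) * h z \<partial>Q)"
  by (intro integral_mult(2) assms sq_integrable_mult_integrable)

text \<open>By the projection property, the nonnegative quantity E (h - r)^2 equals E h^2 - E
  r^2.\<close>

lemma second_moment_le:
  assumes h: "sq_integrable Q h"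
  shows "(\<integral>z. (r (fst z))\<^sup>2 \<partial>Q) \<le> (\<integral>z. (h z)\<^sup>2 \<partial>Q)"
proof -
  note r = sq_integrable_r[OF h]
  have "0 \<le> (\<integral>z. (h z - r (fst z))\<^sup>2 \<partial>Q)" by simp
  also have "\<dots> = (\<integral>z. (h z)\<^sup>2 - 2 * (r (fst z) * h z) + (r (fst z))\<^sup>2 \<partial>Q)"
    by (simp add: power2_diff algebra_simps)
  also have "\<dots> = (\<integral>z. (h z)\<^sup>2 \<partial>Q) - 2 * (\<integral>z. r (fst z) * h z \<partial>Q) + (\<integral>z. (r (fst z))\<^sup>2 \<partial>Q)"
    using h r sq_integrable_mult_integrable[OF r h] by (simp add: sq_integrable_def)
  also have "(\<integral>z. r (fst z) * h z \<partial>Q) = (\<integral>z. (r (fst z))\<^sup>2 \<partial>Q)"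
    using integral_mult_sq[OF h r_measurable r] by (simp add: power2_eq_square)
  finally show ?thesis by simp
qed

end

section \<open>Weak convergence to normal laws\<close>

text \<open>For small n the point \<tau> + a / \<surd>n may leave the parameter set, and the
  alternative is then replaced by an artificial law; weak limits must not notice this.\<close>

lemma weak_conv_m_eventually_cong:
  assumes "weak_conv_m M L" and "\<forall>\<^sub>F n in sequentially. M n = M' n"
  shows "weak_conv_m M' L"
  unfolding weak_conv_m_def weak_conv_def
proof (intro allI impI)
  fix x assume "isCont (cdf L) x"
  then have "(\<lambda>n. cdf (M n) x) \<longlonglongrightarrow> cdf L x" using assms(1) by (auto simp: weak_conv_m_def weak_conv_def)
  then show "(\<lambda>n. cdf (M' n) x) \<longlonglongrightarrow> cdf L x"
    by (rule Lim_transform_eventually) (use assms(2) in \<open>auto elim!: eventually_mono\<close>)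
qed

lemma real_distribution_centered_normal: "real_distribution (centered_normal v)"
proof -
  interpret S: prob_space std_normal_distribution by (rule prob_space_normal_density) simp
  show ?thesis unfolding centered_normal_def
    by (intro S.real_distribution_distr) measurable
qed

lemma char_centered_normal:
  assumes "0 \<le> v" shows "char (centered_normal v) t = exp (- complex_of_real (t\<^sup>2 * v / 2))"
proof -
  have "char (centered_normal v) t = (\<integral>x. iexp (t * (sqrt v * x)) \<partial>std_normal_distribution)"
    unfolding centered_normal_def char_def by (subst integral_distr) measurable
  also have "\<dots> = char std_normal_distribution (t * sqrt v)" by (simp add: char_def mult.assoc)
  also have "\<dots> = complex_of_real (exp (- (t * sqrt v)\<^sup>2 / 2))" by (simp only: char_std_normal_distribution)
  also have "- (t * sqrt v)\<^sup>2 / 2 = - (t\<^sup>2 * v / 2)" using assms by (simp add: power_mult_distrib)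
  also have "complex_of_real (exp (- (t\<^sup>2 * v / 2))) = exp (- complex_of_real (t\<^sup>2 * v / 2))"
    by (simp only: exp_of_real[symmetric] of_real_minus)
  finally show ?thesis .
qed

lemma centered_normal_moments:
  assumes "0 \<le> v"
  shows "integrable (centered_normal v) (\<lambda>x. x\<^sup>2)" "(\<integral>x. x\<^sup>2 \<partial>centered_normal v) = v" "(\<integral>x. x \<partial>centered_normal v) = 0"
proof -
  have m2: "integrable std_normal_distribution (\<lambda>x. x\<^sup>2)" "(\<integral>x. x\<^sup>2 \<partial>std_normal_distribution) = 1"
    using std_normal_distribution_even_moments[of 1] by simp_all
  have m1: "(\<integral>x. x \<partial>std_normal_distribution) = 0"
    using integral_std_normal_distribution_moment_odd[of 1] by simp
  show "integrable (centered_normal v) (\<lambda>x. x\<^sup>2)"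
    unfolding centered_normal_def by (subst integrable_distr_eq) (auto simp: power_mult_distrib m2)
  have "(\<integral>x. x\<^sup>2 \<partial>centered_normal v) = (\<integral>x. (sqrt v * x)\<^sup>2 \<partial>std_normal_distribution)"
    unfolding centered_normal_def by (subst integral_distr) auto
  also have "\<dots> = v" using assms m2 by (simp add: power_mult_distrib)
  finally show "(\<integral>x. x\<^sup>2 \<partial>centered_normal v) = v" .
  have "(\<integral>x. x \<partial>centered_normal v) = (\<integral>x. sqrt v * x \<partial>std_normal_distribution)"
    unfolding centered_normal_def by (subst integral_distr) auto
  also have "\<dots> = 0" using m1 by simp
  finally show "(\<integral>x. x \<partial>centered_normal v) = 0" .
qed

lemma variance_of_centered_normal: "0 \<le> v \<Longrightarrow> variance_of_law (centered_normal v) = ennreal v"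
  by (simp add: variance_of_law_def centered_normal_moments)

lemma nn_second_moment_centered_normal:
  assumes "0 \<le> v" shows "(\<integral>\<^sup>+x. ennreal (x\<^sup>2) \<partial>centered_normal v) = ennreal v"
  using nn_integral_eq_integral[OF centered_normal_moments(1)[OF assms]] centered_normal_moments(2)[OF assms] by simp

lemma weak_limit_unique:
  assumes "\<And>n. real_distribution (M n)" "real_distribution L" "real_distribution L'"
    "weak_conv_m M L" "weak_conv_m M L'"
  shows "L = L'"
proof (rule Levy_uniqueness[OF assms(2,3)])
  show "char L = char L'"
    using LIMSEQ_unique[OF levy_continuity1[OF assms(1,2,4)] levy_continuity1[OF assms(1,3,5)]] by blast
qed

section \<open>Differentiability in quadratic mean\<close>

locale dqm_mixture = mixture \<nu> \<Theta> f
  for \<nu> :: "'x measure" and \<Theta> :: "'t measure" and f :: "'x \<Rightarrow> 't \<Rightarrow> real" +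
  fixes \<T> :: "(real ^ 'd) set" and G :: "real ^ 'd \<Rightarrow> 't measure" and rhot :: "real ^ 'd \<Rightarrow> 't \<Rightarrow> real ^ 'd"
  assumes open_T: "open \<T>"
    and sets_G: "\<And>\<tau>. \<tau> \<in> \<T> \<Longrightarrow> sets (G \<tau>) = sets \<Theta>"
    and prob_G: "\<And>\<tau>. \<tau> \<in> \<T> \<Longrightarrow> prob_space (G \<tau>)"
    and rhot_measurable: "\<And>\<tau>. \<tau> \<in> \<T> \<Longrightarrow> rhot \<tau> \<in> borel_measurable \<Theta>"
    and dqm_integrable: "\<And>\<tau>. \<tau> \<in> \<T> \<Longrightarrow> \<forall>\<^sub>F \<Delta> in at 0. integrable (G \<tau>)
           (\<lambda>\<theta>. (sqrt (ac_density (G \<tau>) (G (\<tau> + \<Delta>)) \<theta>) - 1 - \<Delta> \<bullet> rhot \<tau> \<theta> / 2)\<^sup>2)"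
    and dqm: "\<And>\<tau>. \<tau> \<in> \<T> \<Longrightarrow>
           (\<lambda>\<Delta>. \<integral>\<theta>. (sqrt (ac_density (G \<tau>) (G (\<tau> + \<Delta>)) \<theta>) - 1 - \<Delta> \<bullet> rhot \<tau> \<theta> / 2)\<^sup>2 \<partial>G \<tau>)
             \<in> o[at 0](\<lambda>\<Delta>. (norm \<Delta>)\<^sup>2)"
    and dqm_mass: "\<And>\<tau>. \<tau> \<in> \<T> \<Longrightarrow>
           (\<lambda>\<Delta>. (\<integral>\<theta>. ac_density (G \<tau>) (G (\<tau> + \<Delta>)) \<theta> \<partial>G \<tau>) - 1) \<in> o[at 0](\<lambda>\<Delta>. (norm \<Delta>)\<^sup>2)"
begin

abbreviation P :: "real ^ 'd \<Rightarrow> ('x \<times> 't) measure" where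
  "P \<tau> \<equiv> joint_law \<nu> f (G \<tau>)"

definition qd :: "real ^ 'd \<Rightarrow> real ^ 'd \<Rightarrow> 't \<Rightarrow> real" where
  "qd \<tau> \<Delta> = ac_density (G \<tau>) (G (\<tau> + \<Delta>))"

definition rem :: "real ^ 'd \<Rightarrow> real ^ 'd \<Rightarrow> 't \<Rightarrow> real" where
  "rem \<tau> \<Delta> \<theta> = sqrt (qd \<tau> \<Delta> \<theta>) - 1 - \<Delta> \<bullet> rhot \<tau> \<theta> / 2"

text \<open>The integrability clause matters because the integral of a function that is not
  integrable is 0 by convention, so smallness of the integral alone would say nothing.\<close>

definition near :: "real ^ 'd \<Rightarrow> real ^ 'd \<Rightarrow> bool" where
  "near \<tau> \<Delta> \<longleftrightarrow> \<tau> + \<Delta> \<in> \<T> \<and> integrable (G \<tau>) (\<lambda>\<theta>. (rem \<tau> \<Delta> \<theta>)\<^sup>2)"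

lemma qd_nonneg: "0 \<le> qd \<tau> \<Delta> \<theta>"
  by (simp add: qd_def ac_density_nonneg)

context
  fixes \<tau> :: "real ^ 'd" assumes \<tau>: "\<tau> \<in> \<T>"
begin

lemma prob_space_P: "prob_space (P \<tau>)" and sets_P: "sets (P \<tau>) = sets (\<nu> \<Otimes>\<^sub>M \<Theta>)"
  and fst_P: "fst \<in> P \<tau> \<rightarrow>\<^sub>M \<nu>" and snd_P: "snd \<in> P \<tau> \<rightarrow>\<^sub>M \<Theta>"
  using prob_space_joint_law[OF sets_G[OF \<tau>] prob_G[OF \<tau>]] sets_joint_law[OF sets_G[OF \<tau>] prob_G[OF \<tau>]]
    fst_measurable[OF sets_G[OF \<tau>] prob_G[OF \<tau>]] snd_measurable[OF sets_G[OF \<tau>] prob_G[OF \<tau>]]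
  unfolding measurable_cong_sets[OF refl sets_G[OF \<tau>]] by blast+

lemma G_measurable: "g \<in> borel_measurable (G \<tau>) \<longleftrightarrow> g \<in> borel_measurable \<Theta>"
  using measurable_cong_sets[OF sets_G[OF \<tau>] refl] by blast

lemma qd_measurable [measurable]: "qd \<tau> \<Delta> \<in> borel_measurable (G \<tau>)"
  unfolding qd_def by measurable

lemma rhot_G [measurable]: "rhot \<tau> \<in> borel_measurable (G \<tau>)"
  using rhot_measurable[OF \<tau>] G_measurable measurable_cong_sets[OF sets_G[OF \<tau>] refl] by blast

lemma rem_measurable [measurable]: "rem \<tau> \<Delta> \<in> borel_measurable (G \<tau>)"
  unfolding rem_def by measurable

lemma eventually_near: "\<forall>\<^sub>F \<Delta> in at 0. near \<tau> \<Delta>"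
proof -
  have "((\<lambda>\<Delta>. \<tau> + \<Delta>) \<longlongrightarrow> \<tau> + 0) (at 0)" by (intro tendsto_intros)
  then have "\<forall>\<^sub>F \<Delta> in at 0. \<tau> + \<Delta> \<in> \<T>" using topological_tendstoD[OF _ open_T, of "\<lambda>\<Delta>. \<tau> + \<Delta>"] \<tau> by auto
  then show ?thesis using dqm_integrable[OF \<tau>] by eventually_elim (simp add: near_def rem_def qd_def)
qed

text \<open>The subdensity has mass at most 1, hence its root is square integrable; so is the score
  in direction \<Delta>, being 2 (sqrt q - 1 - rem).\<close>

lemma near_facts:
  assumes n: "near \<tau> \<Delta>"
  shows "sq_integrable (G \<tau>) (rem \<tau> \<Delta>)" "integrable (G \<tau>) (qd \<tau> \<Delta>)" "(\<integral>\<theta>. qd \<tau> \<Delta> \<theta> \<partial>G \<tau>) \<le> 1"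
    "sq_integrable (G \<tau>) (\<lambda>\<theta>. sqrt (qd \<tau> \<Delta> \<theta>))" "sq_integrable (G \<tau>) (\<lambda>\<theta>. \<Delta> \<bullet> rhot \<tau> \<theta>)"
    "\<tau> + \<Delta> \<in> \<T>"
proof -
  interpret prob_space "G \<tau>" by (rule prob_G[OF \<tau>])
  show T: "\<tau> + \<Delta> \<in> \<T>" using n by (simp add: near_def)
  show r: "sq_integrable (G \<tau>) (rem \<tau> \<Delta>)" using n by (simp add: near_def sq_integrable_def)
  have "(\<integral>\<^sup>+\<theta>. 1 * ennreal (qd \<tau> \<Delta> \<theta>) \<partial>G \<tau>) \<le> (\<integral>\<^sup>+\<theta>. 1 \<partial>G (\<tau> + \<Delta>))"
    unfolding qd_def using sets_G[OF \<tau>] sets_G[OF T]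
    by (intro nn_integral_ac_density_le prob_space.finite_measure prob_G \<tau> T) auto
  also have "\<dots> = 1" using prob_space.emeasure_space_1[OF prob_G[OF T]] by simp
  finally have le: "(\<integral>\<^sup>+\<theta>. ennreal (qd \<tau> \<Delta> \<theta>) \<partial>G \<tau>) \<le> 1" by simp
  show i: "integrable (G \<tau>) (qd \<tau> \<Delta>)"
    using le qd_nonneg by (intro integrableI_bounded) (auto simp: less_top[symmetric] top_unique)
  show "(\<integral>\<theta>. qd \<tau> \<Delta> \<theta> \<partial>G \<tau>) \<le> 1"
    using le nn_integral_eq_integral[OF i] qd_nonneg by simp
  show s: "sq_integrable (G \<tau>) (\<lambda>\<theta>. sqrt (qd \<tau> \<Delta> \<theta>))" using i qd_nonneg by (simp add: sq_integrable_def)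
  have "sq_integrable (G \<tau>) (\<lambda>\<theta>. 2 * (sqrt (qd \<tau> \<Delta> \<theta>) - 1 - rem \<tau> \<Delta> \<theta>))"
    by (intro sq_integrable_cmult sq_integrable_diff s r sq_integrable_const)
  then show "sq_integrable (G \<tau>) (\<lambda>\<theta>. \<Delta> \<bullet> rhot \<tau> \<theta>)" by (simp add: rem_def)
qed

lemma filterlim_scaled_direction:
  assumes "v \<noteq> 0" shows "filterlim (\<lambda>n. v /\<^sub>R sqrt (real n)) (at (0 :: real ^ 'd)) sequentially"
proof (rule filterlim_atI)
  have "(\<lambda>n. inverse (sqrt (real n))) \<longlonglongrightarrow> 0"
    by (intro tendsto_inverse_0_at_top filterlim_compose[OF sqrt_at_top] filterlim_real_sequentially)
  then have "(\<lambda>n. inverse (sqrt (real n)) *\<^sub>R v) \<longlonglongrightarrow> 0 *\<^sub>R v" by (intro tendsto_intros)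
  then show "(\<lambda>n. v /\<^sub>R sqrt (real n)) \<longlonglongrightarrow> 0" by simp
  show "\<forall>\<^sub>F n in sequentially. v /\<^sub>R sqrt (real n) \<noteq> 0"
    using eventually_gt_at_top[of 0] by eventually_elim (use assms in simp)
qed

text \<open>Along \<Delta> = v / \<surd>n the squared norm is a multiple of 1/n. The case v = 0 is
  excluded because the filter \<open>at 0\<close> ignores the origin.\<close>

lemma small_o_along_direction:
  assumes v: "v \<noteq> 0" and h: "h \<in> o[at 0](\<lambda>\<Delta> :: real ^ 'd. (norm \<Delta>)\<^sup>2)"
  shows "(\<lambda>n. real n * h (v /\<^sub>R sqrt (real n))) \<longlonglongrightarrow> (0::real)"
proof -
  have "((\<lambda>\<Delta>. h \<Delta> / (norm \<Delta>)\<^sup>2) \<longlongrightarrow> 0) (at 0)"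
    using smalloD_tendsto[OF h] .
  then have "(\<lambda>n. h (v /\<^sub>R sqrt (real n)) / (norm (v /\<^sub>R sqrt (real n)))\<^sup>2) \<longlonglongrightarrow> 0"
    by (rule filterlim_compose[OF _ filterlim_scaled_direction[OF v]])
  then have "(\<lambda>n. (norm v)\<^sup>2 * (h (v /\<^sub>R sqrt (real n)) / (norm (v /\<^sub>R sqrt (real n)))\<^sup>2)) \<longlonglongrightarrow> 0"
    by (rule tendsto_mult_right_zero)
  moreover have "\<forall>\<^sub>F n in sequentially. (norm v)\<^sup>2 * (h (v /\<^sub>R sqrt (real n)) / (norm (v /\<^sub>R sqrt (real n)))\<^sup>2) = real n * h (v /\<^sub>R sqrt (real n))"
    using eventually_gt_at_top[of 0]
    by eventually_elim (use v in \<open>simp add: power_mult_distrib power_inverse field_simps\<close>)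
  ultimately show ?thesis by (rule Lim_transform_eventually)
qed

lemma rem_small_o: "(\<lambda>\<Delta>. \<integral>\<theta>. (rem \<tau> \<Delta> \<theta>)\<^sup>2 \<partial>G \<tau>) \<in> o[at 0](\<lambda>\<Delta>. (norm \<Delta>)\<^sup>2)"
  and mass_small_o: "(\<lambda>\<Delta>. (\<integral>\<theta>. qd \<tau> \<Delta> \<theta> \<partial>G \<tau>) - 1) \<in> o[at 0](\<lambda>\<Delta>. (norm \<Delta>)\<^sup>2)"
  using dqm[OF \<tau>] dqm_mass[OF \<tau>] by (simp_all add: rem_def[abs_def] qd_def)

text \<open>Square integrability is known for short directions by \<open>near_facts\<close> and
  scales to all others.\<close>

lemma sq_integrable_score: "sq_integrable (G \<tau>) (\<lambda>\<theta>. v \<bullet> rhot \<tau> \<theta>)"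
proof (cases "v = 0")
  case True
  then show ?thesis by (simp add: sq_integrable_def)
next
  case False
  have "\<forall>\<^sub>F n in sequentially. near \<tau> (v /\<^sub>R sqrt (real n)) \<and> n > 0"
    by (intro eventually_conj eventually_gt_at_top eventually_compose_filterlim[OF eventually_near filterlim_scaled_direction[OF False]])
  from eventually_happens[OF this] obtain n where n: "near \<tau> (v /\<^sub>R sqrt (real n))" "n > 0" by auto
  have "sq_integrable (G \<tau>) (\<lambda>\<theta>. sqrt (real n) * ((v /\<^sub>R sqrt (real n)) \<bullet> rhot \<tau> \<theta>))"
    by (intro sq_integrable_cmult near_facts(5)[OF n(1)])
  then show ?thesis using n(2) by (simp add: mult.assoc[symmetric])
qed

text \<open>Squaring sqrt q = 1 + l / 2 + rem gives q - 1 = l + 2 rem + (l / 2 + rem)^2 with l the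
  score along v / \<surd>n. Integrating and multiplying by \<surd>n isolates the mean of the score;
  the mass defect, the remainder and the square each contribute a term tending to 0.\<close>

lemma score_mean_zero: "(\<integral>\<theta>. v \<bullet> rhot \<tau> \<theta> \<partial>G \<tau>) = 0"
proof (cases "v = 0")
  case False
  interpret prob_space "G \<tau>" by (rule prob_G[OF \<tau>])
  let ?D = "\<lambda>n. v /\<^sub>R sqrt (real n)"
  define R where "R n = (\<integral>\<theta>. (rem \<tau> (?D n) \<theta>)\<^sup>2 \<partial>G \<tau>)" for n
  define m where "m n = (\<integral>\<theta>. qd \<tau> (?D n) \<theta> \<partial>G \<tau>) - 1" for n
  define J where "J = (\<integral>\<theta>. (v \<bullet> rhot \<tau> \<theta>)\<^sup>2 \<partial>G \<tau>)"
  define E where "E = (\<integral>\<theta>. v \<bullet> rhot \<tau> \<theta> \<partial>G \<tau>)"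
  have R: "(\<lambda>n. real n * R n) \<longlonglongrightarrow> 0" unfolding R_def by (rule small_o_along_direction[OF False rem_small_o])
  have m: "(\<lambda>n. real n * m n) \<longlonglongrightarrow> 0" unfolding m_def by (rule small_o_along_direction[OF False mass_small_o])
  have inv: "(\<lambda>n. inverse (sqrt (real n))) \<longlonglongrightarrow> 0"
    by (intro tendsto_inverse_0_at_top filterlim_compose[OF sqrt_at_top] filterlim_real_sequentially)
  have "\<forall>\<^sub>F n in sequentially. near \<tau> (?D n)"
    by (rule eventually_compose_filterlim[OF eventually_near filterlim_scaled_direction[OF False]])
  then have ev: "\<forall>\<^sub>F n in sequentially. \<bar>E\<bar> \<le> \<bar>real n * m n\<bar> * inverse (sqrt (real n)) + 2 * sqrt (real n * R n)
      + (J / 2) * inverse (sqrt (real n)) + 2 * (real n * R n) * inverse (sqrt (real n))"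
    using eventually_gt_at_top[of 0]
  proof eventually_elim
    fix n :: nat assume near: "near \<tau> (?D n)" and n: "0 < n"
    let ?s = "sqrt (real n)"
    let ?l = "\<lambda>\<theta>. v \<bullet> rhot \<tau> \<theta> / ?s"
    note nf = near_facts[OF near]
    have sl: "sq_integrable (G \<tau>) ?l" using sq_integrable_cmult[OF sq_integrable_score, of "1 / ?s" v] by simp
    have sh: "sq_integrable (G \<tau>) (\<lambda>\<theta>. ?l \<theta> / 2 + rem \<tau> (?D n) \<theta>)"
      using sq_integrable_add[OF sq_integrable_cmult[OF sl, of "1/2"] nf(1)] by (simp add: mult.commute)
    have il: "integrable (G \<tau>) ?l" "integrable (G \<tau>) (rem \<tau> (?D n))" "integrable (G \<tau>) (\<lambda>\<theta>. (?l \<theta> / 2 + rem \<tau> (?D n) \<theta>)\<^sup>2)"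
      by (rule sq_integrable_integrable[OF sl], rule sq_integrable_integrable[OF nf(1)], rule conjunct2[OF sh[unfolded sq_integrable_real_iff]])
    have q: "qd \<tau> (?D n) \<theta> - 1 = ?l \<theta> + 2 * rem \<tau> (?D n) \<theta> + (?l \<theta> / 2 + rem \<tau> (?D n) \<theta>)\<^sup>2" for \<theta>
    proof -
      have "sqrt (qd \<tau> (?D n) \<theta>) = 1 + (?l \<theta> / 2 + rem \<tau> (?D n) \<theta>)" by (simp add: rem_def inverse_eq_divide)
      moreover have "qd \<tau> (?D n) \<theta> = (sqrt (qd \<tau> (?D n) \<theta>))\<^sup>2" using qd_nonneg by simp
      moreover have "(1 + (l / 2 + r))\<^sup>2 - 1 = l + 2 * r + (l / 2 + r)\<^sup>2" for l r :: real
        by (simp add: power2_eq_square algebra_simps)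
      ultimately show ?thesis by (simp only:)
    qed
    have "m n = (\<integral>\<theta>. qd \<tau> (?D n) \<theta> - 1 \<partial>G \<tau>)" unfolding m_def using nf(2) by (simp add: prob_space)
    also have "\<dots> = E / ?s + 2 * (\<integral>\<theta>. rem \<tau> (?D n) \<theta> \<partial>G \<tau>) + (\<integral>\<theta>. (?l \<theta> / 2 + rem \<tau> (?D n) \<theta>)\<^sup>2 \<partial>G \<tau>)"
      unfolding q E_def using il by simp
    finally have mE: "E = ?s * m n - 2 * (?s * (\<integral>\<theta>. rem \<tau> (?D n) \<theta> \<partial>G \<tau>)) - ?s * (\<integral>\<theta>. (?l \<theta> / 2 + rem \<tau> (?D n) \<theta>)\<^sup>2 \<partial>G \<tau>)"
      using n by (simp add: field_simps)
    have 1: "\<bar>?s * m n\<bar> = \<bar>real n * m n\<bar> * inverse ?s"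
    proof -
      have "(?s * ?s) * m n * inverse ?s = ?s * m n" using n by (simp del: real_sqrt_mult_self)
      then have "real n * m n * inverse ?s = ?s * m n" by simp
      then have "\<bar>?s * m n\<bar> = \<bar>real n * m n * inverse ?s\<bar>" by (simp only:)
      then show ?thesis by (simp only: abs_mult abs_inverse abs_of_nonneg real_sqrt_ge_zero of_nat_0_le_iff)
    qed
    have "\<bar>\<integral>\<theta>. 1 * rem \<tau> (?D n) \<theta> \<partial>G \<tau>\<bar> \<le> sqrt (\<integral>\<theta>. (norm (1::real))\<^sup>2 \<partial>G \<tau>) * sqrt (\<integral>\<theta>. (norm (rem \<tau> (?D n) \<theta>))\<^sup>2 \<partial>G \<tau>)"
      using cauchy_schwarz[OF sq_integrable_const[of "1::real"] nf(1)] by simp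
    then have "\<bar>\<integral>\<theta>. rem \<tau> (?D n) \<theta> \<partial>G \<tau>\<bar> \<le> sqrt (R n)" by (simp add: R_def prob_space)
    then have "?s * \<bar>\<integral>\<theta>. rem \<tau> (?D n) \<theta> \<partial>G \<tau>\<bar> \<le> ?s * sqrt (R n)" by (rule mult_left_mono) simp
    then have 2: "\<bar>?s * (\<integral>\<theta>. rem \<tau> (?D n) \<theta> \<partial>G \<tau>)\<bar> \<le> sqrt (real n * R n)" by (simp add: abs_mult real_sqrt_mult)
    have "(\<integral>\<theta>. (?l \<theta> / 2 + rem \<tau> (?D n) \<theta>)\<^sup>2 \<partial>G \<tau>) \<le> (\<integral>\<theta>. (v \<bullet> rhot \<tau> \<theta>)\<^sup>2 / (2 * real n) + 2 * (rem \<tau> (?D n) \<theta>)\<^sup>2 \<partial>G \<tau>)"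
    proof (rule integral_mono[OF il(3)])
      show "integrable (G \<tau>) (\<lambda>\<theta>. (v \<bullet> rhot \<tau> \<theta>)\<^sup>2 / (2 * real n) + 2 * (rem \<tau> (?D n) \<theta>)\<^sup>2)"
        using sq_integrable_score[of v] nf(1) by (auto simp: sq_integrable_def)
      fix \<theta>
      have "(?l \<theta> / 2 + rem \<tau> (?D n) \<theta>)\<^sup>2 \<le> 2 * (?l \<theta> / 2)\<^sup>2 + 2 * (rem \<tau> (?D n) \<theta>)\<^sup>2"
        using norm_add_power2_le[of "?l \<theta> / 2" "rem \<tau> (?D n) \<theta>"] by (simp only: real_norm_def power2_abs)
      also have "2 * (?l \<theta> / 2)\<^sup>2 = (v \<bullet> rhot \<tau> \<theta>)\<^sup>2 / (2 * real n)" using n by (simp add: power_divide field_simps)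
      finally show "(?l \<theta> / 2 + rem \<tau> (?D n) \<theta>)\<^sup>2 \<le> (v \<bullet> rhot \<tau> \<theta>)\<^sup>2 / (2 * real n) + 2 * (rem \<tau> (?D n) \<theta>)\<^sup>2" .
    qed
    also have "\<dots> = J / (2 * real n) + 2 * R n"
      unfolding J_def R_def using sq_integrable_score[of v] nf(1) by (simp add: sq_integrable_def)
    finally have "?s * (\<integral>\<theta>. (?l \<theta> / 2 + rem \<tau> (?D n) \<theta>)\<^sup>2 \<partial>G \<tau>) \<le> ?s * (J / (2 * real n) + 2 * R n)"
      by (rule mult_left_mono) simp
    also have "\<dots> = (J / 2) * inverse ?s + 2 * (real n * R n) * inverse ?s"
    proof -
      have "s * (J / (2 * (s * s)) + 2 * r) = (J / 2) * inverse s + 2 * (s * s * r) * inverse s" if "s > 0" for s r :: real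
        using that by (simp add: field_simps)
      from this[of ?s "R n"] show ?thesis using n by simp
    qed
    finally have 3: "\<bar>?s * (\<integral>\<theta>. (?l \<theta> / 2 + rem \<tau> (?D n) \<theta>)\<^sup>2 \<partial>G \<tau>)\<bar> \<le> (J / 2) * inverse ?s + 2 * (real n * R n) * inverse ?s"
      by (simp add: abs_mult)
    show "\<bar>E\<bar> \<le> \<bar>real n * m n\<bar> * inverse ?s + 2 * sqrt (real n * R n) + (J / 2) * inverse ?s + 2 * (real n * R n) * inverse ?s"
      using mE 1 2 3 by linarith
  qed
  have "(\<lambda>n. \<bar>real n * m n\<bar> * inverse (sqrt (real n)) + 2 * sqrt (real n * R n)
      + (J / 2) * inverse (sqrt (real n)) + 2 * (real n * R n) * inverse (sqrt (real n)))
     \<longlonglongrightarrow> \<bar>0\<bar> * 0 + 2 * sqrt 0 + (J / 2) * 0 + 2 * 0 * 0"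
    by (intro tendsto_intros R m inv)
  from tendsto_lowerbound[OF this ev] have "\<bar>E\<bar> \<le> 0" by simp
  then show ?thesis by (simp add: E_def)
qed simp

section \<open>Scores and local alternatives under the joint law\<close>

lemma score_P:
  shows "(\<lambda>z. v \<bullet> rhot \<tau> (snd z)) \<in> borel_measurable (P \<tau>)" "sq_integrable (P \<tau>) (\<lambda>z. v \<bullet> rhot \<tau> (snd z))"
    "(\<integral>z. v \<bullet> rhot \<tau> (snd z) \<partial>P \<tau>) = 0"
proof -
  have m: "(\<lambda>\<theta>. v \<bullet> rhot \<tau> \<theta>) \<in> borel_measurable \<Theta>" "(\<lambda>\<theta>. (v \<bullet> rhot \<tau> \<theta>)\<^sup>2) \<in> borel_measurable \<Theta>"
    using rhot_measurable[OF \<tau>] by measurable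
  show m': "(\<lambda>z. v \<bullet> rhot \<tau> (snd z)) \<in> borel_measurable (P \<tau>)" by (rule measurable_compose[OF snd_P m(1)])
  show "sq_integrable (P \<tau>) (\<lambda>z. v \<bullet> rhot \<tau> (snd z))"
    using m' sq_integrable_score[of v] integral_joint_law_snd(2)[OF sets_G[OF \<tau>] prob_G[OF \<tau>] m(2)]
    by (simp add: sq_integrable_def)
  show "(\<integral>z. v \<bullet> rhot \<tau> (snd z) \<partial>P \<tau>) = 0"
    using integral_joint_law_snd(1)[OF sets_G[OF \<tau>] prob_G[OF \<tau>] m(1)] score_mean_zero by simp
qed

text \<open>One truncation \<open>yn\<close> serves all s at once, as the entire functions of the
  lower bound require. The locale demands its conditions for every n, so where \<tau> + s v /
  \<surd>n is unsuitable the alternative is P \<tau> itself with density 1.\<close>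

lemma local_alternatives:
  assumes d: "sq_integrable (P \<tau>) d" and d0: "(\<integral>z. d z \<partial>P \<tau>) = 0"
  obtains yn M' q where
    "\<And>s. local_alternative (P \<tau>) d yn (\<lambda>z. v \<bullet> rhot \<tau> (snd z) / 2) (M' s) (q s) s"
    "\<And>s. \<forall>\<^sub>F n in sequentially. M' s n = P (\<tau> + (s *\<^sub>R v) /\<^sub>R sqrt (real n))"
proof -
  interpret prob_space "P \<tau>" by (rule prob_space_P)
  define y where "y z = v \<bullet> rhot \<tau> (snd z) / 2" for z :: "'x \<times> 't"
  have sy: "sq_integrable (P \<tau>) y"
    unfolding y_def using sq_integrable_cmult[OF score_P(2), of "1/2" v] by simp
  have y0: "(\<integral>z. y z \<partial>P \<tau>) = 0" unfolding y_def using score_P(3)[of v] by simp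
  obtain yn where yn: "L2_tendsto (P \<tau>) yn y" "\<And>n. (\<integral>z. yn n z \<partial>P \<tau>) = 0"
    "\<And>n x. x \<in> space (P \<tau>) \<Longrightarrow> \<bar>yn n x\<bar> \<le> 2 * sqrt (sqrt (real n))"
    using truncation[OF sy y0] by metis
  interpret perturbation "P \<tau>" d yn y
    using d d0 yn by unfold_locales auto
  define D where "D s n = (s *\<^sub>R v) /\<^sub>R sqrt (real n)" for s n
  define good where "good s n \<longleftrightarrow> s *\<^sub>R v \<noteq> 0 \<and> near \<tau> (D s n)" for s n
  define M' where "M' s n = (if good s n then P (\<tau> + D s n) else P \<tau>)" for s n
  define q where "q s n z = (if good s n then qd \<tau> (D s n) (snd z) else 1)" for s n and z :: "'x \<times> 't"
  have good_ev: "\<forall>\<^sub>F n in sequentially. good s n" if "s *\<^sub>R v \<noteq> 0" for s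
    using eventually_compose_filterlim[OF eventually_near filterlim_scaled_direction[OF that]] that
    by (simp add: good_def D_def)
  have inT: "good s n \<Longrightarrow> \<tau> + D s n \<in> \<T>" for s n by (simp add: good_def near_def)
  have qdm [measurable]: "(\<lambda>z. qd \<tau> \<Delta> (snd z)) \<in> borel_measurable (P \<tau>)" for \<Delta>
    by (rule measurable_compose[OF snd_P]) (use qd_measurable G_measurable in blast)
  have remm: "(\<lambda>\<theta>. (rem \<tau> \<Delta> \<theta>)\<^sup>2) \<in> borel_measurable \<Theta>" "qd \<tau> \<Delta> \<in> borel_measurable \<Theta>" for \<Delta>
    using rem_measurable qd_measurable G_measurable[symmetric] by (auto simp: G_measurable[symmetric])
  have Iq: "(\<integral>z. qd \<tau> \<Delta> (snd z) \<partial>P \<tau>) = (\<integral>\<theta>. qd \<tau> \<Delta> \<theta> \<partial>G \<tau>)" for \<Delta>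
    by (rule integral_joint_law_snd(1)[OF sets_G[OF \<tau>] prob_G[OF \<tau>] remm(2)])
  have Irem: "(\<integral>z. (rem \<tau> \<Delta> (snd z))\<^sup>2 \<partial>P \<tau>) = (\<integral>\<theta>. (rem \<tau> \<Delta> \<theta>)\<^sup>2 \<partial>G \<tau>)"
    "integrable (P \<tau>) (\<lambda>z. (rem \<tau> \<Delta> (snd z))\<^sup>2) \<longleftrightarrow> integrable (G \<tau>) (\<lambda>\<theta>. (rem \<tau> \<Delta> \<theta>)\<^sup>2)" for \<Delta>
    using integral_joint_law_snd[OF sets_G[OF \<tau>] prob_G[OF \<tau>] remm(1)] by auto
  have "local_alternative (P \<tau>) d yn y (M' s) (q s) s" for s
  proof (intro local_alternative.intro local_alternative_axioms.intro perturbation_axioms)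
    show "prob_space (M' s n)" for n
      using prob_space_joint_law[OF sets_G prob_G] inT[of s n] \<tau> by (auto simp: M'_def)
    show "sets (M' s n) = sets (P \<tau>)" for n
      using sets_joint_law[OF sets_G prob_G] inT[of s n] \<tau> by (auto simp: M'_def)
    show "q s n \<in> borel_measurable (P \<tau>)" for n
      unfolding q_def by measurable
    show "0 \<le> q s n z" for n z by (auto simp: q_def qd_nonneg)
    show "(\<integral>\<^sup>+z. h z * ennreal (q s n z) \<partial>P \<tau>) \<le> (\<integral>\<^sup>+z. h z \<partial>M' s n)" if h: "h \<in> borel_measurable (P \<tau>)" for n h
    proof (cases "good s n")
      case True
      then show ?thesis
        using joint_law_subdensity[OF sets_G[OF \<tau>] prob_G[OF \<tau>] sets_G[OF inT] prob_G[OF inT] h, OF True True]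
        by (simp add: M'_def q_def qd_def)
    qed (simp add: M'_def q_def)
    show "(\<lambda>n. real n * ((\<integral>z. q s n z \<partial>P \<tau>) - 1)) \<longlonglongrightarrow> 0"
    proof (cases "s *\<^sub>R v = 0")
      case True
      then show ?thesis by (simp add: q_def good_def prob_space)
    next
      case False
      have "(\<lambda>n. real n * ((\<integral>\<theta>. qd \<tau> (D s n) \<theta> \<partial>G \<tau>) - 1)) \<longlonglongrightarrow> 0"
        unfolding D_def by (rule small_o_along_direction[OF False mass_small_o])
      moreover have "\<forall>\<^sub>F n in sequentially. real n * ((\<integral>\<theta>. qd \<tau> (D s n) \<theta> \<partial>G \<tau>) - 1) = real n * ((\<integral>z. q s n z \<partial>P \<tau>) - 1)"
        using good_ev[OF False] by eventually_elim (simp add: q_def Iq)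
      ultimately show ?thesis by (rule Lim_transform_eventually)
    qed
    have L2: "(\<lambda>n. s\<^sup>2 * (\<integral>z. (norm (yn n z - y z))\<^sup>2 \<partial>P \<tau>)) \<longlonglongrightarrow> 0"
      using L2_tendstoD(3)[OF yn(1)] by (rule tendsto_mult_right_zero)
    have sd: "sq_integrable (P \<tau>) (\<lambda>z. yn n z - y z)" for n by (intro sq_integrable_diff sq_yn sy)
    show "(\<lambda>n. real n * (\<integral>z. (sqrt (q s n z) - (1 + s * yn n z / sqrt (real n)))\<^sup>2 \<partial>P \<tau>)) \<longlonglongrightarrow> 0"
    \<comment> \<open>When s v = 0 the density is 1 although s \<open>yn\<close> need not vanish.
      Its limit s y does, so the error is s^2 / n times the truncation error.\<close>
    proof (cases "s *\<^sub>R v = 0")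
      case True
      have sy0: "s * y z = 0" for z using True by (auto simp: y_def)
      have "\<forall>\<^sub>F n in sequentially. s\<^sup>2 * (\<integral>z. (norm (yn n z - y z))\<^sup>2 \<partial>P \<tau>)
          = real n * (\<integral>z. (sqrt (q s n z) - (1 + s * yn n z / sqrt (real n)))\<^sup>2 \<partial>P \<tau>)"
        using eventually_gt_at_top[of 0]
      proof eventually_elim
        fix n :: nat assume n: "0 < n"
        have "(sqrt (q s n z) - (1 + s * yn n z / sqrt (real n)))\<^sup>2 = s\<^sup>2 / real n * (norm (yn n z - y z))\<^sup>2" for z
        proof -
          have "s * yn n z = s * (yn n z - y z)" using sy0[of z] by (simp add: right_diff_distrib)
          moreover have "q s n z = 1" using True by (simp add: q_def good_def)
          ultimately have "(sqrt (q s n z) - (1 + s * yn n z / sqrt (real n)))\<^sup>2 = (s * (yn n z - y z) / sqrt (real n))\<^sup>2" by auto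
          then show ?thesis using n by (simp add: power_mult_distrib power_divide)
        qed
        then show "s\<^sup>2 * (\<integral>z. (norm (yn n z - y z))\<^sup>2 \<partial>P \<tau>)
          = real n * (\<integral>z. (sqrt (q s n z) - (1 + s * yn n z / sqrt (real n)))\<^sup>2 \<partial>P \<tau>)" using n by simp
      qed
      with L2 show ?thesis by (rule Lim_transform_eventually)
    next
      case False
      have lim: "(\<lambda>n. 2 * (real n * (\<integral>\<theta>. (rem \<tau> (D s n) \<theta>)\<^sup>2 \<partial>G \<tau>)) + 2 * (s\<^sup>2 * (\<integral>z. (norm (yn n z - y z))\<^sup>2 \<partial>P \<tau>))) \<longlonglongrightarrow> 2 * 0 + 2 * 0"
        unfolding D_def by (intro tendsto_intros L2 small_o_along_direction[OF False rem_small_o])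
      show ?thesis
      proof (rule tendsto_sandwich[OF _ _ tendsto_const])
        show "(\<lambda>n. 2 * (real n * (\<integral>\<theta>. (rem \<tau> (D s n) \<theta>)\<^sup>2 \<partial>G \<tau>)) + 2 * (s\<^sup>2 * (\<integral>z. (norm (yn n z - y z))\<^sup>2 \<partial>P \<tau>))) \<longlonglongrightarrow> 0"
          using lim by simp
        show "\<forall>\<^sub>F n in sequentially. 0 \<le> real n * (\<integral>z. (sqrt (q s n z) - (1 + s * yn n z / sqrt (real n)))\<^sup>2 \<partial>P \<tau>)" by simp
        show "\<forall>\<^sub>F n in sequentially. real n * (\<integral>z. (sqrt (q s n z) - (1 + s * yn n z / sqrt (real n)))\<^sup>2 \<partial>P \<tau>)
           \<le> 2 * (real n * (\<integral>\<theta>. (rem \<tau> (D s n) \<theta>)\<^sup>2 \<partial>G \<tau>)) + 2 * (s\<^sup>2 * (\<integral>z. (norm (yn n z - y z))\<^sup>2 \<partial>P \<tau>))"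
          using good_ev[OF False] eventually_gt_at_top[of 0]
        proof eventually_elim
          fix n :: nat assume g: "good s n" and n: "0 < n"
          let ?S = "sqrt (real n)"
          \<comment> \<open>The error splits into the remainder of the quadratic mean derivative and
            the truncation error of the score; the factor of the latter reflects that y is half the
            score.\<close>
          have e: "sqrt (q s n z) - (1 + s * yn n z / ?S) = rem \<tau> (D s n) (snd z) + (- (s / ?S)) * (yn n z - y z)" for z
          proof -
            have Dx: "D s n \<bullet> x = s / ?S * (v \<bullet> x)" for x by (simp add: D_def inverse_eq_divide)
            have "a - (1 + s * b / S) = (a - 1 - (s / S * r) / 2) + (- (s / S)) * (b - r / 2)" for a b r S :: real
              by (simp add: algebra_simps)
            moreover have "q s n z = qd \<tau> (D s n) (snd z)" using g by (simp only: q_def if_True)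
            ultimately show ?thesis by (simp only: rem_def y_def Dx)
          qed
          have sr: "sq_integrable (P \<tau>) (\<lambda>z. rem \<tau> (D s n) (snd z))"
          proof -
            have "rem \<tau> (D s n) \<in> borel_measurable \<Theta>" using rem_measurable[of "D s n"] by (simp only: G_measurable)
            from measurable_compose[OF snd_P this] have "(\<lambda>z. rem \<tau> (D s n) (snd z)) \<in> borel_measurable (P \<tau>)" .
            moreover have "integrable (P \<tau>) (\<lambda>z. (rem \<tau> (D s n) (snd z))\<^sup>2)"
              using g unfolding Irem(2) good_def near_def by blast
            ultimately show ?thesis by (simp only: sq_integrable_real_iff simp_thms)
          qed
          have "(\<integral>z. (sqrt (q s n z) - (1 + s * yn n z / ?S))\<^sup>2 \<partial>P \<tau>)
             \<le> (\<integral>z. 2 * (rem \<tau> (D s n) (snd z))\<^sup>2 + 2 * ((s\<^sup>2 / real n) * (norm (yn n z - y z))\<^sup>2) \<partial>P \<tau>)"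
            unfolding e
          proof (rule integral_mono)
            show "integrable (P \<tau>) (\<lambda>z. (rem \<tau> (D s n) (snd z) + (- (s / ?S)) * (yn n z - y z))\<^sup>2)"
              using sq_integrable_add[OF sr sq_integrable_cmult[OF sd[of n], of "- (s / ?S)"]] by (simp add: sq_integrable_def)
            show "integrable (P \<tau>) (\<lambda>z. 2 * (rem \<tau> (D s n) (snd z))\<^sup>2 + 2 * ((s\<^sup>2 / real n) * (norm (yn n z - y z))\<^sup>2))"
              using sr sd[of n] by (simp add: sq_integrable_def)
            show "(rem \<tau> (D s n) (snd z) + (- (s / ?S)) * (yn n z - y z))\<^sup>2 \<le> 2 * (rem \<tau> (D s n) (snd z))\<^sup>2 + 2 * ((s\<^sup>2 / real n) * (norm (yn n z - y z))\<^sup>2)" for z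
            proof -
              have "((- (s / ?S)) * (yn n z - y z))\<^sup>2 = (s\<^sup>2 / real n) * (norm (yn n z - y z))\<^sup>2"
                by (simp add: power_mult_distrib power_divide)
              then show ?thesis
                using norm_add_power2_le[of "rem \<tau> (D s n) (snd z)" "(- (s / ?S)) * (yn n z - y z)"]
                by (simp only: real_norm_def power2_abs)
            qed
          qed
          also have "\<dots> = 2 * (\<integral>\<theta>. (rem \<tau> (D s n) \<theta>)\<^sup>2 \<partial>G \<tau>) + 2 * ((s\<^sup>2 / real n) * (\<integral>z. (norm (yn n z - y z))\<^sup>2 \<partial>P \<tau>))"
            using sr sd[of n] by (simp add: sq_integrable_def Irem(1))
          finally have "real n * (\<integral>z. (sqrt (q s n z) - (1 + s * yn n z / ?S))\<^sup>2 \<partial>P \<tau>)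
            \<le> real n * (2 * (\<integral>\<theta>. (rem \<tau> (D s n) \<theta>)\<^sup>2 \<partial>G \<tau>) + 2 * ((s\<^sup>2 / real n) * (\<integral>z. (norm (yn n z - y z))\<^sup>2 \<partial>P \<tau>)))"
            by (rule mult_left_mono) simp
          then show "real n * (\<integral>z. (sqrt (q s n z) - (1 + s * yn n z / ?S))\<^sup>2 \<partial>P \<tau>)
            \<le> 2 * (real n * (\<integral>\<theta>. (rem \<tau> (D s n) \<theta>)\<^sup>2 \<partial>G \<tau>)) + 2 * (s\<^sup>2 * (\<integral>z. (norm (yn n z - y z))\<^sup>2 \<partial>P \<tau>))"
            using n by (simp add: algebra_simps)
        qed
      qed
    qed
  qed
  moreover have "\<forall>\<^sub>F n in sequentially. M' s n = P (\<tau> + (s *\<^sub>R v) /\<^sub>R sqrt (real n))" for s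
  proof (cases "s *\<^sub>R v = 0")
    case True
    then show ?thesis by (auto simp: M'_def good_def)
  next
    case False
    show ?thesis using good_ev[OF False] by eventually_elim (simp add: M'_def D_def)
  qed
  ultimately show ?thesis using that[of yn M' q] unfolding y_def by blast
qed

end

end

text \<open>Truncating r is an L2-small change, whose effect is uniform in g by Cauchy-Schwarz and
  the bound C. The gain is that bounded test functions can be moved into estimates where a square
  integrable one could not.\<close>

lemma bounded_test_functions_suffice:
  fixes g :: "'p \<Rightarrow> 'a \<Rightarrow> real"
  assumes r: "sq_integrable M r"
    and g: "\<forall>\<^sub>F \<Delta> in F. sq_integrable M (g \<Delta>) \<and> (\<integral>x. (g \<Delta> x)\<^sup>2 \<partial>M) \<le> C"
    and b: "\<And>K :: nat. ((\<lambda>\<Delta>. \<integral>x. g \<Delta> x * (if \<bar>r x\<bar> \<le> real K then r x else 0) \<partial>M) \<longlongrightarrow> 0) F"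
  shows "((\<lambda>\<Delta>. \<integral>x. g \<Delta> x * r x \<partial>M) \<longlongrightarrow> 0) F"
proof (rule tendstoI)
  fix e :: real assume e: "0 < e"
  define t where "t K x = (if \<bar>r x\<bar> \<le> real K then r x else 0)" for K :: nat and x
  have [measurable]: "r \<in> borel_measurable M" using r by (rule sq_integrable_measurable)
  have tm [measurable]: "t K \<in> borel_measurable M" for K unfolding t_def by measurable
  have L2: "L2_tendsto M t r"
  proof (rule L2_tendsto_dominated[OF _ _ sq_integrable_norm[OF r]])
    show "(\<lambda>K. t K x) \<longlonglongrightarrow> r x" for x
    proof (rule tendsto_eventually)
      have "\<forall>\<^sub>F K in sequentially. \<bar>r x\<bar> \<le> real K"
        using filterlim_real_sequentially by (simp add: filterlim_at_top)
      then show "\<forall>\<^sub>F K in sequentially. t K x = r x" by eventually_elim (simp add: t_def)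
    qed
  qed (auto simp: t_def)
  define c where "c = sqrt \<bar>C\<bar> + 1"
  have c: "c > 0" by (simp add: c_def add_nonneg_pos)
  have "(\<lambda>K. sqrt (\<integral>x. (norm (t K x - r x))\<^sup>2 \<partial>M)) \<longlonglongrightarrow> sqrt 0"
    by (intro tendsto_intros L2_tendstoD(3)[OF L2])
  then have "\<forall>\<^sub>F K in sequentially. sqrt (\<integral>x. (norm (t K x - r x))\<^sup>2 \<partial>M) < e / (2 * c)"
    using e c by (intro order_tendstoD(2)) auto
  then obtain K where K: "sqrt (\<integral>x. (norm (t K x - r x))\<^sup>2 \<partial>M) < e / (2 * c)"
    using eventually_happens by fastforce
  have st: "sq_integrable M (t K)" "sq_integrable M (\<lambda>x. t K x - r x)"
    using L2_tendstoD(1)[OF L2] r by (auto intro: sq_integrable_diff)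
  have "\<forall>\<^sub>F \<Delta> in F. dist (\<integral>x. g \<Delta> x * t K x \<partial>M) 0 < e / 2"
    using e b[of K] unfolding t_def by (intro tendstoD) auto
  then show "\<forall>\<^sub>F \<Delta> in F. dist (\<integral>x. g \<Delta> x * r x \<partial>M) 0 < e"
    using g
  proof eventually_elim
    fix \<Delta> assume 1: "dist (\<integral>x. g \<Delta> x * t K x \<partial>M) 0 < e / 2"
      and gd: "sq_integrable M (g \<Delta>) \<and> (\<integral>x. (g \<Delta> x)\<^sup>2 \<partial>M) \<le> C"
    have "\<bar>\<integral>x. g \<Delta> x * (t K x - r x) \<partial>M\<bar> \<le> sqrt (\<integral>x. (g \<Delta> x)\<^sup>2 \<partial>M) * sqrt (\<integral>x. (norm (t K x - r x))\<^sup>2 \<partial>M)"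
      using cauchy_schwarz[OF conjunct1[OF gd] st(2)] by simp
    also have "\<dots> \<le> c * (e / (2 * c))"
    proof (intro mult_mono)
      have "sqrt (\<integral>x. (g \<Delta> x)\<^sup>2 \<partial>M) \<le> sqrt \<bar>C\<bar>" using gd by (intro real_sqrt_le_mono) auto
      then show "sqrt (\<integral>x. (g \<Delta> x)\<^sup>2 \<partial>M) \<le> c" unfolding c_def by linarith
    qed (use K c in auto)
    also have "\<dots> = e / 2" using c by simp
    finally have 2: "\<bar>\<integral>x. g \<Delta> x * (t K x - r x) \<partial>M\<bar> \<le> e / 2" .
    have "(\<integral>x. g \<Delta> x * (t K x - r x) \<partial>M) = (\<integral>x. g \<Delta> x * t K x \<partial>M) - (\<integral>x. g \<Delta> x * r x \<partial>M)"
      unfolding right_diff_distrib using gd st(1) r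
      by (intro Bochner_Integration.integral_diff sq_integrable_mult_integrable) auto
    then show "dist (\<integral>x. g \<Delta> x * r x \<partial>M) 0 < e" using 1 2 unfolding dist_real_def by linarith
  qed
qed

text \<open>Statistics are functions on infinite sequences; \<open>res\<close> expresses that they
  look at the first n coordinates, so integrals reduce to the n-fold power.\<close>

lemma char_distr_sample_law:
  assumes M: "prob_space M" and \<xi>: "\<xi> \<in> borel_measurable (power_measure n M)"
    and res: "\<And>\<omega>. \<xi> (restrict \<omega> {..<n}) = \<xi> \<omega>"
  shows "char (distr (sample_law M) borel \<xi>) t = (\<integral>\<omega>. iexp (t * \<xi> \<omega>) \<partial>power_measure n M)"
    and "real_distribution (distr (sample_law M) borel \<xi>)"
proof -
  interpret S: prob_space "sample_law M" using M by (rule prob_space_sample_law)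
  have "(\<lambda>\<omega>. restrict \<omega> {..<n}) \<in> sample_law M \<rightarrow>\<^sub>M power_measure n M"
    unfolding sample_law_def by (rule measurable_restrict_subset) auto
  from measurable_compose[OF this \<xi>] have m [measurable]: "\<xi> \<in> borel_measurable (sample_law M)" by (simp add: res)
  note [measurable] = \<xi>
  have "char (distr (sample_law M) borel \<xi>) t = (\<integral>\<omega>. iexp (t * \<xi> \<omega>) \<partial>sample_law M)"
    unfolding char_def by (subst integral_distr) measurable
  also have "\<dots> = (\<integral>\<omega>. (\<lambda>\<omega>. iexp (t * \<xi> \<omega>)) (restrict \<omega> {..<n}) \<partial>sample_law M)" by (simp add: res)
  also have "\<dots> = (\<integral>\<omega>. iexp (t * \<xi> \<omega>) \<partial>power_measure n M)" by (rule integral_sample_law[OF M]) measurable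
  finally show "char (distr (sample_law M) borel \<xi>) t = (\<integral>\<omega>. iexp (t * \<xi> \<omega>) \<partial>power_measure n M)" .
  show "real_distribution (distr (sample_law M) borel \<xi>)" by (rule S.real_distribution_distr[OF m])
qed

context dqm_mixture
begin

text \<open>Levy's continuity theorem applied to \<open>linear_statistic_limit\<close> with s = 1
  and direction a. Closeness to the linear statistic is assumed under P \<tau>, the conclusion holds
  under the alternatives, and the limit does not involve a: this is regularity.\<close>

lemma linear_statistic_weak_conv:
  assumes \<tau>: "\<tau> \<in> \<T>" and d: "sq_integrable (P \<tau>) d" "(\<integral>z. d z \<partial>P \<tau>) = 0"
    and orth: "(\<integral>z. d z * (a \<bullet> rhot \<tau> (snd z)) \<partial>P \<tau>) = 0"
    and \<xi>: "\<And>n. \<xi> n \<in> borel_measurable (Pi\<^sub>M {..<n} (\<lambda>_. \<nu> \<Otimes>\<^sub>M \<Theta>))"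
    and res: "\<And>n \<omega>. \<xi> n (restrict \<omega> {..<n}) = \<xi> n \<omega>"
    and conv: "\<And>\<epsilon>. \<epsilon> > 0 \<Longrightarrow> (\<lambda>n. measure (power_measure n (P \<tau>))
       {\<omega> \<in> space (power_measure n (P \<tau>)). \<epsilon> < \<bar>\<xi> n \<omega> - (\<Sum>j<n. d (\<omega> j)) / sqrt (real n)\<bar>}) \<longlonglongrightarrow> 0"
  shows "weak_conv_m (\<lambda>n. distr (sample_law (P (\<tau> + a /\<^sub>R sqrt (real n)))) borel (\<xi> n)) (centered_normal (\<integral>z. (d z)\<^sup>2 \<partial>P \<tau>))"
proof -
  obtain yn M' q where la: "\<And>s. local_alternative (P \<tau>) d yn (\<lambda>z. a \<bullet> rhot \<tau> (snd z) / 2) (M' s) (q s) s"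
    and ev: "\<And>s. \<forall>\<^sub>F n in sequentially. M' s n = P (\<tau> + (s *\<^sub>R a) /\<^sub>R sqrt (real n))"

  proof (rule local_alternatives[OF \<tau> d, where v=a])
    fix yn M' q
    assume "\<And>s. local_alternative (P \<tau>) d yn (\<lambda>z. a \<bullet> rhot \<tau> (snd z) / 2) (M' s) (q s) s"
      "\<And>s. \<forall>\<^sub>F n in sequentially. M' s n = P (\<tau> + (s *\<^sub>R a) /\<^sub>R sqrt (real n))"
    then show thesis by (rule that)
  qed
  interpret local_alternative "P \<tau>" d yn "\<lambda>z. a \<bullet> rhot \<tau> (snd z) / 2" "M' 1" "q 1" 1 by (rule la)
  have sM: "sets (power_measure n (M' 1 n)) = sets (Pi\<^sub>M {..<n} (\<lambda>_. \<nu> \<Otimes>\<^sub>M \<Theta>))"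
    "sets (power_measure n (P \<tau>)) = sets (Pi\<^sub>M {..<n} (\<lambda>_. \<nu> \<Otimes>\<^sub>M \<Theta>))" for n
    using sets_M' sets_P[OF \<tau>] by (auto intro!: sets_PiM_cong)
  have \<xi>m: "\<xi> n \<in> borel_measurable (power_measure n (M' 1 n))" "\<xi> n \<in> borel_measurable (power_measure n (P \<tau>))" for n
    unfolding measurable_cong_sets[OF sM(1) refl] measurable_cong_sets[OF sM(2) refl] by (rule \<xi>)+
  have o: "(\<integral>z. d z * (a \<bullet> rhot \<tau> (snd z) / 2) \<partial>P \<tau>) = 0" using orth by simp
  have "weak_conv_m (\<lambda>n. distr (sample_law (M' 1 n)) borel (\<xi> n)) (centered_normal (\<integral>z. (d z)\<^sup>2 \<partial>P \<tau>))"
  proof (rule levy_continuity)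
    show "real_distribution (distr (sample_law (M' 1 n)) borel (\<xi> n))" for n
      by (rule char_distr_sample_law(2)[OF M' \<xi>m(1) res])
    show "real_distribution (centered_normal (\<integral>z. (d z)\<^sup>2 \<partial>P \<tau>))" by (rule real_distribution_centered_normal)
    show "(\<lambda>n. char (distr (sample_law (M' 1 n)) borel (\<xi> n)) t) \<longlonglongrightarrow> char (centered_normal (\<integral>z. (d z)\<^sup>2 \<partial>P \<tau>)) t" for t
      unfolding char_distr_sample_law(1)[OF M' \<xi>m(1) res] char_centered_normal[OF Bochner_Integration.integral_nonneg[OF zero_le_power2]]
      by (rule linear_statistic_limit[OF \<xi>m(2) o conv])
  qed
  then show ?thesis
    by (rule weak_conv_m_eventually_cong) (use ev[of 1] in \<open>auto elim!: eventually_mono\<close>)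
qed

text \<open>The one-parameter family in direction v already forces the bound; in the application v
  is the least favourable direction \<open>gdir\<close>, for which \<open>cond\<close>
  holds.\<close>

lemma regular_limit_variance_ge:
  fixes u :: "'x \<Rightarrow> 't \<Rightarrow> real" and m :: "'x \<Rightarrow> real"
  assumes \<tau>: "\<tau> \<in> \<T>" and u: "(\<lambda>z. u (fst z) (snd z)) \<in> borel_measurable (\<nu> \<Otimes>\<^sub>M \<Theta>)" and m: "m \<in> borel_measurable \<nu>"
    and d: "sq_integrable (P \<tau>) d" "(\<integral>z. d z \<partial>P \<tau>) = 0"
    and d_eq: "\<And>z. d z = m (fst z) - u (fst z) (snd z)"
    and cond: "\<And>\<beta> C. \<beta> \<in> borel_measurable \<nu> \<Longrightarrow> (\<And>x. x \<in> space \<nu> \<Longrightarrow> norm (\<beta> x) \<le> C) \<Longrightarrow>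
       (\<integral>z. \<beta> (fst z) * complex_of_real (d z - v \<bullet> rhot \<tau> (snd z)) \<partial>P \<tau>) = 0"
    and orth: "(\<integral>z. d z * (v \<bullet> rhot \<tau> (snd z)) \<partial>P \<tau>) = 0"
    and reg: "regular_with_limit \<nu> P u \<tau> T L"
  shows "ennreal (\<integral>z. (d z)\<^sup>2 \<partial>P \<tau>) \<le> variance_of_law L"
proof -
  have T: "T n \<in> borel_measurable (Pi\<^sub>M {..<n} (\<lambda>_. \<nu>))" for n
    using reg by (auto simp: regular_with_limit_def is_estimator_def)
  have L: "real_distribution L" using reg by (simp add: regular_with_limit_def)
  have wc: "weak_conv_m (\<lambda>n. distr (sample_law (P (\<tau> + a /\<^sub>R sqrt (real n)))) borel
               (\<lambda>\<omega>. (T n (observed n \<omega>) - utility_sum u n \<omega>) / sqrt (real n))) L" for a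
    using reg by (simp add: regular_with_limit_def)
  obtain yn M' q where la: "\<And>s. local_alternative (P \<tau>) d yn (\<lambda>z. v \<bullet> rhot \<tau> (snd z) / 2) (M' s) (q s) s"
    and ev: "\<And>s. \<forall>\<^sub>F n in sequentially. M' s n = P (\<tau> + (s *\<^sub>R v) /\<^sub>R sqrt (real n))"
  proof (rule local_alternatives[OF \<tau> d, where v=v])
    fix yn M' q
    assume "\<And>s. local_alternative (P \<tau>) d yn (\<lambda>z. v \<bullet> rhot \<tau> (snd z) / 2) (M' s) (q s) s"
      "\<And>s. \<forall>\<^sub>F n in sequentially. M' s n = P (\<tau> + (s *\<^sub>R v) /\<^sub>R sqrt (real n))"
    then show thesis by (rule that)
  qed
  define \<xi> where "\<xi> n \<omega> = (T n (\<lambda>j\<in>{..<n}. fst (\<omega> j)) - (\<Sum>j<n. u (fst (\<omega> j)) (snd (\<omega> j)))) / sqrt (real n)" for n and \<omega> :: "nat \<Rightarrow> 'x \<times> 't"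
  have \<xi>_eq: "(\<lambda>\<omega>. (T n (observed n \<omega>) - utility_sum u n \<omega>) / sqrt (real n)) = \<xi> n" for n
    by (simp add: \<xi>_def observed_def utility_sum_def fun_eq_iff)
  have res: "\<xi> n (restrict \<omega> {..<n}) = \<xi> n \<omega>" for n \<omega>
  proof -
    have "(\<lambda>j\<in>{..<n}. fst (restrict \<omega> {..<n} j)) = (\<lambda>j\<in>{..<n}. fst (\<omega> j))" by (auto simp: restrict_def)
    then show ?thesis unfolding \<xi>_def by simp
  qed
  have om: "(\<lambda>\<omega>. \<lambda>j\<in>{..<n}. fst (\<omega> j)) \<in> Pi\<^sub>M {..<n} (\<lambda>_. \<nu> \<Otimes>\<^sub>M \<Theta>) \<rightarrow>\<^sub>M Pi\<^sub>M {..<n} (\<lambda>_. \<nu>)" for n :: nat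
    by (intro measurable_restrict measurable_compose[OF _ measurable_fst[of \<nu> \<Theta>]] measurable_component_singleton)
  have \<xi>0: "\<xi> n \<in> borel_measurable (Pi\<^sub>M {..<n} (\<lambda>_. \<nu> \<Otimes>\<^sub>M \<Theta>))" for n
    unfolding \<xi>_def by (intro borel_measurable_divide borel_measurable_diff measurable_compose[OF om T] measurable_sum_components[OF u] borel_measurable_const)
  have ch: "norm (char L t) \<le> exp (- t\<^sup>2 * (\<integral>z. (d z)\<^sup>2 \<partial>P \<tau>) / 2)" for t
  proof (rule regular_limit_char_bound[OF la fst_P[OF \<tau>] T _ m, where u="\<lambda>z. u (fst z) (snd z)"])
    show "(\<lambda>z. u (fst z) (snd z)) \<in> borel_measurable (P \<tau>)" using u unfolding measurable_cong_sets[OF sets_P[OF \<tau>] refl] .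
    show "d z = m (fst z) - u (fst z) (snd z)" for z by (rule d_eq)
    show "(\<integral>z. \<beta> (fst z) * complex_of_real (d z - 2 * (v \<bullet> rhot \<tau> (snd z) / 2)) \<partial>P \<tau>) = 0"
      if "\<beta> \<in> borel_measurable \<nu>" "\<And>x. x \<in> space \<nu> \<Longrightarrow> norm (\<beta> x) \<le> C" for \<beta> C
      using cond[OF that] by simp
    show "(\<integral>z. d z * (v \<bullet> rhot \<tau> (snd z) / 2) \<partial>P \<tau>) = 0" using orth by simp
    show "(\<lambda>n. \<integral>\<omega>. iexp (t * ((T n (\<lambda>j\<in>{..<n}. fst (\<omega> j)) - (\<Sum>j<n. u (fst (\<omega> j)) (snd (\<omega> j)))) / sqrt (real n)))
        \<partial>power_measure n (M' s n)) \<longlonglongrightarrow> char L t" for s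
    proof -
      interpret local_alternative "P \<tau>" d yn "\<lambda>z. v \<bullet> rhot \<tau> (snd z) / 2" "M' s" "q s" s by (rule la)
      have sM: "sets (power_measure n (M' s n)) = sets (Pi\<^sub>M {..<n} (\<lambda>_. \<nu> \<Otimes>\<^sub>M \<Theta>))" for n
        using sets_M' sets_P[OF \<tau>] by (auto intro!: sets_PiM_cong)
      have \<xi>m: "\<xi> n \<in> borel_measurable (power_measure n (M' s n))" for n
        unfolding measurable_cong_sets[OF sM refl] by (rule \<xi>0)
      have "weak_conv_m (\<lambda>n. distr (sample_law (M' s n)) borel (\<xi> n)) L"
        by (rule weak_conv_m_eventually_cong[OF wc[of "s *\<^sub>R v", unfolded \<xi>_eq]]) (use ev[of s] in \<open>auto elim!: eventually_mono\<close>)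
      from levy_continuity1[OF char_distr_sample_law(2)[OF M' \<xi>m res] L this]
      show ?thesis unfolding char_distr_sample_law(1)[OF M' \<xi>m res] \<xi>_def .
    qed
  qed
  show ?thesis by (rule variance_of_law_ge[OF L ch]) simp
qed

section \<open>Expansion of means under a change of parameter\<close>

lemma score_component:
  assumes \<tau>: "\<tau> \<in> \<T>"
  shows "sq_integrable (P \<tau>) (\<lambda>z. rhot \<tau> (snd z) $ i)" "(\<integral>z. rhot \<tau> (snd z) $ i \<partial>P \<tau>) = 0"
  using score_P[OF \<tau>, of "axis i 1"] by (simp_all add: inner_axis')

text \<open>The function h may vary with \<Delta> in any way compatible with bounded second moments
  under both laws; this generality is needed for h = ubar (\<tau> + \<Delta>), about whose behaviour
  in \<Delta> nothing more is known at this point.\<close>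

lemma mean_expansion:
  fixes h :: "real ^ 'd \<Rightarrow> 'x \<times> 't \<Rightarrow> real"
  assumes \<tau>: "\<tau> \<in> \<T>" and C: "0 \<le> C"
    and h: "\<forall>\<^sub>F \<Delta> in at 0. sq_integrable (P \<tau>) (h \<Delta>) \<and> sq_integrable (P (\<tau> + \<Delta>)) (h \<Delta>)
      \<and> (\<integral>z. (h \<Delta> z)\<^sup>2 \<partial>P \<tau>) \<le> C \<and> (\<integral>z. (h \<Delta> z)\<^sup>2 \<partial>P (\<tau> + \<Delta>)) \<le> C"
  shows "((\<lambda>\<Delta>. ((\<integral>z. h \<Delta> z \<partial>P (\<tau> + \<Delta>)) - (\<integral>z. h \<Delta> z \<partial>P \<tau>) - (\<integral>z. h \<Delta> z * (\<Delta> \<bullet> rhot \<tau> (snd z)) \<partial>P \<tau>)) / norm \<Delta>) \<longlongrightarrow> 0) (at 0)"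
    and "((\<lambda>\<Delta>. (\<integral>z. h \<Delta> z \<partial>P (\<tau> + \<Delta>)) - (\<integral>z. h \<Delta> z \<partial>P \<tau>)) \<longlongrightarrow> 0) (at 0)"
proof -
  interpret prob_space "P \<tau>" by (rule prob_space_P[OF \<tau>])
  define p where "p \<Delta> z = sqrt (qd \<tau> \<Delta> (snd z))" for \<Delta> and z :: "'x \<times> 't"
  define r where "r \<Delta> z = rem \<tau> \<Delta> (snd z)" for \<Delta> and z :: "'x \<times> 't"
  define R where "R \<Delta> = (\<integral>\<theta>. (rem \<tau> \<Delta> \<theta>)\<^sup>2 \<partial>G \<tau>)" for \<Delta>
  define mm where "mm \<Delta> = (\<integral>\<theta>. qd \<tau> \<Delta> \<theta> \<partial>G \<tau>)" for \<Delta>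
  define N where "N = (\<Sum>i\<in>UNIV. \<integral>z. (rhot \<tau> (snd z) $ i)\<^sup>2 \<partial>P \<tau>)"
  have qdm: "qd \<tau> \<Delta> \<in> borel_measurable \<Theta>" and remm: "rem \<tau> \<Delta> \<in> borel_measurable \<Theta>" for \<Delta>
    using qd_measurable[OF \<tau>] rem_measurable[OF \<tau>] by (simp_all only: G_measurable[OF \<tau>])
  have qm [measurable]: "(\<lambda>z. qd \<tau> \<Delta> (snd z)) \<in> borel_measurable (P \<tau>)" for \<Delta>
    by (rule measurable_compose[OF snd_P[OF \<tau>] qdm])
  have rm [measurable]: "r \<Delta> \<in> borel_measurable (P \<tau>)" for \<Delta>
    unfolding r_def by (rule measurable_compose[OF snd_P[OF \<tau>] remm])
  have pm [measurable]: "p \<Delta> \<in> borel_measurable (P \<tau>)" for \<Delta> unfolding p_def by measurable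
  have pr: "p \<Delta> z = 1 + \<Delta> \<bullet> rhot \<tau> (snd z) / 2 + r \<Delta> z" for \<Delta> z by (simp add: p_def r_def rem_def)
  have Ir: "(\<integral>z. (r \<Delta> z)\<^sup>2 \<partial>P \<tau>) = R \<Delta>" and Ir': "near \<tau> \<Delta> \<Longrightarrow> sq_integrable (P \<tau>) (r \<Delta>)" for \<Delta>
  proof -
    have m: "(\<lambda>\<theta>. (rem \<tau> \<Delta> \<theta>)\<^sup>2) \<in> borel_measurable \<Theta>" using remm[of \<Delta>] by measurable
    show "(\<integral>z. (r \<Delta> z)\<^sup>2 \<partial>P \<tau>) = R \<Delta>"
      unfolding r_def R_def by (rule integral_joint_law_snd(1)[OF sets_G[OF \<tau>] prob_G[OF \<tau>] m])
    show "sq_integrable (P \<tau>) (r \<Delta>)" if "near \<tau> \<Delta>"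
      using that rm[of \<Delta>] integral_joint_law_snd(2)[OF sets_G[OF \<tau>] prob_G[OF \<tau>] m]
      by (simp add: sq_integrable_def r_def near_def)
  qed
  have Iq: "(\<integral>z. qd \<tau> \<Delta> (snd z) \<partial>P \<tau>) = mm \<Delta>" for \<Delta>
    unfolding mm_def by (rule integral_joint_law_snd(1)[OF sets_G[OF \<tau>] prob_G[OF \<tau>] qdm])
  have sl: "sq_integrable (P \<tau>) (\<lambda>z. \<Delta> \<bullet> rhot \<tau> (snd z))" for \<Delta> by (rule score_P(2)[OF \<tau>])
  have lN: "(\<integral>z. (\<Delta> \<bullet> rhot \<tau> (snd z))\<^sup>2 \<partial>P \<tau>) \<le> (norm \<Delta>)\<^sup>2 * N" for \<Delta>
  proof -
    have i: "integrable (P \<tau>) (\<lambda>z. \<Sum>i\<in>UNIV. (rhot \<tau> (snd z) $ i)\<^sup>2)"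
      using score_component(1)[OF \<tau>] by (intro Bochner_Integration.integrable_sum) (auto simp: sq_integrable_def)
    have "(\<integral>z. (\<Delta> \<bullet> rhot \<tau> (snd z))\<^sup>2 \<partial>P \<tau>) \<le> (\<integral>z. (norm \<Delta>)\<^sup>2 * (\<Sum>i\<in>UNIV. (rhot \<tau> (snd z) $ i)\<^sup>2) \<partial>P \<tau>)"
    proof (rule integral_mono)
      show "integrable (P \<tau>) (\<lambda>z. (\<Delta> \<bullet> rhot \<tau> (snd z))\<^sup>2)" using sl[of \<Delta>] by (simp add: sq_integrable_def)
      show "integrable (P \<tau>) (\<lambda>z. (norm \<Delta>)\<^sup>2 * (\<Sum>i\<in>UNIV. (rhot \<tau> (snd z) $ i)\<^sup>2))" by (rule integrable_mult_right[OF i])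
      fix z
      have "(\<Delta> \<bullet> rhot \<tau> (snd z))\<^sup>2 \<le> (norm \<Delta> * norm (rhot \<tau> (snd z)))\<^sup>2"
        using Cauchy_Schwarz_ineq2[of \<Delta> "rhot \<tau> (snd z)"] by (simp add: abs_le_square_iff[symmetric])
      also have "\<dots> = (norm \<Delta>)\<^sup>2 * (\<Sum>i\<in>UNIV. (rhot \<tau> (snd z) $ i)\<^sup>2)"
        by (simp add: power_mult_distrib norm_vec_def L2_set_def sum_nonneg)
      finally show "(\<Delta> \<bullet> rhot \<tau> (snd z))\<^sup>2 \<le> (norm \<Delta>)\<^sup>2 * (\<Sum>i\<in>UNIV. (rhot \<tau> (snd z) $ i)\<^sup>2)" .
    qed
    also have "\<dots> = (norm \<Delta>)\<^sup>2 * N"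
      unfolding N_def using score_component(1)[OF \<tau>]
      by (subst integral_mult_right_zero, subst Bochner_Integration.integral_sum) (auto simp: sq_integrable_def)
    finally show ?thesis .
  qed
  have Rlim: "((\<lambda>\<Delta>. R \<Delta> / (norm \<Delta>)\<^sup>2) \<longlongrightarrow> 0) (at 0)" unfolding R_def by (rule smalloD_tendsto[OF rem_small_o[OF \<tau>]])
  have mlim: "((\<lambda>\<Delta>. (mm \<Delta> - 1) / (norm \<Delta>)\<^sup>2) \<longlongrightarrow> 0) (at 0)" unfolding mm_def by (rule smalloD_tendsto[OF mass_small_o[OF \<tau>]])
  have normlim: "((\<lambda>\<Delta> :: real ^ 'd. norm \<Delta>) \<longlongrightarrow> 0) (at 0)" by (rule tendsto_norm_zero) (rule tendsto_ident_at)
  have n0: "\<forall>\<^sub>F \<Delta> :: real ^ 'd in at 0. \<Delta> \<noteq> 0" by (simp add: eventually_at_filter)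
  have Rlim0: "(R \<longlongrightarrow> 0) (at 0)"
  proof -
    have "((\<lambda>\<Delta>. R \<Delta> / (norm \<Delta>)\<^sup>2 * (norm \<Delta>)\<^sup>2) \<longlongrightarrow> 0 * 0\<^sup>2) (at 0)" by (intro tendsto_intros Rlim normlim)
    moreover have "\<forall>\<^sub>F \<Delta> in at 0. R \<Delta> / (norm \<Delta>)\<^sup>2 * (norm \<Delta>)\<^sup>2 = R \<Delta>" using n0 by eventually_elim simp
    ultimately show ?thesis by (simp add: Lim_transform_eventually)
  qed
  have good: "\<forall>\<^sub>F \<Delta> in at 0. near \<tau> \<Delta> \<and> \<Delta> \<noteq> 0 \<and> sq_integrable (P \<tau>) (h \<Delta>) \<and> sq_integrable (P (\<tau> + \<Delta>)) (h \<Delta>)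
      \<and> (\<integral>z. (h \<Delta> z)\<^sup>2 \<partial>P \<tau>) \<le> C \<and> (\<integral>z. (h \<Delta> z)\<^sup>2 \<partial>P (\<tau> + \<Delta>)) \<le> C"
    using h n0 eventually_near[OF \<tau>] by eventually_elim blast
  have dom: "(\<integral>z. g z * qd \<tau> \<Delta> (snd z) \<partial>P \<tau>) \<le> (\<integral>z. g z \<partial>P (\<tau> + \<Delta>))"
    if \<Delta>: "near \<tau> \<Delta>" and g0: "\<And>z. 0 \<le> g z" and gi: "integrable (P (\<tau> + \<Delta>)) g" for g \<Delta>
  proof -
    have T: "\<tau> + \<Delta> \<in> \<T>" using \<Delta> by (simp add: near_def)
    have gm [measurable]: "g \<in> borel_measurable (P \<tau>)"
      using gi sets_P[OF T] sets_P[OF \<tau>] measurable_cong_sets[of "P (\<tau> + \<Delta>)" "P \<tau>" borel borel] by auto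
    have "(\<integral>\<^sup>+z. ennreal (g z * qd \<tau> \<Delta> (snd z)) \<partial>P \<tau>) = (\<integral>\<^sup>+z. ennreal (g z) * ennreal (qd \<tau> \<Delta> (snd z)) \<partial>P \<tau>)"
      using g0 qd_nonneg by (simp add: ennreal_mult)
    also have "\<dots> \<le> (\<integral>\<^sup>+z. ennreal (g z) \<partial>P (\<tau> + \<Delta>))"
      unfolding qd_def by (rule joint_law_subdensity[OF sets_G[OF \<tau>] prob_G[OF \<tau>] sets_G[OF T] prob_G[OF T]]) measurable
    also have "\<dots> = ennreal (\<integral>z. g z \<partial>P (\<tau> + \<Delta>))" by (rule nn_integral_eq_integral[OF gi]) (use g0 in auto)
    finally have le: "(\<integral>\<^sup>+z. ennreal (g z * qd \<tau> \<Delta> (snd z)) \<partial>P \<tau>) \<le> ennreal (\<integral>z. g z \<partial>P (\<tau> + \<Delta>))" .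
    have "(\<integral>z. g z * qd \<tau> \<Delta> (snd z) \<partial>P \<tau>) = enn2real (\<integral>\<^sup>+z. ennreal (g z * qd \<tau> \<Delta> (snd z)) \<partial>P \<tau>)"
      by (rule integral_eq_nn_integral) (use g0 qd_nonneg in auto)
    also have "\<dots> \<le> (\<integral>z. g z \<partial>P (\<tau> + \<Delta>))"
      using le g0 by (intro enn2real_leI) auto
    finally show ?thesis .
  qed
  have sp: "sq_integrable (P \<tau>) (p \<Delta>)" if "near \<tau> \<Delta>" for \<Delta>
  proof -
    have "sq_integrable (P \<tau>) (\<lambda>z. 1 + 1/2 * (\<Delta> \<bullet> rhot \<tau> (snd z)) + r \<Delta> z)"
      by (intro sq_integrable_add sq_integrable_const sq_integrable_cmult sl Ir' that)
    then show ?thesis by (simp add: pr[abs_def])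
  qed
  have hp: "sq_integrable (P \<tau>) (\<lambda>z. h \<Delta> z * p \<Delta> z)" "(\<integral>z. (h \<Delta> z * p \<Delta> z)\<^sup>2 \<partial>P \<tau>) \<le> (\<integral>z. (h \<Delta> z)\<^sup>2 \<partial>P (\<tau> + \<Delta>))"
    if \<Delta>: "near \<tau> \<Delta>" and s: "sq_integrable (P \<tau>) (h \<Delta>)" "sq_integrable (P (\<tau> + \<Delta>)) (h \<Delta>)" for \<Delta>
  proof -
    have [measurable]: "h \<Delta> \<in> borel_measurable (P \<tau>)" using s(1) by (rule sq_integrable_measurable)
    have T: "\<tau> + \<Delta> \<in> \<T>" using \<Delta> by (simp add: near_def)
    have e: "(h \<Delta> z * p \<Delta> z)\<^sup>2 = (h \<Delta> z)\<^sup>2 * qd \<tau> \<Delta> (snd z)" for z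
      by (simp add: power_mult_distrib p_def qd_nonneg)
    have i2: "integrable (P (\<tau> + \<Delta>)) (\<lambda>z. (h \<Delta> z)\<^sup>2)" using s(2) by (simp add: sq_integrable_def)
    show "(\<integral>z. (h \<Delta> z * p \<Delta> z)\<^sup>2 \<partial>P \<tau>) \<le> (\<integral>z. (h \<Delta> z)\<^sup>2 \<partial>P (\<tau> + \<Delta>))"
      unfolding e by (rule dom[OF \<Delta> zero_le_power2 i2])
    have "(\<integral>\<^sup>+z. ennreal ((h \<Delta> z)\<^sup>2) * ennreal (qd \<tau> \<Delta> (snd z)) \<partial>P \<tau>) \<le> (\<integral>\<^sup>+z. ennreal ((h \<Delta> z)\<^sup>2) \<partial>P (\<tau> + \<Delta>))"
      unfolding qd_def by (rule joint_law_subdensity[OF sets_G[OF \<tau>] prob_G[OF \<tau>] sets_G[OF T] prob_G[OF T]]) measurable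
    also have "\<dots> < \<infinity>" using i2 nn_integral_eq_integral[OF i2] by simp
    finally have "integrable (P \<tau>) (\<lambda>z. (h \<Delta> z * p \<Delta> z)\<^sup>2)"
      unfolding e using qd_nonneg by (intro integrableI_bounded) (auto simp: ennreal_mult)
    then show "sq_integrable (P \<tau>) (\<lambda>z. h \<Delta> z * p \<Delta> z)" by (simp add: sq_integrable_real_iff)
  qed
  \<comment> \<open>\<open>A1\<close> is the mean over what the subdensity misses, \<open>A2\<close>
    the effect of the quadratic mean remainder, \<open>B i\<close> the effect of replacing sqrt q by
    1 in front of the i-th score.\<close>
  define A1 where "A1 \<Delta> = (\<integral>z. h \<Delta> z \<partial>P (\<tau> + \<Delta>)) - (\<integral>z. h \<Delta> z * qd \<tau> \<Delta> (snd z) \<partial>P \<tau>)" for \<Delta>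
  define A2 where "A2 \<Delta> = (\<integral>z. (h \<Delta> z * p \<Delta> z + h \<Delta> z) * r \<Delta> z \<partial>P \<tau>)" for \<Delta>
  define B where "B i \<Delta> = (\<integral>z. (h \<Delta> z * p \<Delta> z - h \<Delta> z) * (rhot \<tau> (snd z) $ i) \<partial>P \<tau>)" for i \<Delta>
  \<comment> \<open>The missing part has mass o(norm \<Delta> squared), so its integral of h should
    be o(norm \<Delta>) by Cauchy-Schwarz. As that part is not at hand as a measure, domination is
    applied instead to l h^2 + h + 1 / (4 l) and to l h^2 - h + 1 / (4 l); l = \<eta> norm \<Delta>
    balances the two error terms.\<close>
  have A1_bound: "\<bar>A1 \<Delta>\<bar> \<le> norm \<Delta> * (\<eta> * C + \<bar>(mm \<Delta> - 1) / (norm \<Delta>)\<^sup>2\<bar> / (4 * \<eta>))"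
    if g: "near \<tau> \<Delta> \<and> \<Delta> \<noteq> 0 \<and> sq_integrable (P \<tau>) (h \<Delta>) \<and> sq_integrable (P (\<tau> + \<Delta>)) (h \<Delta>)
      \<and> (\<integral>z. (h \<Delta> z)\<^sup>2 \<partial>P \<tau>) \<le> C \<and> (\<integral>z. (h \<Delta> z)\<^sup>2 \<partial>P (\<tau> + \<Delta>)) \<le> C" and \<eta>: "\<eta> > 0" for \<Delta> \<eta>
  proof -
    have \<Delta>: "near \<tau> \<Delta>" "\<Delta> \<noteq> 0" and s: "sq_integrable (P \<tau>) (h \<Delta>)" "sq_integrable (P (\<tau> + \<Delta>)) (h \<Delta>)"
      and le: "(\<integral>z. (h \<Delta> z)\<^sup>2 \<partial>P (\<tau> + \<Delta>)) \<le> C" using g by auto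
    have T: "\<tau> + \<Delta> \<in> \<T>" using \<Delta> by (simp add: near_def)
    interpret P': prob_space "P (\<tau> + \<Delta>)" by (rule prob_space_P[OF T])
    define l where "l = \<eta> * norm \<Delta>"
    have l: "l > 0" using \<eta> \<Delta> by (simp add: l_def)
    have i': "integrable (P (\<tau> + \<Delta>)) (\<lambda>z. (h \<Delta> z)\<^sup>2)" "integrable (P (\<tau> + \<Delta>)) (h \<Delta>)"
      using s(2) P'.sq_integrable_integrable[OF s(2)] by (auto simp: sq_integrable_def)
    have pp: "p \<Delta> z * p \<Delta> z = qd \<tau> \<Delta> (snd z)" for z using qd_nonneg by (simp add: p_def)
    have iq: "integrable (P \<tau>) (\<lambda>z. (h \<Delta> z)\<^sup>2 * qd \<tau> \<Delta> (snd z))" "integrable (P \<tau>) (\<lambda>z. h \<Delta> z * qd \<tau> \<Delta> (snd z))"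
      "integrable (P \<tau>) (\<lambda>z. qd \<tau> \<Delta> (snd z))"
    proof -
      have e1: "(h \<Delta> z * p \<Delta> z) * (h \<Delta> z * p \<Delta> z) = (h \<Delta> z)\<^sup>2 * qd \<tau> \<Delta> (snd z)" for z
        unfolding pp[symmetric] power2_eq_square by (simp only: ac_simps)
      have e2: "(h \<Delta> z * p \<Delta> z) * p \<Delta> z = h \<Delta> z * qd \<tau> \<Delta> (snd z)" for z
        unfolding pp[symmetric] by (simp only: ac_simps)
      note hp1 = hp(1)[OF \<Delta>(1) s] and sp1 = sp[OF \<Delta>(1)]
      show "integrable (P \<tau>) (\<lambda>z. (h \<Delta> z)\<^sup>2 * qd \<tau> \<Delta> (snd z))" using sq_integrable_mult_integrable[OF hp1 hp1] unfolding e1 .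
      show "integrable (P \<tau>) (\<lambda>z. h \<Delta> z * qd \<tau> \<Delta> (snd z))" using sq_integrable_mult_integrable[OF hp1 sp1] unfolding e2 .
      show "integrable (P \<tau>) (\<lambda>z. qd \<tau> \<Delta> (snd z))" using sq_integrable_mult_integrable[OF sp1 sp1] unfolding pp .
    qed
    have side: "\<sigma> * ((\<integral>z. h \<Delta> z * qd \<tau> \<Delta> (snd z) \<partial>P \<tau>) - (\<integral>z. h \<Delta> z \<partial>P (\<tau> + \<Delta>))) \<le> l * C + (1 - mm \<Delta>) / (4 * l)"
      if \<sigma>: "\<sigma> = 1 \<or> \<sigma> = -1" for \<sigma> :: real
    proof -
      \<comment> \<open>Completing the square, where \<sigma>^2 = 1.\<close>
      have nn: "0 \<le> l * (h \<Delta> z)\<^sup>2 + \<sigma> * h \<Delta> z + 1 / (4 * l)" for z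
      proof -
        have "l * (h \<Delta> z)\<^sup>2 + \<sigma> * h \<Delta> z + 1 / (4 * l) = (2 * l * h \<Delta> z + \<sigma>)\<^sup>2 / (4 * l)"
          using l \<sigma> by (auto simp: field_simps power2_eq_square)
        then show ?thesis using l by simp
      qed
      have "(\<integral>z. (l * (h \<Delta> z)\<^sup>2 + \<sigma> * h \<Delta> z + 1 / (4 * l)) * qd \<tau> \<Delta> (snd z) \<partial>P \<tau>)
          \<le> (\<integral>z. l * (h \<Delta> z)\<^sup>2 + \<sigma> * h \<Delta> z + 1 / (4 * l) \<partial>P (\<tau> + \<Delta>))"
        using i' by (intro dom[OF \<Delta>(1) nn]) auto
      also have "\<dots> = l * (\<integral>z. (h \<Delta> z)\<^sup>2 \<partial>P (\<tau> + \<Delta>)) + \<sigma> * (\<integral>z. h \<Delta> z \<partial>P (\<tau> + \<Delta>)) + 1 / (4 * l)"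
        using i' by (simp add: P'.prob_space)
      also have "(\<integral>z. (l * (h \<Delta> z)\<^sup>2 + \<sigma> * h \<Delta> z + 1 / (4 * l)) * qd \<tau> \<Delta> (snd z) \<partial>P \<tau>)
         = l * (\<integral>z. (h \<Delta> z)\<^sup>2 * qd \<tau> \<Delta> (snd z) \<partial>P \<tau>) + \<sigma> * (\<integral>z. h \<Delta> z * qd \<tau> \<Delta> (snd z) \<partial>P \<tau>) + 1 / (4 * l) * mm \<Delta>"
        unfolding Iq[symmetric] distrib_right mult.assoc using iq
        by (simp only: Bochner_Integration.integral_add Bochner_Integration.integrable_add integrable_mult_right integral_mult_right_zero)
      finally have 1: "l * (\<integral>z. (h \<Delta> z)\<^sup>2 * qd \<tau> \<Delta> (snd z) \<partial>P \<tau>) + \<sigma> * (\<integral>z. h \<Delta> z * qd \<tau> \<Delta> (snd z) \<partial>P \<tau>) + 1 / (4 * l) * mm \<Delta>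
        \<le> l * (\<integral>z. (h \<Delta> z)\<^sup>2 \<partial>P (\<tau> + \<Delta>)) + \<sigma> * (\<integral>z. h \<Delta> z \<partial>P (\<tau> + \<Delta>)) + 1 / (4 * l)" .
      have 2: "0 \<le> l * (\<integral>z. (h \<Delta> z)\<^sup>2 * qd \<tau> \<Delta> (snd z) \<partial>P \<tau>)"
        using l qd_nonneg by (intro mult_nonneg_nonneg Bochner_Integration.integral_nonneg) auto
      have 3: "l * (\<integral>z. (h \<Delta> z)\<^sup>2 \<partial>P (\<tau> + \<Delta>)) \<le> l * C" using l le by (intro mult_left_mono) auto
      have 4: "(1 - mm \<Delta>) / (4 * l) = 1 / (4 * l) - 1 / (4 * l) * mm \<Delta>" by (simp add: diff_divide_distrib)
      show ?thesis unfolding right_diff_distrib 4 using 1 2 3 by linarith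
    qed
    have "\<bar>A1 \<Delta>\<bar> \<le> l * C + (1 - mm \<Delta>) / (4 * l)"
      unfolding A1_def using side[of 1] side[of "-1"] by (simp add: abs_le_iff)
    also have "(1 - mm \<Delta>) / (4 * l) = norm \<Delta> * ((1 - mm \<Delta>) / (norm \<Delta>)\<^sup>2 / (4 * \<eta>))"
      using \<Delta> by (simp add: l_def power2_eq_square)
    also have "l * C + norm \<Delta> * ((1 - mm \<Delta>) / (norm \<Delta>)\<^sup>2 / (4 * \<eta>)) \<le> norm \<Delta> * (\<eta> * C + \<bar>(mm \<Delta> - 1) / (norm \<Delta>)\<^sup>2\<bar> / (4 * \<eta>))"
    proof -
      have "(1 - mm \<Delta>) / (norm \<Delta>)\<^sup>2 \<le> \<bar>(mm \<Delta> - 1) / (norm \<Delta>)\<^sup>2\<bar>"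
        using abs_ge_minus_self[of "(mm \<Delta> - 1) / (norm \<Delta>)\<^sup>2"] by (simp add: minus_divide_left)
      then have "norm \<Delta> * ((1 - mm \<Delta>) / (norm \<Delta>)\<^sup>2 / (4 * \<eta>)) \<le> norm \<Delta> * (\<bar>(mm \<Delta> - 1) / (norm \<Delta>)\<^sup>2\<bar> / (4 * \<eta>))"
        using \<eta> by (intro mult_left_mono divide_right_mono) auto
      then show ?thesis by (simp add: l_def distrib_left mult.assoc mult.commute mult.left_commute)
    qed
    finally show ?thesis .
  qed
  have A1lim: "((\<lambda>\<Delta>. A1 \<Delta> / norm \<Delta>) \<longlongrightarrow> 0) (at 0)"
  proof (rule tendstoI)
    fix e :: real assume e: "e > 0"
    \<comment> \<open>Half of e is spent on \<eta> C; the other half is left for the mass defect,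
      which is small for small \<Delta> once \<eta> is fixed.\<close>
    define \<eta> where "\<eta> = e / (2 * (C + 1))"
    have \<eta>: "\<eta> > 0" using e C by (simp add: \<eta>_def)
    have "\<eta> * C < e / 2"
    proof -
      have "\<eta> * C < \<eta> * (C + 1)" using \<eta> by simp
      also have "\<dots> = e / 2" using C by (simp add: \<eta>_def field_simps)
      finally show ?thesis .
    qed
    have "((\<lambda>\<Delta>. \<bar>(mm \<Delta> - 1) / (norm \<Delta>)\<^sup>2\<bar> / (4 * \<eta>)) \<longlongrightarrow> \<bar>0\<bar> / (4 * \<eta>)) (at 0)"
      using \<eta> by (intro tendsto_intros mlim) auto
    then have "\<forall>\<^sub>F \<Delta> in at 0. \<bar>(mm \<Delta> - 1) / (norm \<Delta>)\<^sup>2\<bar> / (4 * \<eta>) < e / 2"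
      using e by (intro order_tendstoD(2)) auto
    with good show "\<forall>\<^sub>F \<Delta> in at 0. dist (A1 \<Delta> / norm \<Delta>) 0 < e"
    proof eventually_elim
      fix \<Delta> assume g: "near \<tau> \<Delta> \<and> \<Delta> \<noteq> 0 \<and> sq_integrable (P \<tau>) (h \<Delta>) \<and> sq_integrable (P (\<tau> + \<Delta>)) (h \<Delta>)
      \<and> (\<integral>z. (h \<Delta> z)\<^sup>2 \<partial>P \<tau>) \<le> C \<and> (\<integral>z. (h \<Delta> z)\<^sup>2 \<partial>P (\<tau> + \<Delta>)) \<le> C"
        and m: "\<bar>(mm \<Delta> - 1) / (norm \<Delta>)\<^sup>2\<bar> / (4 * \<eta>) < e / 2"
      have "\<bar>A1 \<Delta>\<bar> / norm \<Delta> \<le> \<eta> * C + \<bar>(mm \<Delta> - 1) / (norm \<Delta>)\<^sup>2\<bar> / (4 * \<eta>)"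
        using A1_bound[OF g \<eta>] g by (simp add: pos_divide_le_eq mult.commute)
      also have "\<dots> < e" using m \<open>\<eta> * C < e / 2\<close> by linarith
      finally show "dist (A1 \<Delta> / norm \<Delta>) 0 < e" by (simp add: dist_real_def)
    qed
  qed
  have A2lim: "((\<lambda>\<Delta>. A2 \<Delta> / norm \<Delta>) \<longlongrightarrow> 0) (at 0)"
  proof (rule Lim_null_comparison)
    have "((\<lambda>\<Delta>. sqrt (4 * C) * sqrt (R \<Delta> / (norm \<Delta>)\<^sup>2)) \<longlongrightarrow> sqrt (4 * C) * sqrt 0) (at 0)" by (intro tendsto_intros Rlim)
    then show "((\<lambda>\<Delta>. sqrt (4 * C) * sqrt (R \<Delta> / (norm \<Delta>)\<^sup>2)) \<longlongrightarrow> 0) (at 0)" by simp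
    show "\<forall>\<^sub>F \<Delta> in at 0. norm (A2 \<Delta> / norm \<Delta>) \<le> sqrt (4 * C) * sqrt (R \<Delta> / (norm \<Delta>)\<^sup>2)"
      using good
    proof eventually_elim
      fix \<Delta> assume g: "near \<tau> \<Delta> \<and> \<Delta> \<noteq> 0 \<and> sq_integrable (P \<tau>) (h \<Delta>) \<and> sq_integrable (P (\<tau> + \<Delta>)) (h \<Delta>)
        \<and> (\<integral>z. (h \<Delta> z)\<^sup>2 \<partial>P \<tau>) \<le> C \<and> (\<integral>z. (h \<Delta> z)\<^sup>2 \<partial>P (\<tau> + \<Delta>)) \<le> C"
      then have s: "sq_integrable (P \<tau>) (h \<Delta>)" "sq_integrable (P \<tau>) (\<lambda>z. h \<Delta> z * p \<Delta> z)" "sq_integrable (P \<tau>) (r \<Delta>)"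
        and le: "(\<integral>z. (h \<Delta> z)\<^sup>2 \<partial>P \<tau>) \<le> C" "(\<integral>z. (h \<Delta> z * p \<Delta> z)\<^sup>2 \<partial>P \<tau>) \<le> C"
        using hp[of \<Delta>] Ir'[of \<Delta>] by auto
      have "(\<integral>z. (h \<Delta> z * p \<Delta> z + h \<Delta> z)\<^sup>2 \<partial>P \<tau>) \<le> (\<integral>z. 2 * (h \<Delta> z * p \<Delta> z)\<^sup>2 + 2 * (h \<Delta> z)\<^sup>2 \<partial>P \<tau>)"
        using s sq_integrable_add[OF s(2,1)] norm_add_power2_le[of "h \<Delta> _ * p \<Delta> _" "h \<Delta> _"]
        by (intro integral_mono) (auto simp: sq_integrable_real_iff abs_mult power_mult_distrib)
      also have "\<dots> \<le> 4 * C" using s le by (simp add: sq_integrable_real_iff)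
      finally have b: "(\<integral>z. (h \<Delta> z * p \<Delta> z + h \<Delta> z)\<^sup>2 \<partial>P \<tau>) \<le> 4 * C" .
      have "\<bar>A2 \<Delta>\<bar> \<le> sqrt (\<integral>z. (h \<Delta> z * p \<Delta> z + h \<Delta> z)\<^sup>2 \<partial>P \<tau>) * sqrt (R \<Delta>)"
        unfolding A2_def Ir[symmetric] using cauchy_schwarz[OF sq_integrable_add[OF s(2,1)] s(3)] by simp
      also have "\<dots> \<le> sqrt (4 * C) * sqrt (R \<Delta>)"
        using b by (intro mult_right_mono real_sqrt_le_mono) (auto simp: R_def)
      finally have "\<bar>A2 \<Delta>\<bar> / norm \<Delta> \<le> sqrt (4 * C) * sqrt (R \<Delta>) / norm \<Delta>" by (rule divide_right_mono) simp
      then show "norm (A2 \<Delta> / norm \<Delta>) \<le> sqrt (4 * C) * sqrt (R \<Delta> / (norm \<Delta>)\<^sup>2)"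
        by (simp add: real_sqrt_divide)
    qed
  qed
  \<comment> \<open>The function h (sqrt q - 1) is bounded in L2 but need not be small there, h
    being unbounded. Against a bounded test function it is small in L1, since sqrt q - 1 tends to 0
    in L2.\<close>
  have Blim: "(B i \<longlongrightarrow> 0) (at 0)" for i
    unfolding B_def
  proof (rule bounded_test_functions_suffice[where C="4 * C"])
    show "sq_integrable (P \<tau>) (\<lambda>z. rhot \<tau> (snd z) $ i)" by (rule score_component(1)[OF \<tau>])
    show "\<forall>\<^sub>F \<Delta> in at 0. sq_integrable (P \<tau>) (\<lambda>z. h \<Delta> z * p \<Delta> z - h \<Delta> z) \<and> (\<integral>z. (h \<Delta> z * p \<Delta> z - h \<Delta> z)\<^sup>2 \<partial>P \<tau>) \<le> 4 * C"
      using good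
    proof eventually_elim
      fix \<Delta> assume g: "near \<tau> \<Delta> \<and> \<Delta> \<noteq> 0 \<and> sq_integrable (P \<tau>) (h \<Delta>) \<and> sq_integrable (P (\<tau> + \<Delta>)) (h \<Delta>)
        \<and> (\<integral>z. (h \<Delta> z)\<^sup>2 \<partial>P \<tau>) \<le> C \<and> (\<integral>z. (h \<Delta> z)\<^sup>2 \<partial>P (\<tau> + \<Delta>)) \<le> C"
      then have s: "sq_integrable (P \<tau>) (h \<Delta>)" "sq_integrable (P \<tau>) (\<lambda>z. h \<Delta> z * p \<Delta> z)"
        and le: "(\<integral>z. (h \<Delta> z)\<^sup>2 \<partial>P \<tau>) \<le> C" "(\<integral>z. (h \<Delta> z * p \<Delta> z)\<^sup>2 \<partial>P \<tau>) \<le> C"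
        using hp[of \<Delta>] by auto
      have "(\<integral>z. (h \<Delta> z * p \<Delta> z - h \<Delta> z)\<^sup>2 \<partial>P \<tau>) \<le> (\<integral>z. 2 * (h \<Delta> z * p \<Delta> z)\<^sup>2 + 2 * (h \<Delta> z)\<^sup>2 \<partial>P \<tau>)"
        using s sq_integrable_diff[OF s(2,1)] norm_add_power2_le[of "h \<Delta> _ * p \<Delta> _" "- h \<Delta> _"]
        by (intro integral_mono) (auto simp: sq_integrable_real_iff abs_mult power_mult_distrib)
      also have "\<dots> \<le> 4 * C" using s le by (simp add: sq_integrable_real_iff)
      finally show "sq_integrable (P \<tau>) (\<lambda>z. h \<Delta> z * p \<Delta> z - h \<Delta> z) \<and> (\<integral>z. (h \<Delta> z * p \<Delta> z - h \<Delta> z)\<^sup>2 \<partial>P \<tau>) \<le> 4 * C"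
        using sq_integrable_diff[OF s(2,1)] by simp
    qed
    fix K :: nat
    let ?t = "\<lambda>z. if \<bar>rhot \<tau> (snd z) $ i\<bar> \<le> real K then rhot \<tau> (snd z) $ i else 0"
    show "((\<lambda>\<Delta>. \<integral>z. (h \<Delta> z * p \<Delta> z - h \<Delta> z) * ?t z \<partial>P \<tau>) \<longlongrightarrow> 0) (at 0)"
    proof (rule Lim_null_comparison)
      have "((\<lambda>\<Delta>. real K * (sqrt C * sqrt ((norm \<Delta>)\<^sup>2 * N + 2 * R \<Delta>))) \<longlongrightarrow> real K * (sqrt C * sqrt (0\<^sup>2 * N + 2 * 0))) (at 0)"
        by (intro tendsto_intros normlim Rlim0)
      then show "((\<lambda>\<Delta>. real K * (sqrt C * sqrt ((norm \<Delta>)\<^sup>2 * N + 2 * R \<Delta>))) \<longlongrightarrow> 0) (at 0)" by simp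
      show "\<forall>\<^sub>F \<Delta> in at 0. norm (\<integral>z. (h \<Delta> z * p \<Delta> z - h \<Delta> z) * ?t z \<partial>P \<tau>) \<le> real K * (sqrt C * sqrt ((norm \<Delta>)\<^sup>2 * N + 2 * R \<Delta>))"
        using good
      proof eventually_elim
        fix \<Delta> assume g: "near \<tau> \<Delta> \<and> \<Delta> \<noteq> 0 \<and> sq_integrable (P \<tau>) (h \<Delta>) \<and> sq_integrable (P (\<tau> + \<Delta>)) (h \<Delta>)
          \<and> (\<integral>z. (h \<Delta> z)\<^sup>2 \<partial>P \<tau>) \<le> C \<and> (\<integral>z. (h \<Delta> z)\<^sup>2 \<partial>P (\<tau> + \<Delta>)) \<le> C"
        then have s: "sq_integrable (P \<tau>) (h \<Delta>)" and sr: "sq_integrable (P \<tau>) (r \<Delta>)" and le: "(\<integral>z. (h \<Delta> z)\<^sup>2 \<partial>P \<tau>) \<le> C"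
          using Ir'[of \<Delta>] by auto
        have sp1: "sq_integrable (P \<tau>) (\<lambda>z. p \<Delta> z - 1)" using g by (intro sq_integrable_diff sp sq_integrable_const) auto
        have [measurable]: "h \<Delta> \<in> borel_measurable (P \<tau>)" using s by (rule sq_integrable_measurable)
        have [measurable]: "(\<lambda>z. rhot \<tau> (snd z) $ i) \<in> borel_measurable (P \<tau>)"
          by (rule sq_integrable_measurable[OF score_component(1)[OF \<tau>]])
        have i1: "integrable (P \<tau>) (\<lambda>z. h \<Delta> z * (p \<Delta> z - 1))" by (rule sq_integrable_mult_integrable[OF s sp1])
        have tb: "norm ((h \<Delta> z * p \<Delta> z - h \<Delta> z) * ?t z) \<le> real K * \<bar>h \<Delta> z * (p \<Delta> z - 1)\<bar>" for z
        proof -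
          have "norm ((h \<Delta> z * p \<Delta> z - h \<Delta> z) * ?t z) = \<bar>?t z\<bar> * \<bar>h \<Delta> z * (p \<Delta> z - 1)\<bar>"
            by (simp add: abs_mult right_diff_distrib mult.commute)
          also have "\<dots> \<le> real K * \<bar>h \<Delta> z * (p \<Delta> z - 1)\<bar>" by (intro mult_right_mono) auto
          finally show ?thesis .
        qed
        have i2: "integrable (P \<tau>) (\<lambda>z. (h \<Delta> z * p \<Delta> z - h \<Delta> z) * ?t z)"
          by (rule Bochner_Integration.integrable_bound[of _ "\<lambda>z. real K * \<bar>h \<Delta> z * (p \<Delta> z - 1)\<bar>"])
            (use i1 tb in \<open>auto intro!: AE_I2 order_trans[OF tb abs_ge_self]\<close>)
        have "norm (\<integral>z. (h \<Delta> z * p \<Delta> z - h \<Delta> z) * ?t z \<partial>P \<tau>) \<le> (\<integral>z. norm ((h \<Delta> z * p \<Delta> z - h \<Delta> z) * ?t z) \<partial>P \<tau>)"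
          by (rule integral_norm_bound)
        also have "\<dots> \<le> (\<integral>z. real K * \<bar>h \<Delta> z * (p \<Delta> z - 1)\<bar> \<partial>P \<tau>)"
          by (rule integral_mono) (use i1 i2 tb in auto)
        also have "\<dots> = real K * (\<integral>z. \<bar>h \<Delta> z * (p \<Delta> z - 1)\<bar> \<partial>P \<tau>)" by simp
        also have "\<dots> \<le> real K * (sqrt C * sqrt ((norm \<Delta>)\<^sup>2 * N + 2 * R \<Delta>))"
        proof (rule mult_left_mono)
          have "(\<integral>z. \<bar>h \<Delta> z * (p \<Delta> z - 1)\<bar> \<partial>P \<tau>) \<le> sqrt (\<integral>z. (h \<Delta> z)\<^sup>2 \<partial>P \<tau>) * sqrt (\<integral>z. (p \<Delta> z - 1)\<^sup>2 \<partial>P \<tau>)"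
            by (rule cauchy_schwarz_abs[OF s sp1])
          also have "\<dots> \<le> sqrt C * sqrt ((norm \<Delta>)\<^sup>2 * N + 2 * R \<Delta>)"
          proof (intro mult_mono real_sqrt_le_mono le)
            have e: "p \<Delta> z - 1 = \<Delta> \<bullet> rhot \<tau> (snd z) / 2 + r \<Delta> z" for z by (simp add: pr)
            have "(\<integral>z. (p \<Delta> z - 1)\<^sup>2 \<partial>P \<tau>) \<le> (\<integral>z. (\<Delta> \<bullet> rhot \<tau> (snd z))\<^sup>2 / 2 + 2 * (r \<Delta> z)\<^sup>2 \<partial>P \<tau>)"
            proof (rule integral_mono)
              show "integrable (P \<tau>) (\<lambda>z. (p \<Delta> z - 1)\<^sup>2)" using sp1 by (simp add: sq_integrable_real_iff)
              show "integrable (P \<tau>) (\<lambda>z. (\<Delta> \<bullet> rhot \<tau> (snd z))\<^sup>2 / 2 + 2 * (r \<Delta> z)\<^sup>2)"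
                using sl[of \<Delta>] sr by (simp add: sq_integrable_real_iff)
              show "(p \<Delta> z - 1)\<^sup>2 \<le> (\<Delta> \<bullet> rhot \<tau> (snd z))\<^sup>2 / 2 + 2 * (r \<Delta> z)\<^sup>2" for z
              proof -
                have "(a / 2 + b)\<^sup>2 \<le> a\<^sup>2 / 2 + 2 * b\<^sup>2" for a b :: real
                  using zero_le_power2[of "a / 2 - b"] by (simp add: power2_eq_square algebra_simps)
                then show ?thesis unfolding e .
              qed
            qed
            also have "\<dots> = (\<integral>z. (\<Delta> \<bullet> rhot \<tau> (snd z))\<^sup>2 \<partial>P \<tau>) / 2 + 2 * R \<Delta>"
              using sl[of \<Delta>] sr by (simp add: sq_integrable_real_iff Ir)
            also have "\<dots> \<le> (norm \<Delta>)\<^sup>2 * N + 2 * R \<Delta>"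
            proof -
              have "0 \<le> (\<integral>z. (\<Delta> \<bullet> rhot \<tau> (snd z))\<^sup>2 \<partial>P \<tau>)" by simp
              then show ?thesis using lN[of \<Delta>] by linarith
            qed
            finally show "(\<integral>z. (p \<Delta> z - 1)\<^sup>2 \<partial>P \<tau>) \<le> (norm \<Delta>)\<^sup>2 * N + 2 * R \<Delta>" .
          qed (use C in auto)
          finally show "(\<integral>z. \<bar>h \<Delta> z * (p \<Delta> z - 1)\<bar> \<partial>P \<tau>) \<le> sqrt C * sqrt ((norm \<Delta>)\<^sup>2 * N + 2 * R \<Delta>)" .
        qed simp
        finally show "norm (\<integral>z. (h \<Delta> z * p \<Delta> z - h \<Delta> z) * ?t z \<partial>P \<tau>) \<le> real K * (sqrt C * sqrt ((norm \<Delta>)\<^sup>2 * N + 2 * R \<Delta>))" .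
      qed
    qed
  qed
  have Bsum: "((\<lambda>\<Delta>. (\<Sum>i\<in>UNIV. \<Delta> $ i * B i \<Delta>) / 2 / norm \<Delta>) \<longlongrightarrow> 0) (at 0)"
  proof (rule Lim_null_comparison)
    have "((\<lambda>\<Delta>. (\<Sum>i\<in>UNIV. \<bar>B i \<Delta>\<bar>) / 2) \<longlongrightarrow> (\<Sum>i\<in>(UNIV :: 'd set). \<bar>0\<bar>) / 2) (at 0)"
      by (intro tendsto_divide tendsto_sum tendsto_rabs Blim tendsto_const) simp
    then show "((\<lambda>\<Delta>. (\<Sum>i\<in>UNIV. \<bar>B i \<Delta>\<bar>) / 2) \<longlongrightarrow> 0) (at 0)" by simp
    show "\<forall>\<^sub>F \<Delta> in at 0. norm ((\<Sum>i\<in>UNIV. \<Delta> $ i * B i \<Delta>) / 2 / norm \<Delta>) \<le> (\<Sum>i\<in>UNIV. \<bar>B i \<Delta>\<bar>) / 2"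
      using n0
    proof eventually_elim
      fix \<Delta> :: "real ^ 'd" assume z: "\<Delta> \<noteq> 0"
      have "\<bar>\<Sum>i\<in>UNIV. \<Delta> $ i * B i \<Delta>\<bar> \<le> (\<Sum>i\<in>UNIV. \<bar>\<Delta> $ i * B i \<Delta>\<bar>)" by (rule sum_abs)
      also have "\<dots> \<le> (\<Sum>i\<in>UNIV. norm \<Delta> * \<bar>B i \<Delta>\<bar>)"
        unfolding abs_mult by (intro sum_mono mult_right_mono component_le_norm_cart) auto
      finally have "\<bar>\<Sum>i\<in>UNIV. \<Delta> $ i * B i \<Delta>\<bar> \<le> norm \<Delta> * (\<Sum>i\<in>UNIV. \<bar>B i \<Delta>\<bar>)" by (simp add: sum_distrib_left)
      then have "\<bar>\<Sum>i\<in>UNIV. \<Delta> $ i * B i \<Delta>\<bar> / norm \<Delta> \<le> (\<Sum>i\<in>UNIV. \<bar>B i \<Delta>\<bar>)"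
        using z by (simp add: pos_divide_le_eq mult.commute)
      then show "norm ((\<Sum>i\<in>UNIV. \<Delta> $ i * B i \<Delta>) / 2 / norm \<Delta>) \<le> (\<Sum>i\<in>UNIV. \<bar>B i \<Delta>\<bar>) / 2" by simp
    qed
  qed
  have main: "\<forall>\<^sub>F \<Delta> in at 0. A1 \<Delta> + A2 \<Delta> + (\<Sum>i\<in>UNIV. \<Delta> $ i * B i \<Delta>) / 2
     = (\<integral>z. h \<Delta> z \<partial>P (\<tau> + \<Delta>)) - (\<integral>z. h \<Delta> z \<partial>P \<tau>) - (\<integral>z. h \<Delta> z * (\<Delta> \<bullet> rhot \<tau> (snd z)) \<partial>P \<tau>)"
    using good
  proof eventually_elim
    fix \<Delta> assume g: "near \<tau> \<Delta> \<and> \<Delta> \<noteq> 0 \<and> sq_integrable (P \<tau>) (h \<Delta>) \<and> sq_integrable (P (\<tau> + \<Delta>)) (h \<Delta>)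
          \<and> (\<integral>z. (h \<Delta> z)\<^sup>2 \<partial>P \<tau>) \<le> C \<and> (\<integral>z. (h \<Delta> z)\<^sup>2 \<partial>P (\<tau> + \<Delta>)) \<le> C"
    then have s: "sq_integrable (P \<tau>) (h \<Delta>)" "sq_integrable (P \<tau>) (\<lambda>z. h \<Delta> z * p \<Delta> z)" "sq_integrable (P \<tau>) (r \<Delta>)"
      "sq_integrable (P \<tau>) (p \<Delta>)"
      using hp[of \<Delta>] Ir'[of \<Delta>] sp[of \<Delta>] by auto
    let ?l = "\<lambda>z. \<Delta> \<bullet> rhot \<tau> (snd z)"
    have sub: "sq_integrable (P \<tau>) (\<lambda>z. h \<Delta> z * p \<Delta> z - h \<Delta> z)" by (rule sq_integrable_diff[OF s(2,1)])
    have "(\<Sum>i\<in>UNIV. \<Delta> $ i * B i \<Delta>) = (\<integral>z. (\<Sum>i\<in>UNIV. \<Delta> $ i * ((h \<Delta> z * p \<Delta> z - h \<Delta> z) * (rhot \<tau> (snd z) $ i))) \<partial>P \<tau>)"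
      unfolding B_def using sq_integrable_mult_integrable[OF sub score_component(1)[OF \<tau>]]
      by (subst Bochner_Integration.integral_sum) auto
    also have "\<dots> = (\<integral>z. (h \<Delta> z * p \<Delta> z - h \<Delta> z) * ?l z \<partial>P \<tau>)"
      by (simp only: inner_vec_def inner_real_def sum_distrib_left ac_simps)
    finally have Bs: "(\<Sum>i\<in>UNIV. \<Delta> $ i * B i \<Delta>) / 2 = (\<integral>z. 1 / 2 * ((h \<Delta> z * p \<Delta> z - h \<Delta> z) * ?l z) \<partial>P \<tau>)" by simp
    have iA: "integrable (P \<tau>) (\<lambda>z. (h \<Delta> z * p \<Delta> z + h \<Delta> z) * r \<Delta> z)"
      by (rule sq_integrable_mult_integrable[OF sq_integrable_add[OF s(2,1)] s(3)])
    have iB: "integrable (P \<tau>) (\<lambda>z. 1 / 2 * ((h \<Delta> z * p \<Delta> z - h \<Delta> z) * ?l z))"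
      by (intro integrable_mult_right sq_integrable_mult_integrable[OF sub sl])
    have ih: "integrable (P \<tau>) (h \<Delta>)" "integrable (P \<tau>) (\<lambda>z. h \<Delta> z * ?l z)"
      by (rule sq_integrable_integrable[OF s(1)], rule sq_integrable_mult_integrable[OF s(1) sl])
    \<comment> \<open>Since q - 1 = (sqrt q + 1)(sqrt q - 1) and sqrt q - 1 = l / 2 + r, the product
      h q is h + (h sqrt q + h)(l / 2 + r); splitting off h l leaves the factor h sqrt q - h in
      front of l / 2.\<close>
    have q: "h \<Delta> z * qd \<tau> \<Delta> (snd z) = (h \<Delta> z * p \<Delta> z + h \<Delta> z) * r \<Delta> z + 1 / 2 * ((h \<Delta> z * p \<Delta> z - h \<Delta> z) * ?l z) + h \<Delta> z + h \<Delta> z * ?l z" for z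
    proof -
      have "qd \<tau> \<Delta> (snd z) = p \<Delta> z * p \<Delta> z" using qd_nonneg by (simp add: p_def)
      moreover have "r \<Delta> z = p \<Delta> z - 1 - ?l z / 2" by (simp add: pr)
      moreover have "a * (b * b) = (a * b + a) * (b - 1 - c / 2) + 1 / 2 * ((a * b - a) * c) + a + a * c" for a b c :: real
        by (simp add: algebra_simps)
      ultimately show ?thesis by (simp only:)
    qed
    have "(\<integral>z. h \<Delta> z * qd \<tau> \<Delta> (snd z) \<partial>P \<tau>) = A2 \<Delta> + (\<Sum>i\<in>UNIV. \<Delta> $ i * B i \<Delta>) / 2 + (\<integral>z. h \<Delta> z \<partial>P \<tau>) + (\<integral>z. h \<Delta> z * ?l z \<partial>P \<tau>)"
      unfolding q A2_def Bs using iA iB ih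
      by (simp only: Bochner_Integration.integral_add Bochner_Integration.integrable_add)
    then show "A1 \<Delta> + A2 \<Delta> + (\<Sum>i\<in>UNIV. \<Delta> $ i * B i \<Delta>) / 2
     = (\<integral>z. h \<Delta> z \<partial>P (\<tau> + \<Delta>)) - (\<integral>z. h \<Delta> z \<partial>P \<tau>) - (\<integral>z. h \<Delta> z * ?l z \<partial>P \<tau>)" unfolding A1_def by simp
  qed
  have "((\<lambda>\<Delta>. A1 \<Delta> / norm \<Delta> + A2 \<Delta> / norm \<Delta> + (\<Sum>i\<in>UNIV. \<Delta> $ i * B i \<Delta>) / 2 / norm \<Delta>) \<longlongrightarrow> 0 + 0 + 0) (at 0)"
    by (intro tendsto_add A1lim A2lim Bsum)
  then have "((\<lambda>\<Delta>. (A1 \<Delta> + A2 \<Delta> + (\<Sum>i\<in>UNIV. \<Delta> $ i * B i \<Delta>) / 2) / norm \<Delta>) \<longlongrightarrow> 0) (at 0)"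
    by (simp add: add_divide_distrib)
  then show 1: "((\<lambda>\<Delta>. ((\<integral>z. h \<Delta> z \<partial>P (\<tau> + \<Delta>)) - (\<integral>z. h \<Delta> z \<partial>P \<tau>) - (\<integral>z. h \<Delta> z * (\<Delta> \<bullet> rhot \<tau> (snd z)) \<partial>P \<tau>)) / norm \<Delta>) \<longlongrightarrow> 0) (at 0)"
    by (rule Lim_transform_eventually) (use main in \<open>eventually_elim, simp\<close>)
  let ?X = "\<lambda>\<Delta>. (\<integral>z. h \<Delta> z \<partial>P (\<tau> + \<Delta>)) - (\<integral>z. h \<Delta> z \<partial>P \<tau>) - (\<integral>z. h \<Delta> z * (\<Delta> \<bullet> rhot \<tau> (snd z)) \<partial>P \<tau>)"
  have 2: "((\<lambda>\<Delta>. \<integral>z. h \<Delta> z * (\<Delta> \<bullet> rhot \<tau> (snd z)) \<partial>P \<tau>) \<longlongrightarrow> 0) (at 0)"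
  proof (rule Lim_null_comparison)
    have "((\<lambda>\<Delta> :: real ^ 'd. sqrt C * sqrt ((norm \<Delta>)\<^sup>2 * N)) \<longlongrightarrow> sqrt C * sqrt (0\<^sup>2 * N)) (at 0)"
      by (intro tendsto_intros normlim)
    then show "((\<lambda>\<Delta> :: real ^ 'd. sqrt C * sqrt ((norm \<Delta>)\<^sup>2 * N)) \<longlongrightarrow> 0) (at 0)" by simp
    show "\<forall>\<^sub>F \<Delta> in at 0. norm (\<integral>z. h \<Delta> z * (\<Delta> \<bullet> rhot \<tau> (snd z)) \<partial>P \<tau>) \<le> sqrt C * sqrt ((norm \<Delta>)\<^sup>2 * N)"
      using good
    proof eventually_elim
      fix \<Delta> assume g: "near \<tau> \<Delta> \<and> \<Delta> \<noteq> 0 \<and> sq_integrable (P \<tau>) (h \<Delta>) \<and> sq_integrable (P (\<tau> + \<Delta>)) (h \<Delta>)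
          \<and> (\<integral>z. (h \<Delta> z)\<^sup>2 \<partial>P \<tau>) \<le> C \<and> (\<integral>z. (h \<Delta> z)\<^sup>2 \<partial>P (\<tau> + \<Delta>)) \<le> C"
      have "norm (\<integral>z. h \<Delta> z * (\<Delta> \<bullet> rhot \<tau> (snd z)) \<partial>P \<tau>) \<le> sqrt (\<integral>z. (h \<Delta> z)\<^sup>2 \<partial>P \<tau>) * sqrt (\<integral>z. (\<Delta> \<bullet> rhot \<tau> (snd z))\<^sup>2 \<partial>P \<tau>)"
        using cauchy_schwarz[of "P \<tau>" "h \<Delta>", OF _ sl[of \<Delta>]] g by simp
      also have "\<dots> \<le> sqrt C * sqrt ((norm \<Delta>)\<^sup>2 * N)"
        using g C by (intro mult_mono real_sqrt_le_mono lN) auto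
      finally show "norm (\<integral>z. h \<Delta> z * (\<Delta> \<bullet> rhot \<tau> (snd z)) \<partial>P \<tau>) \<le> sqrt C * sqrt ((norm \<Delta>)\<^sup>2 * N)" .
    qed
  qed
  have "((\<lambda>\<Delta>. ?X \<Delta> / norm \<Delta> * norm \<Delta> + (\<integral>z. h \<Delta> z * (\<Delta> \<bullet> rhot \<tau> (snd z)) \<partial>P \<tau>)) \<longlongrightarrow> 0 * 0 + 0) (at 0)"
    by (intro tendsto_add tendsto_mult 1 2 normlim)
  then have "((\<lambda>\<Delta>. ?X \<Delta> / norm \<Delta> * norm \<Delta> + (\<integral>z. h \<Delta> z * (\<Delta> \<bullet> rhot \<tau> (snd z)) \<partial>P \<tau>)) \<longlongrightarrow> 0) (at 0)" by simp
  then show "((\<lambda>\<Delta>. (\<integral>z. h \<Delta> z \<partial>P (\<tau> + \<Delta>)) - (\<integral>z. h \<Delta> z \<partial>P \<tau>)) \<longlongrightarrow> 0) (at 0)"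
    by (rule Lim_transform_eventually) (use n0 in \<open>eventually_elim, simp\<close>)
qed

end

section \<open>Conditional mean utility and scores\<close>

locale utility_model = dqm_mixture \<nu> \<Theta> f \<T> G rhot
  for \<nu> :: "'x measure" and \<Theta> :: "'t measure" and f \<T> and G :: "real ^ 'd \<Rightarrow> 't measure" and rhot +
  fixes u :: "'x \<Rightarrow> 't \<Rightarrow> real" and \<rho> :: "real ^ 'd \<Rightarrow> 'x \<Rightarrow> real ^ 'd" and ubar :: "real ^ 'd \<Rightarrow> 'x \<Rightarrow> real"
  assumes u_measurable: "(\<lambda>z. u (fst z) (snd z)) \<in> borel_measurable (\<nu> \<Otimes>\<^sub>M \<Theta>)"
    and u_sq: "\<And>\<tau>. \<tau> \<in> \<T> \<Longrightarrow> \<exists>\<epsilon>>0. \<exists>C. \<forall>\<tau>'\<in>\<T> \<inter> ball \<tau> \<epsilon>.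
           integrable (joint_law \<nu> f (G \<tau>')) (\<lambda>z. (u (fst z) (snd z))\<^sup>2) \<and>
           (\<integral>z. (u (fst z) (snd z))\<^sup>2 \<partial>joint_law \<nu> f (G \<tau>')) \<le> C"
    and ce_score: "\<And>\<tau> i. \<tau> \<in> \<T> \<Longrightarrow> is_cond_exp_X \<nu> (joint_law \<nu> f (G \<tau>)) (\<lambda>z. rhot \<tau> (snd z) $ i) (\<lambda>x. \<rho> \<tau> x $ i)"
    and ce_u: "\<And>\<tau>. \<tau> \<in> \<T> \<Longrightarrow> is_cond_exp_X \<nu> (joint_law \<nu> f (G \<tau>)) (\<lambda>z. u (fst z) (snd z)) (ubar \<tau>)"
    and ubar_sq: "\<And>\<tau>. \<tau> \<in> \<T> \<Longrightarrow> \<forall>\<^sub>F \<Delta> in at 0. integrable (joint_law \<nu> f (G \<tau>)) (\<lambda>z. (ubar (\<tau> + \<Delta>) (fst z))\<^sup>2)"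
    and ubar_O: "\<And>\<tau>. \<tau> \<in> \<T> \<Longrightarrow> (\<lambda>\<Delta>. \<integral>z. (ubar (\<tau> + \<Delta>) (fst z))\<^sup>2 \<partial>joint_law \<nu> f (G \<tau>)) \<in> O[at 0](\<lambda>_. 1)"
begin

abbreviation uu :: "'x \<times> 't \<Rightarrow> real" where
  "uu z \<equiv> u (fst z) (snd z)"

definition mean_u :: "real ^ 'd \<Rightarrow> real" where
  "mean_u \<tau> = (\<integral>z. uu z \<partial>P \<tau>)"

text \<open>The vector \<gamma> of the theorem. The name anticipates
  \<open>mean_ubar_derivative\<close>: it is the gradient at \<Delta> = 0 of the P \<tau>-mean of
  ubar (\<tau> + \<Delta>).\<close>

definition grad :: "real ^ 'd \<Rightarrow> real ^ 'd" where
  "grad \<tau> = (\<integral>z. uu z *\<^sub>R rhot \<tau> (snd z) - ubar \<tau> (fst z) *\<^sub>R \<rho> \<tau> (fst z) \<partial>P \<tau>)"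

context
  fixes \<tau> :: "real ^ 'd" assumes \<tau>: "\<tau> \<in> \<T>"
begin

lemma score_cond_exp: "cond_exp_X (P \<tau>) \<nu> (\<lambda>z. rhot \<tau> (snd z) $ i) (\<lambda>x. \<rho> \<tau> x $ i)"
  by (intro cond_exp_X.intro cond_exp_X_axioms.intro prob_space_P fst_P ce_score \<tau>)

lemma u_cond_exp: "cond_exp_X (P \<tau>) \<nu> uu (ubar \<tau>)"
  by (intro cond_exp_X.intro cond_exp_X_axioms.intro prob_space_P fst_P ce_u \<tau>)

lemma uu_measurable: "uu \<in> borel_measurable (P \<tau>)"
  using u_measurable unfolding measurable_cong_sets[OF sets_P[OF \<tau>] refl] .

lemma sq_u: "sq_integrable (P \<tau>) uu"
proof -
  from u_sq[OF \<tau>] obtain \<epsilon> where "\<epsilon> > 0" "\<forall>\<tau>'\<in>\<T> \<inter> ball \<tau> \<epsilon>. integrable (P \<tau>') (\<lambda>z. (uu z)\<^sup>2)" by blast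
  then have "integrable (P \<tau>) (\<lambda>z. (uu z)\<^sup>2)" using \<tau> by auto
  then show ?thesis using uu_measurable by (simp add: sq_integrable_real_iff)
qed

lemma ubar_measurable: "ubar \<tau> \<in> borel_measurable \<nu>"
  by (rule cond_exp_X.r_measurable[OF u_cond_exp])

lemma sq_ubar: "sq_integrable (P \<tau>) (\<lambda>z. ubar \<tau> (fst z))"
  by (rule cond_exp_X.sq_integrable_r[OF u_cond_exp sq_u])

lemma \<rho>_component_measurable: "(\<lambda>x. \<rho> \<tau> x $ i) \<in> borel_measurable \<nu>"
  by (rule cond_exp_X.r_measurable[OF score_cond_exp])

lemma sq_\<rho>_component: "sq_integrable (P \<tau>) (\<lambda>z. \<rho> \<tau> (fst z) $ i)"
  by (rule cond_exp_X.sq_integrable_r[OF score_cond_exp score_component(1)[OF \<tau>]])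

lemma inner_sum: "v \<bullet> (x :: real ^ 'd) = (\<Sum>i\<in>UNIV. v $ i * x $ i)"
  by (simp add: inner_vec_def)

lemma \<rho>_measurable: "(\<lambda>x. v \<bullet> \<rho> \<tau> x) \<in> borel_measurable \<nu>"
  unfolding inner_sum by (intro borel_measurable_sum borel_measurable_times borel_measurable_const \<rho>_component_measurable)

lemma sq_\<rho>: "sq_integrable (P \<tau>) (\<lambda>z. v \<bullet> \<rho> \<tau> (fst z))"
  unfolding inner_sum by (intro sq_integrable_sum sq_integrable_cmult sq_\<rho>_component)

lemma score_projection:
  assumes b: "\<beta> \<in> borel_measurable \<nu>" "sq_integrable (P \<tau>) (\<lambda>z. \<beta> (fst z))"
  shows "(\<integral>z. \<beta> (fst z) * (v \<bullet> \<rho> \<tau> (fst z)) \<partial>P \<tau>) = (\<integral>z. \<beta> (fst z) * (v \<bullet> rhot \<tau> (snd z)) \<partial>P \<tau>)"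
proof -
  have i: "integrable (P \<tau>) (\<lambda>z. \<beta> (fst z) * (\<rho> \<tau> (fst z) $ i))" "integrable (P \<tau>) (\<lambda>z. \<beta> (fst z) * (rhot \<tau> (snd z) $ i))" for i
    by (rule sq_integrable_mult_integrable[OF b(2) sq_\<rho>_component], rule sq_integrable_mult_integrable[OF b(2) score_component(1)[OF \<tau>]])
  have e: "b * (v \<bullet> x) = (\<Sum>i\<in>UNIV. v $ i * (b * x $ i))" for b and x :: "real ^ 'd"
    by (simp only: inner_sum sum_distrib_left ac_simps)
  have "(\<integral>z. \<beta> (fst z) * (v \<bullet> \<rho> \<tau> (fst z)) \<partial>P \<tau>) = (\<Sum>i\<in>UNIV. v $ i * (\<integral>z. \<beta> (fst z) * (\<rho> \<tau> (fst z) $ i) \<partial>P \<tau>))"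
    unfolding e using i(1) by (subst Bochner_Integration.integral_sum) auto
  also have "\<dots> = (\<Sum>i\<in>UNIV. v $ i * (\<integral>z. \<beta> (fst z) * (rhot \<tau> (snd z) $ i) \<partial>P \<tau>))"
    using cond_exp_X.integral_mult_sq[OF score_cond_exp score_component(1)[OF \<tau>] b] by simp
  also have "\<dots> = (\<integral>z. \<beta> (fst z) * (v \<bullet> rhot \<tau> (snd z)) \<partial>P \<tau>)"
    unfolding e using i(2) by (subst Bochner_Integration.integral_sum) auto
  finally show ?thesis .
qed

lemma u_projection:
  assumes b: "\<beta> \<in> borel_measurable \<nu>" "sq_integrable (P \<tau>) (\<lambda>z. \<beta> (fst z))"
  shows "(\<integral>z. \<beta> (fst z) * ubar \<tau> (fst z) \<partial>P \<tau>) = (\<integral>z. \<beta> (fst z) * uu z \<partial>P \<tau>)"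
  by (rule cond_exp_X.integral_mult_sq[OF u_cond_exp sq_u b])

lemma \<rho>_mean_zero: "(\<integral>z. v \<bullet> \<rho> \<tau> (fst z) \<partial>P \<tau>) = 0"
proof -
  interpret prob_space "P \<tau>" by (rule prob_space_P[OF \<tau>])
  show ?thesis using score_projection[of "\<lambda>_. 1" v] sq_integrable_const[of "1::real"] score_P(3)[OF \<tau>, of v] by simp
qed

lemma ubar_mean: "(\<integral>z. ubar \<tau> (fst z) \<partial>P \<tau>) = mean_u \<tau>"
  unfolding mean_u_def by (rule cond_exp_X.integral_r[OF u_cond_exp])

lemma sq_integrable_vec:
  fixes w :: "'x \<times> 't \<Rightarrow> real ^ 'd"
  assumes "\<And>i. sq_integrable (P \<tau>) (\<lambda>z. w z $ i)"
  shows "sq_integrable (P \<tau>) w"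
proof -
  have [measurable]: "(\<lambda>z. w z $ i) \<in> borel_measurable (P \<tau>)" for i using assms by (rule sq_integrable_measurable)
  have "w \<in> borel_measurable (P \<tau>)"
    by (subst borel_measurable_euclidean_space) (auto simp: Basis_vec_def inner_axis)
  moreover have "integrable (P \<tau>) (\<lambda>z. \<Sum>i\<in>UNIV. (w z $ i)\<^sup>2)"
    using assms by (intro Bochner_Integration.integrable_sum) (simp add: sq_integrable_real_iff)
  ultimately show ?thesis by (simp add: sq_integrable_def norm_vec_def L2_set_def sum_nonneg)
qed

lemma integrable_scaleR_sq:
  fixes w :: "'x \<times> 't \<Rightarrow> real ^ 'd"
  assumes a: "sq_integrable (P \<tau>) a" and w: "sq_integrable (P \<tau>) w"
  shows "integrable (P \<tau>) (\<lambda>z. a z *\<^sub>R w z)"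
proof (rule Bochner_Integration.integrable_bound)
  show "integrable (P \<tau>) (\<lambda>z. a z * norm (w z))" by (rule sq_integrable_mult_integrable[OF a sq_integrable_norm[OF w]])
  show "(\<lambda>z. a z *\<^sub>R w z) \<in> borel_measurable (P \<tau>)"
    using sq_integrable_measurable[OF a] sq_integrable_measurable[OF w] by measurable
qed (simp add: abs_mult)

lemma inner_grad: "v \<bullet> grad \<tau> = (\<integral>z. uu z * (v \<bullet> rhot \<tau> (snd z)) \<partial>P \<tau>) - (\<integral>z. ubar \<tau> (fst z) * (v \<bullet> \<rho> \<tau> (fst z)) \<partial>P \<tau>)"
proof -
  have sr: "sq_integrable (P \<tau>) (\<lambda>z. rhot \<tau> (snd z))" "sq_integrable (P \<tau>) (\<lambda>z. \<rho> \<tau> (fst z))"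
    by (rule sq_integrable_vec[OF score_component(1)[OF \<tau>]], rule sq_integrable_vec[OF sq_\<rho>_component])
  have i: "integrable (P \<tau>) (\<lambda>z. uu z *\<^sub>R rhot \<tau> (snd z) - ubar \<tau> (fst z) *\<^sub>R \<rho> \<tau> (fst z))"
    by (intro Bochner_Integration.integrable_diff integrable_scaleR_sq sq_u sq_ubar sr)
  have "v \<bullet> grad \<tau> = (\<integral>z. v \<bullet> (uu z *\<^sub>R rhot \<tau> (snd z) - ubar \<tau> (fst z) *\<^sub>R \<rho> \<tau> (fst z)) \<partial>P \<tau>)"
    unfolding grad_def by (rule integral_inner_right[symmetric, OF i])
  also have "\<dots> = (\<integral>z. uu z * (v \<bullet> rhot \<tau> (snd z)) - ubar \<tau> (fst z) * (v \<bullet> \<rho> \<tau> (fst z)) \<partial>P \<tau>)"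
    by (simp only: inner_diff_right inner_scaleR_right)
  also have "\<dots> = (\<integral>z. uu z * (v \<bullet> rhot \<tau> (snd z)) \<partial>P \<tau>) - (\<integral>z. ubar \<tau> (fst z) * (v \<bullet> \<rho> \<tau> (fst z)) \<partial>P \<tau>)"
    by (intro Bochner_Integration.integral_diff sq_integrable_mult_integrable sq_u sq_ubar score_P(2)[OF \<tau>] sq_\<rho>)
  finally show ?thesis .
qed

text \<open>Collects what \<open>mean_expansion\<close> asks of u and of ubar (\<tau> + \<Delta>),
  with one constant. The second moment of ubar (\<tau> + \<Delta>) is bounded under P \<tau> by
  assumption and under P (\<tau> + \<Delta>) by that of u, whose conditional mean it is
  there.\<close>

lemma local_bounds:
  obtains C where "0 \<le> C" "\<forall>\<^sub>F \<Delta> in at 0. \<tau> + \<Delta> \<in> \<T> \<and> sq_integrable (P \<tau>) uu \<and> sq_integrable (P (\<tau> + \<Delta>)) uu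
      \<and> (\<integral>z. (uu z)\<^sup>2 \<partial>P \<tau>) \<le> C \<and> (\<integral>z. (uu z)\<^sup>2 \<partial>P (\<tau> + \<Delta>)) \<le> C
      \<and> sq_integrable (P \<tau>) (\<lambda>z. ubar (\<tau> + \<Delta>) (fst z)) \<and> sq_integrable (P (\<tau> + \<Delta>)) (\<lambda>z. ubar (\<tau> + \<Delta>) (fst z))
      \<and> (\<integral>z. (ubar (\<tau> + \<Delta>) (fst z))\<^sup>2 \<partial>P \<tau>) \<le> C \<and> (\<integral>z. (ubar (\<tau> + \<Delta>) (fst z))\<^sup>2 \<partial>P (\<tau> + \<Delta>)) \<le> C"
proof -
  from u_sq[OF \<tau>] obtain \<epsilon> C1 where \<epsilon>: "\<epsilon> > 0" and C1: "\<And>\<tau>'. \<tau>' \<in> \<T> \<Longrightarrow> \<tau>' \<in> ball \<tau> \<epsilon> \<Longrightarrow> (\<integral>z. (uu z)\<^sup>2 \<partial>P \<tau>') \<le> C1" by blast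
  obtain C2 where C2: "\<forall>\<^sub>F \<Delta> in at 0. norm (\<integral>z. (ubar (\<tau> + \<Delta>) (fst z))\<^sup>2 \<partial>P \<tau>) \<le> C2 * norm (1::real)"
    using ubar_O[OF \<tau>] by (elim landau_o.bigE)
  define C where "C = max (max C1 C2) 0"
  have t: "((\<lambda>\<Delta>. \<tau> + \<Delta>) \<longlongrightarrow> \<tau> + 0) (at 0)" by (intro tendsto_intros)
  have "\<forall>\<^sub>F \<Delta> in at 0. \<tau> + \<Delta> \<in> ball \<tau> \<epsilon>"
    using topological_tendstoD[OF t open_ball[of \<tau> \<epsilon>]] \<epsilon> by simp
  moreover have "\<forall>\<^sub>F \<Delta> in at 0. \<tau> + \<Delta> \<in> \<T>" using topological_tendstoD[OF t open_T] \<tau> by simp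
  ultimately have "\<forall>\<^sub>F \<Delta> in at 0. \<tau> + \<Delta> \<in> \<T> \<and> sq_integrable (P \<tau>) uu \<and> sq_integrable (P (\<tau> + \<Delta>)) uu
      \<and> (\<integral>z. (uu z)\<^sup>2 \<partial>P \<tau>) \<le> C \<and> (\<integral>z. (uu z)\<^sup>2 \<partial>P (\<tau> + \<Delta>)) \<le> C
      \<and> sq_integrable (P \<tau>) (\<lambda>z. ubar (\<tau> + \<Delta>) (fst z)) \<and> sq_integrable (P (\<tau> + \<Delta>)) (\<lambda>z. ubar (\<tau> + \<Delta>) (fst z))
      \<and> (\<integral>z. (ubar (\<tau> + \<Delta>) (fst z))\<^sup>2 \<partial>P \<tau>) \<le> C \<and> (\<integral>z. (ubar (\<tau> + \<Delta>) (fst z))\<^sup>2 \<partial>P (\<tau> + \<Delta>)) \<le> C"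
    using ubar_sq[OF \<tau>] C2
  proof eventually_elim
    fix \<Delta>
    assume b: "\<tau> + \<Delta> \<in> ball \<tau> \<epsilon>" and T: "\<tau> + \<Delta> \<in> \<T>"
      and i: "integrable (P \<tau>) (\<lambda>z. (ubar (\<tau> + \<Delta>) (fst z))\<^sup>2)"
      and le: "norm (\<integral>z. (ubar (\<tau> + \<Delta>) (fst z))\<^sup>2 \<partial>P \<tau>) \<le> C2 * norm (1::real)"
    interpret T: dqm_mixture \<nu> \<Theta> f \<T> G rhot by (rule dqm_mixture_axioms)
    have ce: "cond_exp_X (P (\<tau> + \<Delta>)) \<nu> uu (ubar (\<tau> + \<Delta>))"
      by (intro cond_exp_X.intro cond_exp_X_axioms.intro prob_space_P fst_P ce_u T)
    have su: "sq_integrable (P (\<tau> + \<Delta>)) uu"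
    proof -
      from u_sq[OF T] obtain \<epsilon>' where "\<epsilon>' > 0" "\<forall>\<tau>'\<in>\<T> \<inter> ball (\<tau> + \<Delta>) \<epsilon>'. integrable (P \<tau>') (\<lambda>z. (uu z)\<^sup>2)" by blast
      then have "integrable (P (\<tau> + \<Delta>)) (\<lambda>z. (uu z)\<^sup>2)" using T by auto
      moreover have "uu \<in> borel_measurable (P (\<tau> + \<Delta>))" using u_measurable unfolding measurable_cong_sets[OF sets_P[OF T] refl] .
      ultimately show ?thesis by (simp add: sq_integrable_real_iff)
    qed
    have m: "(\<lambda>z. ubar (\<tau> + \<Delta>) (fst z)) \<in> borel_measurable (P \<tau>)"
      by (rule measurable_compose[OF fst_P[OF \<tau>] cond_exp_X.r_measurable[OF ce]])
    have 1: "sq_integrable (P \<tau>) (\<lambda>z. ubar (\<tau> + \<Delta>) (fst z))" using m i by (simp add: sq_integrable_real_iff)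
    have 2: "(\<integral>z. (uu z)\<^sup>2 \<partial>P \<tau>) \<le> C" using C1[OF \<tau>] \<epsilon> by (auto simp: C_def)
    have 3: "(\<integral>z. (uu z)\<^sup>2 \<partial>P (\<tau> + \<Delta>)) \<le> C" using C1[OF T b] by (auto simp: C_def)
    have 4: "(\<integral>z. (ubar (\<tau> + \<Delta>) (fst z))\<^sup>2 \<partial>P \<tau>) \<le> C" using le by (simp add: C_def)
    have 5: "(\<integral>z. (ubar (\<tau> + \<Delta>) (fst z))\<^sup>2 \<partial>P (\<tau> + \<Delta>)) \<le> C"
      using cond_exp_X.second_moment_le[OF ce su] 3 by linarith
    show "\<tau> + \<Delta> \<in> \<T> \<and> sq_integrable (P \<tau>) uu \<and> sq_integrable (P (\<tau> + \<Delta>)) uu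
      \<and> (\<integral>z. (uu z)\<^sup>2 \<partial>P \<tau>) \<le> C \<and> (\<integral>z. (uu z)\<^sup>2 \<partial>P (\<tau> + \<Delta>)) \<le> C
      \<and> sq_integrable (P \<tau>) (\<lambda>z. ubar (\<tau> + \<Delta>) (fst z)) \<and> sq_integrable (P (\<tau> + \<Delta>)) (\<lambda>z. ubar (\<tau> + \<Delta>) (fst z))
      \<and> (\<integral>z. (ubar (\<tau> + \<Delta>) (fst z))\<^sup>2 \<partial>P \<tau>) \<le> C \<and> (\<integral>z. (ubar (\<tau> + \<Delta>) (fst z))\<^sup>2 \<partial>P (\<tau> + \<Delta>)) \<le> C"
      using T sq_u su 1 2 3 4 5 cond_exp_X.sq_integrable_r[OF ce su] by blast
  qed
  then show ?thesis by (intro that[of C]) (auto simp: C_def)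
qed

end

text \<open>Bounded functions of \<open>X\<close> are tested first: their product with \<open>ubar (\<tau> + \<Delta>)\<close> has the
  \<open>P (\<tau> + \<Delta>)\<close>-mean of their product with \<open>u\<close>.\<close>

lemma ubar_weakly_continuous:
  assumes \<tau>: "\<tau> \<in> \<T>" and r: "r \<in> borel_measurable \<nu>" "sq_integrable (P \<tau>) (\<lambda>z. r (fst z))"
  shows "((\<lambda>\<Delta>. \<integral>z. ubar (\<tau> + \<Delta>) (fst z) * r (fst z) \<partial>P \<tau>) \<longlongrightarrow> (\<integral>z. ubar \<tau> (fst z) * r (fst z) \<partial>P \<tau>)) (at 0)"
proof -
  obtain C where C: "0 \<le> C" and ev: "\<forall>\<^sub>F \<Delta> in at 0. \<tau> + \<Delta> \<in> \<T> \<and> sq_integrable (P \<tau>) uu \<and> sq_integrable (P (\<tau> + \<Delta>)) uu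
      \<and> (\<integral>z. (uu z)\<^sup>2 \<partial>P \<tau>) \<le> C \<and> (\<integral>z. (uu z)\<^sup>2 \<partial>P (\<tau> + \<Delta>)) \<le> C
      \<and> sq_integrable (P \<tau>) (\<lambda>z. ubar (\<tau> + \<Delta>) (fst z)) \<and> sq_integrable (P (\<tau> + \<Delta>)) (\<lambda>z. ubar (\<tau> + \<Delta>) (fst z))
      \<and> (\<integral>z. (ubar (\<tau> + \<Delta>) (fst z))\<^sup>2 \<partial>P \<tau>) \<le> C \<and> (\<integral>z. (ubar (\<tau> + \<Delta>) (fst z))\<^sup>2 \<partial>P (\<tau> + \<Delta>)) \<le> C"
    using local_bounds[OF \<tau>] .
  let ?D = "(\<integral>z. (ubar \<tau> (fst z))\<^sup>2 \<partial>P \<tau>)"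
  have sb: "sq_integrable (P \<tau>) (\<lambda>z. ubar \<tau> (fst z))" by (rule sq_ubar[OF \<tau>])
  have "((\<lambda>\<Delta>. \<integral>z. (ubar (\<tau> + \<Delta>) (fst z) - ubar \<tau> (fst z)) * r (fst z) \<partial>P \<tau>) \<longlongrightarrow> 0) (at 0)"
  proof (rule bounded_test_functions_suffice[OF r(2), where C="2 * C + 2 * ?D"])
    show "\<forall>\<^sub>F \<Delta> in at 0. sq_integrable (P \<tau>) (\<lambda>z. ubar (\<tau> + \<Delta>) (fst z) - ubar \<tau> (fst z)) \<and>
       (\<integral>z. (ubar (\<tau> + \<Delta>) (fst z) - ubar \<tau> (fst z))\<^sup>2 \<partial>P \<tau>) \<le> 2 * C + 2 * ?D"
      using ev
    proof eventually_elim
      fix \<Delta>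
      assume "\<tau> + \<Delta> \<in> \<T> \<and> sq_integrable (P \<tau>) uu \<and> sq_integrable (P (\<tau> + \<Delta>)) uu
      \<and> (\<integral>z. (uu z)\<^sup>2 \<partial>P \<tau>) \<le> C \<and> (\<integral>z. (uu z)\<^sup>2 \<partial>P (\<tau> + \<Delta>)) \<le> C
      \<and> sq_integrable (P \<tau>) (\<lambda>z. ubar (\<tau> + \<Delta>) (fst z)) \<and> sq_integrable (P (\<tau> + \<Delta>)) (\<lambda>z. ubar (\<tau> + \<Delta>) (fst z))
      \<and> (\<integral>z. (ubar (\<tau> + \<Delta>) (fst z))\<^sup>2 \<partial>P \<tau>) \<le> C \<and> (\<integral>z. (ubar (\<tau> + \<Delta>) (fst z))\<^sup>2 \<partial>P (\<tau> + \<Delta>)) \<le> C"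
      then have s: "sq_integrable (P \<tau>) (\<lambda>z. ubar (\<tau> + \<Delta>) (fst z))" and le: "(\<integral>z. (ubar (\<tau> + \<Delta>) (fst z))\<^sup>2 \<partial>P \<tau>) \<le> C" by auto
      have sd: "sq_integrable (P \<tau>) (\<lambda>z. ubar (\<tau> + \<Delta>) (fst z) - ubar \<tau> (fst z))" by (rule sq_integrable_diff[OF s sb])
      have "(\<integral>z. (ubar (\<tau> + \<Delta>) (fst z) - ubar \<tau> (fst z))\<^sup>2 \<partial>P \<tau>) \<le> (\<integral>z. 2 * (ubar (\<tau> + \<Delta>) (fst z))\<^sup>2 + 2 * (ubar \<tau> (fst z))\<^sup>2 \<partial>P \<tau>)"
      proof (rule integral_mono)
        show "integrable (P \<tau>) (\<lambda>z. (ubar (\<tau> + \<Delta>) (fst z) - ubar \<tau> (fst z))\<^sup>2)" using sd by (simp add: sq_integrable_real_iff)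
        show "integrable (P \<tau>) (\<lambda>z. 2 * (ubar (\<tau> + \<Delta>) (fst z))\<^sup>2 + 2 * (ubar \<tau> (fst z))\<^sup>2)" using s sb by (simp add: sq_integrable_real_iff)
        show "(ubar (\<tau> + \<Delta>) (fst z) - ubar \<tau> (fst z))\<^sup>2 \<le> 2 * (ubar (\<tau> + \<Delta>) (fst z))\<^sup>2 + 2 * (ubar \<tau> (fst z))\<^sup>2" for z
          using norm_add_power2_le[of "ubar (\<tau> + \<Delta>) (fst z)" "- ubar \<tau> (fst z)"] by simp
      qed
      also have "\<dots> \<le> 2 * C + 2 * ?D" using s sb le by (simp add: sq_integrable_real_iff)
      finally show "sq_integrable (P \<tau>) (\<lambda>z. ubar (\<tau> + \<Delta>) (fst z) - ubar \<tau> (fst z)) \<and>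
       (\<integral>z. (ubar (\<tau> + \<Delta>) (fst z) - ubar \<tau> (fst z))\<^sup>2 \<partial>P \<tau>) \<le> 2 * C + 2 * ?D" using sd by simp
    qed
    fix K :: nat
    define t where "t x = (if \<bar>r x\<bar> \<le> real K then r x else 0)" for x
    have tm: "t \<in> borel_measurable \<nu>" unfolding t_def using r(1) by measurable
    have tb: "\<bar>t x\<bar> \<le> real K" for x by (simp add: t_def)
    have sqt: "sq_integrable (P \<tau>') (\<lambda>z. g z * t (fst z))" and let_t: "(\<integral>z. (g z * t (fst z))\<^sup>2 \<partial>P \<tau>') \<le> (real K)\<^sup>2 * (\<integral>z. (g z)\<^sup>2 \<partial>P \<tau>')"
      if T': "\<tau>' \<in> \<T>" and g: "sq_integrable (P \<tau>') g" for \<tau>' g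
    proof -
      have [measurable]: "(\<lambda>z. t (fst z)) \<in> borel_measurable (P \<tau>')" by (rule measurable_compose[OF fst_P[OF T'] tm])
      have [measurable]: "g \<in> borel_measurable (P \<tau>')" using g by (rule sq_integrable_measurable)
      show s: "sq_integrable (P \<tau>') (\<lambda>z. g z * t (fst z))"
        by (rule sq_integrable_bound[OF g, where C="real K"]) (auto simp: abs_mult mult.commute[of "real K"] intro!: mult_left_mono tb)
      have "(\<integral>z. (g z * t (fst z))\<^sup>2 \<partial>P \<tau>') \<le> (\<integral>z. (real K)\<^sup>2 * (g z)\<^sup>2 \<partial>P \<tau>')"
      proof (rule integral_mono)
        show "integrable (P \<tau>') (\<lambda>z. (g z * t (fst z))\<^sup>2)" using s by (simp add: sq_integrable_real_iff)
        show "integrable (P \<tau>') (\<lambda>z. (real K)\<^sup>2 * (g z)\<^sup>2)" using g by (simp add: sq_integrable_real_iff)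
        show "(g z * t (fst z))\<^sup>2 \<le> (real K)\<^sup>2 * (g z)\<^sup>2" for z
        proof -
          have "(t (fst z))\<^sup>2 \<le> (real K)\<^sup>2" using tb[of "fst z"] by (simp add: abs_le_square_iff[symmetric])
          from mult_left_mono[OF this zero_le_power2[of "g z"]] show ?thesis by (simp add: power_mult_distrib mult.commute)
        qed
      qed
      then show "(\<integral>z. (g z * t (fst z))\<^sup>2 \<partial>P \<tau>') \<le> (real K)\<^sup>2 * (\<integral>z. (g z)\<^sup>2 \<partial>P \<tau>')" by simp
    qed
    have K0: "0 \<le> (real K)\<^sup>2 * C" using C by simp
    have st: "sq_integrable (P \<tau>') (\<lambda>z. t (fst z))" if "\<tau>' \<in> \<T>" for \<tau>'
    proof -
      interpret prob_space "P \<tau>'" by (rule prob_space_P[OF that])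
      show ?thesis using sqt[OF that sq_integrable_const[of 1]] by simp
    qed
    have A: "((\<lambda>\<Delta>. (\<integral>z. ubar (\<tau> + \<Delta>) (fst z) * t (fst z) \<partial>P (\<tau> + \<Delta>)) - (\<integral>z. ubar (\<tau> + \<Delta>) (fst z) * t (fst z) \<partial>P \<tau>)) \<longlongrightarrow> 0) (at 0)"
    proof (rule mean_expansion(2)[OF \<tau> K0])
      show "\<forall>\<^sub>F \<Delta> in at 0. sq_integrable (P \<tau>) (\<lambda>z. ubar (\<tau> + \<Delta>) (fst z) * t (fst z)) \<and> sq_integrable (P (\<tau> + \<Delta>)) (\<lambda>z. ubar (\<tau> + \<Delta>) (fst z) * t (fst z))
        \<and> (\<integral>z. (ubar (\<tau> + \<Delta>) (fst z) * t (fst z))\<^sup>2 \<partial>P \<tau>) \<le> (real K)\<^sup>2 * C \<and> (\<integral>z. (ubar (\<tau> + \<Delta>) (fst z) * t (fst z))\<^sup>2 \<partial>P (\<tau> + \<Delta>)) \<le> (real K)\<^sup>2 * C"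
        using ev
        by eventually_elim (intro conjI sqt \<tau> order_trans[OF let_t] mult_left_mono; (blast | simp))
    qed
    have B: "((\<lambda>\<Delta>. (\<integral>z. uu z * t (fst z) \<partial>P (\<tau> + \<Delta>)) - (\<integral>z. uu z * t (fst z) \<partial>P \<tau>)) \<longlongrightarrow> 0) (at 0)"
    proof (rule mean_expansion(2)[OF \<tau> K0])
      show "\<forall>\<^sub>F \<Delta> in at 0. sq_integrable (P \<tau>) (\<lambda>z. uu z * t (fst z)) \<and> sq_integrable (P (\<tau> + \<Delta>)) (\<lambda>z. uu z * t (fst z))
        \<and> (\<integral>z. (uu z * t (fst z))\<^sup>2 \<partial>P \<tau>) \<le> (real K)\<^sup>2 * C \<and> (\<integral>z. (uu z * t (fst z))\<^sup>2 \<partial>P (\<tau> + \<Delta>)) \<le> (real K)\<^sup>2 * C"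
        using ev
        by eventually_elim (intro conjI sqt \<tau> order_trans[OF let_t] mult_left_mono; (blast | simp))
    qed
    \<comment> \<open>The means of u t and of ubar (\<tau> + \<Delta>) t under P (\<tau> + \<Delta>)
      are equal. They cancel in the difference of the two continuity statements, and the change of
      ubar under P \<tau> is left.\<close>
    have "((\<lambda>\<Delta>. ((\<integral>z. uu z * t (fst z) \<partial>P (\<tau> + \<Delta>)) - (\<integral>z. uu z * t (fst z) \<partial>P \<tau>))
      - ((\<integral>z. ubar (\<tau> + \<Delta>) (fst z) * t (fst z) \<partial>P (\<tau> + \<Delta>)) - (\<integral>z. ubar (\<tau> + \<Delta>) (fst z) * t (fst z) \<partial>P \<tau>))) \<longlongrightarrow> 0 - 0) (at 0)"
      by (intro tendsto_diff A B)
    moreover have "\<forall>\<^sub>F \<Delta> in at 0. ((\<integral>z. uu z * t (fst z) \<partial>P (\<tau> + \<Delta>)) - (\<integral>z. uu z * t (fst z) \<partial>P \<tau>))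
      - ((\<integral>z. ubar (\<tau> + \<Delta>) (fst z) * t (fst z) \<partial>P (\<tau> + \<Delta>)) - (\<integral>z. ubar (\<tau> + \<Delta>) (fst z) * t (fst z) \<partial>P \<tau>))
      = (\<integral>z. (ubar (\<tau> + \<Delta>) (fst z) - ubar \<tau> (fst z)) * t (fst z) \<partial>P \<tau>)"
      using ev
    proof eventually_elim
      fix \<Delta>
      assume "\<tau> + \<Delta> \<in> \<T> \<and> sq_integrable (P \<tau>) uu \<and> sq_integrable (P (\<tau> + \<Delta>)) uu
      \<and> (\<integral>z. (uu z)\<^sup>2 \<partial>P \<tau>) \<le> C \<and> (\<integral>z. (uu z)\<^sup>2 \<partial>P (\<tau> + \<Delta>)) \<le> C
      \<and> sq_integrable (P \<tau>) (\<lambda>z. ubar (\<tau> + \<Delta>) (fst z)) \<and> sq_integrable (P (\<tau> + \<Delta>)) (\<lambda>z. ubar (\<tau> + \<Delta>) (fst z))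
      \<and> (\<integral>z. (ubar (\<tau> + \<Delta>) (fst z))\<^sup>2 \<partial>P \<tau>) \<le> C \<and> (\<integral>z. (ubar (\<tau> + \<Delta>) (fst z))\<^sup>2 \<partial>P (\<tau> + \<Delta>)) \<le> C"
      then have T: "\<tau> + \<Delta> \<in> \<T>" and s: "sq_integrable (P \<tau>) (\<lambda>z. ubar (\<tau> + \<Delta>) (fst z))" by auto
      have 1: "(\<integral>z. ubar (\<tau> + \<Delta>) (fst z) * t (fst z) \<partial>P (\<tau> + \<Delta>)) = (\<integral>z. uu z * t (fst z) \<partial>P (\<tau> + \<Delta>))"
        using u_projection[OF T tm st[OF T]] by (simp only: mult.commute)
      have 2: "(\<integral>z. ubar \<tau> (fst z) * t (fst z) \<partial>P \<tau>) = (\<integral>z. uu z * t (fst z) \<partial>P \<tau>)"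
        using u_projection[OF \<tau> tm st[OF \<tau>]] by (simp only: mult.commute)
      have "(\<integral>z. (ubar (\<tau> + \<Delta>) (fst z) - ubar \<tau> (fst z)) * t (fst z) \<partial>P \<tau>) = (\<integral>z. ubar (\<tau> + \<Delta>) (fst z) * t (fst z) \<partial>P \<tau>) - (\<integral>z. ubar \<tau> (fst z) * t (fst z) \<partial>P \<tau>)"
        unfolding left_diff_distrib by (intro Bochner_Integration.integral_diff sq_integrable_mult_integrable s sb st[OF \<tau>])
      then show "((\<integral>z. uu z * t (fst z) \<partial>P (\<tau> + \<Delta>)) - (\<integral>z. uu z * t (fst z) \<partial>P \<tau>))
      - ((\<integral>z. ubar (\<tau> + \<Delta>) (fst z) * t (fst z) \<partial>P (\<tau> + \<Delta>)) - (\<integral>z. ubar (\<tau> + \<Delta>) (fst z) * t (fst z) \<partial>P \<tau>))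
      = (\<integral>z. (ubar (\<tau> + \<Delta>) (fst z) - ubar \<tau> (fst z)) * t (fst z) \<partial>P \<tau>)" using 1 2 by linarith
    qed
    ultimately have "((\<lambda>\<Delta>. \<integral>z. (ubar (\<tau> + \<Delta>) (fst z) - ubar \<tau> (fst z)) * t (fst z) \<partial>P \<tau>) \<longlongrightarrow> 0 - 0) (at 0)"
      by (rule Lim_transform_eventually)
    then show "((\<lambda>\<Delta>. \<integral>z. (ubar (\<tau> + \<Delta>) (fst z) - ubar \<tau> (fst z)) * (if \<bar>r (fst z)\<bar> \<le> real K then r (fst z) else 0) \<partial>P \<tau>) \<longlongrightarrow> 0) (at 0)"
      unfolding t_def by simp
  qed
  moreover have "\<forall>\<^sub>F \<Delta> in at 0. (\<integral>z. (ubar (\<tau> + \<Delta>) (fst z) - ubar \<tau> (fst z)) * r (fst z) \<partial>P \<tau>)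
      = (\<integral>z. ubar (\<tau> + \<Delta>) (fst z) * r (fst z) \<partial>P \<tau>) - (\<integral>z. ubar \<tau> (fst z) * r (fst z) \<partial>P \<tau>)"
    using ev
    by eventually_elim (unfold left_diff_distrib, intro Bochner_Integration.integral_diff sq_integrable_mult_integrable sb r(2), blast)
  ultimately have "((\<lambda>\<Delta>. (\<integral>z. ubar (\<tau> + \<Delta>) (fst z) * r (fst z) \<partial>P \<tau>) - (\<integral>z. ubar \<tau> (fst z) * r (fst z) \<partial>P \<tau>)) \<longlongrightarrow> 0) (at 0)"
    by (rule Lim_transform_eventually)
  then show ?thesis by (simp add: LIM_zero_iff)
qed

text \<open>The expansion of ubar (\<tau> + \<Delta>) is subtracted from that of u. The means under
  P (\<tau> + \<Delta>) cancel, and the wanted difference remains, except that the first-order term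
  still contains ubar (\<tau> + \<Delta>) instead of ubar \<tau>; weak continuity tested against the
  components of \<rho> corrects this at a cost of o(norm \<Delta>).\<close>

lemma mean_ubar_derivative:
  assumes \<tau>: "\<tau> \<in> \<T>"
  shows "((\<lambda>\<Delta>. ((\<integral>z. ubar (\<tau> + \<Delta>) (fst z) \<partial>P \<tau>) - mean_u \<tau> - \<Delta> \<bullet> grad \<tau>) / norm \<Delta>) \<longlongrightarrow> 0) (at 0)"
proof -
  obtain C where C: "0 \<le> C" and ev: "\<forall>\<^sub>F \<Delta> in at 0. \<tau> + \<Delta> \<in> \<T> \<and> sq_integrable (P \<tau>) uu \<and> sq_integrable (P (\<tau> + \<Delta>)) uu
      \<and> (\<integral>z. (uu z)\<^sup>2 \<partial>P \<tau>) \<le> C \<and> (\<integral>z. (uu z)\<^sup>2 \<partial>P (\<tau> + \<Delta>)) \<le> C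
      \<and> sq_integrable (P \<tau>) (\<lambda>z. ubar (\<tau> + \<Delta>) (fst z)) \<and> sq_integrable (P (\<tau> + \<Delta>)) (\<lambda>z. ubar (\<tau> + \<Delta>) (fst z))
      \<and> (\<integral>z. (ubar (\<tau> + \<Delta>) (fst z))\<^sup>2 \<partial>P \<tau>) \<le> C \<and> (\<integral>z. (ubar (\<tau> + \<Delta>) (fst z))\<^sup>2 \<partial>P (\<tau> + \<Delta>)) \<le> C"
    using local_bounds[OF \<tau>] .
  have A: "((\<lambda>\<Delta>. ((\<integral>z. ubar (\<tau> + \<Delta>) (fst z) \<partial>P (\<tau> + \<Delta>)) - (\<integral>z. ubar (\<tau> + \<Delta>) (fst z) \<partial>P \<tau>)
      - (\<integral>z. ubar (\<tau> + \<Delta>) (fst z) * (\<Delta> \<bullet> rhot \<tau> (snd z)) \<partial>P \<tau>)) / norm \<Delta>) \<longlongrightarrow> 0) (at 0)"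
    by (rule mean_expansion(1)[OF \<tau> C]) (use ev in \<open>eventually_elim, blast\<close>)
  have B: "((\<lambda>\<Delta>. ((\<integral>z. uu z \<partial>P (\<tau> + \<Delta>)) - (\<integral>z. uu z \<partial>P \<tau>)
      - (\<integral>z. uu z * (\<Delta> \<bullet> rhot \<tau> (snd z)) \<partial>P \<tau>)) / norm \<Delta>) \<longlongrightarrow> 0) (at 0)"
    by (rule mean_expansion(1)[OF \<tau> C]) (use ev in \<open>eventually_elim, blast\<close>)
  define c where "c i \<Delta> = (\<integral>z. ubar (\<tau> + \<Delta>) (fst z) * (\<rho> \<tau> (fst z) $ i) \<partial>P \<tau>) - (\<integral>z. ubar \<tau> (fst z) * (\<rho> \<tau> (fst z) $ i) \<partial>P \<tau>)" for i \<Delta>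
  have clim: "(c i \<longlongrightarrow> 0) (at 0)" for i
    unfolding c_def using ubar_weakly_continuous[OF \<tau> \<rho>_component_measurable[OF \<tau>] sq_\<rho>_component[OF \<tau>]]
    by (simp add: LIM_zero_iff)
  have csum: "((\<lambda>\<Delta>. (\<Sum>i\<in>UNIV. \<Delta> $ i * c i \<Delta>) / norm \<Delta>) \<longlongrightarrow> 0) (at 0)"
  proof (rule Lim_null_comparison)
    have "((\<lambda>\<Delta>. (\<Sum>i\<in>UNIV. \<bar>c i \<Delta>\<bar>)) \<longlongrightarrow> (\<Sum>i\<in>(UNIV :: 'd set). \<bar>0\<bar>)) (at 0)"
      by (intro tendsto_sum tendsto_rabs clim)
    then show "((\<lambda>\<Delta>. (\<Sum>i\<in>UNIV. \<bar>c i \<Delta>\<bar>)) \<longlongrightarrow> 0) (at 0)" by simp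
    show "\<forall>\<^sub>F \<Delta> in at 0. norm ((\<Sum>i\<in>UNIV. \<Delta> $ i * c i \<Delta>) / norm \<Delta>) \<le> (\<Sum>i\<in>UNIV. \<bar>c i \<Delta>\<bar>)"
    proof (intro always_eventually allI)
      fix \<Delta> :: "real ^ 'd"
      have "\<bar>\<Sum>i\<in>UNIV. \<Delta> $ i * c i \<Delta>\<bar> \<le> (\<Sum>i\<in>UNIV. \<bar>\<Delta> $ i * c i \<Delta>\<bar>)" by (rule sum_abs)
      also have "\<dots> \<le> (\<Sum>i\<in>UNIV. norm \<Delta> * \<bar>c i \<Delta>\<bar>)"
        unfolding abs_mult by (intro sum_mono mult_right_mono component_le_norm_cart) auto
      finally have "\<bar>\<Sum>i\<in>UNIV. \<Delta> $ i * c i \<Delta>\<bar> \<le> norm \<Delta> * (\<Sum>i\<in>UNIV. \<bar>c i \<Delta>\<bar>)" by (simp add: sum_distrib_left)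
      then show "norm ((\<Sum>i\<in>UNIV. \<Delta> $ i * c i \<Delta>) / norm \<Delta>) \<le> (\<Sum>i\<in>UNIV. \<bar>c i \<Delta>\<bar>)"
        by (cases "\<Delta> = 0") (simp_all add: pos_divide_le_eq mult.commute sum_nonneg)
    qed
  qed
  have "((\<lambda>\<Delta>. ((\<integral>z. uu z \<partial>P (\<tau> + \<Delta>)) - (\<integral>z. uu z \<partial>P \<tau>) - (\<integral>z. uu z * (\<Delta> \<bullet> rhot \<tau> (snd z)) \<partial>P \<tau>)) / norm \<Delta>
     - ((\<integral>z. ubar (\<tau> + \<Delta>) (fst z) \<partial>P (\<tau> + \<Delta>)) - (\<integral>z. ubar (\<tau> + \<Delta>) (fst z) \<partial>P \<tau>)
      - (\<integral>z. ubar (\<tau> + \<Delta>) (fst z) * (\<Delta> \<bullet> rhot \<tau> (snd z)) \<partial>P \<tau>)) / norm \<Delta>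
     - (\<Sum>i\<in>UNIV. \<Delta> $ i * c i \<Delta>) / norm \<Delta>) \<longlongrightarrow> 0 - 0 - 0) (at 0)"
    by (intro tendsto_diff A B csum)
  then have L: "((\<lambda>\<Delta>. ((\<integral>z. uu z \<partial>P (\<tau> + \<Delta>)) - (\<integral>z. uu z \<partial>P \<tau>) - (\<integral>z. uu z * (\<Delta> \<bullet> rhot \<tau> (snd z)) \<partial>P \<tau>)) / norm \<Delta>
     - ((\<integral>z. ubar (\<tau> + \<Delta>) (fst z) \<partial>P (\<tau> + \<Delta>)) - (\<integral>z. ubar (\<tau> + \<Delta>) (fst z) \<partial>P \<tau>)
      - (\<integral>z. ubar (\<tau> + \<Delta>) (fst z) * (\<Delta> \<bullet> rhot \<tau> (snd z)) \<partial>P \<tau>)) / norm \<Delta>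
     - (\<Sum>i\<in>UNIV. \<Delta> $ i * c i \<Delta>) / norm \<Delta>) \<longlongrightarrow> 0) (at 0)" by simp
  show ?thesis
  proof (rule Lim_transform_eventually[OF L])
    show "\<forall>\<^sub>F \<Delta> in at 0. ((\<integral>z. uu z \<partial>P (\<tau> + \<Delta>)) - (\<integral>z. uu z \<partial>P \<tau>) - (\<integral>z. uu z * (\<Delta> \<bullet> rhot \<tau> (snd z)) \<partial>P \<tau>)) / norm \<Delta>
     - ((\<integral>z. ubar (\<tau> + \<Delta>) (fst z) \<partial>P (\<tau> + \<Delta>)) - (\<integral>z. ubar (\<tau> + \<Delta>) (fst z) \<partial>P \<tau>)
      - (\<integral>z. ubar (\<tau> + \<Delta>) (fst z) * (\<Delta> \<bullet> rhot \<tau> (snd z)) \<partial>P \<tau>)) / norm \<Delta>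
     - (\<Sum>i\<in>UNIV. \<Delta> $ i * c i \<Delta>) / norm \<Delta>
     = ((\<integral>z. ubar (\<tau> + \<Delta>) (fst z) \<partial>P \<tau>) - mean_u \<tau> - \<Delta> \<bullet> grad \<tau>) / norm \<Delta>"
      using ev
    proof eventually_elim
      fix \<Delta>
      assume "\<tau> + \<Delta> \<in> \<T> \<and> sq_integrable (P \<tau>) uu \<and> sq_integrable (P (\<tau> + \<Delta>)) uu
      \<and> (\<integral>z. (uu z)\<^sup>2 \<partial>P \<tau>) \<le> C \<and> (\<integral>z. (uu z)\<^sup>2 \<partial>P (\<tau> + \<Delta>)) \<le> C
      \<and> sq_integrable (P \<tau>) (\<lambda>z. ubar (\<tau> + \<Delta>) (fst z)) \<and> sq_integrable (P (\<tau> + \<Delta>)) (\<lambda>z. ubar (\<tau> + \<Delta>) (fst z))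
      \<and> (\<integral>z. (ubar (\<tau> + \<Delta>) (fst z))\<^sup>2 \<partial>P \<tau>) \<le> C \<and> (\<integral>z. (ubar (\<tau> + \<Delta>) (fst z))\<^sup>2 \<partial>P (\<tau> + \<Delta>)) \<le> C"
      then have T: "\<tau> + \<Delta> \<in> \<T>" and s: "sq_integrable (P \<tau>) (\<lambda>z. ubar (\<tau> + \<Delta>) (fst z))" by auto
      have e1: "(\<integral>z. ubar (\<tau> + \<Delta>) (fst z) \<partial>P (\<tau> + \<Delta>)) = (\<integral>z. uu z \<partial>P (\<tau> + \<Delta>))"
        using ubar_mean[OF T] by (simp add: mean_u_def)
      have e2: "(\<integral>z. ubar (\<tau> + \<Delta>) (fst z) * (\<Delta> \<bullet> rhot \<tau> (snd z)) \<partial>P \<tau>) = (\<integral>z. ubar (\<tau> + \<Delta>) (fst z) * (\<Delta> \<bullet> \<rho> \<tau> (fst z)) \<partial>P \<tau>)"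
        by (rule score_projection[OF \<tau> ubar_measurable[OF T] s, symmetric])
      have e3: "(\<Sum>i\<in>UNIV. \<Delta> $ i * c i \<Delta>) = (\<integral>z. ubar (\<tau> + \<Delta>) (fst z) * (\<Delta> \<bullet> \<rho> \<tau> (fst z)) \<partial>P \<tau>) - (\<integral>z. ubar \<tau> (fst z) * (\<Delta> \<bullet> \<rho> \<tau> (fst z)) \<partial>P \<tau>)"
      proof -
        have "b * (\<Delta> \<bullet> x) = (\<Sum>i\<in>UNIV. \<Delta> $ i * (b * x $ i))" for b and x :: "real ^ 'd"
          by (simp only: inner_vec_def inner_real_def sum_distrib_left ac_simps)
        then have "(\<integral>z. g z * (\<Delta> \<bullet> \<rho> \<tau> (fst z)) \<partial>P \<tau>) = (\<Sum>i\<in>UNIV. \<Delta> $ i * (\<integral>z. g z * (\<rho> \<tau> (fst z) $ i) \<partial>P \<tau>))"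
          if "sq_integrable (P \<tau>) g" for g
          using sq_integrable_mult_integrable[OF that sq_\<rho>_component[OF \<tau>]] by (simp add: Bochner_Integration.integral_sum)
        then show ?thesis using s sq_ubar[OF \<tau>] by (simp add: c_def right_diff_distrib sum_subtractf)
      qed
      show "((\<integral>z. uu z \<partial>P (\<tau> + \<Delta>)) - (\<integral>z. uu z \<partial>P \<tau>) - (\<integral>z. uu z * (\<Delta> \<bullet> rhot \<tau> (snd z)) \<partial>P \<tau>)) / norm \<Delta>
     - ((\<integral>z. ubar (\<tau> + \<Delta>) (fst z) \<partial>P (\<tau> + \<Delta>)) - (\<integral>z. ubar (\<tau> + \<Delta>) (fst z) \<partial>P \<tau>)
      - (\<integral>z. ubar (\<tau> + \<Delta>) (fst z) * (\<Delta> \<bullet> rhot \<tau> (snd z)) \<partial>P \<tau>)) / norm \<Delta>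
     - (\<Sum>i\<in>UNIV. \<Delta> $ i * c i \<Delta>) / norm \<Delta>
     = ((\<integral>z. ubar (\<tau> + \<Delta>) (fst z) \<partial>P \<tau>) - mean_u \<tau> - \<Delta> \<bullet> grad \<tau>) / norm \<Delta>"
        unfolding e1 e2 e3 inner_grad[OF \<tau>] diff_divide_distrib[symmetric] mean_u_def
        by (rule arg_cong[where f="\<lambda>x. x / norm \<Delta>"]) linarith
    qed
  qed
qed

end

section \<open>Convergence in outer probability\<close>

lemma outer_measure_of_Un_le:
  assumes "A \<subseteq> space M" "B \<subseteq> space M"
  shows "outer_measure_of M (A \<union> B) \<le> outer_measure_of M A + outer_measure_of M B"
proof -
  obtain E F where E: "E \<in> sets M" "A \<subseteq> E" "outer_measure_of M A = emeasure M E"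
    and F: "F \<in> sets M" "B \<subseteq> F" "outer_measure_of M B = emeasure M F"
    using outer_measure_of_attain[OF assms(1)] outer_measure_of_attain[OF assms(2)] by blast
  have "outer_measure_of M (A \<union> B) \<le> outer_measure_of M (E \<union> F)" using E F by (intro outer_measure_of_mono) auto
  also have "\<dots> = emeasure M (E \<union> F)" using E F by simp
  also have "\<dots> \<le> emeasure M E + emeasure M F" using E F by (intro emeasure_subadditive)
  finally show ?thesis using E F by simp
qed

lemma ennreal_tendsto_0I:
  fixes f :: "nat \<Rightarrow> ennreal"
  assumes "\<And>r. r > 0 \<Longrightarrow> \<forall>\<^sub>F n in sequentially. f n \<le> ennreal r"
  shows "f \<longlonglongrightarrow> 0"
proof (rule order_tendstoI)
  fix a :: ennreal assume "0 < a"
  then obtain b where b: "0 < b" "b < a" using dense by blast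
  then have "b < \<infinity>" by (metis infinity_ennreal_def order_less_le_trans top_greatest)
  then obtain r where r: "b = ennreal r" "r \<ge> 0" by (cases b) auto
  with b have "r > 0" by (cases "r = 0") auto
  from assms[OF this] show "\<forall>\<^sub>F n in sequentially. f n < a"
    by eventually_elim (use b r in auto)
qed simp

lemma outer_measure_tendsto_0_add:
  assumes sub: "\<forall>\<^sub>F n in sequentially. E n \<subseteq> A n \<union> B n"
    and sp: "\<And>n. A n \<subseteq> space M" "\<And>n. B n \<subseteq> space M"
    and A: "(\<lambda>n. outer_measure_of M (A n)) \<longlonglongrightarrow> 0" and B: "(\<lambda>n. outer_measure_of M (B n)) \<longlonglongrightarrow> 0"
  shows "(\<lambda>n. outer_measure_of M (E n)) \<longlonglongrightarrow> 0"
proof (rule tendsto_sandwich[OF _ _ tendsto_const])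
  show "(\<lambda>n. outer_measure_of M (A n) + outer_measure_of M (B n)) \<longlonglongrightarrow> 0"
    using tendsto_add[OF A B] by simp
  show "\<forall>\<^sub>F n in sequentially. outer_measure_of M (E n) \<le> outer_measure_of M (A n) + outer_measure_of M (B n)"
    using sub
    by eventually_elim (rule order_trans[OF outer_measure_of_mono outer_measure_of_Un_le[OF sp]])
qed simp

text \<open>Sets depending measurably on the first n coordinates have outer measure equal to their
  measure in the n-fold power; this connects the stochastic order conditions with integrals over
  finite powers.\<close>

lemma measure_power_tendsto_0:
  fixes X :: "nat \<Rightarrow> (nat \<Rightarrow> 'a \<times> 'b) \<Rightarrow> real"
  assumes M: "prob_space M" and X: "\<And>n. X n \<in> borel_measurable (power_measure n M)"
    and res: "\<And>n \<omega>. X n (restrict \<omega> {..<n}) = X n \<omega>"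
    and lim: "(\<lambda>n. outer_measure_of (sample_law M) {\<omega> \<in> space (sample_law M). \<epsilon> < X n \<omega>}) \<longlonglongrightarrow> 0"
  shows "(\<lambda>n. measure (power_measure n M) {\<omega> \<in> space (power_measure n M). \<epsilon> < X n \<omega>}) \<longlonglongrightarrow> 0"
proof -
  interpret S: prob_space "sample_law M" by (rule prob_space_sample_law[OF M])
  have rm: "(\<lambda>\<omega>. restrict \<omega> {..<n}) \<in> sample_law M \<rightarrow>\<^sub>M power_measure n M" for n :: nat
    unfolding sample_law_def by (rule measurable_restrict_subset) auto
  have A: "{\<omega> \<in> space (power_measure n M). \<epsilon> < X n \<omega>} \<in> sets (power_measure n M)" for n
    using X[of n] by measurable
  have eq: "{\<omega> \<in> space (sample_law M). restrict \<omega> {..<n} \<in> {\<omega> \<in> space (power_measure n M). \<epsilon> < X n \<omega>}} = {\<omega> \<in> space (sample_law M). \<epsilon> < X n \<omega>}" for n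
    using measurable_space[OF rm[of n]] by (auto simp: res)
  have "{\<omega> \<in> space (sample_law M). \<epsilon> < X n \<omega>} \<in> sets (sample_law M)" for n
  proof -
    have "X n \<in> borel_measurable (sample_law M)" using measurable_compose[OF rm X] by (simp add: res)
    then show ?thesis by measurable
  qed
  then have "outer_measure_of (sample_law M) {\<omega> \<in> space (sample_law M). \<epsilon> < X n \<omega>} = ennreal (measure (power_measure n M) {\<omega> \<in> space (power_measure n M). \<epsilon> < X n \<omega>})" for n
    using measure_sample_law[OF M A[of n]] unfolding eq by (simp add: S.emeasure_eq_measure)
  then show ?thesis using lim by (simp add: ennreal_tendsto_0_iff)
qed

lemma observed_restrict: "observed n (restrict \<omega> {..<n}) = observed n \<omega>"
  by (auto simp: observed_def restrict_def)

lemma utility_sum_restrict: "utility_sum u n (restrict \<omega> {..<n}) = utility_sum u n \<omega>"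
  by (simp add: utility_sum_def)

lemma observed_measurable: "observed n \<in> Pi\<^sub>M {..<n} (\<lambda>_. \<nu> \<Otimes>\<^sub>M \<Theta>) \<rightarrow>\<^sub>M Pi\<^sub>M {..<n} (\<lambda>_. \<nu>)"
  unfolding observed_def
  by (intro measurable_restrict measurable_compose[OF _ measurable_fst[of \<nu> \<Theta>]] measurable_component_singleton)

section \<open>The plug-in estimator\<close>

locale plug_in_model = utility_model \<nu> \<Theta> f \<T> G rhot u \<rho> ubar
  for \<nu> :: "'x measure" and \<Theta> :: "'t measure" and f \<T> and G :: "real ^ 'd \<Rightarrow> 't measure" and rhot u \<rho> ubar +
  fixes tauhat :: "nat \<Rightarrow> (nat \<Rightarrow> 'x) \<Rightarrow> real ^ 'd" and \<kappa> :: "real ^ 'd \<Rightarrow> 'x \<Rightarrow> real ^ 'd"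
  assumes rank_info: "\<And>\<tau>. \<tau> \<in> \<T> \<Longrightarrow> rank (cov_matrix (joint_law \<nu> f (G \<tau>)) (\<lambda>z. \<rho> \<tau> (fst z))) = CARD('d)"
    and tauhat_est: "is_estimator \<nu> tauhat"
    and \<kappa>_meas: "\<And>\<tau>. \<tau> \<in> \<T> \<Longrightarrow> \<kappa> \<tau> \<in> borel_measurable \<nu>"
    and \<kappa>_int: "\<And>\<tau>. \<tau> \<in> \<T> \<Longrightarrow> integrable (joint_law \<nu> f (G \<tau>)) (\<lambda>z. (norm (\<kappa> \<tau> (fst z)))\<^sup>2)"
    and \<kappa>_mean: "\<And>\<tau>. \<tau> \<in> \<T> \<Longrightarrow> (\<integral>z. \<kappa> \<tau> (fst z) \<partial>joint_law \<nu> f (G \<tau>)) = 0"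
    and tauhat_linear: "\<And>\<tau>. \<tau> \<in> \<T> \<Longrightarrow> small_oP (sample_law (joint_law \<nu> f (G \<tau>)))
           (\<lambda>n \<omega>. ereal (norm (tauhat n (observed n \<omega>) - \<tau>
                               - (1 / real n) *\<^sub>R (\<Sum>j<n. \<kappa> \<tau> (fst (\<omega> j))))))
           (\<lambda>n. 1 / sqrt (real n))"
    and \<kappa>_cov: "\<And>\<tau>. \<tau> \<in> \<T> \<Longrightarrow> (\<chi> i j. \<integral>z. \<kappa> \<tau> (fst z) $ i * \<rho> \<tau> (fst z) $ j \<partial>joint_law \<nu> f (G \<tau>)) = mat 1"
    and plug_est: "is_estimator \<nu> (plug_in_sum ubar tauhat)"
    and stoch: "\<And>\<tau> c. \<tau> \<in> \<T> \<Longrightarrow> 0 < c \<Longrightarrow> small_oP (sample_law (joint_law \<nu> f (G \<tau>)))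
           (\<lambda>n \<omega>. SUP \<Delta>\<in>cball 0 (c / sqrt (real n)).
              ereal \<bar>\<Sum>j<n. ubar (\<tau> + \<Delta>) (fst (\<omega> j)) - ubar \<tau> (fst (\<omega> j))
                            - ((\<integral>z. ubar (\<tau> + \<Delta>) (fst z) \<partial>joint_law \<nu> f (G \<tau>)) - (\<integral>z. u (fst z) (snd z) \<partial>joint_law \<nu> f (G \<tau>)))\<bar>)
           (\<lambda>n. sqrt (real n))"
begin

definition Info :: "real ^ 'd \<Rightarrow> real ^ 'd ^ 'd" where
  "Info \<tau> = cov_matrix (P \<tau>) (\<lambda>z. \<rho> \<tau> (fst z))"

text \<open>The least favourable direction: the lower bound obtained along it coincides with the
  variance that \<open>Tstar\<close> attains.\<close>

definition gdir :: "real ^ 'd \<Rightarrow> real ^ 'd" where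
  "gdir \<tau> = matrix_inv (Info \<tau>) *v grad \<tau>"

text \<open>The summands of the linear part of \<open>T - S\<close> when the observable part is \<open>\<Sum>(ubar + b)(X)\<close>.\<close>

definition resid :: "real ^ 'd \<Rightarrow> ('x \<Rightarrow> real) \<Rightarrow> 'x \<times> 't \<Rightarrow> real" where
  "resid \<tau> b z = (ubar \<tau> (fst z) + b (fst z)) - u (fst z) (snd z)"

context
  fixes \<tau> :: "real ^ 'd" assumes \<tau>: "\<tau> \<in> \<T>"
begin

section \<open>Information matrix and influence functions\<close>

lemma Info_entry: "Info \<tau> $ i $ j = (\<integral>z. \<rho> \<tau> (fst z) $ i * \<rho> \<tau> (fst z) $ j \<partial>P \<tau>)"
proof -
  have "(\<integral>z. \<rho> \<tau> (fst z) $ i \<partial>P \<tau>) = 0" for i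
    using \<rho>_mean_zero[OF \<tau>, of "axis i 1"] by (simp add: inner_axis')
  then show ?thesis by (simp add: Info_def cov_matrix_def)
qed

lemma Info_inner: "v \<bullet> (Info \<tau> *v w) = (\<integral>z. (v \<bullet> \<rho> \<tau> (fst z)) * (w \<bullet> \<rho> \<tau> (fst z)) \<partial>P \<tau>)"
proof -
  have i: "integrable (P \<tau>) (\<lambda>z. \<rho> \<tau> (fst z) $ i * \<rho> \<tau> (fst z) $ j)" for i j
    by (rule sq_integrable_mult_integrable[OF sq_\<rho>_component[OF \<tau>] sq_\<rho>_component[OF \<tau>]])
  have "(v \<bullet> x) * (w \<bullet> x) = (\<Sum>i\<in>UNIV. \<Sum>j\<in>UNIV. (v $ i * w $ j) * (x $ i * x $ j))" for x :: "real ^ 'd"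
    by (simp only: inner_vec_def inner_real_def sum_product ac_simps)
  then have "(\<integral>z. (v \<bullet> \<rho> \<tau> (fst z)) * (w \<bullet> \<rho> \<tau> (fst z)) \<partial>P \<tau>)
      = (\<Sum>i\<in>UNIV. \<Sum>j\<in>UNIV. (v $ i * w $ j) * (\<integral>z. \<rho> \<tau> (fst z) $ i * \<rho> \<tau> (fst z) $ j \<partial>P \<tau>))"
    using i by (simp add: Bochner_Integration.integral_sum Bochner_Integration.integrable_sum)
  also have "\<dots> = v \<bullet> (Info \<tau> *v w)"
    by (simp add: Info_entry[symmetric] inner_vec_def matrix_vector_mult_def sum_distrib_left ac_simps)
  finally show ?thesis ..
qed

lemma Info_symmetric: "v \<bullet> (Info \<tau> *v w) = w \<bullet> (Info \<tau> *v v)"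
  unfolding Info_inner by (simp only: mult.commute)

text \<open>\<open>matrix_inv\<close> is a choice that has to be justified: full rank gives
  injectivity, and injectivity a two-sided inverse.\<close>

lemma Info_inverse: "Info \<tau> *v (matrix_inv (Info \<tau>) *v x) = x"
proof -
  have "inj ((*v) (Info \<tau>))" using rank_info[OF \<tau>] unfolding Info_def[symmetric] full_rank_injective .
  then have "invertible (Info \<tau>)" unfolding invertible_left_inverse matrix_left_invertible_injective .
  then have "Info \<tau> ** matrix_inv (Info \<tau>) = mat 1"
    unfolding invertible_def matrix_inv_def by (rule someI2_ex) blast
  then show ?thesis by (simp add: matrix_vector_mul_assoc)
qed

lemma Info_gdir: "Info \<tau> *v gdir \<tau> = grad \<tau>"
  unfolding gdir_def by (rule Info_inverse)

lemma inverse_inner_grad: "(matrix_inv (Info \<tau>) *v x) \<bullet> grad \<tau> = x \<bullet> gdir \<tau>"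
proof -
  have "(matrix_inv (Info \<tau>) *v x) \<bullet> grad \<tau> = gdir \<tau> \<bullet> (Info \<tau> *v (matrix_inv (Info \<tau>) *v x))"
    unfolding Info_gdir[symmetric] by (rule Info_symmetric)
  then show ?thesis by (simp add: Info_inverse inner_commute)
qed

lemma score_cov_gdir: "(\<integral>z. (gdir \<tau> \<bullet> \<rho> \<tau> (fst z)) * (v \<bullet> \<rho> \<tau> (fst z)) \<partial>P \<tau>) = v \<bullet> grad \<tau>"
  unfolding Info_gdir[symmetric] Info_inner by (simp only: mult.commute)

lemma sq_\<kappa>_vec: "sq_integrable (P \<tau>) (\<lambda>z. \<kappa> \<tau> (fst z))"
  using \<kappa>_int[OF \<tau>] measurable_compose[OF fst_P[OF \<tau>] \<kappa>_meas[OF \<tau>]] by (simp add: sq_integrable_def)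

lemma \<kappa>_measurable: "(\<lambda>x. v \<bullet> \<kappa> \<tau> x) \<in> borel_measurable \<nu>"
  using \<kappa>_meas[OF \<tau>] by measurable

lemma sq_\<kappa>: "sq_integrable (P \<tau>) (\<lambda>z. v \<bullet> \<kappa> \<tau> (fst z))"
  using measurable_compose[OF fst_P[OF \<tau>] \<kappa>_measurable]
  by (rule sq_integrable_bound[OF sq_\<kappa>_vec, where C="norm v"]) (simp add: Cauchy_Schwarz_ineq2)

lemma \<kappa>_mean_zero: "(\<integral>z. v \<bullet> \<kappa> \<tau> (fst z) \<partial>P \<tau>) = 0"
proof -
  interpret prob_space "P \<tau>" by (rule prob_space_P[OF \<tau>])
  have "integrable (P \<tau>) (\<lambda>z. \<kappa> \<tau> (fst z))"
    using integrable_scaleR_sq[OF \<tau> sq_integrable_const[of 1] sq_\<kappa>_vec] by simp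
  then show ?thesis using \<kappa>_mean[OF \<tau>] by (simp add: integral_inner_right)
qed

lemma \<kappa>_score: "(\<integral>z. (v \<bullet> \<kappa> \<tau> (fst z)) * (w \<bullet> \<rho> \<tau> (fst z)) \<partial>P \<tau>) = v \<bullet> w"
proof -
  have sk: "sq_integrable (P \<tau>) (\<lambda>z. \<kappa> \<tau> (fst z) $ i)" for i
    using sq_\<kappa>[of "axis i 1"] by (simp add: inner_axis')
  have i: "integrable (P \<tau>) (\<lambda>z. \<kappa> \<tau> (fst z) $ i * \<rho> \<tau> (fst z) $ j)" for i j
    by (rule sq_integrable_mult_integrable[OF sk sq_\<rho>_component[OF \<tau>]])
  have kc: "(\<integral>z. \<kappa> \<tau> (fst z) $ i * \<rho> \<tau> (fst z) $ j \<partial>P \<tau>) = (if i = j then 1 else 0)" for i j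
    using arg_cong[OF \<kappa>_cov[OF \<tau>], of "\<lambda>A. A $ i $ j"] by (simp add: mat_def)
  have "(v \<bullet> x) * (w \<bullet> y) = (\<Sum>i\<in>UNIV. \<Sum>j\<in>UNIV. (v $ i * w $ j) * (x $ i * y $ j))" for x y :: "real ^ 'd"
    by (simp only: inner_vec_def inner_real_def sum_product ac_simps)
  then have "(\<integral>z. (v \<bullet> \<kappa> \<tau> (fst z)) * (w \<bullet> \<rho> \<tau> (fst z)) \<partial>P \<tau>)
      = (\<Sum>i\<in>UNIV. \<Sum>j\<in>UNIV. (v $ i * w $ j) * (\<integral>z. \<kappa> \<tau> (fst z) $ i * \<rho> \<tau> (fst z) $ j \<partial>P \<tau>))"
    using i by (simp add: Bochner_Integration.integral_sum Bochner_Integration.integrable_sum)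
  also have "\<dots> = (\<Sum>i\<in>UNIV. \<Sum>j\<in>UNIV. (v $ i * w $ j) * (if i = j then 1 else 0))"
    unfolding kc ..
  also have "(\<Sum>i\<in>UNIV. \<Sum>j\<in>UNIV. (v $ i * w $ j) * (if i = j then 1 else 0)) = v \<bullet> w"
    by (simp add: inner_vec_def if_distrib cong: if_cong)
  finally show ?thesis .
qed

text \<open>By \<open>inner_grad\<close>, ubar - u has covariance - a \<bullet> \<gamma> with the
  score in direction a. Any correction b(X) whose covariance with the scores is \<gamma> therefore
  makes the residual orthogonal to all of them, which is what regularity rests on.\<close>

lemma resid_facts:
  assumes b: "b \<in> borel_measurable \<nu>" "sq_integrable (P \<tau>) (\<lambda>z. b (fst z))" "(\<integral>z. b (fst z) \<partial>P \<tau>) = 0"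
    and bs: "\<And>a. (\<integral>z. b (fst z) * (a \<bullet> \<rho> \<tau> (fst z)) \<partial>P \<tau>) = a \<bullet> grad \<tau>"
  shows "sq_integrable (P \<tau>) (resid \<tau> b)" "(\<integral>z. resid \<tau> b z \<partial>P \<tau>) = 0"
    "(\<integral>z. resid \<tau> b z * (a \<bullet> rhot \<tau> (snd z)) \<partial>P \<tau>) = 0"
proof -
  interpret prob_space "P \<tau>" by (rule prob_space_P[OF \<tau>])
  note su = sq_u[OF \<tau>] and sub = sq_ubar[OF \<tau>] and sl = score_P(2)[OF \<tau>]
  show "sq_integrable (P \<tau>) (resid \<tau> b)" unfolding resid_def[abs_def]
    by (intro sq_integrable_add sq_integrable_diff su sub b)
  have "(\<integral>z. resid \<tau> b z \<partial>P \<tau>) = (\<integral>z. ubar \<tau> (fst z) \<partial>P \<tau>) + (\<integral>z. b (fst z) \<partial>P \<tau>) - (\<integral>z. uu z \<partial>P \<tau>)"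
    unfolding resid_def using sq_integrable_integrable[OF su] sq_integrable_integrable[OF sub] sq_integrable_integrable[OF b(2)] by simp
  then show "(\<integral>z. resid \<tau> b z \<partial>P \<tau>) = 0" using ubar_mean[OF \<tau>] b(3) by (simp add: mean_u_def)
  have "(\<integral>z. resid \<tau> b z * (a \<bullet> rhot \<tau> (snd z)) \<partial>P \<tau>) = (\<integral>z. ubar \<tau> (fst z) * (a \<bullet> rhot \<tau> (snd z)) \<partial>P \<tau>)
     + (\<integral>z. b (fst z) * (a \<bullet> rhot \<tau> (snd z)) \<partial>P \<tau>) - (\<integral>z. uu z * (a \<bullet> rhot \<tau> (snd z)) \<partial>P \<tau>)"
    unfolding resid_def distrib_right left_diff_distrib
    using sq_integrable_mult_integrable[OF su sl] sq_integrable_mult_integrable[OF sub sl] sq_integrable_mult_integrable[OF b(2) sl]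
    by simp
  also have "(\<integral>z. ubar \<tau> (fst z) * (a \<bullet> rhot \<tau> (snd z)) \<partial>P \<tau>) = (\<integral>z. ubar \<tau> (fst z) * (a \<bullet> \<rho> \<tau> (fst z)) \<partial>P \<tau>)"
    by (rule score_projection[OF \<tau> ubar_measurable[OF \<tau>] sub, symmetric])
  also have "(\<integral>z. b (fst z) * (a \<bullet> rhot \<tau> (snd z)) \<partial>P \<tau>) = a \<bullet> grad \<tau>"
    using score_projection[OF \<tau> b(1,2), of a] bs[of a] by simp
  finally show "(\<integral>z. resid \<tau> b z * (a \<bullet> rhot \<tau> (snd z)) \<partial>P \<tau>) = 0"
    using inner_grad[OF \<tau>, of a] by simp
qed

text \<open>\<open>bstar\<close> and \<open>bhat\<close> are the corrections \<gamma> \<bullet>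
  \<kappa>star and \<gamma> \<bullet> \<kappa>, belonging to the efficient and to the given
  influence function; the first is written with \<open>gdir\<close>, using the symmetry of the
  information.\<close>

definition bstar :: "'x \<Rightarrow> real" where "bstar x = gdir \<tau> \<bullet> \<rho> \<tau> x"
definition bhat :: "'x \<Rightarrow> real" where "bhat x = grad \<tau> \<bullet> \<kappa> \<tau> x"

lemma bstar_facts: "bstar \<in> borel_measurable \<nu>" "sq_integrable (P \<tau>) (\<lambda>z. bstar (fst z))" "(\<integral>z. bstar (fst z) \<partial>P \<tau>) = 0"
    "(\<integral>z. bstar (fst z) * (a \<bullet> \<rho> \<tau> (fst z)) \<partial>P \<tau>) = a \<bullet> grad \<tau>"
  unfolding bstar_def[abs_def] by (rule \<rho>_measurable[OF \<tau>] sq_\<rho>[OF \<tau>] \<rho>_mean_zero[OF \<tau>] score_cov_gdir)+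

lemma bhat_facts: "bhat \<in> borel_measurable \<nu>" "sq_integrable (P \<tau>) (\<lambda>z. bhat (fst z))" "(\<integral>z. bhat (fst z) \<partial>P \<tau>) = 0"
    "(\<integral>z. bhat (fst z) * (a \<bullet> \<rho> \<tau> (fst z)) \<partial>P \<tau>) = a \<bullet> grad \<tau>"
  unfolding bhat_def[abs_def] by (rule \<kappa>_measurable sq_\<kappa> \<kappa>_mean_zero \<kappa>_score[THEN trans, OF inner_commute])+

lemmas resid_bstar = resid_facts[OF bstar_facts]
lemmas resid_bhat = resid_facts[OF bhat_facts]

text \<open>The variance that the choice of \<kappa> adds: both corrections are centred, so this
  second moment is the second variance in the statement.\<close>

definition excess :: real where
  "excess = (\<integral>z. (bhat (fst z) - bstar (fst z))\<^sup>2 \<partial>P \<tau>)"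

definition vstar :: real where "vstar = (\<integral>z. (resid \<tau> bstar z)\<^sup>2 \<partial>P \<tau>)"

text \<open>Pythagoras. The difference of the two corrections depends on X, hence is orthogonal to
  ubar - u; and it is orthogonal to \<open>bstar\<close>, a linear combination of components of
  \<rho>, because both corrections have the same covariance with \<rho>.\<close>

lemma second_moment_resid_bhat: "(\<integral>z. (resid \<tau> bhat z)\<^sup>2 \<partial>P \<tau>) = vstar + excess"
proof -
  define c where "c x = bhat x - bstar x" for x
  have cm: "c \<in> borel_measurable \<nu>" unfolding c_def using bhat_facts(1) bstar_facts(1) by measurable
  have sc: "sq_integrable (P \<tau>) (\<lambda>z. c (fst z))" unfolding c_def by (intro sq_integrable_diff bhat_facts bstar_facts)
  note su = sq_u[OF \<tau>] and sub = sq_ubar[OF \<tau>]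
  have i: "integrable (P \<tau>) (\<lambda>z. (resid \<tau> bstar z)\<^sup>2)" "integrable (P \<tau>) (\<lambda>z. (c (fst z))\<^sup>2)" "integrable (P \<tau>) (\<lambda>z. resid \<tau> bstar z * c (fst z))"
    using resid_bstar(1) sc sq_integrable_mult_integrable[OF resid_bstar(1) sc] by (simp_all add: sq_integrable_real_iff)
  have j: "integrable (P \<tau>) (\<lambda>z. c (fst z) * ubar \<tau> (fst z))" "integrable (P \<tau>) (\<lambda>z. c (fst z) * uu z)" "integrable (P \<tau>) (\<lambda>z. bstar (fst z) * c (fst z))"
    by (rule sq_integrable_mult_integrable[OF sc sub] sq_integrable_mult_integrable[OF sc su] sq_integrable_mult_integrable[OF bstar_facts(2) sc])+
  have "resid \<tau> bstar z * c (fst z) = c (fst z) * ubar \<tau> (fst z) - c (fst z) * uu z + bstar (fst z) * c (fst z)" for z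
    by (simp add: resid_def algebra_simps)
  then have "(\<integral>z. resid \<tau> bstar z * c (fst z) \<partial>P \<tau>) = (\<integral>z. c (fst z) * ubar \<tau> (fst z) \<partial>P \<tau>) - (\<integral>z. c (fst z) * uu z \<partial>P \<tau>) + (\<integral>z. bstar (fst z) * c (fst z) \<partial>P \<tau>)"
    using j by simp
  also have "(\<integral>z. c (fst z) * ubar \<tau> (fst z) \<partial>P \<tau>) = (\<integral>z. c (fst z) * uu z \<partial>P \<tau>)" by (rule u_projection[OF \<tau> cm sc])
  also have "(\<integral>z. bstar (fst z) * c (fst z) \<partial>P \<tau>) = (\<integral>z. bhat (fst z) * bstar (fst z) \<partial>P \<tau>) - (\<integral>z. bstar (fst z) * bstar (fst z) \<partial>P \<tau>)"
    unfolding c_def right_diff_distrib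
    using sq_integrable_mult_integrable[OF bstar_facts(2) bhat_facts(2)] sq_integrable_mult_integrable[OF bstar_facts(2) bstar_facts(2)]
    by (simp add: mult.commute)
  also have "\<dots> = 0" using bhat_facts(4)[of "gdir \<tau>"] bstar_facts(4)[of "gdir \<tau>"] unfolding bstar_def[symmetric] by simp
  finally have cross: "(\<integral>z. resid \<tau> bstar z * c (fst z) \<partial>P \<tau>) = 0" by simp
  have "(resid \<tau> bhat z)\<^sup>2 = (resid \<tau> bstar z)\<^sup>2 + (c (fst z))\<^sup>2 + 2 * (resid \<tau> bstar z * c (fst z))" for z
  proof -
    have "resid \<tau> bhat z = resid \<tau> bstar z + c (fst z)" by (simp add: resid_def c_def)
    then show ?thesis by (simp add: power2_sum)
  qed
  then have "(\<integral>z. (resid \<tau> bhat z)\<^sup>2 \<partial>P \<tau>) = (\<integral>z. (resid \<tau> bstar z)\<^sup>2 \<partial>P \<tau>) + (\<integral>z. (c (fst z))\<^sup>2 \<partial>P \<tau>) + 2 * (\<integral>z. resid \<tau> bstar z * c (fst z) \<partial>P \<tau>)"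
    using i by simp
  then show ?thesis unfolding cross by (simp add: vstar_def excess_def c_def)
qed

section \<open>Linearization of the plug-in sum\<close>

abbreviation S :: "(nat \<Rightarrow> 'x \<times> 't) measure" where "S \<equiv> sample_law (P \<tau>)"

lemma sets_power: "sets (power_measure n (P \<tau>)) = sets (Pi\<^sub>M {..<n} (\<lambda>_. \<nu> \<Otimes>\<^sub>M \<Theta>))"
  by (intro sets_PiM_cong sets_P \<tau> refl)

text \<open>Chebyshev's inequality for the squared norm, summed over components. Outer measure is
  used so that the bound combines with the two stochastic order conditions.\<close>

lemma \<kappa>_tail_bound:
  assumes c: "c > 0" and n: "n > 0"
  shows "outer_measure_of S {\<omega> \<in> space S. c * sqrt (real n) < norm (\<Sum>j<n. \<kappa> \<tau> (fst (\<omega> j)))}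
     \<le> ennreal ((\<integral>z. (norm (\<kappa> \<tau> (fst z)))\<^sup>2 \<partial>P \<tau>) / c\<^sup>2)"
proof -
  interpret prob_space "P \<tau>" by (rule prob_space_P[OF \<tau>])
  interpret S: prob_space S by (rule prob_space_sample_law[OF prob_space_axioms])
  interpret PW: prob_space "power_measure n (P \<tau>)" by (rule prob_space_power)
  have sk: "sq_integrable (P \<tau>) (\<lambda>z. \<kappa> \<tau> (fst z) $ i)" and k0: "(\<integral>z. \<kappa> \<tau> (fst z) $ i \<partial>P \<tau>) = 0" for i
    using sq_\<kappa>[of "axis i 1"] \<kappa>_mean_zero[of "axis i 1"] by (simp_all add: inner_axis')
  define Y where "Y \<omega> = (\<Sum>i\<in>UNIV. (\<Sum>j<n. \<kappa> \<tau> (fst (\<omega> j)) $ i)\<^sup>2)" for \<omega> :: "nat \<Rightarrow> 'x \<times> 't"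
  have Yn: "Y \<omega> = (norm (\<Sum>j<n. \<kappa> \<tau> (fst (\<omega> j))))\<^sup>2" for \<omega>
    by (simp add: Y_def norm_vec_def L2_set_def sum_nonneg)
  have Yi: "integrable (power_measure n (P \<tau>)) Y"
    unfolding Y_def by (intro Bochner_Integration.integrable_sum power_second_moment(1) sk k0) simp
  have "(\<integral>\<omega>. Y \<omega> \<partial>power_measure n (P \<tau>)) = (\<Sum>i\<in>UNIV. real n * (\<integral>z. (\<kappa> \<tau> (fst z) $ i)\<^sup>2 \<partial>P \<tau>))"
    unfolding Y_def using power_second_moment[OF sk k0 finite_lessThan[of n]] by (simp add: Bochner_Integration.integral_sum)
  also have "\<dots> = real n * (\<Sum>i\<in>UNIV. \<integral>z. (\<kappa> \<tau> (fst z) $ i)\<^sup>2 \<partial>P \<tau>)" by (simp add: sum_distrib_left)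
  also have "(\<Sum>i\<in>UNIV. \<integral>z. (\<kappa> \<tau> (fst z) $ i)\<^sup>2 \<partial>P \<tau>) = (\<integral>z. (norm (\<kappa> \<tau> (fst z)))\<^sup>2 \<partial>P \<tau>)"
    using sk by (subst Bochner_Integration.integral_sum[symmetric]) (auto simp: sq_integrable_real_iff norm_vec_def L2_set_def sum_nonneg)
  finally have EY: "(\<integral>\<omega>. Y \<omega> \<partial>power_measure n (P \<tau>)) = real n * (\<integral>z. (norm (\<kappa> \<tau> (fst z)))\<^sup>2 \<partial>P \<tau>)" .
  let ?A = "{\<omega> \<in> space (power_measure n (P \<tau>)). Y \<omega> \<ge> c\<^sup>2 * real n}"
  have A: "?A \<in> sets (power_measure n (P \<tau>))" using Yi by measurable
  have "measure (power_measure n (P \<tau>)) ?A \<le> (\<integral>\<omega>. Y \<omega> \<partial>power_measure n (P \<tau>)) / (c\<^sup>2 * real n)"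
  proof (rule integral_Markov_inequality_measure[where A="{}"])
    show "AE \<omega> in power_measure n (P \<tau>). 0 \<le> Y \<omega>" by (simp add: Yn)
  qed (use Yi c n in auto)
  also have "\<dots> = (\<integral>z. (norm (\<kappa> \<tau> (fst z)))\<^sup>2 \<partial>P \<tau>) / c\<^sup>2" using n by (simp add: EY)
  finally have le: "measure (power_measure n (P \<tau>)) ?A \<le> (\<integral>z. (norm (\<kappa> \<tau> (fst z)))\<^sup>2 \<partial>P \<tau>) / c\<^sup>2" .
  have rm: "(\<lambda>\<omega>. restrict \<omega> {..<n}) \<in> S \<rightarrow>\<^sub>M power_measure n (P \<tau>)"
    unfolding sample_law_def by (rule measurable_restrict_subset) auto
  have AS: "{\<omega> \<in> space S. restrict \<omega> {..<n} \<in> ?A} \<in> sets S" using measurable_sets[OF rm A] by (simp add: vimage_def Int_def conj_commute)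
  have sub: "{\<omega> \<in> space S. c * sqrt (real n) < norm (\<Sum>j<n. \<kappa> \<tau> (fst (\<omega> j)))} \<subseteq> {\<omega> \<in> space S. restrict \<omega> {..<n} \<in> ?A}"
  proof safe
    fix \<omega> assume w: "\<omega> \<in> space S" and l: "c * sqrt (real n) < norm (\<Sum>j<n. \<kappa> \<tau> (fst (\<omega> j)))"
    then show "restrict \<omega> {..<n} \<in> space (power_measure n (P \<tau>))" by (intro measurable_space[OF rm])
    have "(c * sqrt (real n))\<^sup>2 \<le> (norm (\<Sum>j<n. \<kappa> \<tau> (fst (\<omega> j))))\<^sup>2" using l c by (intro power_mono) auto
    then show "c\<^sup>2 * real n \<le> Y (restrict \<omega> {..<n})" by (simp add: Yn power_mult_distrib)
  qed
  have "outer_measure_of S {\<omega> \<in> space S. c * sqrt (real n) < norm (\<Sum>j<n. \<kappa> \<tau> (fst (\<omega> j)))} \<le> outer_measure_of S {\<omega> \<in> space S. restrict \<omega> {..<n} \<in> ?A}"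
    by (rule outer_measure_of_mono[OF sub])
  also have "\<dots> = ennreal (measure (power_measure n (P \<tau>)) ?A)"
    using AS measure_sample_law[OF prob_space_axioms A] by (simp add: S.emeasure_eq_measure)
  finally show ?thesis using le by (meson ennreal_leI order_trans)
qed

text \<open>The supremum in the stochastic condition is what allows the random \<Delta> =
  \<open>tauhat\<close> - \<tau> to be inserted. Off three exceptional sets \<Delta> lies in the
  ball of radius c / \<surd>n, and the error is a sum of three terms, each at most \<epsilon>
  \<surd>n / 3.\<close>

lemma plug_in_linearization:
  assumes \<epsilon>: "\<epsilon> > 0"
  shows "(\<lambda>n. outer_measure_of S {\<omega> \<in> space S. \<epsilon> < \<bar>(plug_in_sum ubar tauhat n (observed n \<omega>) - utility_sum u n \<omega>) / sqrt (real n)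
      - (\<Sum>j<n. resid \<tau> bhat (\<omega> j)) / sqrt (real n)\<bar>}) \<longlonglongrightarrow> 0"
    (is "(\<lambda>n. outer_measure_of S (?E n)) \<longlonglongrightarrow> 0")
proof (rule ennreal_tendsto_0I)
  fix \<zeta> :: real assume \<zeta>: "\<zeta> > 0"
  define K2 where "K2 = (\<integral>z. (norm (\<kappa> \<tau> (fst z)))\<^sup>2 \<partial>P \<tau>)"
  have K20: "0 \<le> K2" by (simp add: K2_def)
  \<comment> \<open>Makes the Chebyshev bound K2 / c0^2 at most \<zeta> / 3; the summand 1 keeps c0
    positive when K2 = 0.\<close>
  define c0 where "c0 = sqrt (3 * (K2 + 1) / \<zeta>)"
  have c0: "c0 > 0" unfolding c0_def using K20 \<zeta> by simp
  \<comment> \<open>The extra 1 covers the distance \<delta> / \<surd>n, with \<delta> \<le> 1,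
    between \<Delta> and the average of the influence function.\<close>
  define c where "c = c0 + 1"
  define \<delta> where "\<delta> = min 1 (\<epsilon> / (3 * (norm (grad \<tau>) + 1)))"
  have \<delta>: "\<delta> > 0" "\<delta> \<le> 1" "norm (grad \<tau>) * \<delta> \<le> \<epsilon> / 3"
  proof -
    have g: "norm (grad \<tau>) + 1 > 0" by (simp add: add_nonneg_pos)
    show "\<delta> > 0" "\<delta> \<le> 1" unfolding \<delta>_def using \<epsilon> g by auto
    have "norm (grad \<tau>) * \<delta> \<le> (norm (grad \<tau>) + 1) * (\<epsilon> / (3 * (norm (grad \<tau>) + 1)))"
      unfolding \<delta>_def using \<epsilon> g by (intro mult_mono) auto
    also have "\<dots> = \<epsilon> / 3" using g by (simp add: field_simps)
    finally show "norm (grad \<tau>) * \<delta> \<le> \<epsilon> / 3" .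
  qed
  have c: "c > 0" using c0 by (simp add: c_def)
  define m where "m \<Delta> = (\<integral>z. ubar (\<tau> + \<Delta>) (fst z) \<partial>P \<tau>) - mean_u \<tau>" for \<Delta>
  have "\<forall>\<^sub>F \<Delta> in at 0. dist ((m \<Delta> - \<Delta> \<bullet> grad \<tau>) / norm \<Delta>) 0 < \<epsilon> / (3 * c)"
    unfolding m_def using \<epsilon> c by (intro tendstoD[OF mean_ubar_derivative[OF \<tau>]]) auto
  then obtain r where r: "r > 0" and rm: "\<And>\<Delta>. \<Delta> \<noteq> 0 \<Longrightarrow> norm \<Delta> < r \<Longrightarrow> \<bar>(m \<Delta> - \<Delta> \<bullet> grad \<tau>) / norm \<Delta>\<bar> < \<epsilon> / (3 * c)"
    unfolding eventually_at by (auto simp: dist_real_def)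
  have mb: "\<bar>m \<Delta> - \<Delta> \<bullet> grad \<tau>\<bar> \<le> \<epsilon> / (3 * c) * norm \<Delta>" if "norm \<Delta> < r" for \<Delta>
  proof (cases "\<Delta> = 0")
    case True
    then show ?thesis using ubar_mean[OF \<tau>] by (simp add: m_def)
  next
    case False
    then have "\<bar>m \<Delta> - \<Delta> \<bullet> grad \<tau>\<bar> / norm \<Delta> < \<epsilon> / (3 * c)" using rm[OF False that] by simp
    then show ?thesis using False by (simp add: pos_divide_less_eq)
  qed
  define A where "A n = {\<omega> \<in> space S. ereal (\<epsilon> / 3 * sqrt (real n)) < (SUP \<Delta>\<in>cball 0 (c / sqrt (real n)).
              ereal \<bar>\<Sum>j<n. ubar (\<tau> + \<Delta>) (fst (\<omega> j)) - ubar \<tau> (fst (\<omega> j)) - m \<Delta>\<bar>)}" for n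
  define B where "B n = {\<omega> \<in> space S. ereal (\<delta> * (1 / sqrt (real n))) < ereal (norm (tauhat n (observed n \<omega>) - \<tau>
                               - (1 / real n) *\<^sub>R (\<Sum>j<n. \<kappa> \<tau> (fst (\<omega> j)))))}" for n
  define D where "D n = {\<omega> \<in> space S. c0 * sqrt (real n) < norm (\<Sum>j<n. \<kappa> \<tau> (fst (\<omega> j)))}" for n
  have Al: "(\<lambda>n. outer_measure_of S (A n)) \<longlonglongrightarrow> 0"
    using stoch[OF \<tau> c, unfolded small_oP_def, rule_format, of "\<epsilon> / 3"] \<epsilon> unfolding A_def m_def mean_u_def by simp
  have Bl: "(\<lambda>n. outer_measure_of S (B n)) \<longlonglongrightarrow> 0"
    using tauhat_linear[OF \<tau>] \<delta> unfolding small_oP_def B_def by blast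
  have "\<forall>\<^sub>F n in sequentially. outer_measure_of S (A n) < ennreal (\<zeta> / 3)" "\<forall>\<^sub>F n in sequentially. outer_measure_of S (B n) < ennreal (\<zeta> / 3)"
    using \<zeta> by (auto intro!: order_tendstoD(2)[OF Al] order_tendstoD(2)[OF Bl])
  moreover have "\<forall>\<^sub>F n in sequentially. c / sqrt (real n) < r"
  proof -
    have "(\<lambda>n. c * inverse (sqrt (real n))) \<longlonglongrightarrow> c * 0"
      by (intro tendsto_intros tendsto_inverse_0_at_top filterlim_compose[OF sqrt_at_top] filterlim_real_sequentially)
    then have "\<forall>\<^sub>F n in sequentially. c * inverse (sqrt (real n)) < r" using r by (intro order_tendstoD(2)) auto
    then show ?thesis by (simp add: divide_inverse)
  qed
  ultimately show "\<forall>\<^sub>F n in sequentially. outer_measure_of S (?E n) \<le> ennreal \<zeta>"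
    using eventually_gt_at_top[of 0]
  proof eventually_elim
    fix n :: nat
    assume oA: "outer_measure_of S (A n) < ennreal (\<zeta> / 3)" and oB: "outer_measure_of S (B n) < ennreal (\<zeta> / 3)"
      and cr: "c / sqrt (real n) < r" and n: "0 < n"
    let ?s = "sqrt (real n)"
    have s: "?s > 0" "?s * ?s = real n" using n by auto
    have "?E n \<subseteq> A n \<union> (B n \<union> D n)"
    proof
      fix \<omega> assume E: "\<omega> \<in> ?E n"
      then have sp: "\<omega> \<in> space S" and big: "\<epsilon> < \<bar>(plug_in_sum ubar tauhat n (observed n \<omega>) - utility_sum u n \<omega>) / ?s - (\<Sum>j<n. resid \<tau> bhat (\<omega> j)) / ?s\<bar>" by auto
      show "\<omega> \<in> A n \<union> (B n \<union> D n)"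
      proof (rule ccontr)
        assume "\<omega> \<notin> A n \<union> (B n \<union> D n)"
        then have nA: "\<omega> \<notin> A n" and nB: "\<omega> \<notin> B n" and nD: "\<omega> \<notin> D n" by auto
        define kb where "kb = (1 / real n) *\<^sub>R (\<Sum>j<n. \<kappa> \<tau> (fst (\<omega> j)))"
        define \<Delta> where "\<Delta> = tauhat n (observed n \<omega>) - \<tau>"
        have b: "norm (\<Delta> - kb) \<le> \<delta> / ?s" using nB sp by (auto simp: B_def \<Delta>_def kb_def)
        have "norm kb = norm (\<Sum>j<n. \<kappa> \<tau> (fst (\<omega> j))) / real n" using n by (simp add: kb_def)
        also have "\<dots> \<le> c0 * ?s / real n" using nD sp n by (intro divide_right_mono) (auto simp: D_def)
        also have "\<dots> = c0 / ?s" using s by (simp add: field_simps)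
        finally have kb: "norm kb \<le> c0 / ?s" .
        have "norm \<Delta> \<le> norm (\<Delta> - kb) + norm kb" using norm_triangle_ineq[of "\<Delta> - kb" kb] by simp
        also have "\<dots> \<le> \<delta> / ?s + c0 / ?s" using b kb by simp
        also have "\<dots> \<le> c / ?s" using \<delta>(2) s by (simp add: c_def add_divide_distrib[symmetric] divide_right_mono)
        finally have \<Delta>c: "norm \<Delta> \<le> c / ?s" .
        let ?t = "\<lambda>\<Delta>. \<Sum>j<n. ubar (\<tau> + \<Delta>) (fst (\<omega> j)) - ubar \<tau> (fst (\<omega> j)) - m \<Delta>"
        have "ereal \<bar>?t \<Delta>\<bar> \<le> (SUP \<Delta>\<in>cball 0 (c / ?s). ereal \<bar>?t \<Delta>\<bar>)"
          by (rule SUP_upper) (use \<Delta>c in simp)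
        also have "\<dots> \<le> ereal (\<epsilon> / 3 * ?s)" using nA sp by (simp add: A_def not_less)
        finally have 1: "\<bar>?t \<Delta>\<bar> \<le> \<epsilon> / 3 * ?s" by simp
        have "\<bar>real n * (m \<Delta> - \<Delta> \<bullet> grad \<tau>)\<bar> = real n * \<bar>m \<Delta> - \<Delta> \<bullet> grad \<tau>\<bar>" by (simp add: abs_mult)
        also have "\<dots> \<le> real n * (\<epsilon> / (3 * c) * (c / ?s))"
          using mb[of \<Delta>] \<Delta>c cr \<epsilon> c by (intro mult_left_mono order_trans[OF mb] mult_left_mono) auto
        also have "\<dots> = \<epsilon> / 3 * ?s" using c s by (simp add: field_simps)
        finally have 2: "\<bar>real n * (m \<Delta> - \<Delta> \<bullet> grad \<tau>)\<bar> \<le> \<epsilon> / 3 * ?s" .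
        have "\<bar>real n * ((\<Delta> - kb) \<bullet> grad \<tau>)\<bar> \<le> real n * (norm (\<Delta> - kb) * norm (grad \<tau>))"
          using Cauchy_Schwarz_ineq2[of "\<Delta> - kb" "grad \<tau>"] by (simp add: abs_mult mult_left_mono)
        also have "\<dots> \<le> real n * (\<delta> / ?s * norm (grad \<tau>))"
          using b by (intro mult_left_mono mult_right_mono) auto
        also have "\<dots> = ?s * (norm (grad \<tau>) * \<delta>)" using s by (simp add: field_simps)
        also have "\<dots> \<le> ?s * (\<epsilon> / 3)" using \<delta>(3) by (intro mult_left_mono) auto
        finally have 3: "\<bar>real n * ((\<Delta> - kb) \<bullet> grad \<tau>)\<bar> \<le> \<epsilon> / 3 * ?s" by (simp add: mult.commute)
        have k: "(\<Sum>j<n. bhat (fst (\<omega> j))) = real n * (kb \<bullet> grad \<tau>)"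
          using n by (simp add: bhat_def kb_def inner_sum_left inner_commute)
        have "plug_in_sum ubar tauhat n (observed n \<omega>) = (\<Sum>j<n. ubar (\<tau> + \<Delta>) (fst (\<omega> j)))"
          by (simp add: plug_in_sum_def \<Delta>_def observed_def)
        moreover have "(\<Sum>j<n. resid \<tau> bhat (\<omega> j)) = (\<Sum>j<n. ubar \<tau> (fst (\<omega> j))) + (\<Sum>j<n. bhat (fst (\<omega> j))) - utility_sum u n \<omega>"
          by (simp add: resid_def utility_sum_def sum.distrib sum_subtractf)
        moreover have "?t \<Delta> = (\<Sum>j<n. ubar (\<tau> + \<Delta>) (fst (\<omega> j))) - (\<Sum>j<n. ubar \<tau> (fst (\<omega> j))) - real n * m \<Delta>"
          by (simp add: sum_subtractf)
        \<comment> \<open>The three terms are the stochastic fluctuation of ubar, the Taylor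
          remainder of its mean, and the nonlinear part of \<open>tauhat\<close> seen through
          \<gamma>.\<close>
        ultimately have "plug_in_sum ubar tauhat n (observed n \<omega>) - utility_sum u n \<omega> - (\<Sum>j<n. resid \<tau> bhat (\<omega> j))
           = ?t \<Delta> + real n * (m \<Delta> - \<Delta> \<bullet> grad \<tau>) + real n * ((\<Delta> - kb) \<bullet> grad \<tau>)"
          unfolding k by (simp add: inner_diff_left right_diff_distrib)
        then have "\<bar>plug_in_sum ubar tauhat n (observed n \<omega>) - utility_sum u n \<omega> - (\<Sum>j<n. resid \<tau> bhat (\<omega> j))\<bar> \<le> \<epsilon> * ?s"
          using 1 2 3 by linarith
        then have "\<bar>(plug_in_sum ubar tauhat n (observed n \<omega>) - utility_sum u n \<omega> - (\<Sum>j<n. resid \<tau> bhat (\<omega> j))) / ?s\<bar> \<le> \<epsilon>"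
          using s by (simp add: abs_divide pos_divide_le_eq)
        then show False using big by (simp add: diff_divide_distrib)
      qed
    qed
    then have "outer_measure_of S (?E n) \<le> outer_measure_of S (A n \<union> (B n \<union> D n))" by (rule outer_measure_of_mono)
    also have "\<dots> \<le> outer_measure_of S (A n) + outer_measure_of S (B n \<union> D n)"
      by (intro outer_measure_of_Un_le) (auto simp: A_def B_def D_def)
    also have "\<dots> \<le> outer_measure_of S (A n) + (outer_measure_of S (B n) + outer_measure_of S (D n))"
      by (intro add_left_mono outer_measure_of_Un_le) (auto simp: B_def D_def)
    also have "\<dots> \<le> ennreal (\<zeta> / 3) + (ennreal (\<zeta> / 3) + ennreal (\<zeta> / 3))"
    proof (intro add_mono)
      have "outer_measure_of S (D n) \<le> ennreal (K2 / c0\<^sup>2)" unfolding D_def K2_def by (rule \<kappa>_tail_bound[OF c0 n])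
      also have "K2 / c0\<^sup>2 \<le> \<zeta> / 3"
      proof -
        have q: "c0\<^sup>2 = 3 * (K2 + 1) / \<zeta>" unfolding c0_def using K20 \<zeta> by simp
        have "K2 / c0\<^sup>2 = \<zeta> / 3 * (K2 / (K2 + 1))" unfolding q by simp
        also have "\<dots> \<le> \<zeta> / 3" using K20 \<zeta> by (intro mult_left_le) auto
        finally show ?thesis .
      qed
      finally show "outer_measure_of S (D n) \<le> ennreal (\<zeta> / 3)" by (simp add: ennreal_leI)
    qed (use oA oB in auto)
    also have "\<dots> = ennreal \<zeta>" using \<zeta> by (simp add: ennreal_plus[symmetric] del: ennreal_plus)
    finally show "outer_measure_of S (?E n) \<le> ennreal \<zeta>" .
  qed
qed

section \<open>Regularity, the variance bound and the two efficiency criteria\<close>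

lemma estimator_error_measurable:
  assumes T: "is_estimator \<nu> T"
  shows "(\<lambda>\<omega>. (T n (observed n \<omega>) - utility_sum u n \<omega>) / sqrt (real n)) \<in> borel_measurable (Pi\<^sub>M {..<n} (\<lambda>_. \<nu> \<Otimes>\<^sub>M \<Theta>))"
proof -
  have "(\<lambda>\<omega>. T n (observed n \<omega>)) \<in> borel_measurable (Pi\<^sub>M {..<n} (\<lambda>_. \<nu> \<Otimes>\<^sub>M \<Theta>))"
    using T by (intro measurable_compose[OF observed_measurable]) (simp add: is_estimator_def)
  moreover have "utility_sum u n \<in> borel_measurable (Pi\<^sub>M {..<n} (\<lambda>_. \<nu> \<Otimes>\<^sub>M \<Theta>))"
    unfolding utility_sum_def[abs_def] by (rule measurable_sum_components[OF u_measurable])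
  ultimately show ?thesis by measurable
qed

lemma sum_resid_measurable:
  assumes "sq_integrable (P \<tau>) d"
  shows "(\<lambda>\<omega>. (\<Sum>j<n. d (\<omega> j)) / sqrt (real n)) \<in> borel_measurable (power_measure n (P \<tau>))"
  by (intro borel_measurable_divide measurable_sum_components sq_integrable_measurable[OF assms]) simp

lemma plug_in_regular:
  "weak_conv_m (\<lambda>n. distr (sample_law (P (\<tau> + a /\<^sub>R sqrt (real n)))) borel
      (\<lambda>\<omega>. (plug_in_sum ubar tauhat n (observed n \<omega>) - utility_sum u n \<omega>) / sqrt (real n))) (centered_normal (vstar + excess))"
  unfolding second_moment_resid_bhat[symmetric]
proof (rule linear_statistic_weak_conv[OF \<tau> resid_bhat(1,2)])
  show "(\<integral>z. resid \<tau> bhat z * (a \<bullet> rhot \<tau> (snd z)) \<partial>P \<tau>) = 0" by (rule resid_bhat(3))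
  show m: "(\<lambda>\<omega>. (plug_in_sum ubar tauhat n (observed n \<omega>) - utility_sum u n \<omega>) / sqrt (real n)) \<in> borel_measurable (Pi\<^sub>M {..<n} (\<lambda>_. \<nu> \<Otimes>\<^sub>M \<Theta>))" for n
    by (rule estimator_error_measurable[OF plug_est])
  show "(plug_in_sum ubar tauhat n (observed n (restrict \<omega> {..<n})) - utility_sum u n (restrict \<omega> {..<n})) / sqrt (real n)
    = (plug_in_sum ubar tauhat n (observed n \<omega>) - utility_sum u n \<omega>) / sqrt (real n)" for n \<omega>
    by (simp only: observed_restrict utility_sum_restrict)
  fix \<epsilon> :: real assume \<epsilon>: "\<epsilon> > 0"
  show "(\<lambda>n. measure (power_measure n (P \<tau>)) {\<omega> \<in> space (power_measure n (P \<tau>)).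
      \<epsilon> < \<bar>(plug_in_sum ubar tauhat n (observed n \<omega>) - utility_sum u n \<omega>) / sqrt (real n) - (\<Sum>j<n. resid \<tau> bhat (\<omega> j)) / sqrt (real n)\<bar>}) \<longlonglongrightarrow> 0"
  proof (rule measure_power_tendsto_0[OF prob_space_P[OF \<tau>]])
    show "(\<lambda>\<omega>. \<bar>(plug_in_sum ubar tauhat n (observed n \<omega>) - utility_sum u n \<omega>) / sqrt (real n) - (\<Sum>j<n. resid \<tau> bhat (\<omega> j)) / sqrt (real n)\<bar>)
        \<in> borel_measurable (power_measure n (P \<tau>))" for n
      by (intro borel_measurable_abs borel_measurable_diff sum_resid_measurable[OF resid_bhat(1)])
         (rule m[unfolded measurable_cong_sets[OF sets_power[symmetric] refl]])
  qed (simp_all only: observed_restrict utility_sum_restrict plug_in_linearization[OF \<epsilon>], simp)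
qed

lemma vstar_nonneg: "0 \<le> vstar" and excess_nonneg: "0 \<le> excess"
  by (simp_all add: vstar_def excess_def)

text \<open>It uses the true \<tau>, which is legitimate because regularity and the bound refer to
  one fixed parameter. Its error is exactly the sum of the residuals belonging to
  \<open>bstar\<close>.\<close>

definition Tstar :: "nat \<Rightarrow> (nat \<Rightarrow> 'x) \<Rightarrow> real" where
  "Tstar n x = (\<Sum>j<n. ubar \<tau> (x j) + bstar (x j))"

lemma Tstar_regular: "regular_with_limit \<nu> P u \<tau> Tstar (centered_normal vstar)"
  unfolding regular_with_limit_def
proof (intro conjI allI)
  have mm: "(\<lambda>x. ubar \<tau> x + bstar x) \<in> borel_measurable \<nu>"
    by (intro borel_measurable_add ubar_measurable[OF \<tau>] bstar_facts(1))
  show est: "is_estimator \<nu> Tstar"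
    unfolding is_estimator_def Tstar_def[abs_def] by (intro allI measurable_sum_components[OF mm])
  show "real_distribution (centered_normal vstar)" by (rule real_distribution_centered_normal)
  have eq: "(Tstar n (observed n \<omega>) - utility_sum u n \<omega>) / sqrt (real n) = (\<Sum>j<n. resid \<tau> bstar (\<omega> j)) / sqrt (real n)" for n \<omega>
    by (simp add: Tstar_def observed_def utility_sum_def resid_def sum_subtractf)
  fix a
  show "weak_conv_m (\<lambda>n. distr (sample_law (P (\<tau> + a /\<^sub>R sqrt (real n)))) borel
      (\<lambda>\<omega>. (Tstar n (observed n \<omega>) - utility_sum u n \<omega>) / sqrt (real n))) (centered_normal vstar)"
    unfolding vstar_def
  proof (rule linear_statistic_weak_conv[OF \<tau> resid_bstar(1,2,3)])
    show "(\<lambda>\<omega>. (Tstar n (observed n \<omega>) - utility_sum u n \<omega>) / sqrt (real n)) \<in> borel_measurable (Pi\<^sub>M {..<n} (\<lambda>_. \<nu> \<Otimes>\<^sub>M \<Theta>))" for n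
      by (rule estimator_error_measurable[OF est])
    show "(Tstar n (observed n (restrict \<omega> {..<n})) - utility_sum u n (restrict \<omega> {..<n})) / sqrt (real n)
      = (Tstar n (observed n \<omega>) - utility_sum u n \<omega>) / sqrt (real n)" for n \<omega>
      by (simp only: observed_restrict utility_sum_restrict)
  qed (simp add: eq)
qed

lemma variance_bound_eq: "variance_bound \<nu> P u \<tau> = ennreal vstar"
  unfolding variance_bound_def
proof (rule antisym)
  show "(INF L\<in>{L. \<exists>T. regular_with_limit \<nu> P u \<tau> T L}. variance_of_law L) \<le> ennreal vstar"
    unfolding variance_of_centered_normal[OF vstar_nonneg, symmetric]
    by (rule INF_lower) (use Tstar_regular in blast)
  show "ennreal vstar \<le> (INF L\<in>{L. \<exists>T. regular_with_limit \<nu> P u \<tau> T L}. variance_of_law L)"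
  proof (rule INF_greatest)
    fix L assume "L \<in> {L. \<exists>T. regular_with_limit \<nu> P u \<tau> T L}"
    then obtain T where reg: "regular_with_limit \<nu> P u \<tau> T L" by blast
    have mm: "(\<lambda>x. ubar \<tau> x + bstar x) \<in> borel_measurable \<nu>"
      by (intro borel_measurable_add ubar_measurable[OF \<tau>] bstar_facts(1))
    show "ennreal vstar \<le> variance_of_law L"
      unfolding vstar_def
    proof (rule regular_limit_variance_ge[OF \<tau> u_measurable mm resid_bstar(1,2) _ _ _ reg])
      show "resid \<tau> bstar z = (ubar \<tau> (fst z) + bstar (fst z)) - u (fst z) (snd z)" for z by (simp add: resid_def)
      show "(\<integral>z. resid \<tau> bstar z * (gdir \<tau> \<bullet> rhot \<tau> (snd z)) \<partial>P \<tau>) = 0" by (rule resid_bstar(3))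
      fix \<beta> :: "'x \<Rightarrow> complex" and C
      assume \<beta>: "\<beta> \<in> borel_measurable \<nu>" "\<And>x. x \<in> space \<nu> \<Longrightarrow> norm (\<beta> x) \<le> C"
      interpret prob_space "P \<tau>" by (rule prob_space_P[OF \<tau>])
      let ?d = "\<lambda>z. resid \<tau> bstar z - gdir \<tau> \<bullet> rhot \<tau> (snd z)"
      have sd: "sq_integrable (P \<tau>) ?d" by (rule sq_integrable_diff[OF resid_bstar(1) score_P(2)[OF \<tau>]])
      \<comment> \<open>The function is (ubar - u) + v \<bullet> (\<rho> - rhot) with v =
        \<open>gdir\<close>, and both summands are conditionally centred given X. Complex test
        functions are treated through their real and imaginary parts.\<close>
      have real0: "(\<integral>z. k (fst z) * ?d z \<partial>P \<tau>) = 0" and reali: "integrable (P \<tau>) (\<lambda>z. k (fst z) * ?d z)"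
        if k: "k \<in> borel_measurable \<nu>" "\<And>x. x \<in> space \<nu> \<Longrightarrow> norm (k x) \<le> C" for k :: "'x \<Rightarrow> real"
      proof -
        have sk: "sq_integrable (P \<tau>) (\<lambda>z. k (fst z))"
          by (rule sq_integrable_bounded[OF measurable_compose[OF fst_P[OF \<tau>] k(1)] k(2)[OF measurable_space[OF fst_P[OF \<tau>]]]])
        show "integrable (P \<tau>) (\<lambda>z. k (fst z) * ?d z)" by (rule sq_integrable_mult_integrable[OF sk sd])
        have "k (fst z) * ?d z = (k (fst z) * ubar \<tau> (fst z) - k (fst z) * uu z) + (k (fst z) * (gdir \<tau> \<bullet> \<rho> \<tau> (fst z)) - k (fst z) * (gdir \<tau> \<bullet> rhot \<tau> (snd z)))" for z
          by (simp add: resid_def bstar_def algebra_simps)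
        then have "(\<integral>z. k (fst z) * ?d z \<partial>P \<tau>) = ((\<integral>z. k (fst z) * ubar \<tau> (fst z) \<partial>P \<tau>) - (\<integral>z. k (fst z) * uu z \<partial>P \<tau>))
            + ((\<integral>z. k (fst z) * (gdir \<tau> \<bullet> \<rho> \<tau> (fst z)) \<partial>P \<tau>) - (\<integral>z. k (fst z) * (gdir \<tau> \<bullet> rhot \<tau> (snd z)) \<partial>P \<tau>))"
          using sq_integrable_mult_integrable[OF sk sq_ubar[OF \<tau>]] sq_integrable_mult_integrable[OF sk sq_u[OF \<tau>]]
            sq_integrable_mult_integrable[OF sk sq_\<rho>[OF \<tau>]] sq_integrable_mult_integrable[OF sk score_P(2)[OF \<tau>]]
          by simp
        then show "(\<integral>z. k (fst z) * ?d z \<partial>P \<tau>) = 0"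
          using u_projection[OF \<tau> k(1) sk] score_projection[OF \<tau> k(1) sk] by simp
      qed
      have rei: "norm (Re (\<beta> x)) \<le> C" "norm (Im (\<beta> x)) \<le> C" if "x \<in> space \<nu>" for x
        using \<beta>(2)[OF that] abs_Re_le_cmod[of "\<beta> x"] abs_Im_le_cmod[of "\<beta> x"] by auto
      have m: "(\<lambda>x. Re (\<beta> x)) \<in> borel_measurable \<nu>" "(\<lambda>x. Im (\<beta> x)) \<in> borel_measurable \<nu>" using \<beta>(1) by auto
      have "\<beta> (fst z) * complex_of_real (?d z) = complex_of_real (Re (\<beta> (fst z)) * ?d z) + \<i> * complex_of_real (Im (\<beta> (fst z)) * ?d z)" for z
        by (simp add: complex_eq_iff)
      then have "(\<integral>z. \<beta> (fst z) * complex_of_real (?d z) \<partial>P \<tau>)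
          = complex_of_real (\<integral>z. Re (\<beta> (fst z)) * ?d z \<partial>P \<tau>) + \<i> * complex_of_real (\<integral>z. Im (\<beta> (fst z)) * ?d z \<partial>P \<tau>)"
        using reali[OF m(1) rei(1)] reali[OF m(2) rei(2)]
        by (simp only: integral_complex_of_real[symmetric] integral_mult_right_zero[symmetric] Bochner_Integration.integral_add
            integrable_mult_right complex_of_real_integrable_eq)
      then show "(\<integral>z. \<beta> (fst z) * complex_of_real (?d z) \<partial>P \<tau>) = 0"
        using real0[OF m(1) rei(1)] real0[OF m(2) rei(2)] by simp
    qed
  qed
qed

text \<open>Taking a = 0 shows that the limit law of the plug-in error is unique, so its second
  moment can only be \<open>vstar\<close> + \<open>excess\<close>.\<close>

lemma efficient_for_sum_iff: "efficient_for_sum \<nu> P u \<tau> (plug_in_sum ubar tauhat) \<longleftrightarrow> excess = 0"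
proof -
  have v: "0 \<le> vstar + excess" using vstar_nonneg excess_nonneg by simp
  have reg: "regular_with_limit \<nu> P u \<tau> (plug_in_sum ubar tauhat) (centered_normal (vstar + excess))"
    unfolding regular_with_limit_def using plug_est real_distribution_centered_normal plug_in_regular by blast
  have uniq: "L = centered_normal (vstar + excess)" if L: "regular_with_limit \<nu> P u \<tau> (plug_in_sum ubar tauhat) L" for L
  proof (rule weak_limit_unique)
    let ?M = "\<lambda>n. distr (sample_law (P (\<tau> + 0 /\<^sub>R sqrt (real n)))) borel
      (\<lambda>\<omega>. (plug_in_sum ubar tauhat n (observed n \<omega>) - utility_sum u n \<omega>) / sqrt (real n))"
    show "weak_conv_m ?M L" using L unfolding regular_with_limit_def by blast
    show "weak_conv_m ?M (centered_normal (vstar + excess))" by (rule plug_in_regular)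
    show "real_distribution L" using L unfolding regular_with_limit_def by blast
    show "real_distribution (centered_normal (vstar + excess))" by (rule real_distribution_centered_normal)
    show "real_distribution (?M n)" for n
      using char_distr_sample_law(2)[OF prob_space_P[OF \<tau>] estimator_error_measurable[OF plug_est, unfolded measurable_cong_sets[OF sets_power[symmetric] refl]]]
      by (simp add: observed_restrict utility_sum_restrict)
  qed
  have "efficient_for_sum \<nu> P u \<tau> (plug_in_sum ubar tauhat) \<longleftrightarrow> ennreal (vstar + excess) = ennreal vstar"
    unfolding efficient_for_sum_def variance_bound_eq nn_second_moment_centered_normal[OF v, symmetric]
    using reg uniq by blast
  then show ?thesis using vstar_nonneg excess_nonneg by simp
qed

text \<open>The deviation from the efficient expansion is \<gamma> \<bullet> r plus the average of
  \<open>ee\<close>, with r of smaller order than 1 / \<surd>n. Efficiency thus means that the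
  normalized sum of \<open>ee\<close> tends to 0 in probability; as its limit law is normal with
  variance \<open>excess\<close>, this forces \<open>excess\<close> to vanish. Conversely,
  \<open>excess\<close> = 0 makes \<open>ee\<close> vanish almost surely.\<close>

lemma efficient_for_linear_iff:
  "efficient_for_linear \<nu> (P \<tau>) (\<rho> \<tau>) \<tau> (grad \<tau>) (\<lambda>n x. grad \<tau> \<bullet> tauhat n x) \<longleftrightarrow> excess = 0"
proof -
  interpret prob_space "P \<tau>" by (rule prob_space_P[OF \<tau>])
  interpret S: prob_space S by (rule prob_space_sample_law[OF prob_space_axioms])
  have est: "is_estimator \<nu> (\<lambda>n x. grad \<tau> \<bullet> tauhat n x)"
    using tauhat_est unfolding is_estimator_def by (intro allI borel_measurable_inner borel_measurable_const) blast
  define ee where "ee z = bhat (fst z) - bstar (fst z)" for z :: "'x \<times> 't"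
  have se: "sq_integrable (P \<tau>) ee" unfolding ee_def by (intro sq_integrable_diff bhat_facts bstar_facts)
  have e0: "(\<integral>z. ee z \<partial>P \<tau>) = 0"
    unfolding ee_def using sq_integrable_integrable[OF bhat_facts(2)] sq_integrable_integrable[OF bstar_facts(2)] bhat_facts(3) bstar_facts(3) by simp
  have ex: "excess = (\<integral>z. (ee z)\<^sup>2 \<partial>P \<tau>)" by (simp add: excess_def ee_def)
  define r where "r n \<omega> = tauhat n (observed n \<omega>) - \<tau> - (1 / real n) *\<^sub>R (\<Sum>j<n. \<kappa> \<tau> (fst (\<omega> j)))" for n and \<omega> :: "nat \<Rightarrow> 'x \<times> 't"
  define R where "R n \<omega> = grad \<tau> \<bullet> tauhat n (observed n \<omega>) - grad \<tau> \<bullet> \<tau> - (1 / real n) *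
          (\<Sum>j<n. grad \<tau> \<bullet> (matrix_inv (Info \<tau>) *v \<rho> \<tau> (fst (\<omega> j))))" for n and \<omega> :: "nat \<Rightarrow> 'x \<times> 't"
  have R: "R n \<omega> = grad \<tau> \<bullet> r n \<omega> + (1 / real n) * (\<Sum>j<n. ee (\<omega> j))" for n \<omega>
  proof -
    have "grad \<tau> \<bullet> (matrix_inv (Info \<tau>) *v x) = gdir \<tau> \<bullet> x" for x
      using inverse_inner_grad[of x] by (simp add: inner_commute)
    then show ?thesis
      by (simp add: R_def r_def ee_def bhat_def bstar_def inner_diff_right inner_sum_right sum_subtractf right_diff_distrib)
  qed
  have def: "efficient_for_linear \<nu> (P \<tau>) (\<rho> \<tau>) \<tau> (grad \<tau>) (\<lambda>n x. grad \<tau> \<bullet> tauhat n x)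
     \<longleftrightarrow> (\<forall>\<epsilon>>0. (\<lambda>n. outer_measure_of S {\<omega> \<in> space S. \<epsilon> / sqrt (real n) < \<bar>R n \<omega>\<bar>}) \<longlonglongrightarrow> 0)"
    unfolding efficient_for_linear_def small_oP_def Info_def[symmetric] R_def using est by simp
  have rl: "(\<lambda>n. outer_measure_of S {\<omega> \<in> space S. \<epsilon> / sqrt (real n) < norm (r n \<omega>)}) \<longlonglongrightarrow> 0" if "\<epsilon> > 0" for \<epsilon>
    using tauhat_linear[OF \<tau>] that unfolding small_oP_def r_def by simp
  define g where "g = norm (grad \<tau>) + 1"
  have g: "g > 0" "norm (grad \<tau>) \<le> g" by (simp_all add: g_def add_nonneg_pos)
  have gr: "\<bar>grad \<tau> \<bullet> x\<bar> \<le> g * norm x" for x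
    by (rule order_trans[OF Cauchy_Schwarz_ineq2]) (intro mult_right_mono g, simp)
  show ?thesis unfolding def
  proof
    assume "excess = 0"
    then have "AE z in P \<tau>. (ee z)\<^sup>2 = 0"
      unfolding ex using se by (subst integral_nonneg_eq_0_iff_AE[symmetric]) (auto simp: sq_integrable_real_iff)
    then have ae: "AE z in P \<tau>. ee z = 0" by simp
    have "AE \<omega> in S. ee (\<omega> j) = 0" for j
      unfolding sample_law_def
      by (rule AE_PiM_component) (use ae prob_space_axioms in auto)
    \<comment> \<open>Countably many coordinates share one null set, which joins the exceptional set
      for every n.\<close>
    then have "AE \<omega> in S. \<forall>j. ee (\<omega> j) = 0" by (simp add: AE_all_countable)
    then obtain N where N: "N \<in> null_sets S" "{\<omega> \<in> space S. \<not> (\<forall>j. ee (\<omega> j) = 0)} \<subseteq> N"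
      by (auto elim!: AE_E simp: null_sets_def)
    show "\<forall>\<epsilon>>0. (\<lambda>n. outer_measure_of S {\<omega> \<in> space S. \<epsilon> / sqrt (real n) < \<bar>R n \<omega>\<bar>}) \<longlonglongrightarrow> 0"
    proof (intro allI impI)
      fix \<epsilon> :: real assume \<epsilon>: "\<epsilon> > 0"
      show "(\<lambda>n. outer_measure_of S {\<omega> \<in> space S. \<epsilon> / sqrt (real n) < \<bar>R n \<omega>\<bar>}) \<longlonglongrightarrow> 0"
      proof (rule outer_measure_tendsto_0_add[OF _ _ _ rl[of "\<epsilon> / g"]])
        show "\<forall>\<^sub>F n in sequentially. {\<omega> \<in> space S. \<epsilon> / sqrt (real n) < \<bar>R n \<omega>\<bar>} \<subseteq> {\<omega> \<in> space S. \<epsilon> / g / sqrt (real n) < norm (r n \<omega>)} \<union> N"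
        proof (intro always_eventually allI subsetI)
          fix n \<omega> assume "\<omega> \<in> {\<omega> \<in> space S. \<epsilon> / sqrt (real n) < \<bar>R n \<omega>\<bar>}"
          then have w: "\<omega> \<in> space S" "\<epsilon> / sqrt (real n) < \<bar>R n \<omega>\<bar>" by auto
          show "\<omega> \<in> {\<omega> \<in> space S. \<epsilon> / g / sqrt (real n) < norm (r n \<omega>)} \<union> N"
          proof (cases "\<omega> \<in> N")
            case False
            then have "ee (\<omega> j) = 0" for j using N w by blast
            then have "\<bar>R n \<omega>\<bar> \<le> g * norm (r n \<omega>)" using gr[of "r n \<omega>"] by (simp add: R)
            with w have "\<epsilon> / sqrt (real n) < g * norm (r n \<omega>)" by linarith
            then have "\<epsilon> / g / sqrt (real n) < norm (r n \<omega>)"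
              using divide_strict_right_mono[OF _ g(1), of "\<epsilon> / sqrt (real n)" "g * norm (r n \<omega>)"] g(1) by (simp add: divide_divide_eq_left mult.commute)
            then show ?thesis using w by simp
          qed simp
        qed
        show "(\<lambda>n. outer_measure_of S N) \<longlonglongrightarrow> 0" using N by (auto simp: null_sets_def)
        show "N \<subseteq> space S" using N(1) by (intro sets.sets_into_space) auto
      qed (use \<epsilon> g in auto)
    qed
  next
    assume lin: "\<forall>\<epsilon>>0. (\<lambda>n. outer_measure_of S {\<omega> \<in> space S. \<epsilon> / sqrt (real n) < \<bar>R n \<omega>\<bar>}) \<longlonglongrightarrow> 0"
    define \<xi> where "\<xi> n \<omega> = (\<Sum>j<n. ee (\<omega> j)) / sqrt (real n)" for n and \<omega> :: "nat \<Rightarrow> 'x \<times> 't"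
    have res: "\<xi> n (restrict \<omega> {..<n}) = \<xi> n \<omega>" for n \<omega> by (simp add: \<xi>_def)
    have \<xi>m: "\<xi> n \<in> borel_measurable (power_measure n (P \<tau>))" for n unfolding \<xi>_def by (rule sum_resid_measurable[OF se])
    have \<xi>m': "\<xi> n \<in> borel_measurable (Pi\<^sub>M {..<n} (\<lambda>_. \<nu> \<Otimes>\<^sub>M \<Theta>))" for n
      using \<xi>m[of n] unfolding measurable_cong_sets[OF sets_power refl] .
    have small: "(\<lambda>n. outer_measure_of S {\<omega> \<in> space S. \<epsilon> < \<bar>\<xi> n \<omega>\<bar>}) \<longlonglongrightarrow> 0" if \<epsilon>: "\<epsilon> > 0" for \<epsilon>
    proof (rule outer_measure_tendsto_0_add[OF _ _ _ lin[rule_format, of "\<epsilon> / 2"] rl[of "\<epsilon> / (2 * g)"]])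
      show "\<forall>\<^sub>F n in sequentially. {\<omega> \<in> space S. \<epsilon> < \<bar>\<xi> n \<omega>\<bar>} \<subseteq> {\<omega> \<in> space S. \<epsilon> / 2 / sqrt (real n) < \<bar>R n \<omega>\<bar>} \<union> {\<omega> \<in> space S. \<epsilon> / (2 * g) / sqrt (real n) < norm (r n \<omega>)}"
        using eventually_gt_at_top[of 0]
      proof eventually_elim
        fix n :: nat assume n: "0 < n"
        let ?s = "sqrt (real n)"
        have s: "?s > 0" "real n = ?s * ?s" using n by auto
        show "{\<omega> \<in> space S. \<epsilon> < \<bar>\<xi> n \<omega>\<bar>} \<subseteq> {\<omega> \<in> space S. \<epsilon> / 2 / ?s < \<bar>R n \<omega>\<bar>} \<union> {\<omega> \<in> space S. \<epsilon> / (2 * g) / ?s < norm (r n \<omega>)}"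
        proof (rule ccontr)
          assume "\<not> ?thesis"
          then obtain \<omega> where w: "\<epsilon> < \<bar>\<xi> n \<omega>\<bar>" "\<bar>R n \<omega>\<bar> \<le> \<epsilon> / 2 / ?s" "norm (r n \<omega>) \<le> \<epsilon> / (2 * g) / ?s"
            unfolding subset_iff Un_iff mem_Collect_eq not_less[symmetric] by blast
          have "\<xi> n \<omega> / ?s = (1 / real n) * (\<Sum>j<n. ee (\<omega> j))"
            unfolding \<xi>_def by (subst (2) s(2)) simp
          then have "\<xi> n \<omega> / ?s = R n \<omega> - grad \<tau> \<bullet> r n \<omega>" by (simp add: R)
          then have "\<bar>\<xi> n \<omega> / ?s\<bar> \<le> \<bar>R n \<omega>\<bar> + \<bar>grad \<tau> \<bullet> r n \<omega>\<bar>" by linarith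
          also have "\<dots> \<le> \<epsilon> / 2 / ?s + g * (\<epsilon> / (2 * g) / ?s)"
            using w g by (intro add_mono order_trans[OF gr] mult_left_mono) auto
          also have "\<dots> = \<epsilon> / ?s" using g by (simp add: field_simps)
          finally have "\<bar>\<xi> n \<omega>\<bar> \<le> \<epsilon>" using s by (simp add: abs_divide divide_le_cancel)
          then show False using w by simp
        qed
      qed
    qed (use \<epsilon> g in auto)
    have conv: "(\<lambda>n. measure (power_measure n (P \<tau>)) {\<omega> \<in> space (power_measure n (P \<tau>)). \<epsilon> < \<bar>\<xi> n \<omega>\<bar>}) \<longlonglongrightarrow> 0" if "\<epsilon> > 0" for \<epsilon>
      by (rule measure_power_tendsto_0[OF prob_space_axioms _ _ small[OF that]]) (use \<xi>m res in auto)
    \<comment> \<open>The same sequence is read as a linear statistic of \<open>ee\<close> and,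
      being negligible, as one of the zero function; uniqueness of weak limits identifies the two
      normal laws.\<close>
    let ?M = "\<lambda>n. distr (sample_law (P (\<tau> + 0 /\<^sub>R sqrt (real n)))) borel (\<xi> n)"
    have "weak_conv_m ?M (centered_normal (\<integral>z. (ee z)\<^sup>2 \<partial>P \<tau>))"
      by (rule linear_statistic_weak_conv[OF \<tau> se e0 _ \<xi>m' res]) (simp_all add: \<xi>_def)
    moreover have "weak_conv_m ?M (centered_normal (\<integral>z. 0\<^sup>2 \<partial>P \<tau>))"
    proof (rule linear_statistic_weak_conv[OF \<tau> _ _ _ \<xi>m' res])
      show "sq_integrable (P \<tau>) (\<lambda>_. 0 :: real)" by (rule sq_integrable_const)
    qed (use conv in simp_all)
    moreover have "real_distribution (?M n)" for n
      using char_distr_sample_law(2)[OF prob_space_axioms \<xi>m res] by simp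
    ultimately have "centered_normal (\<integral>z. (ee z)\<^sup>2 \<partial>P \<tau>) = centered_normal (\<integral>z. 0\<^sup>2 \<partial>P \<tau>)"
      by (intro weak_limit_unique[of ?M] real_distribution_centered_normal)
    then have "centered_normal excess = centered_normal 0" by (simp add: ex)
    then show "excess = 0"
      using centered_normal_moments(2)[OF excess_nonneg] centered_normal_moments(2)[of 0] by simp
  qed
qed

lemma variance_vstar:
  "prob_space.variance (P \<tau>) (\<lambda>z. ubar \<tau> (fst z) - mean_u \<tau> + \<rho> \<tau> (fst z) \<bullet> (matrix_inv (Info \<tau>) *v grad \<tau>) - uu z) = vstar"
proof -
  interpret prob_space "P \<tau>" by (rule prob_space_P[OF \<tau>])
  have eq: "ubar \<tau> (fst z) - mean_u \<tau> + \<rho> \<tau> (fst z) \<bullet> (matrix_inv (Info \<tau>) *v grad \<tau>) - uu z = resid \<tau> bstar z - mean_u \<tau>" for z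
    by (simp add: resid_def bstar_def gdir_def inner_commute)
  have "expectation (\<lambda>z. resid \<tau> bstar z - mean_u \<tau>) = - mean_u \<tau>"
    using sq_integrable_integrable[OF resid_bstar(1)] resid_bstar(2) by (simp add: prob_space)
  then show ?thesis unfolding eq by (simp add: vstar_def)
qed

lemma variance_excess:
  "prob_space.variance (P \<tau>) (\<lambda>z. (\<kappa> \<tau> (fst z) - matrix_inv (Info \<tau>) *v \<rho> \<tau> (fst z)) \<bullet> grad \<tau>) = excess"
proof -
  interpret prob_space "P \<tau>" by (rule prob_space_P[OF \<tau>])
  have eq: "(\<kappa> \<tau> (fst z) - matrix_inv (Info \<tau>) *v \<rho> \<tau> (fst z)) \<bullet> grad \<tau> = bhat (fst z) - bstar (fst z)" for z :: "'x \<times> 't"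
    by (simp only: inner_diff_left inverse_inner_grad bhat_def bstar_def inner_commute[of "\<kappa> \<tau> _"] inner_commute[of "\<rho> \<tau> _"])
  have "expectation (\<lambda>z. bhat (fst z) - bstar (fst z)) = 0"
    using sq_integrable_integrable[OF bhat_facts(2)] sq_integrable_integrable[OF bstar_facts(2)] bhat_facts(3) bstar_facts(3) by simp
  then show ?thesis unfolding eq by (simp add: excess_def)
qed

end

end

theorem theorem2p2:
  fixes \<T> :: "(real ^ 'd) set"
    and \<Theta> :: "'t measure" and G :: "real ^ 'd \<Rightarrow> 't measure"
    and \<nu> :: "'x measure" and f :: "'x \<Rightarrow> 't \<Rightarrow> real"
    and P :: "real ^ 'd \<Rightarrow> ('x \<times> 't) measure"
    and u :: "'x \<Rightarrow> 't \<Rightarrow> real"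
    and rhot :: "real ^ 'd \<Rightarrow> 't \<Rightarrow> real ^ 'd"
    and \<rho> :: "real ^ 'd \<Rightarrow> 'x \<Rightarrow> real ^ 'd"
    and Info :: "real ^ 'd \<Rightarrow> real ^ 'd ^ 'd"
    and ubar :: "real ^ 'd \<Rightarrow> 'x \<Rightarrow> real"
    and \<mu> :: "real ^ 'd \<Rightarrow> real"
    and tauhat :: "nat \<Rightarrow> (nat \<Rightarrow> 'x) \<Rightarrow> real ^ 'd"
    and \<kappa> \<kappa>star :: "real ^ 'd \<Rightarrow> 'x \<Rightarrow> real ^ 'd"
    and \<gamma> :: "real ^ 'd \<Rightarrow> real ^ 'd"
    and \<phi>star :: "real ^ 'd \<Rightarrow> 'x \<Rightarrow> real"
    and varstar var :: "real ^ 'd \<Rightarrow> real"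
  assumes "open \<T>"
    \<comment> \<open>the model\<close>
    and "\<And>\<tau>. \<tau> \<in> \<T> \<Longrightarrow> sets (G \<tau>) = sets \<Theta>"
    and "\<And>\<tau>. \<tau> \<in> \<T> \<Longrightarrow> prob_space (G \<tau>)"
    and "\<And>x \<theta>. x \<in> space \<nu> \<Longrightarrow> \<theta> \<in> space \<Theta> \<Longrightarrow> 0 \<le> f x \<theta>"
    and "\<And>\<theta>. \<theta> \<in> space \<Theta> \<Longrightarrow> (\<lambda>x. f x \<theta>) \<in> borel_measurable \<nu>"
    and "(\<lambda>\<theta>. density \<nu> (\<lambda>x. ennreal (f x \<theta>))) \<in> \<Theta> \<rightarrow>\<^sub>M prob_algebra \<nu>"
    and "P = (\<lambda>\<tau>. joint_law \<nu> f (G \<tau>))"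
    and "(\<lambda>z. u (fst z) (snd z)) \<in> borel_measurable (\<nu> \<Otimes>\<^sub>M \<Theta>)"
    \<comment> \<open>differentiability in quadratic mean of the mixing distributions\<close>
    and "\<And>\<tau>. \<tau> \<in> \<T> \<Longrightarrow> rhot \<tau> \<in> borel_measurable \<Theta>"
    and "\<And>\<tau>. \<tau> \<in> \<T> \<Longrightarrow> \<forall>\<^sub>F \<Delta> in at 0. integrable (G \<tau>)
           (\<lambda>\<theta>. (sqrt (ac_density (G \<tau>) (G (\<tau> + \<Delta>)) \<theta>) - 1 - \<Delta> \<bullet> rhot \<tau> \<theta> / 2)\<^sup>2)"
    and "\<And>\<tau>. \<tau> \<in> \<T> \<Longrightarrow>
           (\<lambda>\<Delta>. \<integral>\<theta>. (sqrt (ac_density (G \<tau>) (G (\<tau> + \<Delta>)) \<theta>) - 1 - \<Delta> \<bullet> rhot \<tau> \<theta> / 2)\<^sup>2 \<partial>G \<tau>)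
             \<in> o[at 0](\<lambda>\<Delta>. (norm \<Delta>)\<^sup>2)"
    and "\<And>\<tau>. \<tau> \<in> \<T> \<Longrightarrow>
           (\<lambda>\<Delta>. (\<integral>\<theta>. ac_density (G \<tau>) (G (\<tau> + \<Delta>)) \<theta> \<partial>G \<tau>) - 1) \<in> o[at 0](\<lambda>\<Delta>. (norm \<Delta>)\<^sup>2)"
    \<comment> \<open>the utility has locally bounded second moments\<close>
    and "\<And>\<tau>. \<tau> \<in> \<T> \<Longrightarrow> \<exists>\<epsilon>>0. \<exists>C. \<forall>\<tau>'\<in>\<T> \<inter> ball \<tau> \<epsilon>.
           integrable (P \<tau>') (\<lambda>z. (u (fst z) (snd z))\<^sup>2) \<and>
           (\<integral>z. (u (fst z) (snd z))\<^sup>2 \<partial>P \<tau>') \<le> C"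
    \<comment> \<open>score of the observations, information matrix, conditional and unconditional mean utility\<close>
    and "\<And>\<tau> i. \<tau> \<in> \<T> \<Longrightarrow> is_cond_exp_X \<nu> (P \<tau>) (\<lambda>z. rhot \<tau> (snd z) $ i) (\<lambda>x. \<rho> \<tau> x $ i)"
    and "Info = (\<lambda>\<tau>. cov_matrix (P \<tau>) (\<lambda>z. \<rho> \<tau> (fst z)))"
    and "\<And>\<tau>. \<tau> \<in> \<T> \<Longrightarrow> rank (Info \<tau>) = CARD('d)"
    and "\<And>\<tau>. \<tau> \<in> \<T> \<Longrightarrow> is_cond_exp_X \<nu> (P \<tau>) (\<lambda>z. u (fst z) (snd z)) (ubar \<tau>)"
    and "\<mu> = (\<lambda>\<tau>. \<integral>z. u (fst z) (snd z) \<partial>P \<tau>)"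
    \<comment> \<open>the asymptotically linear estimator and its influence functions\<close>
    and "is_estimator \<nu> tauhat"
    and "\<And>\<tau>. \<tau> \<in> \<T> \<Longrightarrow> \<kappa> \<tau> \<in> borel_measurable \<nu>"
    and "\<And>\<tau>. \<tau> \<in> \<T> \<Longrightarrow> integrable (P \<tau>) (\<lambda>z. (norm (\<kappa> \<tau> (fst z)))\<^sup>2)"
    and "\<And>\<tau>. \<tau> \<in> \<T> \<Longrightarrow> (\<integral>z. \<kappa> \<tau> (fst z) \<partial>P \<tau>) = 0"
    and "\<And>\<tau>. \<tau> \<in> \<T> \<Longrightarrow> small_oP (sample_law (P \<tau>))
           (\<lambda>n \<omega>. ereal (norm (tauhat n (observed n \<omega>) - \<tau>
                               - (1 / real n) *\<^sub>R (\<Sum>j<n. \<kappa> \<tau> (fst (\<omega> j))))))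
           (\<lambda>n. 1 / sqrt (real n))"
    and "\<And>\<tau>. \<tau> \<in> \<T> \<Longrightarrow> (\<chi> i j. \<integral>z. \<kappa> \<tau> (fst z) $ i * \<rho> \<tau> (fst z) $ j \<partial>P \<tau>) = mat 1"
    and "is_estimator \<nu> (plug_in_sum ubar tauhat)"
    \<comment> \<open>conditions on the estimated conditional mean utility\<close>
    and "\<And>\<tau>. \<tau> \<in> \<T> \<Longrightarrow> \<forall>\<^sub>F \<Delta> in at 0. integrable (P \<tau>) (\<lambda>z. (ubar (\<tau> + \<Delta>) (fst z))\<^sup>2)"
    and "\<And>\<tau>. \<tau> \<in> \<T> \<Longrightarrow>
           (\<lambda>\<Delta>. \<integral>z. (ubar (\<tau> + \<Delta>) (fst z))\<^sup>2 \<partial>P \<tau>) \<in> O[at 0](\<lambda>_. 1)"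
    and "\<And>\<tau> c. \<tau> \<in> \<T> \<Longrightarrow> 0 < c \<Longrightarrow> small_oP (sample_law (P \<tau>))
           (\<lambda>n \<omega>. SUP \<Delta>\<in>cball 0 (c / sqrt (real n)).
              ereal \<bar>\<Sum>j<n. ubar (\<tau> + \<Delta>) (fst (\<omega> j)) - ubar \<tau> (fst (\<omega> j))
                            - ((\<integral>z. ubar (\<tau> + \<Delta>) (fst z) \<partial>P \<tau>) - \<mu> \<tau>)\<bar>)
           (\<lambda>n. sqrt (real n))"
    \<comment> \<open>definitions of the quantities in the conclusion\<close>
    and "\<gamma> = (\<lambda>\<tau>. \<integral>z. u (fst z) (snd z) *\<^sub>R rhot \<tau> (snd z)
                        - ubar \<tau> (fst z) *\<^sub>R \<rho> \<tau> (fst z) \<partial>P \<tau>)"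
    and "\<phi>star = (\<lambda>\<tau> x. ubar \<tau> x - \<mu> \<tau> + \<rho> \<tau> x \<bullet> (matrix_inv (Info \<tau>) *v \<gamma> \<tau>))"
    and "\<kappa>star = (\<lambda>\<tau> x. matrix_inv (Info \<tau>) *v \<rho> \<tau> x)"
    and "varstar = (\<lambda>\<tau>. prob_space.variance (P \<tau>) (\<lambda>z. \<phi>star \<tau> (fst z) - u (fst z) (snd z)))"
    and "var = (\<lambda>\<tau>. varstar \<tau> +
           prob_space.variance (P \<tau>) (\<lambda>z. (\<kappa> \<tau> (fst z) - \<kappa>star \<tau> (fst z)) \<bullet> \<gamma> \<tau>))"
  shows "(\<forall>\<tau>\<in>\<T>. weak_conv_m
            (\<lambda>n. distr (sample_law (P \<tau>)) borel
               (\<lambda>\<omega>. (plug_in_sum ubar tauhat n (observed n \<omega>) - utility_sum u n \<omega>) / sqrt (real n)))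
            (centered_normal (var \<tau>))) \<and>
         (\<forall>\<tau>\<^sub>0\<in>\<T>. efficient_for_sum \<nu> P u \<tau>\<^sub>0 (plug_in_sum ubar tauhat) \<longleftrightarrow>
            efficient_for_linear \<nu> (P \<tau>\<^sub>0) (\<rho> \<tau>\<^sub>0) \<tau>\<^sub>0 (\<gamma> \<tau>\<^sub>0) (\<lambda>n x. \<gamma> \<tau>\<^sub>0 \<bullet> tauhat n x))"
proof -
  note eqs = \<open>P = _\<close> \<open>Info = _\<close> \<open>\<mu> = _\<close>
  interpret M: plug_in_model \<nu> \<Theta> f \<T> G rhot u \<rho> ubar tauhat \<kappa>
    by (intro plug_in_model.intro utility_model.intro dqm_mixture.intro mixture.intro plug_in_model_axioms.intro
        utility_model_axioms.intro dqm_mixture_axioms.intro) (fact assms[unfolded eqs])+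
  have Info: "Info \<tau> = M.Info \<tau>" and mu: "\<mu> \<tau> = M.mean_u \<tau>" and gam: "\<gamma> \<tau> = M.grad \<tau>" for \<tau>
    unfolding \<open>\<gamma> = _\<close> eqs by (simp_all add: M.Info_def M.mean_u_def M.grad_def)
  have var: "var \<tau> = M.vstar \<tau> + M.excess \<tau>" if "\<tau> \<in> \<T>" for \<tau>
    unfolding \<open>var = _\<close> \<open>varstar = _\<close> \<open>\<phi>star = _\<close> \<open>\<kappa>star = _\<close> Info mu gam \<open>P = _\<close>
    using M.variance_vstar[OF that] M.variance_excess[OF that] by simp
  show ?thesis
  proof (intro conjI ballI)
    fix \<tau> assume \<tau>: "\<tau> \<in> \<T>"
    show "weak_conv_m (\<lambda>n. distr (sample_law (P \<tau>)) borel
               (\<lambda>\<omega>. (plug_in_sum ubar tauhat n (observed n \<omega>) - utility_sum u n \<omega>) / sqrt (real n)))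
            (centered_normal (var \<tau>))"
      \<comment> \<open>The direction a = 0 gives the law under P \<tau> itself.\<close>
      using M.plug_in_regular[OF \<tau>, of 0] unfolding var[OF \<tau>] \<open>P = _\<close> by simp
    show "efficient_for_sum \<nu> P u \<tau> (plug_in_sum ubar tauhat) \<longleftrightarrow>
            efficient_for_linear \<nu> (P \<tau>) (\<rho> \<tau>) \<tau> (\<gamma> \<tau>) (\<lambda>n x. \<gamma> \<tau> \<bullet> tauhat n x)"
      using M.efficient_for_sum_iff[OF \<tau>] M.efficient_for_linear_iff[OF \<tau>] unfolding gam \<open>P = _\<close> by simp
  qed
qed

end
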